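(* Let $\Omega_j\ (j\in\mathbb N)$ and $\Omega$ belong to $\mathcal A_C(M)$, and let $h_j$ and $h$ be defining functions associated with $\Omega_j$ and $\Omega$ (as in part (3) of the $RC$-GNP condition), such that $$h_j\longrightarrow h\qquad\text{strongly in }C^{2,\alpha}(M).$$ Let $f\in L^2(M)$ be fixed and assume $\operatorname{supp}f\subset K\subset C\subset\Omega_j\cap\Omega$ for all $j$. Let $u_{\Omega_j}$ and $u_\Omega$ denote the unique weak solutions of the Dirichlet problems $-\Delta_g u=f$ with $u=0$ on the boundary, in $\Omega_j$ and $\Omega$ respectively, extended by zero outside their respective domains. Then $$u_{\Omega_j}\longrightarrow u_\Omega\qquad\text{strongly in }H^1(M).$$ In particular, $$\int_M|\nabla_g u_{\Omega_j}|_g^2\,dV_g\longrightarrow\int_M|\nabla_g u_\Omega|_g^2\,dV_g.$$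
   Context: Setting. $(M,g)$ is a smooth compact connected Riemannian manifold without boundary, of dimension $n\ge 2$, with volume measure $dV_g$. $K\subset M$ is a nonempty compact set and $C\subset M$ is a fixed reference domain (connected open set) with $K\subset C$ and $\partial C\in C^{2,\alpha}$ for some fixed $0<\alpha<1$; moreover there is $\rho_C>0$ such that $(x,t)\mapsto\exp_x(t\nu_C(x))$ is a diffeomorphism from $\partial C\times(-\rho_C,\rho_C)$ onto its image, where $\nu_C$ is the outward unit normal. Riemannian $RC$-GNP condition relative to $C$. Constants $A,c_0,\rho_0,\rho_1>0$ are fixed, the same for all domains. A domain $\Omega\subset M$ satisfies the condition if: (1) $C\subset\Omega$; (2) $\partial\Omega\in C^{2,\alpha}$; (3) there is a defining function $h_\Omega\in C^{2,\alpha}(M)$ with $\Omega=\{h_\Omega>0\}$, $\partial\Omega=\{h_\Omega=0\}$, $\|h_\Omega\|_{C^{2,\alpha}(M)}\le A$, and $|\nabla_g h_\Omega|_g\ge c_0$ wherever $|h_\Omega|\le\rho_0$; (4) the normal exponential map $\partial\Omega\times(-\rho_1,\rho_1)\to M$, $(x,t)\mapsto\exp_x(t\nu_\Omega(x))$, with $\nu_\Omega$ the outward unit normal, is a diffeomorphism onto its image. Admissible class. $\mathcal A_C(M)$ is the set of connected open $\Omega\subset M$ with $C\subset\Omega$, $\partial\Omega\in C^{2,\alpha}$, satisfying the $RC$-GNP condition with these uniform constants. Its members are understood to satisfy $\Omega\ne M$ (nonempty boundary), so that the Dirichlet problem is well posed. Weak solution. $u_\Omega\in H_0^1(\Omega)$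 is a weak solution of $-\Delta_g u_\Omega=f$ in $\Omega$, $u_\Omega=0$ on $\partial\Omega$, if $\int_\Omega g(\nabla_g u_\Omega,\nabla_g\varphi)\,dV_g=\int_\Omega f\varphi\,dV_g$ for all $\varphi\in H_0^1(\Omega)$, where $\Delta_g=\operatorname{div}_g\nabla_g$ and $H_0^1(\Omega)$ is the closure of $C_c^\infty(\Omega)$ in the $H^1$-norm. *)

theory Defs
  imports "HOL-Analysis.Analysis"
begin

section \<open>Regularity classes on open subsets of Euclidean space\<close>

abbreviation dirderiv ::
    "'e::euclidean_space \<Rightarrow> ('e \<Rightarrow> 'f::real_normed_vector) \<Rightarrow> 'e \<Rightarrow> 'f" where
  "dirderiv b F x \<equiv> frechet_derivative F (at x) b"

text \<open>Intended for open sets only: all iterated partial derivatives of order at most \<open>k\<close>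
  exist and are continuous.\<close>

primrec Ck_on ::
    "nat \<Rightarrow> ('e::euclidean_space \<Rightarrow> 'f::real_normed_vector) \<Rightarrow> 'e set \<Rightarrow> bool" where
  "Ck_on 0 F S \<longleftrightarrow> continuous_on S F"
| "Ck_on (Suc k) F S \<longleftrightarrow>
     (\<forall>x\<in>S. F differentiable (at x)) \<and> (\<forall>b\<in>Basis. Ck_on k (dirderiv b F) S)"

definition smooth_on :: "('e::euclidean_space \<Rightarrow> 'f::real_normed_vector) \<Rightarrow> 'e set \<Rightarrow> bool" where
  "smooth_on F S \<longleftrightarrow> (\<forall>k. Ck_on k F S)"

definition locally_Holder_on ::
    "real \<Rightarrow> ('e::metric_space \<Rightarrow> 'f::metric_space) \<Rightarrow> 'e set \<Rightarrow> bool" where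
  "locally_Holder_on \<alpha> F S \<longleftrightarrow>
     (\<forall>x\<in>S. \<exists>r>0. \<exists>L. \<forall>y\<in>ball x r \<inter> S. \<forall>z\<in>ball x r \<inter> S.
        dist (F y) (F z) \<le> L * dist y z powr \<alpha>)"

definition C2\<alpha>_on ::
    "real \<Rightarrow> ('e::euclidean_space \<Rightarrow> 'f::real_normed_vector) \<Rightarrow> 'e set \<Rightarrow> bool" where
  "C2\<alpha>_on \<alpha> F S \<longleftrightarrow> Ck_on 2 F S \<and>
     (\<forall>b\<in>Basis. \<forall>b'\<in>Basis. locally_Holder_on \<alpha> (dirderiv b' (dirderiv b F)) S)"

text \<open>Only used for convex compact \<open>S\<close> (closed balls) and functions that are \<open>C\<^sup>2\<^sup>,\<^sup>\<alpha>\<close> near \<open>S\<close>,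
  for which all suprema are finite.  The pairs \<open>x = y\<close> contribute \<open>0/0 = 0\<close> to the Hoelder seminorm.\<close>

definition C2\<alpha>_norm_on :: "real \<Rightarrow> ('e::euclidean_space \<Rightarrow> real) \<Rightarrow> 'e set \<Rightarrow> real" where
  "C2\<alpha>_norm_on \<alpha> F S =
     (SUP x\<in>S. \<bar>F x\<bar>)
     + (\<Sum>b\<in>Basis. SUP x\<in>S. \<bar>dirderiv b F x\<bar>)
     + (\<Sum>b\<in>Basis. \<Sum>b'\<in>Basis. SUP x\<in>S. \<bar>dirderiv b' (dirderiv b F) x\<bar>)
     + (\<Sum>b\<in>Basis. \<Sum>b'\<in>Basis. SUP (x, y)\<in>S \<times> S.
          \<bar>dirderiv b' (dirderiv b F) x - dirderiv b' (dirderiv b F) y\<bar> / dist x y powr \<alpha>)"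

section \<open>Closed Riemannian manifolds\<close>

text \<open>The manifold is the whole (Hausdorff) type \<open>'a\<close>.  A chart is a pair of its domain and its
  coordinate map; the map is irrelevant outside the domain.  The metric is given by its coefficient
  matrices: \<open>gmat M c p\<close> is the matrix \<open>(g\<^sub>i\<^sub>j(p))\<close> in the chart \<open>c\<close>.\<close>

type_synonym ('a, 'n) chart = "'a set \<times> ('a \<Rightarrow> real ^ 'n)"

record ('a, 'n) riem =
  charts :: "('a, 'n) chart set"
  gmat :: "('a, 'n) chart \<Rightarrow> 'a \<Rightarrow> real ^ 'n ^ 'n"

abbreviation cdom :: "('a, 'n::finite) chart \<Rightarrow> 'a set" where "cdom c \<equiv> fst c"
abbreviation cmap :: "('a, 'n::finite) chart \<Rightarrow> 'a \<Rightarrow> real ^ 'n" where "cmap c \<equiv> snd c"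
abbreviation cimg :: "('a, 'n::finite) chart \<Rightarrow> (real ^ 'n) set" where "cimg c \<equiv> cmap c ` cdom c"
abbreviation cinv :: "('a, 'n::finite) chart \<Rightarrow> real ^ 'n \<Rightarrow> 'a" where
  "cinv c \<equiv> inv_into (cdom c) (cmap c)"

text \<open>Jacobian at \<open>p\<close> of the change of coordinates from \<open>c\<close> to \<open>d\<close>.\<close>

definition chart_change ::
    "('a, 'n::finite) chart \<Rightarrow> ('a, 'n) chart \<Rightarrow> 'a \<Rightarrow> real ^ 'n \<Rightarrow> real ^ 'n" where
  "chart_change c d p = frechet_derivative (\<lambda>y. cmap d (cinv c y)) (at (cmap c p))"

definition closed_riemannian_manifold :: "('a::t2_space, 'n::finite) riem \<Rightarrow> bool" where
  "closed_riemannian_manifold M \<longleftrightarrow>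
     compact (UNIV :: 'a set) \<and> connected (UNIV :: 'a set) \<and>
     \<Union> (cdom ` charts M) = UNIV \<and>
     (\<forall>c\<in>charts M. open (cdom c) \<and> open (cimg c) \<and>
        homeomorphism (cdom c) (cimg c) (cmap c) (cinv c)) \<and>
     (\<forall>c\<in>charts M. \<forall>d\<in>charts M.
        smooth_on (\<lambda>y. cmap d (cinv c y)) (cmap c ` (cdom c \<inter> cdom d))) \<and>
     (\<forall>c\<in>charts M. smooth_on (\<lambda>y. gmat M c (cinv c y)) (cimg c)) \<and>
     (\<forall>c\<in>charts M. \<forall>p\<in>cdom c.
        transpose (gmat M c p) = gmat M c p \<and> (\<forall>v. v \<noteq> 0 \<longrightarrow> 0 < v \<bullet> (gmat M c p *v v))) \<and>
     (\<forall>c\<in>charts M. \<forall>d\<in>charts M. \<forall>p\<in>cdom c \<inter> cdom d. \<forall>v w.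
        v \<bullet> (gmat M c p *v w) = chart_change c d p v \<bullet> (gmat M d p *v chart_change c d p w))"

definition smooth_fun :: "('a, 'n::finite) riem \<Rightarrow> ('a \<Rightarrow> real) \<Rightarrow> bool" where
  "smooth_fun M h \<longleftrightarrow> (\<forall>c\<in>charts M. smooth_on (\<lambda>y. h (cinv c y)) (cimg c))"

definition C2\<alpha>_fun :: "('a, 'n::finite) riem \<Rightarrow> real \<Rightarrow> ('a \<Rightarrow> real) \<Rightarrow> bool" where
  "C2\<alpha>_fun M \<alpha> h \<longleftrightarrow> (\<forall>c\<in>charts M. C2\<alpha>_on \<alpha> (\<lambda>y. h (cinv c y)) (cimg c))"

text \<open>The \<open>C\<^sup>2\<^sup>,\<^sup>\<alpha>\<close> norm on a closed manifold is the maximum of the Euclidean norms over a fixed finite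
  cover by coordinate balls; \<open>(c, z, r)\<close> denotes the ball of radius \<open>r\<close> about \<open>z\<close> in the chart \<open>c\<close>.
  Different covers give equivalent norms.\<close>

definition coordinate_ball_cover ::
    "('a, 'n::finite) riem \<Rightarrow> (('a, 'n) chart \<times> (real ^ 'n) \<times> real) set \<Rightarrow> bool" where
  "coordinate_ball_cover M B \<longleftrightarrow> finite B \<and>
     (\<forall>(c, z, r)\<in>B. c \<in> charts M \<and> 0 < r \<and> cball z r \<subseteq> cimg c) \<and>
     (\<Union>(c, z, r)\<in>B. cinv c ` ball z r) = UNIV"

definition C2\<alpha>_norm ::
    "(('a, 'n::finite) chart \<times> (real ^ 'n) \<times> real) set \<Rightarrow> real \<Rightarrow> ('a \<Rightarrow> real) \<Rightarrow> real" where
  "C2\<alpha>_norm B \<alpha> h = Max ((\<lambda>(c, z, r). C2\<alpha>_norm_on \<alpha> (\<lambda>y. h (cinv c y)) (cball z r)) ` B)"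

subsection \<open>Tangent vectors and the gradient\<close>

text \<open>A tangent vector at \<open>p\<close> is the family of its coordinate vectors in all charts around \<open>p\<close>,
  related by the transformation law.  Its entries at other charts are \<open>0\<close>, so that equal tangent
  vectors are equal as functions.\<close>

type_synonym ('a, 'n) tvec = "('a, 'n) chart \<Rightarrow> real ^ 'n"

definition tangent_vector :: "('a, 'n::finite) riem \<Rightarrow> 'a \<Rightarrow> ('a, 'n) tvec \<Rightarrow> bool" where
  "tangent_vector M p v \<longleftrightarrow>
     (\<forall>c. c \<notin> charts M \<or> p \<notin> cdom c \<longrightarrow> v c = 0) \<and>
     (\<forall>c\<in>charts M. \<forall>d\<in>charts M. p \<in> cdom c \<inter> cdom d \<longrightarrow> v d = chart_change c d p (v c))"

text \<open>For tangent vectors the value does not depend on the chart chosen.\<close>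

definition tinner ::
    "('a, 'n::finite) riem \<Rightarrow> 'a \<Rightarrow> ('a, 'n) tvec \<Rightarrow> ('a, 'n) tvec \<Rightarrow> real" where
  "tinner M p v w =
     (let c = (SOME c. c \<in> charts M \<and> p \<in> cdom c) in v c \<bullet> (gmat M c p *v w c))"

definition tnorm :: "('a, 'n::finite) riem \<Rightarrow> 'a \<Rightarrow> ('a, 'n) tvec \<Rightarrow> real" where
  "tnorm M p v = sqrt (tinner M p v v)"

text \<open>In coordinates \<open>(\<nabla>h)\<^sup>i = \<Sum>j. g\<^sup>i\<^sup>j \<partial>\<^sub>j h\<close>.\<close>

definition gradient :: "('a, 'n::finite) riem \<Rightarrow> ('a \<Rightarrow> real) \<Rightarrow> 'a \<Rightarrow> ('a, 'n) tvec" where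
  "gradient M h p = (\<lambda>c. if c \<in> charts M \<and> p \<in> cdom c
     then matrix_inv (gmat M c p) *v
            (\<chi> i. dirderiv (axis i 1) (\<lambda>y. h (cinv c y)) (cmap c p))
     else 0)"

definition has_velocity ::
    "('a::topological_space, 'n::finite) riem \<Rightarrow> (real \<Rightarrow> 'a) \<Rightarrow> real \<Rightarrow> ('a, 'n) tvec \<Rightarrow> bool" where
  "has_velocity M \<gamma> t v \<longleftrightarrow> isCont \<gamma> t \<and> tangent_vector M (\<gamma> t) v \<and>
     (\<forall>c\<in>charts M. \<gamma> t \<in> cdom c \<longrightarrow> ((\<lambda>s. cmap c (\<gamma> s)) has_vector_derivative v c) (at t))"

subsection \<open>Geodesics and the exponential map\<close>

definition christoffel ::
    "('a, 'n::finite) riem \<Rightarrow> ('a, 'n) chart \<Rightarrow> 'a \<Rightarrow> 'n \<Rightarrow> 'n \<Rightarrow> 'n \<Rightarrow> real" where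
  "christoffel M c p k i j =
     (let dg = (\<lambda>l a b. dirderiv (axis l 1) (\<lambda>y. gmat M c (cinv c y) $ a $ b) (cmap c p))
      in (\<Sum>l\<in>UNIV. matrix_inv (gmat M c p) $ k $ l * (dg i j l + dg j i l - dg l i j)) / 2)"

definition geodesic ::
    "('a::topological_space, 'n::finite) riem \<Rightarrow> (real \<Rightarrow> 'a) \<Rightarrow> bool" where
  "geodesic M \<gamma> \<longleftrightarrow> continuous_on UNIV \<gamma> \<and>
     (\<forall>c\<in>charts M. \<forall>t. \<gamma> t \<in> cdom c \<longrightarrow>
        (let x = (\<lambda>s. cmap c (\<gamma> s)); x' = (\<lambda>s. vector_derivative x (at s)) in
         x differentiable (at t) \<and>
         (x' has_vector_derivative
            (\<chi> k. - (\<Sum>i\<in>UNIV. \<Sum>j\<in>UNIV. christoffel M c (\<gamma> t) k i j * x' t $ i * x' t $ j))) (at t)))"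

text \<open>On a closed manifold every geodesic extends to all of the real line, so this is a total map
  on tangent vectors.\<close>

definition exp_map :: "('a::topological_space, 'n::finite) riem \<Rightarrow> 'a \<Rightarrow> ('a, 'n) tvec \<Rightarrow> 'a" where
  "exp_map M p v = (THE q. \<exists>\<gamma>. geodesic M \<gamma> \<and> \<gamma> 0 = p \<and> has_velocity M \<gamma> 0 v \<and> \<gamma> 1 = q)"

subsection \<open>Boundary regularity, outward normal, normal exponential map\<close>

text \<open>Local straightening of the boundary by a \<open>C\<^sup>2\<^sup>,\<^sup>\<alpha>\<close> diffeomorphism \<open>\<psi>\<close> of a coordinate
  neighbourhood, the domain being mapped to an open half space.\<close>

definition C2\<alpha>_boundary ::
    "('a::topological_space, 'n::finite) riem \<Rightarrow> real \<Rightarrow> 'a set \<Rightarrow> bool" where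
  "C2\<alpha>_boundary M \<alpha> \<Omega> \<longleftrightarrow>
     (\<forall>p\<in>frontier \<Omega>. \<exists>c\<in>charts M. p \<in> cdom c \<and>
        (\<exists>W (\<psi> :: real ^ 'n \<Rightarrow> real ^ 'n) k.
           open W \<and> cmap c p \<in> W \<and> W \<subseteq> cimg c \<and> inj_on \<psi> W \<and> open (\<psi> ` W) \<and>
           C2\<alpha>_on \<alpha> \<psi> W \<and> C2\<alpha>_on \<alpha> (inv_into W \<psi>) (\<psi> ` W) \<and>
           (\<forall>y\<in>W. (cinv c y \<in> \<Omega> \<longleftrightarrow> 0 < \<psi> y $ k) \<and> (cinv c y \<in> frontier \<Omega> \<longleftrightarrow> \<psi> y $ k = 0))))"

text \<open>For boundaries of class \<open>C\<^sup>1\<close>: the unique unit tangent vector that is orthogonal to the velocities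
  of all curves in the boundary and along which curves leave the closure of the domain.\<close>

definition outward_normal ::
    "('a::topological_space, 'n::finite) riem \<Rightarrow> 'a set \<Rightarrow> 'a \<Rightarrow> ('a, 'n) tvec" where
  "outward_normal M \<Omega> p = (THE \<nu>. tangent_vector M p \<nu> \<and> tnorm M p \<nu> = 1 \<and>
     (\<forall>\<gamma> w. (\<forall>t. \<gamma> t \<in> frontier \<Omega>) \<and> \<gamma> 0 = p \<and> has_velocity M \<gamma> 0 w \<longrightarrow> tinner M p \<nu> w = 0) \<and>
     (\<forall>\<gamma>. \<gamma> 0 = p \<and> has_velocity M \<gamma> 0 \<nu> \<longrightarrow> (\<forall>\<^sub>F t in at_right 0. \<gamma> t \<notin> closure \<Omega>)))"

definition normal_exp ::
    "('a::topological_space, 'n::finite) riem \<Rightarrow> 'a set \<Rightarrow> 'a \<times> real \<Rightarrow> 'a" where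
  "normal_exp M \<Omega> = (\<lambda>(x, t). exp_map M x (\<lambda>c. t *\<^sub>R outward_normal M \<Omega> x c))"

definition C1_from_cylinder ::
    "('a::topological_space, 'n::finite) riem \<Rightarrow> ('a \<times> real) set \<Rightarrow> ('a \<times> real \<Rightarrow> 'a) \<Rightarrow> bool" where
  "C1_from_cylinder M W F \<longleftrightarrow> continuous_on W F \<and>
     (\<forall>c\<in>charts M. \<forall>d\<in>charts M.
        Ck_on 1 (\<lambda>(y, t). cmap d (F (cinv c y, t)))
          {(y, t). y \<in> cimg c \<and> (cinv c y, t) \<in> W \<and> F (cinv c y, t) \<in> cdom d})"

definition C1_to_cylinder ::
    "('a::topological_space, 'n::finite) riem \<Rightarrow> 'a set \<Rightarrow> ('a \<Rightarrow> 'a \<times> real) \<Rightarrow> bool" where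
  "C1_to_cylinder M W G \<longleftrightarrow> continuous_on W G \<and>
     (\<forall>c\<in>charts M. \<forall>d\<in>charts M.
        Ck_on 1 (\<lambda>y. (cmap d (fst (G (cinv c y))), snd (G (cinv c y))))
          {y. y \<in> cimg c \<and> cinv c y \<in> W \<and> fst (G (cinv c y)) \<in> cdom d})"

text \<open>The normal field of a \<open>C\<^sup>2\<^sup>,\<^sup>\<alpha>\<close> boundary has one derivative less, so diffeomorphism means
  \<open>C\<^sup>1\<close> diffeomorphism.  Differentiability on the submanifold \<open>frontier \<Omega> \<times> (-\<rho>, \<rho>)\<close> is local
  extendability to a \<open>C\<^sup>1\<close> map on an open subset of the cylinder over the manifold; the image has full
  dimension, hence is open.\<close>

definition normal_collar ::
    "('a::topological_space, 'n::finite) riem \<Rightarrow> 'a set \<Rightarrow> real \<Rightarrow> bool" where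
  "normal_collar M \<Omega> \<rho> \<longleftrightarrow>
     (let X = frontier \<Omega> \<times> {- \<rho><..<\<rho>}; E = normal_exp M \<Omega> in
      inj_on E X \<and> open (E ` X) \<and>
      (\<forall>q\<in>X. \<exists>W F. open W \<and> q \<in> W \<and> C1_from_cylinder M W F \<and> (\<forall>q'\<in>X \<inter> W. F q' = E q')) \<and>
      C1_to_cylinder M (E ` X) (inv_into X E))"

section \<open>Reference domain and admissible domains\<close>

definition reference_domain ::
    "('a::topological_space, 'n::finite) riem \<Rightarrow> real \<Rightarrow> 'a set \<Rightarrow> 'a set \<Rightarrow> bool" where
  "reference_domain M \<alpha> K C \<longleftrightarrow> open C \<and> connected C \<and> K \<subseteq> C \<and> C2\<alpha>_boundary M \<alpha> C \<and>
     (\<exists>\<rho>\<^sub>C>0. normal_collar M C \<rho>\<^sub>C)"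

definition defining_function ::
    "('a::topological_space, 'n::finite) riem \<Rightarrow> (('a, 'n) chart \<times> (real ^ 'n) \<times> real) set \<Rightarrow> real \<Rightarrow>
     real \<Rightarrow> real \<Rightarrow> real \<Rightarrow> 'a set \<Rightarrow> ('a \<Rightarrow> real) \<Rightarrow> bool" where
  "defining_function M B \<alpha> A c\<^sub>0 \<rho>\<^sub>0 \<Omega> h \<longleftrightarrow>
     C2\<alpha>_fun M \<alpha> h \<and> \<Omega> = {x. h x > 0} \<and> frontier \<Omega> = {x. h x = 0} \<and>
     C2\<alpha>_norm B \<alpha> h \<le> A \<and> (\<forall>x. \<bar>h x\<bar> \<le> \<rho>\<^sub>0 \<longrightarrow> tnorm M x (gradient M h x) \<ge> c\<^sub>0)"

definition RC_GNP ::
    "('a::topological_space, 'n::finite) riem \<Rightarrow> (('a, 'n) chart \<times> (real ^ 'n) \<times> real) set \<Rightarrow> real \<Rightarrow>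
     real \<Rightarrow> real \<Rightarrow> real \<Rightarrow> real \<Rightarrow> 'a set \<Rightarrow> 'a set \<Rightarrow> bool" where
  "RC_GNP M B \<alpha> A c\<^sub>0 \<rho>\<^sub>0 \<rho>\<^sub>1 C \<Omega> \<longleftrightarrow>
     C \<subseteq> \<Omega> \<and> C2\<alpha>_boundary M \<alpha> \<Omega> \<and>
     (\<exists>h. defining_function M B \<alpha> A c\<^sub>0 \<rho>\<^sub>0 \<Omega> h) \<and>
     normal_collar M \<Omega> \<rho>\<^sub>1"

definition admissible ::
    "('a::topological_space, 'n::finite) riem \<Rightarrow> (('a, 'n) chart \<times> (real ^ 'n) \<times> real) set \<Rightarrow> real \<Rightarrow>
     real \<Rightarrow> real \<Rightarrow> real \<Rightarrow> real \<Rightarrow> 'a set \<Rightarrow> 'a set set" where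
  "admissible M B \<alpha> A c\<^sub>0 \<rho>\<^sub>0 \<rho>\<^sub>1 C =
     {\<Omega>. open \<Omega> \<and> connected \<Omega> \<and> \<Omega> \<noteq> UNIV \<and> C \<subseteq> \<Omega> \<and> C2\<alpha>_boundary M \<alpha> \<Omega> \<and>
          RC_GNP M B \<alpha> A c\<^sub>0 \<rho>\<^sub>0 \<rho>\<^sub>1 C \<Omega>}"

section \<open>Riemannian volume, Sobolev spaces, weak solutions\<close>

definition riemannian_volume :: "('a::topological_space, 'n::finite) riem \<Rightarrow> 'a measure" where
  "riemannian_volume M = (THE V. sets V = sets borel \<and>
     (\<forall>c\<in>charts M. \<forall>S\<in>sets borel. S \<subseteq> cdom c \<longrightarrow>
        emeasure V S = (\<integral>\<^sup>+ y\<in>cmap c ` S. ennreal (sqrt (det (gmat M c (cinv c y)))) \<partial>lborel)))"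

text \<open>Functions on an open set \<open>\<Omega>\<close> are represented by total functions whose values outside \<open>\<Omega>\<close> are
  irrelevant.\<close>

definition L2 :: "('a::topological_space, 'n::finite) riem \<Rightarrow> 'a set \<Rightarrow> ('a \<Rightarrow> real) set" where
  "L2 M \<Omega> = {u. set_borel_measurable (riemannian_volume M) \<Omega> u \<and> set_integrable (riemannian_volume M) \<Omega> (\<lambda>x. (u x)\<^sup>2)}"

text \<open>Square integrable weak gradient on \<open>\<Omega>\<close>: in each chart the covector \<open>\<Sum>j. g\<^sub>i\<^sub>j X\<^sup>j\<close> is the
  distributional differential of \<open>u\<close>.\<close>

definition weak_gradient ::
    "('a::topological_space, 'n::finite) riem \<Rightarrow> 'a set \<Rightarrow> ('a \<Rightarrow> real) \<Rightarrow> ('a \<Rightarrow> ('a, 'n) tvec) \<Rightarrow> bool" where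
  "weak_gradient M \<Omega> u X \<longleftrightarrow>
     (\<forall>x\<in>\<Omega>. tangent_vector M x (X x)) \<and>
     (\<forall>c\<in>charts M. set_borel_measurable (riemannian_volume M) (cdom c \<inter> \<Omega>) (\<lambda>x. X x c)) \<and>
     set_integrable (riemannian_volume M) \<Omega> (\<lambda>x. (tnorm M x (X x))\<^sup>2) \<and>
     (\<forall>c\<in>charts M. \<forall>\<psi> :: real ^ 'n \<Rightarrow> real. \<forall>i.
        smooth_on \<psi> UNIV \<and> compact (closure {y. \<psi> y \<noteq> 0}) \<and>
        closure {y. \<psi> y \<noteq> 0} \<subseteq> cmap c ` (cdom c \<inter> \<Omega>) \<longrightarrow>
        (LINT y|lborel. u (cinv c y) * dirderiv (axis i 1) \<psi> y) =
        - (LINT y|lborel. (gmat M c (cinv c y) *v X (cinv c y) c) $ i * \<psi> y))"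

definition H1 :: "('a::topological_space, 'n::finite) riem \<Rightarrow> 'a set \<Rightarrow> ('a \<Rightarrow> real) set" where
  "H1 M \<Omega> = {u \<in> L2 M \<Omega>. \<exists>X. weak_gradient M \<Omega> u X}"

text \<open>Weak gradients are unique up to null sets.\<close>

definition wgrad ::
    "('a::topological_space, 'n::finite) riem \<Rightarrow> 'a set \<Rightarrow> ('a \<Rightarrow> real) \<Rightarrow> 'a \<Rightarrow> ('a, 'n) tvec" where
  "wgrad M \<Omega> u = (SOME X. weak_gradient M \<Omega> u X)"

definition H1_norm :: "('a::topological_space, 'n::finite) riem \<Rightarrow> 'a set \<Rightarrow> ('a \<Rightarrow> real) \<Rightarrow> real" where
  "H1_norm M \<Omega> u = sqrt ((LINT x:\<Omega>|riemannian_volume M. (u x)\<^sup>2)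
                        + (LINT x:\<Omega>|riemannian_volume M. (tnorm M x (wgrad M \<Omega> u x))\<^sup>2))"

definition test_fun :: "('a::topological_space, 'n::finite) riem \<Rightarrow> 'a set \<Rightarrow> ('a \<Rightarrow> real) \<Rightarrow> bool" where
  "test_fun M \<Omega> \<phi> \<longleftrightarrow>
     smooth_fun M \<phi> \<and> compact (closure {x. \<phi> x \<noteq> 0}) \<and> closure {x. \<phi> x \<noteq> 0} \<subseteq> \<Omega>"

definition H10 :: "('a::topological_space, 'n::finite) riem \<Rightarrow> 'a set \<Rightarrow> ('a \<Rightarrow> real) set" where
  "H10 M \<Omega> = {u \<in> H1 M \<Omega>. \<exists>\<phi>. (\<forall>k::nat. test_fun M \<Omega> (\<phi> k)) \<and>
                 (\<lambda>k. H1_norm M \<Omega> (\<lambda>x. u x - \<phi> k x)) \<longlonglongrightarrow> 0}"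

definition weak_solution ::
    "('a::topological_space, 'n::finite) riem \<Rightarrow> 'a set \<Rightarrow> ('a \<Rightarrow> real) \<Rightarrow> ('a \<Rightarrow> real) \<Rightarrow> bool" where
  "weak_solution M \<Omega> f u \<longleftrightarrow> u \<in> H10 M \<Omega> \<and>
     (\<forall>\<phi>\<in>H10 M \<Omega>.
        (LINT x:\<Omega>|riemannian_volume M. tinner M x (wgrad M \<Omega> u x) (wgrad M \<Omega> \<phi> x)) =
        (LINT x:\<Omega>|riemannian_volume M. f x * \<phi> x))"

definition zero_ext :: "'a set \<Rightarrow> ('a \<Rightarrow> real) \<Rightarrow> 'a \<Rightarrow> real" where
  "zero_ext \<Omega> u = (\<lambda>x. if x \<in> \<Omega> then u x else 0)"

text \<open>Support of an \<open>L\<^sup>2\<close> class: the complement of the largest open set on which \<open>f\<close> vanishes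
  almost everywhere.\<close>

definition ess_supp :: "('a::topological_space, 'n::finite) riem \<Rightarrow> ('a \<Rightarrow> real) \<Rightarrow> 'a set" where
  "ess_supp M f = {x. \<forall>W. open W \<and> x \<in> W \<longrightarrow> \<not> (AE y in riemannian_volume M. y \<in> W \<longrightarrow> f y = 0)}"

end

theory Submission
  imports Defs
begin

text \<open>Write \<open>J \<phi> = 2 \<integral> f \<phi> - \<integral> |\<nabla>\<phi>|\<^sup>2\<close>.  If \<open>u\<close> solves the Dirichlet problem on \<open>W\<close> and \<open>E = \<integral> |\<nabla>u|\<^sup>2\<close>, then
  \<open>\<integral> |\<nabla>u - \<nabla>\<phi>|\<^sup>2 = E - J \<phi>\<close> for every test function \<open>\<phi>\<close> on \<open>W\<close>, so \<open>E\<close> is the supremum of \<open>J\<close> over the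
  test functions on \<open>W\<close>, and a near-maximiser of \<open>J\<close> is close to \<open>u\<close> in \<open>H\<^sup>1\<close> by the Poincare inequality.
  Hence it suffices to find one \<open>\<phi>\<close> that is a near-maximiser for \<open>\<Omega>\<close> and for all \<open>\<Omega>\<^sub>j\<close> with \<open>j\<close> large.  A
  near-maximiser \<open>\<phi>\<close> for \<open>\<Omega> = {h > 0}\<close> has compact support, so uniform convergence makes it a test
  function on \<open>\<Omega>\<^sub>j\<close>.  Conversely \<open>\<Omega>\<^sub>j \<subseteq> {h > -\<epsilon>}\<close>, so it remains to see that \<open>sup J\<close> over
  \<open>{h > -\<epsilon>}\<close> tends to \<open>E\<close> as \<open>\<epsilon>\<close> tends to \<open>0\<close>.  By the parallelogram identity, near-maximisers on \<open>{h > -\<epsilon>}\<close>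
  form a Cauchy sequence; since \<open>\<nabla>h \<noteq> 0\<close> on the boundary, a partition of unity and small translations in
  charts move them into \<open>{h > 0}\<close> with little change in \<open>H\<^sup>1\<close>.\<close>

section \<open>Calculus of the classes \<open>Ck_on\<close>\<close>

text \<open>Two obstacles shape the argument. A small translation changes a fixed smooth function
  little in H^1, but not uniformly over functions of bounded energy. The Cauchy property reduces the
  near-maximisers to one fixed function plus a small remainder, and for the remainder a bound
  independent of the translation length \<open>t\<close> suffices. Along the shift \<open>h\<close>
  gains at least a multiple of \<open>t\<close>, so \<open>t\<close> is fixed first and the
  superlevel is chosen close enough to 0 afterwards. The second obstacle is a Poincare constant
  common to all domains. It comes from an open set where \<open>h\<close> is below a negative level:
  test functions on the limit domain and on all late domains vanish there, and connectedness of the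
  manifold spreads the estimate through coordinate balls. All estimates are made for smooth test
  functions; elements of \<open>H10\<close> enter only as their limits, and suprema of a functional
  replace weak compactness. The encoding adds two duties: the volume is a definite description, so
  its existence and uniqueness rest on a change of variables, and \<open>wgrad\<close> is a choice,
  so weak gradients must be unique almost everywhere.\<close>

lemma frechet_derivative_cong_open:
  assumes "open S" "x \<in> S" "\<And>y. y \<in> S \<Longrightarrow> F y = G y"
  shows "frechet_derivative F (at x) = frechet_derivative G (at x)"
proof -
  have "(F has_derivative D) (at x) \<longleftrightarrow> (G has_derivative D) (at x)" for D
    using has_derivative_transform_within_open[OF _ assms(1,2)] assms(3) by metis
  then show ?thesis by (simp add: frechet_derivative_def)
qed

lemma differentiable_cong_open:
  assumes "open S" "x \<in> S" "\<And>y. y \<in> S \<Longrightarrow> F y = G y"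
  shows "F differentiable (at x) \<longleftrightarrow> G differentiable (at x)"
  using has_derivative_transform_within_open[OF _ assms(1,2)] assms(3)
  unfolding differentiable_def by metis

lemma frechet_derivative_eq:
  "(F has_derivative D) (at x) \<Longrightarrow> frechet_derivative F (at x) = D"
  using frechet_derivative_at by metis

lemma Ck_on_cong:
  assumes "open S" "\<And>y. y \<in> S \<Longrightarrow> F y = G y"
  shows "Ck_on k F S \<longleftrightarrow> Ck_on k G S"
  using assms(2)
proof (induction k arbitrary: F G)
  case 0
  then show ?case by (auto cong: continuous_on_cong)
next
  case (Suc k)
  have "dirderiv b F x = dirderiv b G x" if "x \<in> S" for b x
    using frechet_derivative_cong_open[OF assms(1) that Suc.prems] by simp
  then have "Ck_on k (dirderiv b F) S \<longleftrightarrow> Ck_on k (dirderiv b G) S" for b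
    by (intro Suc.IH)
  moreover have "F differentiable (at x) \<longleftrightarrow> G differentiable (at x)" if "x \<in> S" for x
    by (rule differentiable_cong_open[OF assms(1) that Suc.prems])
  ultimately show ?case by auto
qed

lemma Ck_on_SucD: "Ck_on (Suc k) F S \<Longrightarrow> Ck_on k F S"
proof (induction k arbitrary: F)
  case 0
  then show ?case
    by (auto intro!: continuous_at_imp_continuous_on differentiable_imp_continuous_within)
next
  case (Suc k)
  then show ?case by auto
qed

lemma Ck_on_continuous: "Ck_on k F S \<Longrightarrow> continuous_on S F"
  by (induction k) (auto dest: Ck_on_SucD simp del: Ck_on.simps(2))

lemma Ck_on_const: "Ck_on k (\<lambda>x. c) S"
  by (induction k arbitrary: c) (auto simp: frechet_derivative_eq[OF has_derivative_const])

lemma Ck_on_bounded_linear: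
  assumes "bounded_linear L"
  shows "Ck_on k L S"
proof (cases k)
  case 0
  then show ?thesis
    using assms linear_continuous_on by auto
next
  case (Suc m)
  have "(L has_derivative L) (at x)" for x
    using assms bounded_linear_imp_has_derivative by blast
  then have "L differentiable (at x)" "frechet_derivative L (at x) = L" for x
    using frechet_derivative_eq by (auto simp: differentiable_def)
  then show ?thesis by (simp add: Suc Ck_on_const)
qed

lemma Ck_on_linear_compose:
  assumes "bounded_linear L" "open S" "Ck_on k F S"
  shows "Ck_on k (\<lambda>x. L (F x)) S"
  using assms(3)
proof (induction k arbitrary: F)
  case 0
  then show ?case
    using assms(1) by (auto intro: bounded_linear.continuous_on)
next
  case (Suc k)
  have d: "((\<lambda>x. L (F x)) has_derivative (\<lambda>h. L (frechet_derivative F (at x) h))) (at x)"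
    if "x \<in> S" for x
    using Suc.prems that
    by (auto intro!: bounded_linear.has_derivative[OF assms(1)] simp: frechet_derivative_works)
  have "Ck_on k (dirderiv b (\<lambda>x. L (F x))) S" if "b \<in> Basis" for b
  proof -
    have "Ck_on k (\<lambda>x. L (dirderiv b F x)) S"
      using Suc that by auto
    then show ?thesis
      by (subst Ck_on_cong[OF assms(2), where G = "\<lambda>x. L (dirderiv b F x)"])
        (auto simp: frechet_derivative_eq[OF d])
  qed
  with d show ?case by (auto simp: differentiable_def)
qed

lemma Ck_on_add:
  assumes "open S" "Ck_on k F S" "Ck_on k G S"
  shows "Ck_on k (\<lambda>x. F x + G x) S"
  using assms(2,3)
proof (induction k arbitrary: F G)
  case 0
  then show ?case by (auto intro: continuous_on_add)
next
  case (Suc k)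
  have d: "((\<lambda>x. F x + G x) has_derivative
      (\<lambda>h. frechet_derivative F (at x) h + frechet_derivative G (at x) h)) (at x)"
    if "x \<in> S" for x
    using Suc.prems that
    by (auto intro!: has_derivative_add simp: frechet_derivative_works)
  have "Ck_on k (dirderiv b (\<lambda>x. F x + G x)) S" if "b \<in> Basis" for b
  proof -
    have "Ck_on k (\<lambda>x. dirderiv b F x + dirderiv b G x) S"
      using Suc that by auto
    then show ?thesis
      by (subst Ck_on_cong[OF assms(1), where G = "\<lambda>x. dirderiv b F x + dirderiv b G x"])
        (auto simp: frechet_derivative_eq[OF d])
  qed
  with d show ?case by (auto simp: differentiable_def)
qed

lemma Ck_on_sum:
  assumes "open S" "\<And>i. i \<in> I \<Longrightarrow> Ck_on k (F i) S"
  shows "Ck_on k (\<lambda>x. \<Sum>i\<in>I. F i x) S"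
  using assms(2)
  by (induction I rule: infinite_finite_induct) (auto intro: Ck_on_add[OF assms(1)] Ck_on_const)

text \<open>One induction on the Leibniz rule serves scalar multiples, inner products and products.
  Both factors are generalised because each summand of the derivative pairs a differentiated factor
  with an undifferentiated one.\<close>

lemma (in bounded_bilinear) Ck_on:
  assumes "open S" "Ck_on k F S" "Ck_on k G S"
  shows "Ck_on k (\<lambda>x. prod (F x) (G x)) S"
  using assms(2,3)
proof (induction k arbitrary: F G)
  case 0
  then show ?case by (auto intro: continuous_on)
next
  case (Suc k)
  have d: "((\<lambda>x. prod (F x) (G x)) has_derivative
      (\<lambda>h. prod (F x) (frechet_derivative G (at x) h) + prod (frechet_derivative F (at x) h) (G x))) (at x)"
    if "x \<in> S" for x
    using Suc.prems that
    by (auto intro!: FDERIV simp: frechet_derivative_works)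
  have "Ck_on k (dirderiv b (\<lambda>x. prod (F x) (G x))) S" if "b \<in> Basis" for b
  proof -
    have "Ck_on k (\<lambda>x. prod (F x) (dirderiv b G x) + prod (dirderiv b F x) (G x)) S"
      using Suc.prems that
      by (intro Ck_on_add[OF assms(1)] Suc.IH Ck_on_SucD[of k F] Ck_on_SucD[of k G]) auto
    then show ?thesis
      by (subst Ck_on_cong[OF assms(1),
            where G = "\<lambda>x. prod (F x) (dirderiv b G x) + prod (dirderiv b F x) (G x)"])
        (auto simp: frechet_derivative_eq[OF d])
  qed
  with d show ?case by (auto simp: differentiable_def)
qed

lemmas Ck_on_scaleR = bounded_bilinear.Ck_on[OF bounded_bilinear_scaleR]
lemmas Ck_on_inner = bounded_bilinear.Ck_on[OF bounded_bilinear_inner]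
lemmas Ck_on_mult = bounded_bilinear.Ck_on[OF bounded_bilinear_mult]

text \<open>The derivative of 1/F is -F'/F^2, in which 1/F occurs with one order of smoothness less
  to prove. Hence \<open>F\<close> can stay fixed in the induction.\<close>

lemma Ck_on_inverse:
  fixes F :: "'e::euclidean_space \<Rightarrow> real"
  assumes "open S" "Ck_on k F S" "\<And>x. x \<in> S \<Longrightarrow> F x \<noteq> 0"
  shows "Ck_on k (\<lambda>x. inverse (F x)) S"
  using assms(2)
proof (induction k)
  case 0
  then show ?case using assms(3) by (auto intro: continuous_on_inverse)
next
  case (Suc k)
  have d: "((\<lambda>x. inverse (F x)) has_derivative
      (\<lambda>h. - (inverse (F x) * frechet_derivative F (at x) h * inverse (F x)))) (at x)"
    if "x \<in> S" for x
    using Suc.prems that assms(3)[OF that]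
    by (auto intro!: has_derivative_inverse simp: frechet_derivative_works)
  have "Ck_on k (dirderiv b (\<lambda>x. inverse (F x))) S" if "b \<in> Basis" for b
  proof -
    have "Ck_on k (\<lambda>x. (-1) * (inverse (F x) * dirderiv b F x * inverse (F x))) S"
      using Suc.prems that
      by (intro Ck_on_mult[OF assms(1)] Suc.IH Ck_on_const Ck_on_SucD[of k F]) auto
    then show ?thesis
      by (subst Ck_on_cong[OF assms(1),
            where G = "\<lambda>x. (-1) * (inverse (F x) * dirderiv b F x * inverse (F x))"])
        (auto simp: frechet_derivative_eq[OF d])
  qed
  with d show ?case by (auto simp: differentiable_def)
qed

text \<open>Induction with \<open>G\<close> generalised: a partial derivative of the composition is
  a finite sum of partial derivatives of \<open>G\<close> composed with the same \<open>F\<close>,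
  with partial derivatives of \<open>F\<close> as coefficients.\<close>

lemma Ck_on_compose:
  fixes F :: "'e::euclidean_space \<Rightarrow> 'f::euclidean_space"
  assumes "open S" "open T" "F ` S \<subseteq> T" "Ck_on k F S" "Ck_on k G T"
  shows "Ck_on k (\<lambda>x. G (F x)) S"
  using assms(4,5)
proof (induction k arbitrary: G)
  case 0
  then show ?case using assms(3) by (auto intro: continuous_on_compose2)
next
  case (Suc k)
  have d: "((\<lambda>x. G (F x)) has_derivative
      (\<lambda>h. frechet_derivative G (at (F x)) (frechet_derivative F (at x) h))) (at x)"
    if "x \<in> S" for x
  proof -
    have "(F has_derivative frechet_derivative F (at x)) (at x)"
      using Suc.prems that by (auto simp: frechet_derivative_works)
    moreover have "(G has_derivative frechet_derivative G (at (F x))) (at (F x))"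
      using Suc.prems that assms(3) by (auto simp: frechet_derivative_works)
    ultimately show ?thesis
      using diff_chain_at[of F _ x G] by (simp add: o_def)
  qed
  have eq: "dirderiv b (\<lambda>x. G (F x)) x
      = (\<Sum>b'\<in>Basis. (dirderiv b F x \<bullet> b') *\<^sub>R dirderiv b' G (F x))" if "x \<in> S" for x b
  proof -
    have "linear (frechet_derivative G (at (F x)))"
      using Suc.prems that assms(3)
      by (intro linear_frechet_derivative) auto
    then have "frechet_derivative G (at (F x)) v
      = (\<Sum>b'\<in>Basis. (v \<bullet> b') *\<^sub>R dirderiv b' G (F x))" for v
      by (subst euclidean_representation[of v, symmetric])
        (simp add: linear_sum linear_scale o_def)
    then show ?thesis unfolding frechet_derivative_eq[OF d[OF that]] .
  qed
  have "Ck_on k (dirderiv b (\<lambda>x. G (F x))) S" if "b \<in> Basis" for b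
  proof -
    have "Ck_on k (\<lambda>x. dirderiv b' G (F x)) S" if "b' \<in> Basis" for b'
      using Suc.IH[OF Ck_on_SucD[OF Suc.prems(1)], of "dirderiv b' G"] Suc.prems(2) that by simp
    moreover have "Ck_on k (dirderiv b F) S" using Suc.prems(1) that by simp
    ultimately have "Ck_on k (\<lambda>x. \<Sum>b'\<in>Basis. (dirderiv b F x \<bullet> b') *\<^sub>R dirderiv b' G (F x)) S"
      by (intro Ck_on_sum Ck_on_scaleR Ck_on_inner Ck_on_const assms(1))
    then show ?thesis
      by (subst Ck_on_cong[OF assms(1), OF eq])
  qed
  with d show ?case by (auto simp: differentiable_def)
qed

text \<open>This is the gluing principle: a function given in a chart and 0 off a compact set is
  smooth as soon as it is smooth on two open pieces.\<close>

lemma Ck_on_Un: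
  assumes "open S" "open T" "Ck_on k F S" "Ck_on k F T"
  shows "Ck_on k F (S \<union> T)"
  using assms(3,4)
  by (induction k arbitrary: F) (auto intro: continuous_on_open_Un[OF assms(1,2)])

lemma smooth_on_cong:
  "open S \<Longrightarrow> (\<And>y. y \<in> S \<Longrightarrow> F y = G y) \<Longrightarrow> smooth_on F S \<longleftrightarrow> smooth_on G S"
  unfolding smooth_on_def using Ck_on_cong by metis

lemma smooth_on_const: "smooth_on (\<lambda>x. c) S"
  by (simp add: smooth_on_def Ck_on_const)

lemma smooth_on_bounded_linear: "bounded_linear L \<Longrightarrow> smooth_on L S"
  by (simp add: smooth_on_def Ck_on_bounded_linear)

lemma smooth_on_linear_compose:
  "bounded_linear L \<Longrightarrow> open S \<Longrightarrow> smooth_on F S \<Longrightarrow> smooth_on (\<lambda>x. L (F x)) S"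
  by (simp add: smooth_on_def Ck_on_linear_compose)

lemma smooth_on_add: "open S \<Longrightarrow> smooth_on F S \<Longrightarrow> smooth_on G S \<Longrightarrow> smooth_on (\<lambda>x. F x + G x) S"
  by (simp add: smooth_on_def Ck_on_add)

lemma smooth_on_mult:
  fixes F G :: "'e::euclidean_space \<Rightarrow> real"
  shows "open S \<Longrightarrow> smooth_on F S \<Longrightarrow> smooth_on G S \<Longrightarrow> smooth_on (\<lambda>x. F x * G x) S"
  by (simp add: smooth_on_def Ck_on_mult)

lemma smooth_on_prod:
  fixes F :: "'i \<Rightarrow> 'e::euclidean_space \<Rightarrow> real"
  assumes "open S" "\<And>i. i \<in> I \<Longrightarrow> smooth_on (F i) S"
  shows "smooth_on (\<lambda>x. \<Prod>i\<in>I. F i x) S"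
  using assms(2)
  by (induction I rule: infinite_finite_induct)
    (auto intro: smooth_on_const smooth_on_mult[OF assms(1)])

lemma smooth_on_inner:
  "open S \<Longrightarrow> smooth_on F S \<Longrightarrow> smooth_on G S \<Longrightarrow> smooth_on (\<lambda>x. F x \<bullet> G x) S"
  by (simp add: smooth_on_def Ck_on_inner)

lemma smooth_on_diff:
  "open S \<Longrightarrow> smooth_on F S \<Longrightarrow> smooth_on G S \<Longrightarrow> smooth_on (\<lambda>x. F x - G x) S"
  using smooth_on_add[of S F "\<lambda>x. - G x"]
    smooth_on_linear_compose[OF bounded_linear_minus[OF bounded_linear_ident], of S G] by simp

lemma smooth_on_inverse:
  fixes F :: "'e::euclidean_space \<Rightarrow> real"
  shows "open S \<Longrightarrow> smooth_on F S \<Longrightarrow> (\<And>x. x \<in> S \<Longrightarrow> F x \<noteq> 0) \<Longrightarrow> smooth_on (\<lambda>x. inverse (F x)) S"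
  by (simp add: smooth_on_def Ck_on_inverse)

lemma smooth_on_compose:
  fixes F :: "'e::euclidean_space \<Rightarrow> 'f::euclidean_space"
  shows "open S \<Longrightarrow> open T \<Longrightarrow> F ` S \<subseteq> T \<Longrightarrow> smooth_on F S \<Longrightarrow> smooth_on G T \<Longrightarrow>
    smooth_on (\<lambda>x. G (F x)) S"
  unfolding smooth_on_def using Ck_on_compose by metis

lemma smooth_on_Un:
  "open S \<Longrightarrow> open T \<Longrightarrow> smooth_on F S \<Longrightarrow> smooth_on F T \<Longrightarrow> smooth_on F (S \<union> T)"
  by (simp add: smooth_on_def Ck_on_Un)

lemma smooth_on_continuous: "smooth_on F S \<Longrightarrow> continuous_on S F"
  unfolding smooth_on_def using Ck_on_continuous by blast

lemma smooth_on_has_derivative: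
  assumes "smooth_on F S" "x \<in> S"
  shows "(F has_derivative frechet_derivative F (at x)) (at x)"
proof -
  have "Ck_on (Suc 0) F S" using assms(1) by (simp only: smooth_on_def)
  then show ?thesis using assms(2) by (simp add: frechet_derivative_works)
qed

lemma smooth_on_dirderiv:
  assumes "smooth_on F S" "b \<in> Basis"
  shows "smooth_on (dirderiv b F) S"
proof -
  have "Ck_on (Suc k) F S" for k using assms(1) by (simp only: smooth_on_def)
  then show ?thesis using assms(2) by (simp add: smooth_on_def)
qed

lemma smooth_on_translate:
  fixes F :: "'e::euclidean_space \<Rightarrow> 'f::real_normed_vector"
  assumes "smooth_on F UNIV"
  shows "smooth_on (\<lambda>y. F (y + v)) UNIV"
  by (rule smooth_on_compose[OF open_UNIV open_UNIV _ _ assms])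
    (simp_all add: smooth_on_add smooth_on_bounded_linear bounded_linear_ident smooth_on_const)

section \<open>Smooth bump functions\<close>

text \<open>\<open>flat_exp 0\<close> is the classical flat function exp(-1/x), extended by 0. The
  extra powers of 1/x make the family closed under differentiation up to linear combinations, which
  allows induction on the order.\<close>

definition flat_exp :: "nat \<Rightarrow> real \<Rightarrow> real" where
  "flat_exp m x = (if x \<le> 0 then 0 else exp (- inverse x) * inverse x ^ m)"

lemma flat_exp_tendsto_0: "(flat_exp m \<longlongrightarrow> 0) (at 0)"
proof (rule filterlim_split_at)
  show "(flat_exp m \<longlongrightarrow> 0) (at_left 0)"
    by (rule tendsto_eventually) (auto simp: flat_exp_def eventually_at_left_field intro: exI[of _ "-1"])
  have "((\<lambda>s::real. s ^ m / exp s) \<longlongrightarrow> 0) at_top"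
    by (rule tendsto_power_div_exp_0)
  then have "((\<lambda>x::real. inverse x ^ m / exp (inverse x)) \<longlongrightarrow> 0) (at_right 0)"
    by (rule filterlim_compose[OF _ filterlim_inverse_at_top_right])
  then show "(flat_exp m \<longlongrightarrow> 0) (at_right 0)"
    by (rule Lim_transform_eventually)
      (auto simp: flat_exp_def eventually_at_right_field exp_minus field_simps intro!: exI[of _ 1])
qed

lemma flat_exp_derivative:
  "(flat_exp m has_field_derivative flat_exp (m + 2) x - real m * flat_exp (m + 1) x) (at x)"
proof -
  consider "x < 0" | "x = 0" | "x > 0" by linarith
  then show ?thesis
  proof cases
    case 1
    have "((\<lambda>x. 0) has_field_derivative 0) (at x)" by simp
    then have "(flat_exp m has_field_derivative 0) (at x)"
      by (rule has_field_derivative_transform_within_open[of _ _ _ "{..<0}"])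
        (use 1 in \<open>auto simp: flat_exp_def\<close>)
    with 1 show ?thesis by (simp add: flat_exp_def)
  next
    case 2
    \<comment> \<open>At 0 the difference quotient of \<open>flat_exp m\<close> is
      \<open>flat_exp (Suc m)\<close>, which tends to 0.\<close>
    have "((\<lambda>h. (flat_exp m (0 + h) - flat_exp m 0) / h) \<longlongrightarrow> 0) (at 0)"
      by (rule Lim_transform_eventually[OF flat_exp_tendsto_0[of "Suc m"]])
        (auto simp: flat_exp_def eventually_at field_simps intro!: exI[of _ 1])
    with 2 show ?thesis by (simp add: DERIV_def flat_exp_def)
  next
    case 3
    have "((\<lambda>x. exp (- inverse x) * inverse x ^ m) has_field_derivative
        exp (- inverse x) * inverse x ^ (m + 2) - real m * (exp (- inverse x) * inverse x ^ (m + 1))) (at x)"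
      using 3
      apply (auto intro!: derivative_eq_intros simp: power2_eq_square)
      apply (cases m)
       apply (auto simp: algebra_simps)
      done
    then have "(flat_exp m has_field_derivative
        exp (- inverse x) * inverse x ^ (m + 2) - real m * (exp (- inverse x) * inverse x ^ (m + 1))) (at x)"
      by (rule has_field_derivative_transform_within_open[of _ _ _ "{0<..}"])
        (use 3 in \<open>auto simp: flat_exp_def\<close>)
    with 3 show ?thesis by (simp add: flat_exp_def)
  qed
qed

lemma Ck_on_flat_exp: "Ck_on k (flat_exp m) UNIV"
proof (induction k arbitrary: m)
  case 0
  then show ?case
    using flat_exp_derivative by (auto intro!: continuous_at_imp_continuous_on DERIV_isCont)
next
  case (Suc k)
  have d: "(flat_exp m has_derivative (*) (flat_exp (m + 2) x - real m * flat_exp (m + 1) x)) (at x)" for x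
    using flat_exp_derivative by (simp add: has_field_derivative_def)
  have "dirderiv 1 (flat_exp m) = (\<lambda>x. flat_exp (m + 2) x + (- real m) * flat_exp (m + 1) x)"
    by (auto simp: frechet_derivative_eq[OF d])
  moreover have "Ck_on k (\<lambda>x. flat_exp (m + 2) x + (- real m) * flat_exp (m + 1) x) UNIV"
    by (intro Ck_on_add Ck_on_mult Ck_on_const Suc open_UNIV)
  ultimately show ?case using d by (auto simp: differentiable_def)
qed

abbreviation step :: "real \<Rightarrow> real" where "step \<equiv> flat_exp 0"

lemma smooth_on_step: "smooth_on step UNIV"
  by (simp add: smooth_on_def Ck_on_flat_exp)

lemma smooth_on_step_compose:
  assumes "open S" "smooth_on F S" shows "smooth_on (\<lambda>x. step (F x)) S"
  by (rule smooth_on_compose[OF assms(1) open_UNIV _ assms(2) smooth_on_step]) simp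

lemma step_pos: "0 < x \<Longrightarrow> 0 < step x" and step_zero: "x \<le> 0 \<Longrightarrow> step x = 0"
  and step_nonneg: "0 \<le> step x" and step_le_1: "step x \<le> 1"
  by (auto simp: flat_exp_def)

lemma step_tendsto_1:
  assumes "0 < s" shows "(\<lambda>k. step (real k * s)) \<longlonglongrightarrow> 1"
proof -
  have "(\<lambda>k. exp (- (inverse s * inverse (real k)))) \<longlonglongrightarrow> exp (- (inverse s * 0))"
    by (intro tendsto_intros lim_inverse_n)
  then have "(\<lambda>k. exp (- (inverse s * inverse (real k)))) \<longlonglongrightarrow> 1" by simp
  then show ?thesis
    by (rule Lim_transform_eventually)
      (use assms in \<open>auto simp: flat_exp_def eventually_sequentially mult_le_0_iff intro!: exI[of _ 1]\<close>)
qed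

lemma smooth_ball_bump:
  fixes z :: "'e::euclidean_space"
  assumes "0 < r"
  obtains \<beta> :: "'e \<Rightarrow> real" where "smooth_on \<beta> UNIV" "\<And>y. 0 \<le> \<beta> y" "\<And>y. 0 < \<beta> y \<longleftrightarrow> y \<in> ball z r"
proof
  \<comment> \<open>The squared distance is used because, unlike the distance, it is smooth at the
    centre.\<close>
  let ?\<beta> = "\<lambda>y. step (r\<^sup>2 - (y - z) \<bullet> (y - z))"
  show "smooth_on ?\<beta> UNIV"
    by (intro smooth_on_step_compose smooth_on_diff smooth_on_inner smooth_on_const
        smooth_on_bounded_linear bounded_linear_ident open_UNIV)
  show "0 \<le> ?\<beta> y" for y by (rule step_nonneg)
  have "0 < step x \<longleftrightarrow> 0 < x" for x using step_pos step_zero by (metis less_irrefl not_le)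
  moreover have "0 < r\<^sup>2 - (y - z) \<bullet> (y - z) \<longleftrightarrow> y \<in> ball z r" for y
    using assms by (auto simp: dot_square_norm dist_norm norm_minus_commute power_strict_mono
        dest: power_less_imp_less_base)
  ultimately show "0 < ?\<beta> y \<longleftrightarrow> y \<in> ball z r" for y by simp
qed

text \<open>The bumps increase to the indicator function of the box as \<open>k\<close> tends to infinity.\<close>

definition box_bump :: "'e::euclidean_space \<Rightarrow> 'e \<Rightarrow> nat \<Rightarrow> 'e \<Rightarrow> real" where
  "box_bump a b k y = (\<Prod>i\<in>Basis. step (real k * ((y - a) \<bullet> i)) * step (real k * ((b - y) \<bullet> i)))"

lemma smooth_on_box_bump: "smooth_on (box_bump a b k) UNIV"
  unfolding box_bump_def
  by (intro smooth_on_prod smooth_on_mult smooth_on_step_compose smooth_on_diff smooth_on_inner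
      smooth_on_const smooth_on_bounded_linear bounded_linear_ident open_UNIV)

lemma box_bump_zero:
  assumes "y \<notin> box a b" shows "box_bump a b k y = 0"
proof -
  obtain i where i: "i \<in> Basis" "(y - a) \<bullet> i \<le> 0 \<or> (b - y) \<bullet> i \<le> 0"
    using assms by (force simp: box_def inner_diff_left not_less)
  then have "step (real k * ((y - a) \<bullet> i)) * step (real k * ((b - y) \<bullet> i)) = 0"
    by (auto simp: step_zero mult_nonneg_nonpos)
  with i(1) show ?thesis unfolding box_bump_def by (auto intro: prod_zero)
qed

lemma box_bump_nonneg: "0 \<le> box_bump a b k y" and box_bump_le_1: "box_bump a b k y \<le> 1"
  unfolding box_bump_def
  by (auto intro!: prod_nonneg prod_le_1 mult_le_one simp: step_nonneg step_le_1)

lemma box_bump_tendsto: "(\<lambda>k. box_bump a b k y) \<longlonglongrightarrow> indicator (box a b) y"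
proof (cases "y \<in> box a b")
  case True
  then have "(\<lambda>k. box_bump a b k y) \<longlonglongrightarrow> (\<Prod>i\<in>(Basis::'a set). 1 * 1)"
    unfolding box_bump_def
    by (intro tendsto_intros step_tendsto_1) (auto simp: box_def inner_diff_left)
  with True show ?thesis by simp
qed (simp add: box_bump_zero)

section \<open>Change of variables\<close>

text \<open>The change of variables theorem of the library requires a well-ordered index type.  It is
  transported to an arbitrary finite index type along a well-ordered copy of that type.\<close>

typedef 'n wo = "UNIV :: 'n set" by simp

instantiation wo :: (finite) finite
begin
instance
proof
  have "(UNIV :: 'a wo set) = range Abs_wo"
    by (metis Rep_wo_inverse surjI)
  then show "finite (UNIV :: 'a wo set)" by (metis finite_imageI finite)
qed
end

definition wo_index :: "'n::finite wo \<Rightarrow> nat" where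
  "wo_index = (SOME f. inj f)"

lemma inj_wo_index: "inj (wo_index :: 'n::finite wo \<Rightarrow> nat)"
  unfolding wo_index_def
  by (rule someI_ex[of inj]) (use finite_imp_inj_to_nat_seg[of "UNIV :: 'n wo set"] in blast)

instantiation wo :: (finite) wellorder
begin
definition "x \<le> y \<longleftrightarrow> wo_index x \<le> wo_index (y :: 'a wo)"
definition "x < y \<longleftrightarrow> wo_index x < wo_index (y :: 'a wo)"
instance
proof
  fix P :: "'a wo \<Rightarrow> bool" and a
  assume *: "\<And>x. (\<And>y. y < x \<Longrightarrow> P y) \<Longrightarrow> P x"
  show "P a"
  proof (induction "wo_index a" arbitrary: a rule: less_induct)
    case less
    show ?case by (rule *) (use less in \<open>auto simp: less_wo_def\<close>)
  qed
qed (auto simp: less_eq_wo_def less_wo_def dest: injD[OF inj_wo_index] antisym)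
end

lemma bij_Rep_wo: "bij (Rep_wo :: 'n wo \<Rightarrow> 'n)"
  by (metis Abs_wo_inverse Rep_wo_inverse UNIV_I bijI')

lemma bij_Abs_wo: "bij (Abs_wo :: 'n \<Rightarrow> 'n wo)"
  by (metis Abs_wo_inverse Rep_wo_inverse UNIV_I bijI')

definition to_wo :: "real ^ 'n \<Rightarrow> real ^ 'n wo" where
  "to_wo x = (\<chi> i. x $ Rep_wo i)"

definition of_wo :: "real ^ 'n wo \<Rightarrow> real ^ 'n" where
  "of_wo x = (\<chi> i. x $ Abs_wo i)"

lemma to_of_wo [simp]: "to_wo (of_wo x) = x" "of_wo (to_wo y) = y"
  by (simp_all add: to_wo_def of_wo_def Rep_wo_inverse Abs_wo_inverse)

lemma linear_to_wo: "linear to_wo" and linear_of_wo: "linear of_wo"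
  by (auto intro!: linearI simp: to_wo_def of_wo_def vec_eq_iff)

lemma to_wo_measurable [measurable]: "(to_wo :: real ^ 'n \<Rightarrow> real ^ 'n::finite wo) \<in> borel_measurable borel"
  and of_wo_measurable [measurable]: "(of_wo :: real ^ 'n::finite wo \<Rightarrow> real ^ 'n) \<in> borel_measurable borel"
  using linear_continuous_on[OF linear_conv_bounded_linear[THEN iffD1, OF linear_to_wo]]
    linear_continuous_on[OF linear_conv_bounded_linear[THEN iffD1, OF linear_of_wo]]
  by (auto intro: borel_measurable_continuous_onI)

text \<open>Conjugation with the bijection \<open>Rep_wo\<close> matches the permutations of the two
  index types and preserves signs, so the Leibniz sums agree term by term.\<close>

lemma det_reindex_wo:
  fixes A :: "real ^ 'n::finite ^ 'n"
  shows "det (\<chi> i j. A $ Rep_wo i $ Rep_wo j) = det A"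
proof -
  let ?m = "map_permutation UNIV (Rep_wo :: 'n wo \<Rightarrow> 'n)"
  have inj: "inj (Rep_wo :: 'n wo \<Rightarrow> 'n)" and surj: "surj (Rep_wo :: 'n wo \<Rightarrow> 'n)"
    using bij_Rep_wo by (auto simp: bij_def)
  have m: "?m p = Rep_wo \<circ> p \<circ> Abs_wo" for p
    by (auto simp: map_permutation_def fun_eq_iff surj restrict_id_def inv_into_f_f
        intro!: arg_cong[of _ _ "\<lambda>x. Rep_wo (p x)"] inv_f_eq[OF inj] Abs_wo_inverse)
  have "Rep_wo \<circ> p \<circ> Abs_wo permutes UNIV" if "p permutes UNIV" for p :: "'n wo \<Rightarrow> 'n wo"
    using bij_comp[OF bij_Abs_wo bij_comp[OF permutes_bij[OF that] bij_Rep_wo]]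
    by (intro bij_imp_permutes) (auto simp: comp_assoc)
  moreover have "Abs_wo \<circ> p \<circ> Rep_wo permutes UNIV" if "p permutes UNIV" for p :: "'n \<Rightarrow> 'n"
    using bij_comp[OF bij_Rep_wo bij_comp[OF permutes_bij[OF that] bij_Abs_wo]]
    by (intro bij_imp_permutes) (auto simp: comp_assoc)
  ultimately have bij: "bij_betw ?m {p. p permutes UNIV} {p. p permutes UNIV}"
    by (intro bij_betw_byWitness[where f' = "\<lambda>p. Abs_wo \<circ> p \<circ> Rep_wo"])
      (auto simp: m fun_eq_iff Rep_wo_inverse Abs_wo_inverse)
  have "det A = (\<Sum>p | p permutes UNIV. of_int (sign (?m p)) * (\<Prod>i\<in>UNIV. A $ i $ ?m p i))"
    unfolding det_def by (rule sum.reindex_bij_betw[OF bij, symmetric])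
  also have "\<dots> = (\<Sum>p | p permutes UNIV. of_int (sign p) * (\<Prod>i\<in>UNIV. A $ Rep_wo i $ Rep_wo (p i)))"
  proof (rule sum.cong[OF refl])
    fix p :: "'n wo \<Rightarrow> 'n wo" assume "p \<in> {p. p permutes UNIV}"
    then have "sign (?m p) = sign p" using inj by (intro sign_map_permutation) auto
    moreover have "(\<Prod>i\<in>UNIV. A $ i $ ?m p i) = (\<Prod>i\<in>UNIV. A $ Rep_wo i $ Rep_wo (p i))"
      by (rule prod.reindex_bij_betw[OF bij_Rep_wo, of "\<lambda>i. A $ i $ ?m p i", symmetric, THEN trans])
        (simp add: m Rep_wo_inverse)
    ultimately show "of_int (sign (?m p)) * (\<Prod>i\<in>UNIV. A $ i $ ?m p i) =
      of_int (sign p) * (\<Prod>i\<in>UNIV. A $ Rep_wo i $ Rep_wo (p i))" by simp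
  qed
  finally show ?thesis by (simp add: det_def)
qed

text \<open>Lebesgue measure is determined by the volumes of boxes, and renaming the coordinates
  only permutes the factors of such a volume.\<close>

lemma distr_to_wo: "distr lborel borel (to_wo :: real ^ 'n \<Rightarrow> real ^ 'n::finite wo) = lborel"
proof (rule lborel_eqI[symmetric])
  fix l u :: "real ^ 'n wo"
  assume lu: "\<And>b. b \<in> Basis \<Longrightarrow> l \<bullet> b \<le> u \<bullet> b"
  have le: "l $ i \<le> u $ i" for i
    using lu[of "axis i 1"] by (auto simp: Basis_vec_def inner_axis)
  have eq: "to_wo -` box l u = box (of_wo l) (of_wo u)"
    by (auto simp: box_def Basis_vec_def inner_axis to_wo_def of_wo_def)
      (metis Abs_wo_inverse Rep_wo_inverse UNIV_I)+
  have "emeasure (distr lborel borel (to_wo :: real ^ 'n \<Rightarrow> _)) (box l u)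
    = emeasure lborel (box (of_wo l) (of_wo u))"
    by (subst emeasure_distr) (auto simp: eq)
  also have "\<dots> = ennreal (\<Prod>b\<in>Basis. (of_wo u - of_wo l) \<bullet> b)"
    by (rule emeasure_lborel_box) (auto simp: Basis_vec_def inner_axis of_wo_def le)
  also have "(\<Prod>b\<in>Basis. (of_wo u - of_wo l) \<bullet> b) = (\<Prod>i\<in>UNIV. (of_wo u - of_wo l) $ i)"
    by (subst prod.reindex_bij_betw[of "\<lambda>i. axis i 1" UNIV Basis, symmetric])
      (auto simp: bij_betw_def inj_on_def axis_eq_axis Basis_vec_def inner_axis)
  also have "\<dots> = (\<Prod>i\<in>UNIV. (u - l) $ i)"
    by (subst prod.reindex_bij_betw[OF bij_Rep_wo, symmetric]) (simp add: of_wo_def Rep_wo_inverse)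
  also have "\<dots> = (\<Prod>b\<in>Basis. (u - l) \<bullet> b)"
    by (subst prod.reindex_bij_betw[of "\<lambda>i. axis i 1" UNIV Basis, symmetric])
      (auto simp: bij_betw_def inj_on_def axis_eq_axis Basis_vec_def inner_axis)
  finally show "emeasure (distr lborel borel (to_wo :: real ^ 'n \<Rightarrow> _)) (box l u)
    = ennreal (\<Prod>b\<in>Basis. (u - l) \<bullet> b)" .
qed simp

text \<open>Both integrals may be infinite: in the theorem of the library one side is integrable if and
  only if the other one is.\<close>

lemma nn_integral_change_of_variables_wo:
  fixes g :: "real ^ 'm::{finite,wellorder} \<Rightarrow> real ^ 'm::_" and f :: "real ^ 'm::_ \<Rightarrow> real"
  assumes S: "S \<in> sets borel" and gS: "g ` S \<in> sets borel"
    and der: "\<And>x. x \<in> S \<Longrightarrow> (g has_derivative g' x) (at x)"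
    and inj: "inj_on g S"
    and f: "(\<lambda>x. indicator (g ` S) x * f x) \<in> borel_measurable borel"
    and fg: "(\<lambda>x. indicator S x * (\<bar>det (matrix (g' x))\<bar> * f (g x))) \<in> borel_measurable borel"
    and nonneg: "\<And>x. 0 \<le> f x"
  shows "(\<integral>\<^sup>+x. ennreal (indicator (g ` S) x * f x) \<partial>lborel)
    = (\<integral>\<^sup>+x. ennreal (indicator S x * (\<bar>det (matrix (g' x))\<bar> * f (g x))) \<partial>lborel)"
proof -
  let ?F = "\<lambda>x. indicator (g ` S) x * f x"
  let ?G = "\<lambda>x. indicator S x * (\<bar>det (matrix (g' x))\<bar> * f (g x))"
  have iff: "(\<lambda>x. \<bar>det (matrix (g' x))\<bar> * f (g x)) absolutely_integrable_on S \<and>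
      integral S (\<lambda>x. \<bar>det (matrix (g' x))\<bar> * f (g x)) = b
    \<longleftrightarrow> f absolutely_integrable_on (g ` S) \<and> integral (g ` S) f = b" for b
  proof -
    \<comment> \<open>The change of variables theorem speaks of vector valued functions; the scalar
      integrand is wrapped into a vector with one component and unwrapped afterwards.\<close>
    have "(\<lambda>x. \<bar>det (matrix (g' x))\<bar> *\<^sub>R (vec (f (g x)) :: real ^ 1)) absolutely_integrable_on S \<and>
        integral S (\<lambda>x. \<bar>det (matrix (g' x))\<bar> *\<^sub>R (vec (f (g x)) :: real ^ 1)) = vec b
      \<longleftrightarrow> (\<lambda>x. vec (f x) :: real ^ 1) absolutely_integrable_on (g ` S) \<and>
        integral (g ` S) (\<lambda>x. vec (f x) :: real ^ 1) = vec b"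
      by (rule has_absolute_integral_change_of_variables[OF _ _ inj])
        (use S der in \<open>auto intro: has_derivative_at_withinI\<close>)
    then show ?thesis
      by (simp add: absolutely_integrable_on_1_iff integral_on_1_eq vec_eq_iff)
  qed
  have integ: "integrable lborel (\<lambda>x. indicator T x * h x) \<longleftrightarrow> h absolutely_integrable_on T"
    if "(\<lambda>x. indicator T x * h x) \<in> borel_measurable borel" for h :: "real ^ 'm::_ \<Rightarrow> real" and T
    using that by (simp add: set_integrable_def integrable_completion)
  have val: "integral\<^sup>L lborel (\<lambda>x. indicator T x * h x) = integral T h"
    if "(\<lambda>x. indicator T x * h x) \<in> borel_measurable borel" "h absolutely_integrable_on T"
    for h :: "real ^ 'm::_ \<Rightarrow> real" and T
    using set_lebesgue_integral_eq_integral(2)[OF that(2)] that(1)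
    by (simp add: set_lebesgue_integral_def integral_completion)
  show ?thesis
  proof (cases "f absolutely_integrable_on (g ` S)")
    case True
    then have *: "(\<lambda>x. \<bar>det (matrix (g' x))\<bar> * f (g x)) absolutely_integrable_on S"
      "integral S (\<lambda>x. \<bar>det (matrix (g' x))\<bar> * f (g x)) = integral (g ` S) f"
      using iff by auto
    have "(\<integral>\<^sup>+x. ennreal (?F x) \<partial>lborel) = ennreal (integral\<^sup>L lborel ?F)"
      using True f nonneg by (intro nn_integral_eq_integral) (auto simp: integ)
    also have "\<dots> = ennreal (integral\<^sup>L lborel ?G)"
      using True f fg * by (simp add: val)
    also have "\<dots> = (\<integral>\<^sup>+x. ennreal (?G x) \<partial>lborel)"
      using * fg nonneg by (intro nn_integral_eq_integral[symmetric]) (auto simp: integ)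
    finally show ?thesis .
  next
    case False
    then have *: "\<not> (\<lambda>x. \<bar>det (matrix (g' x))\<bar> * f (g x)) absolutely_integrable_on S"
      using iff by blast
    \<comment> \<open>A measurable nonnegative function that is not integrable has infinite
      integral, so in this case both sides are infinite.\<close>
    have inf: "(\<integral>\<^sup>+x. ennreal (indicator T x * h x) \<partial>lborel) = \<infinity>"
      if "(\<lambda>x. indicator T x * h x) \<in> borel_measurable borel" "\<not> h absolutely_integrable_on T" "\<And>x. 0 \<le> h x"
      for h :: "real ^ 'm::_ \<Rightarrow> real" and T
      using integrableI_nonneg[of "\<lambda>x. indicator T x * h x" lborel] that integ[OF that(1)]
      by (auto simp: less_top[symmetric])
    have "(\<integral>\<^sup>+x. ennreal (?F x) \<partial>lborel) = \<infinity>" by (rule inf[OF f False nonneg])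
    moreover have "(\<integral>\<^sup>+x. ennreal (?G x) \<partial>lborel) = \<infinity>"
      by (rule inf[OF fg *]) (simp add: nonneg)
    ultimately show ?thesis by simp
  qed
qed

lemma nn_integral_of_wo:
  fixes H :: "real ^ 'n::finite \<Rightarrow> real"
  assumes [measurable]: "H \<in> borel_measurable borel"
  shows "(\<integral>\<^sup>+y. ennreal (H (of_wo y)) \<partial>lborel) = (\<integral>\<^sup>+x. ennreal (H x) \<partial>lborel)"
proof -
  have "(\<integral>\<^sup>+y. ennreal (H (of_wo y)) \<partial>distr lborel borel to_wo) = (\<integral>\<^sup>+x. ennreal (H (of_wo (to_wo x))) \<partial>lborel)"
    by (rule nn_integral_distr) simp_all
  then show ?thesis by (simp add: distr_to_wo)
qed

lemma nn_integral_change_of_variables: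
  fixes g :: "real ^ 'n::finite \<Rightarrow> real ^ 'n" and f :: "real ^ 'n \<Rightarrow> real"
  assumes S: "S \<in> sets borel" and gS: "g ` S \<in> sets borel"
    and der: "\<And>x. x \<in> S \<Longrightarrow> (g has_derivative g' x) (at x)"
    and inj: "inj_on g S"
    and f: "(\<lambda>x. indicator (g ` S) x * f x) \<in> borel_measurable borel"
    and fg: "(\<lambda>x. indicator S x * (\<bar>det (matrix (g' x))\<bar> * f (g x))) \<in> borel_measurable borel"
    and nonneg: "\<And>x. 0 \<le> f x"
  shows "(\<integral>\<^sup>+x. ennreal (indicator (g ` S) x * f x) \<partial>lborel)
    = (\<integral>\<^sup>+x. ennreal (indicator S x * (\<bar>det (matrix (g' x))\<bar> * f (g x))) \<partial>lborel)"
proof -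
  define G where "G = (\<lambda>y. to_wo (g (of_wo y)))"
  define G' where "G' = (\<lambda>y v. to_wo (g' (of_wo y) (of_wo v)))"
  define T where "T = to_wo ` S"
  have T: "T = of_wo -` S" unfolding T_def by (auto simp: image_iff) (metis to_of_wo)
  have ind: "indicator T y = (indicator S (of_wo y) :: real)"
    "indicator T y = (indicator S (of_wo y) :: ennreal)" for y
    by (simp_all add: T indicator_def)
  have GT: "G ` T = of_wo -` (g ` S)" 
    unfolding T_def G_def by (auto simp: image_iff) (metis to_of_wo)
  have indG: "indicator (G ` T) y = (indicator (g ` S) (of_wo y) :: real)"
    "indicator (G ` T) y = (indicator (g ` S) (of_wo y) :: ennreal)" for y
    by (simp_all add: GT indicator_def)
  have Tb: "T \<in> sets borel" "G ` T \<in> sets borel"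
    using measurable_sets[OF of_wo_measurable S] measurable_sets[OF of_wo_measurable gS]
    by (simp_all add: T[symmetric] GT[symmetric])
  have bl: "bounded_linear to_wo" "bounded_linear of_wo"
    using linear_to_wo linear_of_wo linear_conv_bounded_linear by auto
  have der': "(G has_derivative G' y) (at y)" if "y \<in> T" for y
  proof -
    have 1: "(of_wo has_derivative of_wo) (at y)"
      by (rule bounded_linear_imp_has_derivative[OF bl(2)])
    have "(g has_derivative g' (of_wo y)) (at (of_wo y))"
      using der that by (simp add: T)
    from diff_chain_at[OF 1 this]
    have "((\<lambda>y. g (of_wo y)) has_derivative (\<lambda>v. g' (of_wo y) (of_wo v))) (at y)"
      by (simp add: o_def)
    from bounded_linear.has_derivative[OF bl(1) this] show ?thesis
      by (simp add: G_def G'_def)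
  qed
  have detG: "det (matrix (G' y)) = det (matrix (g' (of_wo y)))" for y
  proof -
    have "of_wo (axis i (1::real)) = axis (Rep_wo i) 1" for i :: "'n wo"
      by (auto simp: of_wo_def vec_eq_iff axis_def Rep_wo_inverse Abs_wo_inverse)
    then have "matrix (G' y) = (\<chi> i j. matrix (g' (of_wo y)) $ Rep_wo i $ Rep_wo j)"
      by (subst vec_eq_iff) (simp add: matrix_def G'_def to_wo_def)
    then show ?thesis by (simp add: det_reindex_wo)
  qed
  have inj': "inj_on G T"
    using inj unfolding inj_on_def G_def T by (metis to_of_wo vimageE)
  have m1: "(\<lambda>y. indicator (G ` T) y * f (of_wo y)) \<in> borel_measurable borel"
    using measurable_compose[OF of_wo_measurable f] by (simp add: indG)
  have m2: "(\<lambda>y. indicator T y * (\<bar>det (matrix (G' y))\<bar> * f (of_wo (G y)))) \<in> borel_measurable borel"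
    using measurable_compose[OF of_wo_measurable fg] by (simp add: ind detG G_def)
  have "(\<integral>\<^sup>+y. ennreal (indicator (G ` T) y * f (of_wo y)) \<partial>lborel)
    = (\<integral>\<^sup>+y. ennreal (indicator T y * (\<bar>det (matrix (G' y))\<bar> * f (of_wo (G y)))) \<partial>lborel)"
    by (rule nn_integral_change_of_variables_wo[OF Tb der' inj' m1 m2]) (auto simp: nonneg)
  then show ?thesis
    using nn_integral_of_wo[OF f] nn_integral_of_wo[OF fg]
    unfolding ind indG detG unfolding G_def to_of_wo by simp
qed

section \<open>Positive definite matrices\<close>

lemma continuous_on_det:
  fixes F :: "'a::topological_space \<Rightarrow> real ^ 'n::finite ^ 'n"
  assumes "continuous_on S F"
  shows "continuous_on S (\<lambda>x. det (F x))"
  unfolding det_def by (intro continuous_intros assms)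

lemma continuous_on_matrix_vector_mult:
  fixes F :: "'a::topological_space \<Rightarrow> real ^ 'n::finite ^ 'm::finite"
  assumes "continuous_on S F" "continuous_on S v"
  shows "continuous_on S (\<lambda>x. F x *v v x)"
  unfolding matrix_vector_mult_def by (intro continuous_intros assms)

lemma positive_definite_det_nz:
  fixes A :: "real ^ 'n::finite ^ 'n"
  assumes "\<And>v. v \<noteq> 0 \<Longrightarrow> 0 < v \<bullet> (A *v v)"
  shows "det A \<noteq> 0"
proof -
  have "\<forall>x. A *v x = 0 \<longrightarrow> x = 0" using assms by (metis inner_zero_right less_irrefl)
  then show ?thesis
    using invertible_left_inverse[of A] matrix_left_invertible_ker[of A] invertible_det_nz[of A] by simp
qed

text \<open>The segment from the identity to \<open>A\<close> consists of positive definite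
  matrices, on which the determinant cannot vanish. It is 1 at the identity, so by the intermediate
  value theorem it stays positive.\<close>

lemma positive_definite_det_pos:
  fixes A :: "real ^ 'n::finite ^ 'n"
  assumes "\<And>v. v \<noteq> 0 \<Longrightarrow> 0 < v \<bullet> (A *v v)"
  shows "0 < det A"
proof (rule ccontr)
  assume "\<not> 0 < det A"
  define F where "F = (\<lambda>t::real. (1 - t) *\<^sub>R mat 1 + t *\<^sub>R A)"
  have "det (F 1) \<le> 0" "0 \<le> det (F 0)"
    using \<open>\<not> 0 < det A\<close> by (simp_all add: F_def)
  moreover have "continuous_on {0..1} (\<lambda>t. det (F t))"
    unfolding F_def by (intro continuous_on_det continuous_intros)
  ultimately obtain t where t: "0 \<le> t" "t \<le> 1" "det (F t) = 0"
    using IVT2'[of "\<lambda>t. det (F t)" 1 0 0] by auto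
  have "0 < v \<bullet> (F t *v v)" if "v \<noteq> 0" for v
  proof -
    have "v \<bullet> (F t *v v) = (1 - t) * (v \<bullet> v) + t * (v \<bullet> (A *v v))"
      by (simp add: F_def matrix_vector_mult_add_rdistrib scaleR_matrix_vector_assoc[symmetric]
          inner_add_right)
    also have "0 < \<dots>"
    proof (cases "t = 1")
      case False
      then show ?thesis using t that assms[OF that]
        by (intro add_pos_nonneg mult_pos_pos mult_nonneg_nonneg) auto
    qed (use that assms in auto)
    finally show ?thesis .
  qed
  then have "det (F t) \<noteq> 0" by (rule positive_definite_det_nz)
  with t show False by simp
qed

lemma inner_matrix_eqI:
  fixes A B :: "real ^ 'n::finite ^ 'n"
  assumes "\<And>v w. v \<bullet> (A *v w) = v \<bullet> (B *v w)"
  shows "A = B"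
  using assms by (metis matrix_eq inner_eq_zero_iff inner_diff_right right_minus_eq)

text \<open>Used to glue the volume of the manifold from finitely many chart volumes, each
  restricted to its piece of a partition.\<close>

lemma finite_sum_measure:
  fixes \<mu> :: "'i \<Rightarrow> 'a measure"
  assumes "finite I" "\<And>i. i \<in> I \<Longrightarrow> sets (\<mu> i) = sets N"
  obtains V where "sets V = sets N" "\<And>S. S \<in> sets N \<Longrightarrow> emeasure V S = (\<Sum>i\<in>I. emeasure (\<mu> i) S)"
proof
  let ?V = "measure_of (space N) (sets N) (\<lambda>S. \<Sum>i\<in>I. emeasure (\<mu> i) S)"
  show "sets ?V = sets N" by simp
  show "emeasure ?V S = (\<Sum>i\<in>I. emeasure (\<mu> i) S)" if "S \<in> sets N" for S
  proof (rule emeasure_measure_of_sigma)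
    show "sigma_algebra (space N) (sets N)" by (rule sets.sigma_algebra_axioms)
    show "positive (sets N) (\<lambda>S. \<Sum>i\<in>I. emeasure (\<mu> i) S)" by (simp add: positive_def)
    show "countably_additive (sets N) (\<lambda>S. \<Sum>i\<in>I. emeasure (\<mu> i) S)"
    proof (rule countably_additiveI)
      fix A :: "nat \<Rightarrow> 'a set"
      assume A: "range A \<subseteq> sets N" "disjoint_family A"
      have "(\<Sum>k. \<Sum>i\<in>I. emeasure (\<mu> i) (A k)) = (\<Sum>i\<in>I. \<Sum>k. emeasure (\<mu> i) (A k))"
        by (rule suminf_sum) (rule summableI)
      also have "\<dots> = (\<Sum>i\<in>I. emeasure (\<mu> i) (\<Union>k. A k))"
        using A assms(2) by (intro sum.cong suminf_emeasure) auto
      finally show "(\<Sum>k. \<Sum>i\<in>I. emeasure (\<mu> i) (A k)) = (\<Sum>i\<in>I. emeasure (\<mu> i) (\<Union>k. A k))" .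
    qed
  qed fact
qed

section \<open>The Riemannian volume\<close>

locale closed_manifold =
  fixes M :: "('a::t2_space, 'n::finite) riem"
  assumes closed_riemannian: "closed_riemannian_manifold M"
begin

lemma compact_UNIV: "compact (UNIV :: 'a set)"
  and connected_UNIV: "connected (UNIV :: 'a set)"
  using closed_riemannian by (auto simp: closed_riemannian_manifold_def)

lemma ex_chart: obtains c where "c \<in> charts M" "p \<in> cdom c"
  using closed_riemannian unfolding closed_riemannian_manifold_def by blast

lemma open_cdom: "c \<in> charts M \<Longrightarrow> open (cdom c)"
  and open_cimg: "c \<in> charts M \<Longrightarrow> open (cimg c)"
  and homeo: "c \<in> charts M \<Longrightarrow> homeomorphism (cdom c) (cimg c) (cmap c) (cinv c)"
  using closed_riemannian by (auto simp: closed_riemannian_manifold_def)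

lemma cinv_cmap: "c \<in> charts M \<Longrightarrow> p \<in> cdom c \<Longrightarrow> cinv c (cmap c p) = p"
  and cmap_cinv: "c \<in> charts M \<Longrightarrow> y \<in> cimg c \<Longrightarrow> cmap c (cinv c y) = y"
  and cinv_in: "c \<in> charts M \<Longrightarrow> y \<in> cimg c \<Longrightarrow> cinv c y \<in> cdom c"
  and continuous_cmap: "c \<in> charts M \<Longrightarrow> continuous_on (cdom c) (cmap c)"
  and continuous_cinv: "c \<in> charts M \<Longrightarrow> continuous_on (cimg c) (cinv c)"
  using homeo[of c] by (auto simp: homeomorphism_def)

lemma cmap_in: "p \<in> cdom c \<Longrightarrow> cmap c p \<in> cimg c"
  by simp

lemma cmap_image_eq: "c \<in> charts M \<Longrightarrow> S \<subseteq> cdom c \<Longrightarrow> cmap c ` S = cimg c \<inter> cinv c -` S"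
  by (auto simp: cinv_cmap image_iff subset_iff)

lemma cinv_image_eq: "c \<in> charts M \<Longrightarrow> Y \<subseteq> cimg c \<Longrightarrow> cinv c ` Y = cdom c \<inter> cmap c -` Y"
  by (auto simp: cmap_cinv cinv_in image_iff subset_iff) (metis cinv_cmap)

lemma open_cmap_image: "c \<in> charts M \<Longrightarrow> open W \<Longrightarrow> open (cmap c ` (cdom c \<inter> W))"
  using continuous_open_preimage[OF continuous_cinv open_cimg, of c "cdom c \<inter> W"]
    cmap_image_eq[of c "cdom c \<inter> W"] open_cdom[of c] by auto

lemma open_cinv_image: "c \<in> charts M \<Longrightarrow> open Y \<Longrightarrow> Y \<subseteq> cimg c \<Longrightarrow> open (cinv c ` Y)"
  using continuous_open_preimage[OF continuous_cmap open_cdom, of c Y] cinv_image_eq[of c Y] by auto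

lemma compact_cinv_image: "c \<in> charts M \<Longrightarrow> compact Y \<Longrightarrow> Y \<subseteq> cimg c \<Longrightarrow> compact (cinv c ` Y)"
  by (rule compact_continuous_image) (auto intro: continuous_on_subset continuous_cinv)

lemma smooth_chart_change:
  "c \<in> charts M \<Longrightarrow> d \<in> charts M \<Longrightarrow>
    smooth_on (\<lambda>y. cmap d (cinv c y)) (cmap c ` (cdom c \<inter> cdom d))"
  and smooth_gmat: "c \<in> charts M \<Longrightarrow> smooth_on (\<lambda>y. gmat M c (cinv c y)) (cimg c)"
  and gmat_sym: "c \<in> charts M \<Longrightarrow> p \<in> cdom c \<Longrightarrow> transpose (gmat M c p) = gmat M c p"
  and gmat_pos: "c \<in> charts M \<Longrightarrow> p \<in> cdom c \<Longrightarrow> v \<noteq> 0 \<Longrightarrow> 0 < v \<bullet> (gmat M c p *v v)"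
  and gmat_change: "c \<in> charts M \<Longrightarrow> d \<in> charts M \<Longrightarrow> p \<in> cdom c \<Longrightarrow> p \<in> cdom d \<Longrightarrow>
    v \<bullet> (gmat M c p *v w) = chart_change c d p v \<bullet> (gmat M d p *v chart_change c d p w)"
  using closed_riemannian unfolding closed_riemannian_manifold_def by blast+

lemma gmat_inner_commute:
  "c \<in> charts M \<Longrightarrow> p \<in> cdom c \<Longrightarrow> v \<bullet> (gmat M c p *v w) = w \<bullet> (gmat M c p *v v)"
  using gmat_sym[of c p] by (metis dot_lmul_matrix inner_commute transpose_matrix_vector)

lemma gmat_nonneg: "c \<in> charts M \<Longrightarrow> p \<in> cdom c \<Longrightarrow> 0 \<le> v \<bullet> (gmat M c p *v v)"
  using gmat_pos[of c p v] by (cases "v = 0") auto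

lemma det_gmat_pos: "c \<in> charts M \<Longrightarrow> p \<in> cdom c \<Longrightarrow> 0 < det (gmat M c p)"
  by (rule positive_definite_det_pos) (rule gmat_pos)

lemma continuous_gmat: "c \<in> charts M \<Longrightarrow> continuous_on (cimg c) (\<lambda>y. gmat M c (cinv c y))"
  using smooth_gmat smooth_on_continuous by blast

lemma has_derivative_chart_change:
  assumes "c \<in> charts M" "d \<in> charts M" "p \<in> cdom c" "p \<in> cdom d"
  shows "((\<lambda>y. cmap d (cinv c y)) has_derivative chart_change c d p) (at (cmap c p))"
  unfolding chart_change_def
  by (rule smooth_on_has_derivative[OF smooth_chart_change[OF assms(1,2)]]) (use assms in auto)

lemma linear_chart_change:
  assumes "c \<in> charts M" "d \<in> charts M" "p \<in> cdom c" "p \<in> cdom d"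
  shows "linear (chart_change c d p)"
  using has_derivative_chart_change[OF assms] by (rule has_derivative_linear)

text \<open>Differentiates the identity that the two transition maps are inverse to each other on
  the overlap, which is a neighbourhood of the point.\<close>

lemma chart_change_inverse:
  assumes "c \<in> charts M" "d \<in> charts M" "p \<in> cdom c" "p \<in> cdom d"
  shows "chart_change d c p (chart_change c d p v) = v"
proof -
  let ?S = "cmap c ` (cdom c \<inter> cdom d)"
  have p: "cmap c p \<in> ?S" using assms by auto
  have S: "open ?S" using assms by (intro open_cmap_image open_cdom)
  have "((\<lambda>y. cmap c (cinv d (cmap d (cinv c y)))) has_derivative
      (\<lambda>v. chart_change d c p (chart_change c d p v))) (at (cmap c p))"
    using diff_chain_at[OF has_derivative_chart_change[OF assms], of "\<lambda>y. cmap c (cinv d y)"]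
      has_derivative_chart_change[OF assms(2,1,4,3)] assms
    by (simp add: cinv_cmap o_def)
  moreover have "((\<lambda>y. cmap c (cinv d (cmap d (cinv c y)))) has_derivative (\<lambda>v. v)) (at (cmap c p))"
    by (rule has_derivative_transform_within_open[OF has_derivative_ident S p])
      (use assms in \<open>auto simp: cinv_cmap cmap_cinv\<close>)
  ultimately show ?thesis
    using has_derivative_unique by metis
qed

section \<open>Volume density in charts and its independence of the chart\<close>

definition vdens :: "('a, 'n) chart \<Rightarrow> real ^ 'n \<Rightarrow> real" where
  "vdens c y = sqrt (det (gmat M c (cinv c y)))"

lemma vdens_pos: "c \<in> charts M \<Longrightarrow> y \<in> cimg c \<Longrightarrow> 0 < vdens c y"
  unfolding vdens_def using det_gmat_pos cinv_in by (metis real_sqrt_gt_zero)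

lemma continuous_vdens: "c \<in> charts M \<Longrightarrow> continuous_on (cimg c) (vdens c)"
  unfolding vdens_def by (intro continuous_intros continuous_on_det continuous_gmat)

text \<open>Invariance of the metric says that the matrix in \<open>c\<close> is the congruence of
  the matrix in \<open>d\<close> by the Jacobian; the claim is the square root of the resulting
  identity of determinants.\<close>

lemma vdens_change:
  assumes "c \<in> charts M" "d \<in> charts M" "p \<in> cdom c" "p \<in> cdom d"
  shows "vdens c (cmap c p) = \<bar>det (matrix (chart_change c d p))\<bar> * vdens d (cmap d p)"
proof -
  let ?A = "matrix (chart_change c d p)"
  have A: "chart_change c d p v = ?A *v v" for v
    using linear_chart_change[OF assms] by simp
  have "gmat M c p = transpose ?A ** gmat M d p ** ?A"
  proof (rule inner_matrix_eqI)
    fix v w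
    have "v \<bullet> (gmat M c p *v w) = (?A *v v) \<bullet> (gmat M d p *v (?A *v w))"
      using gmat_change[OF assms] A by simp
    also have "\<dots> = v \<bullet> ((transpose ?A ** gmat M d p ** ?A) *v w)"
      by (simp add: matrix_vector_mul_assoc[symmetric])
        (metis dot_lmul_matrix transpose_matrix_vector transpose_transpose)
    finally show "v \<bullet> (gmat M c p *v w) = v \<bullet> ((transpose ?A ** gmat M d p ** ?A) *v w)" .
  qed
  then have "det (gmat M c p) = (det ?A)\<^sup>2 * det (gmat M d p)"
    by (simp add: det_mul power2_eq_square)
  then show ?thesis
    using assms by (simp add: vdens_def cinv_cmap real_sqrt_mult)
qed

text \<open>\<open>cinv c\<close> takes uncontrolled values outside the image of the chart.
  Replacing these by one constant gives a total Borel function, which can be used to push measures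
  forward.\<close>

definition cinv' :: "('a, 'n) chart \<Rightarrow> real ^ 'n \<Rightarrow> 'a" where
  "cinv' c y = (if y \<in> cimg c then cinv c y else undefined)"

lemma cinv'_measurable: "c \<in> charts M \<Longrightarrow> cinv' c \<in> borel_measurable borel"
  unfolding cinv'_def
  by (subst measurable_If_restrict_space_iff)
    (auto intro!: borel_measurable_continuous_on_restrict continuous_cinv open_cimg borel_open)

lemma indicator_vdens_measurable:
  assumes "c \<in> charts M" "S \<in> sets borel" "S \<subseteq> cimg c"
  shows "(\<lambda>y. indicator S y * vdens c y) \<in> borel_measurable borel"
  using borel_measurable_continuous_on_indicator[OF assms(2) continuous_on_subset[OF continuous_vdens[OF assms(1)] assms(3)]]
  by simp

lemma cmap_image_borel:
  assumes "c \<in> charts M" "S \<in> sets borel" "S \<subseteq> cdom c"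
  shows "cmap c ` S \<in> sets borel"
proof -
  have "cmap c ` S = cimg c \<inter> cinv' c -` S"
    using cmap_image_eq[OF assms(1,3)] by (auto simp: cinv'_def)
  then show ?thesis
    using measurable_sets[OF cinv'_measurable[OF assms(1)] assms(2)] open_cimg[OF assms(1)]
    by (auto intro: sets.Int)
qed

text \<open>The density vanishes outside the image of the chart, so the artificial value of
  \<open>cinv'\<close> there receives no mass.\<close>

definition chart_volume :: "('a, 'n) chart \<Rightarrow> 'a measure" where
  "chart_volume c = distr (density lborel (\<lambda>y. ennreal (indicator (cimg c) y * vdens c y))) borel (cinv' c)"

lemma sets_chart_volume [simp]: "sets (chart_volume c) = sets borel"
  by (simp add: chart_volume_def)

lemma emeasure_chart_volume:
  assumes c: "c \<in> charts M" and S: "S \<in> sets borel"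
  shows "emeasure (chart_volume c) S = (\<integral>\<^sup>+y. ennreal (indicator (cmap c ` (S \<inter> cdom c)) y * vdens c y) \<partial>lborel)"
proof -
  have cimg: "cimg c \<in> sets borel" using open_cimg[OF c] by auto
  have [measurable]: "(\<lambda>y. indicator (cimg c) y * vdens c y) \<in> borel_measurable borel"
    by (rule indicator_vdens_measurable[OF c cimg]) simp
  have [measurable]: "cinv' c \<in> borel_measurable borel" by (rule cinv'_measurable[OF c])
  have [measurable]: "S \<in> sets borel" by fact
  have "emeasure (chart_volume c) S
    = (\<integral>\<^sup>+y. ennreal (indicator (cimg c) y * vdens c y) * indicator (cinv' c -` S) y \<partial>lborel)"
    unfolding chart_volume_def
    by (subst emeasure_distr; (subst emeasure_density)?)
      (auto intro: measurable_sets_borel[OF cinv'_measurable[OF c] S])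
  also have "\<dots> = (\<integral>\<^sup>+y. ennreal (indicator (cmap c ` (S \<inter> cdom c)) y * vdens c y) \<partial>lborel)"
    using cmap_image_eq[OF c, of "S \<inter> cdom c"]
    by (intro nn_integral_cong) (auto simp: indicator_def cinv'_def cinv_in[OF c])
  finally show ?thesis .
qed

text \<open>The transition map carries one coordinate integral to the other, and by
  \<open>vdens_change\<close> the Jacobian factor is exactly the quotient of the two
  densities.\<close>

lemma emeasure_chart_volume_eq:
  assumes c: "c \<in> charts M" and d: "d \<in> charts M" and S: "S \<in> sets borel"
    and sub: "S \<subseteq> cdom c" "S \<subseteq> cdom d"
  shows "emeasure (chart_volume c) S = emeasure (chart_volume d) S"
proof -
  let ?g = "\<lambda>y. cmap d (cinv c y)"
  let ?g' = "\<lambda>y. chart_change c d (cinv c y)"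
  let ?S = "cmap c ` S"
  have img: "?g ` ?S = cmap d ` S"
    using sub cinv_cmap[OF c] by (force simp: image_image intro: image_cong)
  have b: "?S \<in> sets borel" "cmap d ` S \<in> sets borel"
    using cmap_image_borel c d S sub by auto
  \<comment> \<open>The change of variables asks for a function that is nonnegative everywhere. Off
    the chart \<open>vdens\<close> may be negative, since \<open>sqrt\<close> is odd; the absolute
    value changes nothing on the sets that matter.\<close>
  have ind: "indicator (cmap d ` S) y * \<bar>vdens d y\<bar> = indicator (cmap d ` S) y * vdens d y" for y
    using sub vdens_pos[OF d] by (force simp: indicator_def)
  have ind2: "indicator ?S y * (\<bar>det (matrix (?g' y))\<bar> * \<bar>vdens d (?g y)\<bar>) = indicator ?S y * vdens c y" for y
  proof (cases "y \<in> ?S")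
    case True
    then obtain p where p: "p \<in> S" "y = cmap c p" by auto
    then have "p \<in> cdom c" "p \<in> cdom d" using sub by auto
    then show ?thesis
      using p vdens_change[OF c d, of p] vdens_pos[OF d cmap_in, of p]
      by (simp add: cinv_cmap[OF c])
  qed simp
  have "(\<integral>\<^sup>+y. ennreal (indicator (?g ` ?S) y * \<bar>vdens d y\<bar>) \<partial>lborel)
    = (\<integral>\<^sup>+y. ennreal (indicator ?S y * (\<bar>det (matrix (?g' y))\<bar> * \<bar>vdens d (?g y)\<bar>)) \<partial>lborel)"
  proof (rule nn_integral_change_of_variables)
    show "?g ` ?S \<in> sets borel" using b img by simp
    show "(?g has_derivative ?g' y) (at y)" if y: "y \<in> ?S" for y
    proof -
      obtain p where p: "p \<in> S" "y = cmap c p" using y by blast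
      moreover from p have "p \<in> cdom c" "p \<in> cdom d" using sub by auto
      ultimately show ?thesis
        using has_derivative_chart_change[OF c d, of p] cinv_cmap[OF c, of p] by simp
    qed
    show "inj_on ?g ?S"
      using sub by (auto intro!: inj_onI simp: subset_iff cinv_cmap[OF c]) (metis cinv_cmap[OF d])
    show "(\<lambda>y. indicator (?g ` ?S) y * \<bar>vdens d y\<bar>) \<in> borel_measurable borel"
      unfolding img ind using sub by (intro indicator_vdens_measurable d b) auto
    show "(\<lambda>y. indicator ?S y * (\<bar>det (matrix (?g' y))\<bar> * \<bar>vdens d (?g y)\<bar>)) \<in> borel_measurable borel"
      unfolding ind2 using sub by (intro indicator_vdens_measurable c b) auto
  qed (use b in auto)
  then show ?thesis
    unfolding img ind ind2 using sub by (simp add: emeasure_chart_volume c d S Int_absorb2)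
qed

lemma finite_chart_cover:
  obtains cs :: "nat \<Rightarrow> ('a, 'n) chart" and m where
    "\<And>i. i < m \<Longrightarrow> cs i \<in> charts M" "(\<Union>i<m. cdom (cs i)) = UNIV"
proof -
  have "\<exists>c\<in>charts M. x \<in> cdom c" for x by (rule ex_chart[of x]) blast
  then have "UNIV \<subseteq> (\<Union>c\<in>charts M. cdom c)" by blast
  then obtain F where F: "F \<subseteq> charts M" "finite F" "UNIV \<subseteq> (\<Union>c\<in>F. cdom c)"
    using compactE_image[OF compact_UNIV, of "charts M" cdom] open_cdom by metis
  obtain m and cs :: "nat \<Rightarrow> ('a, 'n) chart" where "F = cs ` {i. i < m}"
    using finite_imp_nat_seg_image_inj_on[OF F(2)] by auto
  with F show ?thesis by (intro that[of m cs]) (auto simp: lessThan_def)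
qed

text \<open>Chart formulas determine a measure only on Borel sets inside a chart domain. Disjoint
  Borel pieces of this kind let finite additivity carry everything to the whole manifold.\<close>

lemma finite_chart_partition:
  obtains cs :: "nat \<Rightarrow> ('a, 'n) chart" and D :: "nat \<Rightarrow> 'a set" and m where
    "\<And>i. i < m \<Longrightarrow> cs i \<in> charts M" "\<And>i. D i \<in> sets borel" "\<And>i. i < m \<Longrightarrow> D i \<subseteq> cdom (cs i)"
    "(\<Union>i<m. D i) = UNIV" "disjoint_family D"
proof -
  obtain cs :: "nat \<Rightarrow> ('a, 'n) chart" and m where
    cs: "\<And>i. i < m \<Longrightarrow> cs i \<in> charts M" "(\<Union>i<m. cdom (cs i)) = UNIV"
    by (rule finite_chart_cover) blast
  define A where "A = (\<lambda>i. if i < m then cdom (cs i) else {})"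
  define D where "D = disjointed A"
  have "A i \<in> sets borel" for i using borel_open[OF open_cdom[OF cs(1)]] by (simp add: A_def)
  then have "range A \<subseteq> sets borel" by blast
  then have "D i \<in> sets borel" for i
    using sets.range_disjointed_sets[of A borel] by (auto simp: D_def)
  moreover have "D i \<subseteq> cdom (cs i)" if "i < m" for i
    using disjointed_subset[of A i] that by (simp add: A_def D_def)
  moreover have "D i = {}" if "\<not> i < m" for i
    using disjointed_subset[of A i] that by (simp add: A_def D_def)
  then have "(\<Union>i<m. D i) = (\<Union>i. D i)" by blast
  moreover have "(\<Union>i. D i) = (\<Union>i. A i)"
    by (simp add: D_def UN_disjointed_eq)
  moreover have "(\<Union>i. A i) = UNIV" using cs(2) by (auto simp: A_def)
  moreover have "disjoint_family D" by (simp add: D_def disjoint_family_disjointed)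
  ultimately show ?thesis using cs(1) by (intro that[of m cs D]) auto
qed

lemma emeasure_partition:
  assumes "sets V = sets borel" "\<And>i. D i \<in> sets borel" "(\<Union>i<m::nat. D i) = UNIV" "disjoint_family D"
    and "S \<in> sets (borel :: 'a measure)"
  shows "emeasure V S = (\<Sum>i<m. emeasure V (S \<inter> D i))"
proof -
  have "S = (\<Union>i<m. S \<inter> D i)" using assms(3) by auto
  moreover have "(\<Sum>i<m. emeasure V (S \<inter> D i)) = emeasure V (\<Union>i<m. S \<inter> D i)"
  proof (rule sum_emeasure)
    show "disjoint_family_on (\<lambda>i. S \<inter> D i) {..<m}"
      using assms(4) unfolding disjoint_family_on_def by blast
  qed (use assms in auto)
  ultimately show ?thesis by simp
qed

text \<open>The volume is a definite description, so existence and uniqueness are both at stake. For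
  existence, chart volumes restricted to the pieces of a partition are summed; their agreement on
  overlaps gives the formula in every chart. For uniqueness, any two candidates agree on each
  piece.\<close>

lemma riemannian_volume_characterization:
  shows "sets (riemannian_volume M) = sets borel"
    and "\<And>c S. c \<in> charts M \<Longrightarrow> S \<in> sets borel \<Longrightarrow> S \<subseteq> cdom c \<Longrightarrow>
      emeasure (riemannian_volume M) S = emeasure (chart_volume c) S"
proof -
  obtain cs :: "nat \<Rightarrow> ('a, 'n) chart" and D m where D:
    "\<And>i. i < m \<Longrightarrow> cs i \<in> charts M" "\<And>i. D i \<in> sets borel" "\<And>i. i < m \<Longrightarrow> D i \<subseteq> cdom (cs i)"
    "(\<Union>i<m. D i) = UNIV" "disjoint_family D"
    by (rule finite_chart_partition) blast
  define P where "P = (\<lambda>V :: 'a measure. sets V = sets borel \<and>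
    (\<forall>c\<in>charts M. \<forall>S\<in>sets borel. S \<subseteq> cdom c \<longrightarrow> emeasure V S = emeasure (chart_volume c) S))"
  have restate: "(\<integral>\<^sup>+y\<in>cmap c ` S. ennreal (sqrt (det (gmat M c (cinv c y)))) \<partial>lborel)
      = emeasure (chart_volume c) S" if "c \<in> charts M" "S \<in> sets borel" "S \<subseteq> cdom c" for c S
    using that by (auto simp: emeasure_chart_volume Int_absorb2 vdens_def indicator_def intro!: nn_integral_cong)
  have vol: "riemannian_volume M = (THE V. P V)"
    unfolding riemannian_volume_def P_def
    by (intro arg_cong[of _ _ The] ext conj_cong refl ball_cong imp_cong) (simp_all add: restate)
  obtain V where V: "sets V = sets borel"
    "\<And>S. S \<in> sets borel \<Longrightarrow> emeasure V S = (\<Sum>i<m. emeasure (density (chart_volume (cs i)) (indicator (D i))) S)"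
    using finite_sum_measure[of "{..<m}" "\<lambda>i. density (chart_volume (cs i)) (indicator (D i))" borel] by auto
  have eV: "emeasure V S = (\<Sum>i<m. emeasure (chart_volume (cs i)) (S \<inter> D i))" if "S \<in> sets borel" for S
  proof -
    have "emeasure (density (chart_volume (cs i)) (indicator (D i))) S = emeasure (chart_volume (cs i)) (S \<inter> D i)" for i
    proof -
      have "emeasure (density (chart_volume (cs i)) (indicator (D i))) S
        = (\<integral>\<^sup>+x. indicator (D i) x * indicator S x \<partial>chart_volume (cs i))"
        using that D(2) by (intro emeasure_density borel_measurable_indicator) auto
      also have "\<dots> = (\<integral>\<^sup>+x. indicator (S \<inter> D i) x \<partial>chart_volume (cs i))"
        by (rule nn_integral_cong) (auto simp: indicator_def)
      also have "\<dots> = emeasure (chart_volume (cs i)) (S \<inter> D i)"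
        using that D(2) by (intro nn_integral_indicator) auto
      finally show ?thesis .
    qed
    then show ?thesis by (simp add: V(2)[OF that])
  qed
  have "P V"
    unfolding P_def
  proof (intro conjI ballI impI)
    fix c and S :: "'a set" assume c: "c \<in> charts M" and S: "S \<in> sets borel" "S \<subseteq> cdom c"
    have "emeasure V S = (\<Sum>i<m. emeasure (chart_volume c) (S \<inter> D i))"
      unfolding eV[OF S(1)] using D S c by (intro sum.cong refl emeasure_chart_volume_eq) auto
    then show "emeasure V S = emeasure (chart_volume c) S"
      using emeasure_partition[OF _ D(2,4,5) S(1), of "chart_volume c"] by simp
  qed fact
  moreover have "V' = V" if "P V'" for V'
  proof (rule measure_eqI)
    show "sets V' = sets V" using that V by (simp add: P_def)
    fix S assume "S \<in> sets V'"
    then have S: "S \<in> sets borel" using that by (simp add: P_def)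
    have "emeasure V' S = (\<Sum>i<m. emeasure V' (S \<inter> D i))"
      using that D S by (intro emeasure_partition) (auto simp: P_def)
    also have "\<dots> = (\<Sum>i<m. emeasure (chart_volume (cs i)) (S \<inter> D i))"
    proof (intro sum.cong refl)
      fix i assume "i \<in> {..<m}"
      then have "cs i \<in> charts M" "S \<inter> D i \<in> sets borel" "S \<inter> D i \<subseteq> cdom (cs i)"
        using D S by auto
      then show "emeasure V' (S \<inter> D i) = emeasure (chart_volume (cs i)) (S \<inter> D i)"
        using that by (simp add: P_def)
    qed
    finally show "emeasure V' S = emeasure V S" by (simp add: eV S)
  qed
  ultimately have "P (THE V. P V)" by (rule theI)
  then show "sets (riemannian_volume M) = sets borel"
    "\<And>c S. c \<in> charts M \<Longrightarrow> S \<in> sets borel \<Longrightarrow> S \<subseteq> cdom c \<Longrightarrow>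
      emeasure (riemannian_volume M) S = emeasure (chart_volume c) S"
    by (auto simp: vol P_def)
qed

section \<open>Integration over chart domains with respect to the Riemannian volume\<close>

abbreviation V :: "'a measure" where "V \<equiv> riemannian_volume M"

lemma sets_V [simp, measurable_cong]: "sets V = sets borel"
  by (rule riemannian_volume_characterization)

lemma space_V [simp]: "space V = UNIV"
  using sets_eq_imp_space_eq[OF sets_V] by simp

lemma measurable_V [simp]: "f \<in> borel_measurable V \<longleftrightarrow> f \<in> borel_measurable borel"
  using measurable_cong_sets[OF sets_V refl] by blast

text \<open>As an identity of measures it hands the standard rules for densities and image measures
  to every integral over a chart domain.\<close>

lemma density_V_cdom:
  assumes c: "c \<in> charts M"
  shows "density V (\<lambda>x. ennreal (indicator (cdom c) x)) = chart_volume c"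
proof (rule measure_eqI)
  fix S assume "S \<in> sets (density V (\<lambda>x. ennreal (indicator (cdom c) x)))"
  then have S: "S \<in> sets borel" by simp
  have cb: "cdom c \<in> sets borel" using open_cdom[OF c] by auto
  have "emeasure (density V (\<lambda>x. ennreal (indicator (cdom c) x))) S
    = (\<integral>\<^sup>+x. ennreal (indicator (cdom c) x) * indicator S x \<partial>V)"
    using S cb by (intro emeasure_density) auto
  also have "\<dots> = (\<integral>\<^sup>+x. indicator (S \<inter> cdom c) x \<partial>V)"
    by (rule nn_integral_cong) (auto simp: indicator_def)
  also have "\<dots> = emeasure V (S \<inter> cdom c)" using S cb by (intro nn_integral_indicator) auto
  also have "\<dots> = emeasure (chart_volume c) (S \<inter> cdom c)"
    using S cb c by (intro riemannian_volume_characterization) auto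
  also have "\<dots> = emeasure (chart_volume c) S"
    using S cb c by (simp add: emeasure_chart_volume)
  finally show "emeasure (density V (\<lambda>x. ennreal (indicator (cdom c) x))) S = emeasure (chart_volume c) S" .
qed simp

lemma nn_integral_chart:
  assumes c: "c \<in> charts M" and F: "F \<in> borel_measurable borel"
  shows "(\<integral>\<^sup>+x. ennreal (indicator (cdom c) x) * F x \<partial>V)
    = (\<integral>\<^sup>+y. ennreal (indicator (cimg c) y * vdens c y) * F (cinv c y) \<partial>lborel)"
proof -
  have [measurable]: "cdom c \<in> sets borel" "cimg c \<in> sets borel"
    using open_cdom[OF c] open_cimg[OF c] by auto
  have m [measurable]: "(\<lambda>y. indicator (cimg c) y * vdens c y) \<in> borel_measurable borel"
    by (rule indicator_vdens_measurable[OF c]) simp_all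
  have [measurable]: "cinv' c \<in> borel_measurable borel" by (rule cinv'_measurable[OF c])
  have [measurable]: "F \<in> borel_measurable borel" by fact
  have "(\<integral>\<^sup>+x. ennreal (indicator (cdom c) x) * F x \<partial>V)
    = (\<integral>\<^sup>+x. F x \<partial>density V (\<lambda>x. ennreal (indicator (cdom c) x)))"
    by (rule nn_integral_density[symmetric]) simp_all
  also have "\<dots> = (\<integral>\<^sup>+y. ennreal (indicator (cimg c) y * vdens c y) * F (cinv' c y) \<partial>lborel)"
    unfolding density_V_cdom[OF c] chart_volume_def
    by (subst nn_integral_distr; (subst nn_integral_density)?) simp_all
  also have "\<dots> = (\<integral>\<^sup>+y. ennreal (indicator (cimg c) y * vdens c y) * F (cinv c y) \<partial>lborel)"
    by (rule nn_integral_cong) (auto simp: indicator_def cinv'_def)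
  finally show ?thesis .
qed

lemma integral_chart:
  fixes F :: "'a \<Rightarrow> real"
  assumes c: "c \<in> charts M" and F: "F \<in> borel_measurable borel"
  shows "integrable V (\<lambda>x. indicator (cdom c) x * F x)
      \<longleftrightarrow> integrable lborel (\<lambda>y. indicator (cimg c) y * vdens c y * F (cinv c y))" (is ?A)
    and "(LINT x|V. indicator (cdom c) x * F x)
      = (LINT y|lborel. indicator (cimg c) y * vdens c y * F (cinv c y))" (is ?B)
proof -
  have [measurable]: "cdom c \<in> sets borel" "cimg c \<in> sets borel"
    using open_cdom[OF c] open_cimg[OF c] by auto
  have m [measurable]: "(\<lambda>y. indicator (cimg c) y * vdens c y) \<in> borel_measurable borel"
    by (rule indicator_vdens_measurable[OF c]) simp_all
  have m' [measurable]: "cinv' c \<in> borel_measurable borel" by (rule cinv'_measurable[OF c])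
  have [measurable]: "F \<in> borel_measurable borel" by fact
  have nn: "AE y in lborel. 0 \<le> indicator (cimg c) y * vdens c y"
    using vdens_pos[OF c] by (auto intro!: AE_I2 simp: indicator_def less_imp_le)
  have eq: "indicator (cimg c) y * vdens c y * F (cinv' c y) = indicator (cimg c) y * vdens c y * F (cinv c y)" for y
    by (auto simp: indicator_def cinv'_def)
  have "integrable V (\<lambda>x. indicator (cdom c) x * F x)
    \<longleftrightarrow> integrable (density V (\<lambda>x. ennreal (indicator (cdom c) x))) F"
    by (subst integrable_density) auto
  also have "\<dots> \<longleftrightarrow> integrable lborel (\<lambda>y. indicator (cimg c) y * vdens c y * F (cinv c y))"
    unfolding density_V_cdom[OF c] chart_volume_def
    by (subst integrable_distr_eq; (subst integrable_density[OF _ _ nn])?) (simp_all add: eq)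
  finally show ?A .
  have "(LINT x|V. indicator (cdom c) x * F x)
    = integral\<^sup>L (density V (\<lambda>x. ennreal (indicator (cdom c) x))) F"
    by (subst integral_density) auto
  also have "\<dots> = (LINT y|lborel. indicator (cimg c) y * vdens c y * F (cinv c y))"
    unfolding density_V_cdom[OF c] chart_volume_def
    by (subst integral_distr; (subst integral_density[OF _ _ nn])?) (simp_all add: eq)
  finally show ?B .
qed

text \<open>The quadratic form and the norm of the image are continuous on the compact product of
  \<open>Y\<close> with the unit sphere, where they attain their extrema; homogeneity extends the
  bounds to all vectors.\<close>

lemma chart_bounds:
  assumes c: "c \<in> charts M" and Y: "compact Y" "Y \<subseteq> cimg c"
  obtains a b :: real where "0 < a" "0 < b"
    "\<And>y. y \<in> Y \<Longrightarrow> a \<le> vdens c y \<and> vdens c y \<le> b"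
    "\<And>y v. y \<in> Y \<Longrightarrow> a * (v \<bullet> v) \<le> v \<bullet> (gmat M c (cinv c y) *v v)"
    "\<And>y v. y \<in> Y \<Longrightarrow> v \<bullet> (gmat M c (cinv c y) *v v) \<le> b * (v \<bullet> v)"
    "\<And>y v. y \<in> Y \<Longrightarrow> norm (gmat M c (cinv c y) *v v) \<le> b * norm v"
proof (cases "Y = {}")
  case True
  show ?thesis by (rule that[of 1 1]) (auto simp: True)
next
  case False
  have cv: "continuous_on Y (vdens c)" using continuous_on_subset[OF continuous_vdens[OF c] Y(2)] .
  obtain y1 where y1: "y1 \<in> Y" "\<And>y. y \<in> Y \<Longrightarrow> vdens c y1 \<le> vdens c y"
    using continuous_attains_inf[OF Y(1) False cv] by auto
  obtain y2 where y2: "y2 \<in> Y" "\<And>y. y \<in> Y \<Longrightarrow> vdens c y \<le> vdens c y2"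
    using continuous_attains_sup[OF Y(1) False cv] by auto
  let ?Q = "\<lambda>(y, v). v \<bullet> (gmat M c (cinv c y) *v v)"
  let ?N = "\<lambda>(y, v). norm (gmat M c (cinv c y) *v v)"
  let ?K = "Y \<times> sphere (0 :: real ^ 'n) 1"
  have K: "compact ?K" using Y by (intro compact_Times) auto
  have "axis undefined 1 \<in> sphere (0 :: real ^ 'n) 1" by simp
  then have K0: "?K \<noteq> {}" using False by blast
  have g: "continuous_on ?K (\<lambda>z. gmat M c (cinv c (fst z)))"
    by (rule continuous_on_compose2[OF continuous_gmat[OF c]]) (use Y in \<open>auto intro: continuous_intros\<close>)
  have cQ: "continuous_on ?K ?Q" "continuous_on ?K ?N"
    unfolding case_prod_unfold
    by (intro continuous_intros continuous_on_matrix_vector_mult g)+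
  obtain z1 where z1: "z1 \<in> ?K" "\<And>z. z \<in> ?K \<Longrightarrow> ?Q z1 \<le> ?Q z"
    using continuous_attains_inf[OF K K0 cQ(1)] by auto
  obtain z2 where z2: "z2 \<in> ?K" "\<And>z. z \<in> ?K \<Longrightarrow> ?Q z \<le> ?Q z2"
    using continuous_attains_sup[OF K K0 cQ(1)] by auto
  obtain z3 where z3: "z3 \<in> ?K" "\<And>z. z \<in> ?K \<Longrightarrow> ?N z \<le> ?N z3"
    using continuous_attains_sup[OF K K0 cQ(2)] by auto
  define a where "a = min (vdens c y1) (?Q z1)"
  define b where "b = Max {vdens c y2, ?Q z2, ?N z3}"
  have z1pos: "0 < ?Q z1"
  proof -
    obtain y v where "z1 = (y, v)" "y \<in> Y" "norm v = 1" using z1(1) by auto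
    moreover from this have "cinv c y \<in> cdom c" "v \<noteq> 0" using Y(2) cinv_in[OF c, of y] by auto
    ultimately show ?thesis using gmat_pos[OF c, of "cinv c y" v] by simp
  qed
  have v1: "0 < vdens c y1" using vdens_pos[OF c] y1 Y by auto
  have sph: "?Q (y, v) = (norm v)\<^sup>2 * ?Q (y, v /\<^sub>R norm v)" "?N (y, v) = norm v * ?N (y, v /\<^sub>R norm v)"
    "(y, v /\<^sub>R norm v) \<in> ?K" if "y \<in> Y" "v \<noteq> 0" for y v
    using that by (auto simp: matrix_vector_mult_scaleR power2_eq_square field_simps)
  show ?thesis
  proof (rule that[of a b])
    show "0 < a" using z1pos v1 by (simp add: a_def)
    show "0 < b" unfolding b_def using v1 y2(2)[OF y1(1)] by (auto simp: less_max_iff_disj)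
    show "a \<le> vdens c y \<and> vdens c y \<le> b" if "y \<in> Y" for y
      using y1 y2 that by (auto simp: a_def b_def min_le_iff_disj le_max_iff_disj)
    fix y v assume y: "y \<in> Y"
    show "a * (v \<bullet> v) \<le> v \<bullet> (gmat M c (cinv c y) *v v)"
    proof (cases "v = 0")
      case False
      have "a \<le> ?Q (y, v /\<^sub>R norm v)" using z1(2)[OF sph(3)[OF y False]] by (simp add: a_def)
      then have "(norm v)\<^sup>2 * a \<le> ?Q (y, v)"
        unfolding sph(1)[OF y False] by (rule mult_left_mono) simp
      then show ?thesis by (simp add: dot_square_norm mult.commute)
    qed simp
    show "v \<bullet> (gmat M c (cinv c y) *v v) \<le> b * (v \<bullet> v)"
    proof (cases "v = 0")
      case False
      have "?Q (y, v /\<^sub>R norm v) \<le> b" using z2(2)[OF sph(3)[OF y False]] by (simp add: b_def)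
      then have "?Q (y, v) \<le> (norm v)\<^sup>2 * b"
        unfolding sph(1)[OF y False] by (rule mult_left_mono) simp
      then show ?thesis by (simp add: dot_square_norm mult.commute)
    qed simp
    show "norm (gmat M c (cinv c y) *v v) \<le> b * norm v"
    proof (cases "v = 0")
      case False
      have "?N (y, v /\<^sub>R norm v) \<le> b" using z3(2)[OF sph(3)[OF y False]] by (simp add: b_def)
      then have "?N (y, v) \<le> norm v * b"
        unfolding sph(2)[OF y False] by (rule mult_left_mono) simp
      then show ?thesis by (simp add: mult.commute)
    qed simp
  qed
qed

lemma chart_ball:
  assumes "c \<in> charts M" "y \<in> cimg c"
  obtains r where "0 < r" "cball y r \<subseteq> cimg c"
  using open_cimg[OF assms(1)] assms(2) open_contains_cball by blast

text \<open>Every point lies in a coordinate ball with bounded density, and finitely many such balls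
  cover the compact manifold.\<close>

lemma finite_measure_V: "finite_measure V"
proof -
  have "\<exists>W. open W \<and> p \<in> W \<and> emeasure V W < \<infinity>" for p
  proof -
    obtain c where c: "c \<in> charts M" "p \<in> cdom c" by (rule ex_chart)
    obtain r where r: "0 < r" "cball (cmap c p) r \<subseteq> cimg c"
      by (rule chart_ball[OF c(1) cmap_in[OF c(2)]])
    obtain a b where ab: "0 < a" "0 < b" "\<And>y. y \<in> cball (cmap c p) r \<Longrightarrow> a \<le> vdens c y \<and> vdens c y \<le> b"
      by (rule chart_bounds[OF c(1) compact_cball r(2)]) blast
    let ?W = "cinv c ` ball (cmap c p) r"
    have sub: "ball (cmap c p) r \<subseteq> cimg c" using r(2) ball_subset_cball by blast
    have W: "open ?W" using open_cinv_image[OF c(1) open_ball sub] .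
    have Wc: "?W \<subseteq> cdom c" using sub cinv_in[OF c(1)] by blast
    have img: "cmap c ` ?W = ball (cmap c p) r"
      using sub cmap_cinv[OF c(1)] by (force simp: image_image)
    have "emeasure V ?W = emeasure (chart_volume c) ?W"
      using W Wc by (intro riemannian_volume_characterization c(1)) auto
    also have "\<dots> = (\<integral>\<^sup>+y. ennreal (indicator (ball (cmap c p) r) y * vdens c y) \<partial>lborel)"
      using emeasure_chart_volume[OF c(1), of ?W] W Wc img by (simp add: Int_absorb2)
    also have "\<dots> \<le> (\<integral>\<^sup>+y. ennreal b * indicator (ball (cmap c p) r) y \<partial>lborel)"
      using ab(3) by (intro nn_integral_mono) (auto simp: indicator_def intro!: ennreal_leI)
    also have "\<dots> = ennreal b * emeasure lborel (ball (cmap c p) r)"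
      by (rule nn_integral_cmult_indicator) simp
    also have "\<dots> < \<infinity>"
      using emeasure_lborel_ball_finite[of "cmap c p" r] by (simp add: ennreal_mult_less_top)
    finally have "emeasure V ?W < \<infinity>" .
    moreover have "p \<in> ?W" using r(1) cinv_cmap[OF c] by (metis centre_in_ball image_eqI)
    ultimately show ?thesis using W by blast
  qed
  then obtain W where W: "\<And>p. open (W p)" "\<And>p. p \<in> W p" "\<And>p. emeasure V (W p) < \<infinity>" by metis
  obtain F where F: "finite F" "UNIV \<subseteq> (\<Union>p\<in>F. W p)"
    by (rule compactE_image[OF compact_UNIV, of UNIV W]) (use W(1,2) in blast)+
  have "emeasure V UNIV \<le> emeasure V (\<Union>p\<in>F. W p)" using F W(1) by (intro emeasure_mono) auto
  also have "\<dots> \<le> (\<Sum>p\<in>F. emeasure V (W p))" using F W(1) by (intro emeasure_subadditive_finite) auto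
  also have "\<dots> < \<infinity>" using W(3) F(1) by simp
  finally show ?thesis by (intro finite_measureI) auto
qed

end

section \<open>Integral inequalities\<close>

text \<open>Discriminant argument for the nonnegative integral of (s f + t g)^2. Keeping both
  parameters avoids a division when the second norm is positive.\<close>

lemma Cauchy_Schwarz_integral:
  fixes f g :: "'a \<Rightarrow> real"
  assumes [measurable]: "f \<in> borel_measurable N" "g \<in> borel_measurable N"
    and f: "integrable N (\<lambda>x. (f x)\<^sup>2)" and g: "integrable N (\<lambda>x. (g x)\<^sup>2)"
  shows "integrable N (\<lambda>x. f x * g x)"
    and "(LINT x|N. f x * g x)\<^sup>2 \<le> (LINT x|N. (f x)\<^sup>2) * (LINT x|N. (g x)\<^sup>2)"
proof -
  show fg: "integrable N (\<lambda>x. f x * g x)"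
  proof (rule Bochner_Integration.integrable_bound)
    show "integrable N (\<lambda>x. (f x)\<^sup>2 + (g x)\<^sup>2)" using f g by simp
    have "\<bar>a * b\<bar> \<le> a\<^sup>2 + b\<^sup>2" for a b :: real
      using sum_squares_bound[of "\<bar>a\<bar>" "\<bar>b\<bar>"] mult_nonneg_nonneg[OF abs_ge_zero abs_ge_zero, of a b]
      by (simp only: abs_mult power2_abs)
    then show "AE x in N. norm (f x * g x) \<le> norm ((f x)\<^sup>2 + (g x)\<^sup>2)"
      by (auto intro!: AE_I2 simp: abs_of_nonneg)
  qed simp
  let ?A = "LINT x|N. (f x)\<^sup>2" and ?B = "LINT x|N. (g x)\<^sup>2" and ?C = "LINT x|N. f x * g x"
  have quad: "0 \<le> s\<^sup>2 * ?A + 2 * (s * t) * ?C + t\<^sup>2 * ?B" for s t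
  proof -
    have "0 \<le> (LINT x|N. (s * f x + t * g x)\<^sup>2)" by simp
    also have "(\<lambda>x. (s * f x + t * g x)\<^sup>2) = (\<lambda>x. s\<^sup>2 * (f x)\<^sup>2 + 2 * (s * t) * (f x * g x) + t\<^sup>2 * (g x)\<^sup>2)"
      by (auto simp: power2_eq_square algebra_simps)
    also have "(LINT x|N. s\<^sup>2 * (f x)\<^sup>2 + 2 * (s * t) * (f x * g x) + t\<^sup>2 * (g x)\<^sup>2)
      = s\<^sup>2 * ?A + 2 * (s * t) * ?C + t\<^sup>2 * ?B"
      using f g fg by simp
    finally show ?thesis .
  qed
  have A: "0 \<le> ?A" and B: "0 \<le> ?B" by simp_all
  show "?C\<^sup>2 \<le> ?A * ?B"
  proof (cases "?B = 0")
    case False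
    have "0 \<le> ?B\<^sup>2 * ?A + 2 * (?B * (- ?C)) * ?C + (- ?C)\<^sup>2 * ?B" by (rule quad)
    also have "\<dots> = ?B * (?A * ?B - ?C\<^sup>2)" by (simp add: power2_eq_square algebra_simps)
    finally show ?thesis using False B by (simp add: zero_le_mult_iff)
  next
    case True
    \<comment> \<open>With \<open>?B = 0\<close> the form is affine in \<open>t\<close>; being
      nonnegative for all \<open>t\<close>, it has slope 0.\<close>
    have "0 \<le> ?A + 2 * t * ?C" for t using quad[of 1 t] True by simp
    from this[of "- (?A + 1) * ?C"] have "0 \<le> ?A - 2 * (?A + 1) * ?C\<^sup>2"
      by (simp add: power2_eq_square algebra_simps)
    moreover have "0 \<le> ?A + 2 * (- ?C * ?A) * ?C" using \<open>\<And>t. 0 \<le> ?A + 2 * t * ?C\<close> by blast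
    moreover have "?C = 0"
    proof (rule ccontr)
      assume C: "?C \<noteq> 0"
      have "0 \<le> ?A + 2 * (- (?A + 1) / (2 * ?C)) * ?C" using \<open>\<And>t. 0 \<le> ?A + 2 * t * ?C\<close> by blast
      also have "2 * (- (?A + 1) / (2 * ?C)) * ?C = - (?A + 1)" using C by (simp add: field_simps)
      finally show False by simp
    qed
    ultimately show ?thesis using A B by simp
  qed
qed

lemma matrix_vector_measurable:
  fixes A :: "'a \<Rightarrow> real ^ 'n::finite ^ 'm::finite"
  assumes "A \<in> borel_measurable N" "v \<in> borel_measurable N"
  shows "(\<lambda>x. A x *v v x) \<in> borel_measurable N"
  by (rule borel_measurable_continuous_Pair[OF assms, of "(*v)"])
    (intro continuous_on_matrix_vector_mult continuous_intros)

section \<open>Square integrable vector fields\<close>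

context closed_manifold
begin

lemma measurable_chartI:
  fixes F :: "'a \<Rightarrow> real"
  assumes "\<And>c. c \<in> charts M \<Longrightarrow> (\<lambda>x. indicator (cdom c) x * F x) \<in> borel_measurable borel"
  shows "F \<in> borel_measurable borel"
proof -
  obtain cs :: "nat \<Rightarrow> ('a, 'n) chart" and D m where D:
    "\<And>i. i < m \<Longrightarrow> cs i \<in> charts M" "\<And>i. D i \<in> sets borel" "\<And>i. i < m \<Longrightarrow> D i \<subseteq> cdom (cs i)"
    "(\<Union>i<m. D i) = UNIV" "disjoint_family D"
    by (rule finite_chart_partition) blast
  have "F x = (\<Sum>i<m. indicator (D i) x * (indicator (cdom (cs i)) x * F x))" for x
  proof -
    obtain j where j: "j < m" "x \<in> D j" using D(4) by auto
    have "indicator (D i) x * (indicator (cdom (cs i)) x * F x) = (if i = j then F x else 0)" if "i < m" for i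
    proof (cases "i = j")
      case False
      then have "x \<notin> D i" using j D(5) by (auto simp: disjoint_family_on_def)
      then show ?thesis using False by simp
    qed (use j D(3)[OF j(1)] in auto)
    then have "(\<Sum>i<m. indicator (D i) x * (indicator (cdom (cs i)) x * F x)) = (\<Sum>i<m. if i = j then F x else 0)"
      by (intro sum.cong) auto
    with j show ?thesis by simp
  qed
  moreover have "(\<lambda>x. \<Sum>i<m. indicator (D i) x * (indicator (cdom (cs i)) x * F x)) \<in> borel_measurable borel"
  proof (rule borel_measurable_sum)
    fix i assume "i \<in> {..<m}"
    then have F: "(\<lambda>x. indicator (cdom (cs i)) x * F x) \<in> borel_measurable borel" using assms[OF D(1)] by simp
    have "(indicator (D i) :: 'a \<Rightarrow> real) \<in> borel_measurable borel" using D(2) by simp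
    from borel_measurable_times[OF this F]
    show "(\<lambda>x. indicator (D i) x * (indicator (cdom (cs i)) x * F x)) \<in> borel_measurable borel" .
  qed
  ultimately show ?thesis by presburger
qed

lemma gmat_measurable:
  assumes "c \<in> charts M"
  shows "(\<lambda>x. indicator (cdom c) x *\<^sub>R gmat M c x) \<in> borel_measurable borel"
proof -
  have "continuous_on (cdom c) (\<lambda>x. gmat M c (cinv c (cmap c x)))"
    by (rule continuous_on_compose2[OF continuous_gmat[OF assms] continuous_cmap[OF assms]]) simp
  then have "continuous_on (cdom c) (gmat M c)"
    by (rule continuous_on_eq) (simp add: cinv_cmap[OF assms])
  then show ?thesis
    using open_cdom[OF assms] by (intro borel_measurable_continuous_on_indicator) auto
qed

lemma some_chart:
  "(SOME c. c \<in> charts M \<and> p \<in> cdom c) \<in> charts M" "p \<in> cdom (SOME c. c \<in> charts M \<and> p \<in> cdom c)"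
proof -
  have "\<exists>c. c \<in> charts M \<and> p \<in> cdom c" by (rule ex_chart[of p]) blast
  from someI_ex[OF this]
  show "(SOME c. c \<in> charts M \<and> p \<in> cdom c) \<in> charts M" "p \<in> cdom (SOME c. c \<in> charts M \<and> p \<in> cdom c)"
    by blast+
qed

lemma tangent_vector_change:
  "tangent_vector M p v \<Longrightarrow> c \<in> charts M \<Longrightarrow> d \<in> charts M \<Longrightarrow> p \<in> cdom c \<Longrightarrow> p \<in> cdom d \<Longrightarrow>
    v d = chart_change c d p (v c)"
  unfolding tangent_vector_def by blast

lemma tinner_chart:
  assumes "c \<in> charts M" "p \<in> cdom c" "tangent_vector M p v" "tangent_vector M p w"
  shows "tinner M p v w = v c \<bullet> (gmat M c p *v w c)"
proof -
  let ?d = "SOME c. c \<in> charts M \<and> p \<in> cdom c"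
  note d = some_chart[of p]
  have "v c = chart_change ?d c p (v ?d)" "w c = chart_change ?d c p (w ?d)"
    by (rule tangent_vector_change[OF _ d(1) assms(1) d(2) assms(2)], rule assms)+
  then show ?thesis
    unfolding tinner_def Let_def by (simp only: gmat_change[OF d(1) assms(1) d(2) assms(2)])
qed

lemma tinner_commute: "tinner M p v w = tinner M p w v"
  unfolding tinner_def Let_def by (rule gmat_inner_commute) (rule some_chart)+

lemma tinner_lin_left: "tinner M p (\<lambda>c. a *\<^sub>R v c + b *\<^sub>R w c) z = a * tinner M p v z + b * tinner M p w z"
  unfolding tinner_def Let_def by (simp add: inner_add_left)

lemma tinner_lin_right: "tinner M p z (\<lambda>c. a *\<^sub>R v c + b *\<^sub>R w c) = a * tinner M p z v + b * tinner M p z w"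
  by (simp add: tinner_commute[of _ z] tinner_lin_left)

lemma tinner_nonneg: "0 \<le> tinner M p v v"
  unfolding tinner_def Let_def by (rule gmat_nonneg) (rule some_chart)+

lemma tnorm_sq: "(tnorm M p v)\<^sup>2 = tinner M p v v"
  unfolding tnorm_def by (simp add: tinner_nonneg)

lemma tinner_zero [simp]: "tinner M p (\<lambda>c. 0) w = 0" "tinner M p w (\<lambda>c. 0) = 0"
  unfolding tinner_def Let_def by simp_all

lemma tinner_lin_square: "tinner M p (\<lambda>c. a *\<^sub>R v c + b *\<^sub>R w c) (\<lambda>c. a *\<^sub>R v c + b *\<^sub>R w c)
    = a\<^sup>2 * tinner M p v v + 2 * (a * b) * tinner M p v w + b\<^sup>2 * tinner M p w w"
  by (simp add: tinner_lin_left tinner_lin_right tinner_commute[of p w v] power2_eq_square algebra_simps)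

lemma abs_tinner_le: "\<bar>tinner M p v w\<bar> \<le> tinner M p v v + tinner M p w w"
  using tinner_nonneg[of p "\<lambda>c. 1 *\<^sub>R v c + 1 *\<^sub>R w c"] tinner_nonneg[of p "\<lambda>c. 1 *\<^sub>R v c + (-1) *\<^sub>R w c"]
    tinner_nonneg[of p v] tinner_nonneg[of p w]
  unfolding tinner_lin_square by (simp add: abs_le_iff)

lemma tangent_vector_lin:
  assumes "tangent_vector M p v" "tangent_vector M p w"
  shows "tangent_vector M p (\<lambda>c. a *\<^sub>R v c + b *\<^sub>R w c)"
  unfolding tangent_vector_def
proof (intro conjI allI impI ballI)
  fix c d assume "c \<in> charts M" "d \<in> charts M" "p \<in> cdom c \<inter> cdom d"
  then have cd: "c \<in> charts M" "d \<in> charts M" "p \<in> cdom c" "p \<in> cdom d" by auto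
  show "a *\<^sub>R v d + b *\<^sub>R w d = chart_change c d p (a *\<^sub>R v c + b *\<^sub>R w c)"
    using tangent_vector_change[OF assms(1) cd] tangent_vector_change[OF assms(2) cd] linear_chart_change[OF cd]
    by (simp add: linear_add linear_scale)
qed (use assms in \<open>auto simp: tangent_vector_def\<close>)

lemma tangent_vector_zero [simp]: "tangent_vector M p (\<lambda>c. 0)"
  using linear_chart_change unfolding tangent_vector_def by (auto simp: linear_0)

lemma tangent_vector_eqI:
  assumes "tangent_vector M p v" "tangent_vector M p w" "c \<in> charts M" "p \<in> cdom c" "v c = w c"
  shows "v = w"
proof
  fix d
  show "v d = w d"
  proof (cases "d \<in> charts M \<and> p \<in> cdom d")
    case True
    then show ?thesis
      using tangent_vector_change[OF assms(1,3) _ assms(4), of d]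
        tangent_vector_change[OF assms(2,3) _ assms(4), of d] assms(5) by simp
  next
    case False
    then have "v d = 0" "w d = 0" using assms(1,2) unfolding tangent_vector_def by blast+
    then show ?thesis by simp
  qed
qed

text \<open>Fields live on the whole manifold. A field on a domain is extended by 0 before it is
  tested for membership, so that solutions on different domains can be subtracted.\<close>

definition L2_field :: "('a \<Rightarrow> ('a, 'n) tvec) \<Rightarrow> bool" where
  "L2_field X \<longleftrightarrow> (\<forall>x. tangent_vector M x (X x)) \<and>
    (\<forall>c\<in>charts M. (\<lambda>x. indicator (cdom c) x *\<^sub>R X x c) \<in> borel_measurable borel) \<and>
    integrable V (\<lambda>x. tinner M x (X x) (X x))"

definition L2_fun :: "('a \<Rightarrow> real) \<Rightarrow> bool" where
  "L2_fun u \<longleftrightarrow> u \<in> borel_measurable borel \<and> integrable V (\<lambda>x. (u x)\<^sup>2)"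

lemma tinner_measurable:
  assumes "\<And>x. tangent_vector M x (X x)" "\<And>x. tangent_vector M x (Y x)"
    and "\<And>c. c \<in> charts M \<Longrightarrow> (\<lambda>x. indicator (cdom c) x *\<^sub>R X x c) \<in> borel_measurable borel"
    and "\<And>c. c \<in> charts M \<Longrightarrow> (\<lambda>x. indicator (cdom c) x *\<^sub>R Y x c) \<in> borel_measurable borel"
  shows "(\<lambda>x. tinner M x (X x) (Y x)) \<in> borel_measurable borel"
proof (rule measurable_chartI)
  fix c assume c: "c \<in> charts M"
  have eq: "indicator (cdom c) x * tinner M x (X x) (Y x) = (indicator (cdom c) x *\<^sub>R X x c) \<bullet>
    ((indicator (cdom c) x *\<^sub>R gmat M c x) *v (indicator (cdom c) x *\<^sub>R Y x c))" for x
    using tinner_chart[OF c _ assms(1,2)] by (auto simp: indicator_def)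
  show "(\<lambda>x. indicator (cdom c) x * tinner M x (X x) (Y x)) \<in> borel_measurable borel"
    unfolding eq
    by (intro borel_measurable_inner matrix_vector_measurable gmat_measurable assms c)
qed

lemma L2_field_tinner:
  assumes "L2_field X" "L2_field Y"
  shows "integrable V (\<lambda>x. tinner M x (X x) (Y x))"
proof (rule Bochner_Integration.integrable_bound)
  show "integrable V (\<lambda>x. tinner M x (X x) (X x) + tinner M x (Y x) (Y x))"
    using assms by (simp add: L2_field_def)
  show "(\<lambda>x. tinner M x (X x) (Y x)) \<in> borel_measurable V"
    using assms tinner_measurable[of X Y] by (simp add: L2_field_def)
  show "AE x in V. norm (tinner M x (X x) (Y x)) \<le> norm (tinner M x (X x) (X x) + tinner M x (Y x) (Y x))"
    using abs_tinner_le tinner_nonneg by (auto intro!: AE_I2 simp: abs_of_nonneg)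
qed

lemma L2_field_lin:
  assumes "L2_field X" "L2_field Y"
  shows "L2_field (\<lambda>x c. a *\<^sub>R X x c + b *\<^sub>R Y x c)"
proof -
  have "(\<lambda>x. indicator (cdom c) x *\<^sub>R (a *\<^sub>R X x c + b *\<^sub>R Y x c)) \<in> borel_measurable borel"
    if "c \<in> charts M" for c
  proof -
    have "indicator (cdom c) x *\<^sub>R (a *\<^sub>R X x c + b *\<^sub>R Y x c)
      = a *\<^sub>R (indicator (cdom c) x *\<^sub>R X x c) + b *\<^sub>R (indicator (cdom c) x *\<^sub>R Y x c)" for x
      by (simp add: scaleR_add_right mult.commute)
    moreover have "(\<lambda>x. indicator (cdom c) x *\<^sub>R X x c) \<in> borel_measurable borel"
      "(\<lambda>x. indicator (cdom c) x *\<^sub>R Y x c) \<in> borel_measurable borel"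
      using assms that by (simp_all add: L2_field_def)
    ultimately show ?thesis by (simp del: scaleR_scaleR)
  qed
  moreover have "integrable V (\<lambda>x. a\<^sup>2 * tinner M x (X x) (X x) + 2 * (a * b) * tinner M x (X x) (Y x)
      + b\<^sup>2 * tinner M x (Y x) (Y x))"
    using L2_field_tinner[OF assms(1,1)] L2_field_tinner[OF assms] L2_field_tinner[OF assms(2,2)] by simp
  ultimately show ?thesis
    using assms tangent_vector_lin by (simp add: L2_field_def tinner_lin_square)
qed

lemma L2_fun_lin:
  assumes "L2_fun u" "L2_fun v" shows "L2_fun (\<lambda>x. a * u x + b * v x)"
proof -
  have "integrable V (\<lambda>x. u x * v x)"
    using assms by (intro Cauchy_Schwarz_integral) (auto simp: L2_fun_def)
  then have "integrable V (\<lambda>x. a\<^sup>2 * (u x)\<^sup>2 + 2 * (a * b) * (u x * v x) + b\<^sup>2 * (v x)\<^sup>2)"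
    using assms by (simp add: L2_fun_def)
  moreover have "a\<^sup>2 * (u x)\<^sup>2 + 2 * (a * b) * (u x * v x) + b\<^sup>2 * (v x)\<^sup>2 = (a * u x + b * v x)\<^sup>2" for x
    by (simp add: power2_eq_square algebra_simps)
  ultimately show ?thesis using assms by (auto simp: L2_fun_def)
qed

definition ip :: "('a \<Rightarrow> ('a, 'n) tvec) \<Rightarrow> ('a \<Rightarrow> ('a, 'n) tvec) \<Rightarrow> real" where
  "ip X Y = (LINT x|V. tinner M x (X x) (Y x))"

lemma ip_nonneg: "0 \<le> ip X X"
  unfolding ip_def by (rule Bochner_Integration.integral_nonneg) (rule tinner_nonneg)

lemma ip_lin_square:
  assumes "L2_field X" "L2_field Y"
  shows "ip (\<lambda>x c. a *\<^sub>R X x c + b *\<^sub>R Y x c) (\<lambda>x c. a *\<^sub>R X x c + b *\<^sub>R Y x c)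
    = a\<^sup>2 * ip X X + 2 * (a * b) * ip X Y + b\<^sup>2 * ip Y Y"
  unfolding ip_def tinner_lin_square
  using L2_field_tinner[OF assms(1,1)] L2_field_tinner[OF assms] L2_field_tinner[OF assms(2,2)] by simp

subsection \<open>Local estimates in a chart\<close>

lemma pullback_measurable:
  fixes F :: "'a \<Rightarrow> 'b::real_normed_vector"
  assumes c: "c \<in> charts M" and F: "(\<lambda>x. indicator (cdom c) x *\<^sub>R F x) \<in> borel_measurable borel"
  shows "(\<lambda>y. indicator (cimg c) y *\<^sub>R F (cinv c y)) \<in> borel_measurable borel"
proof -
  have [measurable]: "cimg c \<in> sets borel" using open_cimg[OF c] by auto
  have "(\<lambda>y. if y \<in> cimg c then indicator (cdom c) (cinv' c y) *\<^sub>R F (cinv' c y) else 0) \<in> borel_measurable borel"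
    by (rule measurable_If[OF measurable_compose[OF cinv'_measurable[OF c] F]]) simp_all
  moreover have "(if y \<in> cimg c then indicator (cdom c) (cinv' c y) *\<^sub>R F (cinv' c y) else 0)
    = indicator (cimg c) y *\<^sub>R F (cinv c y)" for y
    using cinv_in[OF c] by (auto simp: cinv'_def indicator_def)
  ultimately show ?thesis by simp
qed

text \<open>\<open>W\<close> will be the square of an \<open>L\<^sup>2\<close> function or the square of the length of an \<open>L\<^sup>2\<close> field.\<close>

lemma local_L2_bound:
  assumes c: "c \<in> charts M" and Y: "compact Y" "Y \<subseteq> cimg c"
  obtains C where "0 < C" "\<And>(W :: 'a \<Rightarrow> real) F b. W \<in> borel_measurable borel \<Longrightarrow> (\<And>x. 0 \<le> W x) \<Longrightarrow> integrable V W \<Longrightarrow>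
      (\<lambda>y. indicator (cimg c) y * F y) \<in> borel_measurable borel \<Longrightarrow>
      (\<And>y. y \<in> Y \<Longrightarrow> (F y)\<^sup>2 \<le> b * W (cinv c y)) \<Longrightarrow> 0 \<le> b \<Longrightarrow>
      integrable lborel (\<lambda>y. (indicator Y y * F y)\<^sup>2) \<and>
      (LINT y|lborel. (indicator Y y * F y)\<^sup>2) \<le> C * b * integral\<^sup>L V W"
proof -
  obtain a b' where a: "0 < a" "\<And>y. y \<in> Y \<Longrightarrow> a \<le> vdens c y \<and> vdens c y \<le> b'"
    by (rule chart_bounds[OF c Y]) blast
  have Yb [measurable]: "Y \<in> sets borel" using Y(1) by (rule borel_compact)
  have cb [measurable]: "cimg c \<in> sets borel" "cdom c \<in> sets borel" using open_cimg[OF c] open_cdom[OF c] by auto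
  show ?thesis
  proof (rule that[of "1 / a"])
    show "0 < 1 / a" using a by simp
    fix W :: "'a \<Rightarrow> real" and F b
    assume W: "W \<in> borel_measurable borel" "\<And>x. 0 \<le> W x" "integrable V W"
      and F: "(\<lambda>y. indicator (cimg c) y * F y) \<in> borel_measurable borel"
      and le: "\<And>y. y \<in> Y \<Longrightarrow> (F y)\<^sup>2 \<le> b * W (cinv c y)" and b: "0 \<le> b"
    let ?G = "\<lambda>y. indicator (cimg c) y * vdens c y * W (cinv c y)"
    have iW: "integrable V (\<lambda>x. indicator (cdom c) x * W x)"
      using W(3) integrable_real_mult_indicator[of "cdom c" V W] by (simp add: mult.commute)
    have iG: "integrable lborel ?G" using integral_chart(1)[OF c W(1)] iW by simp
    have bound: "(indicator Y y * F y)\<^sup>2 \<le> b / a * ?G y" for y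
    proof (cases "y \<in> Y")
      case True
      then have y: "y \<in> cimg c" using Y by auto
      have "a * (F y)\<^sup>2 \<le> vdens c y * (b * W (cinv c y))"
        using a(2)[OF True] a(1) True le[OF True] W(2) b by (intro mult_mono) auto
      then show ?thesis using True y a(1) by (simp add: field_simps)
    next
      case False
      have "0 \<le> ?G y" using W(2) vdens_pos[OF c, of y] by (auto simp: indicator_def)
      then show ?thesis using False a b by simp
    qed
    have m: "(\<lambda>y. (indicator Y y * F y)\<^sup>2) \<in> borel_measurable lborel"
    proof -
      have "indicator Y y * F y = indicator Y y * (indicator (cimg c) y * F y)" for y
        using Y(2) by (auto simp: indicator_def)
      moreover have "(\<lambda>y. indicator Y y * (indicator (cimg c) y * F y)) \<in> borel_measurable borel"
        by (rule borel_measurable_times) (use F in simp_all)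
      ultimately have "(\<lambda>y. indicator Y y * F y) \<in> borel_measurable borel" by (simp only:)
      then show ?thesis by simp
    qed
    have int: "integrable lborel (\<lambda>y. (indicator Y y * F y)\<^sup>2)"
    proof (rule Bochner_Integration.integrable_bound[OF _ m])
      show "integrable lborel (\<lambda>y. b / a * ?G y)" using iG by (rule integrable_mult_right)
      show "AE y in lborel. norm ((indicator Y y * F y)\<^sup>2) \<le> norm (b / a * ?G y)"
        using bound by (intro AE_I2) (simp only: real_norm_def abs_power2 order_trans[OF _ abs_ge_self])
    qed
    have "(LINT y|lborel. (indicator Y y * F y)\<^sup>2) \<le> (LINT y|lborel. b / a * ?G y)"
      using iG by (intro integral_mono int bound) auto
    also have "\<dots> = b / a * (LINT x|V. indicator (cdom c) x * W x)"
      using integral_chart(2)[OF c W(1)] by simp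
    also have "\<dots> \<le> b / a * integral\<^sup>L V W"
      using a b iW W by (intro mult_left_mono integral_mono) (auto simp: indicator_def)
    finally show "integrable lborel (\<lambda>y. (indicator Y y * F y)\<^sup>2) \<and>
      (LINT y|lborel. (indicator Y y * F y)\<^sup>2) \<le> 1 / a * b * integral\<^sup>L V W"
      using int by simp
  qed
qed

text \<open>Expresses that both functionals in the integral identity of a weak gradient are
  continuous in the L^2 sense. The single constant serves all functions, fields and components,
  which is what passing to limits requires.\<close>

definition pairing :: "('a, 'n) chart \<Rightarrow> (real ^ 'n \<Rightarrow> real) \<Rightarrow> real \<Rightarrow> bool" where
  "pairing c \<eta> C \<longleftrightarrow>
    (\<forall>u. L2_fun u \<longrightarrow> integrable lborel (\<lambda>y. u (cinv c y) * \<eta> y) \<and>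
      (LINT y|lborel. u (cinv c y) * \<eta> y)\<^sup>2 \<le> C * (LINT x|V. (u x)\<^sup>2)) \<and>
    (\<forall>X i. L2_field X \<longrightarrow> integrable lborel (\<lambda>y. (gmat M c (cinv c y) *v X (cinv c y) c) $ i * \<eta> y) \<and>
      (LINT y|lborel. (gmat M c (cinv c y) *v X (cinv c y) c) $ i * \<eta> y)\<^sup>2 \<le> C * ip X X)"

lemma pairing_fun:
  assumes "pairing c \<eta> C" "L2_fun u"
  shows "integrable lborel (\<lambda>y. u (cinv c y) * \<eta> y)"
    and "(LINT y|lborel. u (cinv c y) * \<eta> y)\<^sup>2 \<le> C * (LINT x|V. (u x)\<^sup>2)"
  using assms unfolding pairing_def by simp_all

lemma pairing_field:
  assumes "pairing c \<eta> C" "L2_field X"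
  shows "integrable lborel (\<lambda>y. (gmat M c (cinv c y) *v X (cinv c y) c) $ i * \<eta> y)"
    and "(LINT y|lborel. (gmat M c (cinv c y) *v X (cinv c y) c) $ i * \<eta> y)\<^sup>2 \<le> C * ip X X"
  using assms unfolding pairing_def by simp_all

text \<open>On the compact set \<open>Y\<close> the density and the metric are comparable with the
  Euclidean ones, so \<open>local_L2_bound\<close> bounds the coordinate expression in L^2 over
  \<open>Y\<close>; Cauchy-Schwarz against \<open>\<eta>\<close> finishes.\<close>

lemma pairing_bound:
  assumes c: "c \<in> charts M" and Y: "compact Y" "Y \<subseteq> cimg c"
    and \<eta>: "\<eta> \<in> borel_measurable borel" "integrable lborel (\<lambda>y. (\<eta> y)\<^sup>2)" "\<And>y. y \<notin> Y \<Longrightarrow> \<eta> y = 0"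
  shows "\<exists>C. pairing c \<eta> C"
proof -
  have Yb [measurable]: "Y \<in> sets borel" using Y(1) by (rule borel_compact)
  note [measurable] = \<eta>(1) and \<eta>2 = \<eta>(2)
  obtain C1 where C1: "0 < C1" "\<And>(W :: 'a \<Rightarrow> real) F b. W \<in> borel_measurable borel \<Longrightarrow> (\<And>x. 0 \<le> W x) \<Longrightarrow> integrable V W \<Longrightarrow>
      (\<lambda>y. indicator (cimg c) y * F y) \<in> borel_measurable borel \<Longrightarrow>
      (\<And>y. y \<in> Y \<Longrightarrow> (F y)\<^sup>2 \<le> b * W (cinv c y)) \<Longrightarrow> 0 \<le> b \<Longrightarrow>
      integrable lborel (\<lambda>y. (indicator Y y * F y)\<^sup>2) \<and>
      (LINT y|lborel. (indicator Y y * F y)\<^sup>2) \<le> C1 * b * integral\<^sup>L V W"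
    by (rule local_L2_bound[OF c Y]) blast
  obtain a b where ab: "0 < a" "0 < b"
    "\<And>y v. y \<in> Y \<Longrightarrow> a * (v \<bullet> v) \<le> v \<bullet> (gmat M c (cinv c y) *v v)"
    "\<And>y v. y \<in> Y \<Longrightarrow> norm (gmat M c (cinv c y) *v v) \<le> b * norm v"
    by (rule chart_bounds[OF c Y]) blast
  define N where "N = (LINT y|lborel. (\<eta> y)\<^sup>2)"
  have key: "integrable lborel (\<lambda>y. F y * \<eta> y) \<and> (LINT y|lborel. F y * \<eta> y)\<^sup>2 \<le> (C1 * k * N) * integral\<^sup>L V W"
    if "W \<in> borel_measurable borel" "\<And>x. 0 \<le> W x" "integrable V W"
      "(\<lambda>y. indicator (cimg c) y * F y) \<in> borel_measurable borel"
      "\<And>y. y \<in> Y \<Longrightarrow> (F y)\<^sup>2 \<le> k * W (cinv c y)" "0 \<le> k" for W F k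
  proof -
    have *: "integrable lborel (\<lambda>y. (indicator Y y * F y)\<^sup>2)"
      "(LINT y|lborel. (indicator Y y * F y)\<^sup>2) \<le> C1 * k * integral\<^sup>L V W"
      using C1(2)[OF that] by auto
    have eq: "F y * \<eta> y = (indicator Y y * F y) * \<eta> y" for y using \<eta>(3) by (auto simp: indicator_def)
    have "indicator Y y * F y = indicator Y y * (indicator (cimg c) y * F y)" for y
      using Y(2) by (auto simp: indicator_def)
    moreover have "(\<lambda>y. indicator Y y * (indicator (cimg c) y * F y)) \<in> borel_measurable borel"
      by (rule borel_measurable_times) (use that(4) in simp_all)
    ultimately have "(\<lambda>y. indicator Y y * F y) \<in> borel_measurable borel" by (simp only:)
    then have m: "(\<lambda>y. indicator Y y * F y) \<in> borel_measurable lborel" by simp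
    have "(LINT y|lborel. (indicator Y y * F y) * \<eta> y)\<^sup>2 \<le> (LINT y|lborel. (indicator Y y * F y)\<^sup>2) * N"
      unfolding N_def by (rule Cauchy_Schwarz_integral(2)[OF m _ *(1) \<eta>2]) simp
    also have "\<dots> \<le> (C1 * k * integral\<^sup>L V W) * N"
      by (rule mult_right_mono[OF *(2)]) (simp add: N_def)
    finally show ?thesis
      using Cauchy_Schwarz_integral(1)[OF m _ *(1) \<eta>2] unfolding eq by (simp add: mult_ac)
  qed
  \<comment> \<open>For a vector v with lowered version g v, each component squared is at most |g
    v|^2, hence at most b^2 |v|^2, hence at most (b^2 / a) times the squared Riemannian
    length.\<close>
  define k where "k = b\<^sup>2 / a"
  have k: "0 \<le> k" using ab by (simp add: k_def)
  define C where "C = C1 * 1 * N + C1 * k * N"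
  have N: "0 \<le> N" by (simp add: N_def)
  have nn: "0 \<le> C1 * 1 * N" "0 \<le> C1 * k * N" using C1(1) k N by auto
  have cx: "(\<lambda>x. indicator (cdom c) x *\<^sub>R u x) \<in> borel_measurable borel"
    if "u \<in> borel_measurable borel" for u :: "'a \<Rightarrow> real"
    using that open_cdom[OF c] by (intro borel_measurable_scaleR borel_measurable_indicator) auto
  have fu: "integrable lborel (\<lambda>y. u (cinv c y) * \<eta> y) \<and>
      (LINT y|lborel. u (cinv c y) * \<eta> y)\<^sup>2 \<le> (C1 * 1 * N) * (LINT x|V. (u x)\<^sup>2)" if "L2_fun u" for u
    using that pullback_measurable[OF c cx, of u] by (intro key) (auto simp: L2_fun_def)
  have fX: "integrable lborel (\<lambda>y. (gmat M c (cinv c y) *v X (cinv c y) c) $ i * \<eta> y) \<and>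
      (LINT y|lborel. (gmat M c (cinv c y) *v X (cinv c y) c) $ i * \<eta> y)\<^sup>2 \<le> (C1 * k * N) * ip X X"
    if X: "L2_field X" for X i
    unfolding ip_def
  proof (rule key)
    show "(\<lambda>x. tinner M x (X x) (X x)) \<in> borel_measurable borel"
      using tinner_measurable[of X X] X by (simp add: L2_field_def)
    show "integrable V (\<lambda>x. tinner M x (X x) (X x))" using X by (simp add: L2_field_def)
    have "(\<lambda>x. (indicator (cdom c) x *\<^sub>R gmat M c x) *v (indicator (cdom c) x *\<^sub>R X x c)) \<in> borel_measurable borel"
      using X c by (intro matrix_vector_measurable gmat_measurable) (auto simp: L2_field_def)
    moreover have "(indicator (cdom c) x *\<^sub>R gmat M c x) *v (indicator (cdom c) x *\<^sub>R X x c)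
      = indicator (cdom c) x *\<^sub>R (gmat M c x *v X x c)" for x by (simp add: indicator_def)
    ultimately have "(\<lambda>x. indicator (cdom c) x *\<^sub>R (gmat M c x *v X x c)) \<in> borel_measurable borel" by simp
    from measurable_compose[OF pullback_measurable[OF c this], of "\<lambda>v. v $ i" borel]
    show "(\<lambda>y. indicator (cimg c) y * (gmat M c (cinv c y) *v X (cinv c y) c) $ i) \<in> borel_measurable borel"
      by (simp add: borel_measurable_continuous_onI continuous_on_component)
    fix y assume y: "y \<in> Y"
    let ?g = "gmat M c (cinv c y)" and ?v = "X (cinv c y) c"
    have "cinv c y \<in> cdom c" using y Y cinv_in[OF c] by auto
    then have t: "tinner M (cinv c y) (X (cinv c y)) (X (cinv c y)) = ?v \<bullet> (?g *v ?v)"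
      using X c by (intro tinner_chart) (auto simp: L2_field_def)
    have "((?g *v ?v) $ i)\<^sup>2 \<le> (norm (?g *v ?v))\<^sup>2"
      using component_le_norm_cart[of "?g *v ?v" i] by (metis abs_ge_zero power2_abs power_mono)
    also have "\<dots> \<le> (b * norm ?v)\<^sup>2" using ab(4)[OF y] by (intro power_mono) auto
    also have "\<dots> = b\<^sup>2 * (?v \<bullet> ?v)" by (simp add: power_mult_distrib dot_square_norm)
    also have "\<dots> \<le> b\<^sup>2 * (?v \<bullet> (?g *v ?v) / a)"
      using ab(3)[OF y, of ?v] ab(1) by (intro mult_left_mono) (auto simp: field_simps)
    finally show "((?g *v ?v) $ i)\<^sup>2 \<le> k * tinner M (cinv c y) (X (cinv c y)) (X (cinv c y))"
      by (simp add: t k_def)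
  qed (auto simp: k tinner_nonneg)
  have "pairing c \<eta> C"
    unfolding pairing_def
  proof (intro conjI allI impI)
    fix u assume u: "L2_fun u"
    show "integrable lborel (\<lambda>y. u (cinv c y) * \<eta> y)" using fu[OF u] by simp
    have "(C1 * 1 * N) * (LINT x|V. (u x)\<^sup>2) \<le> C * (LINT x|V. (u x)\<^sup>2)"
      using nn by (intro mult_right_mono) (auto simp: C_def)
    then show "(LINT y|lborel. u (cinv c y) * \<eta> y)\<^sup>2 \<le> C * (LINT x|V. (u x)\<^sup>2)"
      using fu[OF u] by linarith
  next
    fix X i assume X: "L2_field X"
    show "integrable lborel (\<lambda>y. (gmat M c (cinv c y) *v X (cinv c y) c) $ i * \<eta> y)" using fX[OF X] by simp
    have "(C1 * k * N) * ip X X \<le> C * ip X X"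
      using nn ip_nonneg by (intro mult_right_mono) (auto simp: C_def)
    then show "(LINT y|lborel. (gmat M c (cinv c y) *v X (cinv c y) c) $ i * \<eta> y)\<^sup>2 \<le> C * ip X X"
      using fX[OF X, of i] by linarith
  qed
  then show ?thesis ..
qed

end

section \<open>The fundamental lemma of the calculus of variations\<close>

definition bump_in :: "'e::euclidean_space set \<Rightarrow> ('e \<Rightarrow> real) \<Rightarrow> bool" where
  "bump_in U \<psi> \<longleftrightarrow> smooth_on \<psi> UNIV \<and> compact (closure {y. \<psi> y \<noteq> 0}) \<and> closure {y. \<psi> y \<noteq> 0} \<subseteq> U"

text \<open>Smooth bumps between 0 and 1 converge pointwise to the indicator of the open box, and
  \<open>F\<close> is integrable on the closed box, so dominated convergence applies.\<close>

lemma integral_box_subset_zero: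
  fixes F :: "'e::euclidean_space \<Rightarrow> real"
  assumes F: "integrable lborel (\<lambda>y. indicator (cbox a b) y * F y)" and sub: "cbox a b \<subseteq> U"
    and zero: "\<And>\<psi>. bump_in U \<psi> \<Longrightarrow> (LINT y|lborel. F y * \<psi> y) = 0"
  shows "(LINT y|lborel. indicator (box a b) y * F y) = 0"
proof -
  have "(\<lambda>k. LINT y|lborel. F y * box_bump a b k y) \<longlonglongrightarrow> (LINT y|lborel. indicator (box a b) y * F y)"
  proof (rule integral_dominated_convergence[where w = "\<lambda>y. \<bar>indicator (cbox a b) y * F y\<bar>"])
    have box: "box a b \<subseteq> cbox a b" by (rule box_subset_cbox)
    have eq: "F y * box_bump a b k y = (indicator (cbox a b) y * F y) * box_bump a b k y" for k y
      using box_bump_zero[of y a b k] box by (auto simp: indicator_def)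
    have m: "box_bump a b k \<in> borel_measurable borel" for k
      using smooth_on_continuous[OF smooth_on_box_bump] by (rule borel_measurable_continuous_onI)
    show "(\<lambda>y. F y * box_bump a b k y) \<in> borel_measurable lborel" for k
      unfolding eq using borel_measurable_times[OF borel_measurable_integrable[OF F]] m[of k] by simp
    have eq2: "indicator (box a b) y * F y = indicator (box a b) y * (indicator (cbox a b) y * F y)" for y
      using box by (auto simp: indicator_def)
    show "(\<lambda>y. indicator (box a b) y * F y) \<in> borel_measurable lborel"
      by (subst eq2, rule borel_measurable_times[OF _ borel_measurable_integrable[OF F]]) simp
    show "integrable lborel (\<lambda>y. \<bar>indicator (cbox a b) y * F y\<bar>)" using F by (rule integrable_abs)
    show "AE y in lborel. (\<lambda>k. F y * box_bump a b k y) \<longlonglongrightarrow> indicator (box a b) y * F y"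
    proof (rule AE_I2)
      fix y :: 'e
      have "(\<lambda>k. F y * box_bump a b k y) \<longlonglongrightarrow> F y * indicator (box a b) y"
        by (intro tendsto_mult tendsto_const box_bump_tendsto)
      then show "(\<lambda>k. F y * box_bump a b k y) \<longlonglongrightarrow> indicator (box a b) y * F y" by (simp add: mult.commute)
    qed
    show "AE y in lborel. norm (F y * box_bump a b k y) \<le> \<bar>indicator (cbox a b) y * F y\<bar>" for k
      unfolding eq using box_bump_nonneg[of a b k] box_bump_le_1[of a b k]
      by (auto intro!: AE_I2 mult_left_le simp: abs_mult)
  qed
  moreover have "(LINT y|lborel. F y * box_bump a b k y) = 0" for k
  proof (rule zero)
    have cl: "closure {y. box_bump a b k y \<noteq> 0} \<subseteq> cbox a b"
      using box_bump_zero[of _ a b k] box_subset_cbox[of a b] by (intro closure_minimal) auto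
    then show "bump_in U (box_bump a b k)"
      using sub smooth_on_box_bump[of a b k] bounded_subset[OF bounded_cbox cl]
      by (auto simp: bump_in_def compact_eq_bounded_closed)
  qed
  ultimately show ?thesis using LIMSEQ_unique by (simp add: LIMSEQ_const_iff)
qed

text \<open>Open boxes form a generator of the Borel sets that is stable under intersection. The
  Borel sets over which the localised \<open>F\<close> has integral 0 form a Dynkin system
  containing them, hence are all Borel sets, and the density is 0 almost everywhere.\<close>

lemma AE_zero_on_box:
  fixes F :: "'e::euclidean_space \<Rightarrow> real"
  assumes F: "integrable lborel (\<lambda>y. indicator (cbox a b) y * F y)" and sub: "cbox a b \<subseteq> U"
    and zero: "\<And>\<psi>. bump_in U \<psi> \<Longrightarrow> (LINT y|lborel. F y * \<psi> y) = 0"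
  shows "AE y in lborel. y \<in> box a b \<longrightarrow> F y = 0"
proof -
  let ?G = "\<lambda>y. indicator (box a b) y * F y"
  have box: "box a b \<subseteq> cbox a b" by (rule box_subset_cbox)
  have G: "integrable lborel (\<lambda>y. indicator S y * F y)" if "S \<in> sets borel" "S \<subseteq> cbox a b" for S
  proof -
    have eq: "indicator S y * F y = indicator S y *\<^sub>R (indicator (cbox a b) y * F y)" for y
      using that by (auto simp: indicator_def)
    show ?thesis unfolding eq using F that by (intro integrable_mult_indicator) auto
  qed
  have iG: "integrable lborel ?G" by (rule G) (use box in auto)
  have ind: "indicator A y *\<^sub>R ?G y = indicator (A \<inter> box a b) y * F y" for A y
    by (auto simp: indicator_def)
  have "(LINT y:A|lborel. ?G y) = 0" if "A \<in> sets borel" for A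
  proof -
    have "Int_stable (range (\<lambda>(a, b). box a b :: 'e set))"
      by (auto simp: Int_stable_def box_Int_box)
    moreover have "range (\<lambda>(a, b). box a b :: 'e set) \<subseteq> Pow UNIV" by simp
    moreover have "A \<in> sigma_sets UNIV (range (\<lambda>(a, b). box a b :: 'e set))"
      using that by (simp add: borel_eq_box)
    ultimately show ?thesis
    proof (induction rule: sigma_sets_induct_disjoint)
      case (basic A)
      then obtain p q where A: "A = box p q" by auto
      obtain p' q' where pq: "box p q \<inter> box a b = box p' q'" by (auto simp: box_Int_box)
      have "(LINT y|lborel. indicator (box p' q') y * F y) = 0"
      proof (cases "box p' q' = {}")
        case False
        then have "cbox p' q' \<subseteq> cbox a b"
          using closure_mono[of "box p' q'" "box a b"] pq by (metis closure_box inf_le2 closure_empty empty_subsetI subset_trans box_subset_cbox closed_cbox closure_minimal)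
        then show ?thesis
          using sub by (intro integral_box_subset_zero[OF G _ zero]) auto
      qed simp
      then show ?case by (simp add: set_lebesgue_integral_def ind A pq del: real_scaleR_def)
    next
      case empty
      then show ?case by (simp add: set_lebesgue_integral_def)
    next
      case (compl A)
      then have A: "A \<in> sets borel" by (simp add: borel_eq_box)
      have "(LINT y:UNIV - A|lborel. ?G y) + (LINT y:A|lborel. ?G y) = (LINT y:(UNIV - A) \<union> A|lborel. ?G y)"
        using A iG integrable_mult_indicator[OF _ iG]
        by (intro set_integral_Un[symmetric]) (auto simp: set_integrable_def)
      also have "(UNIV - A) \<union> A = UNIV" by auto
      also have "(LINT y:UNIV|lborel. ?G y) = 0"
        using integral_box_subset_zero[OF F sub zero] by (simp add: set_lebesgue_integral_def)
      finally show ?case using compl by simp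
    next
      case (union A)
      then have A: "A i \<in> sets lborel" for i by (auto simp: borel_eq_box)
      have UA: "(\<Union>i. A i) \<in> sets lborel" using A by auto
      have "(LINT y:(\<Union>i. A i)|lborel. ?G y) = (\<Sum>i. LINT y:A i|lborel. ?G y)"
        using union(1) A integrable_mult_indicator[OF UA iG]
        by (intro lebesgue_integral_countable_add) (auto simp: disjoint_family_on_def set_integrable_def)
      then show ?case using union by simp
    qed
  qed
  then have "AE y in lborel. ?G y = 0"
    by (intro density_unique_real[OF iG integrable_zero]) (simp add: set_lebesgue_integral_def)
  then show ?thesis by (rule AE_mp) (auto intro!: AE_I2)
qed

text \<open>By the Lindelof property countably many boxes suffice to cover \<open>U\<close>, so the
  exceptional null sets of the single boxes can be united.\<close>

lemma fundamental_lemma: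
  fixes F :: "'e::euclidean_space \<Rightarrow> real"
  assumes U: "open U"
    and F: "\<And>a b. cbox a b \<subseteq> U \<Longrightarrow> integrable lborel (\<lambda>y. indicator (cbox a b) y * F y)"
    and zero: "\<And>\<psi>. bump_in U \<psi> \<Longrightarrow> (LINT y|lborel. F y * \<psi> y) = 0"
  shows "AE y in lborel. y \<in> U \<longrightarrow> F y = 0"
proof -
  define \<B> where "\<B> = {box a b | a b. cbox a b \<subseteq> U}"
  obtain \<B>' where \<B>': "\<B>' \<subseteq> \<B>" "countable \<B>'" "\<Union>\<B>' = \<Union>\<B>"
    by (rule Lindelof[of \<B>]) (auto simp: \<B>_def)
  have cover: "U \<subseteq> \<Union>\<B>"
  proof
    fix x assume "x \<in> U"
    then obtain a b where "cbox a b \<subseteq> U" "x \<in> box a b"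
      using open_contains_cbox[OF U] by metis
    then show "x \<in> \<Union>\<B>" by (auto simp: \<B>_def)
  qed
  have "AE y in lborel. \<forall>Q\<in>\<B>'. y \<in> Q \<longrightarrow> F y = 0"
  proof (subst AE_ball_countable[OF \<B>'(2)], intro ballI)
    fix Q assume "Q \<in> \<B>'"
    then obtain a b where "Q = box a b" "cbox a b \<subseteq> U" using \<B>'(1) by (auto simp: \<B>_def)
    then show "AE y in lborel. y \<in> Q \<longrightarrow> F y = 0" using AE_zero_on_box[OF F _ zero] by simp
  qed
  then show ?thesis by (rule AE_mp) (use cover \<B>'(3) in \<open>auto intro!: AE_I2\<close>)
qed

section \<open>Translation invariance and integration by parts in Euclidean space\<close>

lemma nn_integral_translate:
  fixes f :: "'e::euclidean_space \<Rightarrow> ennreal"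
  assumes [measurable]: "f \<in> borel_measurable borel"
  shows "(\<integral>\<^sup>+y. f (y + w) \<partial>lborel) = (\<integral>\<^sup>+y. f y \<partial>lborel)"
proof -
  have "(\<integral>\<^sup>+y. f y \<partial>distr lborel borel ((+) w)) = (\<integral>\<^sup>+y. f (w + y) \<partial>lborel)"
    by (rule nn_integral_distr) simp_all
  then show ?thesis by (simp add: lborel_distr_plus add.commute)
qed

lemma integral_translate:
  fixes f :: "'e::euclidean_space \<Rightarrow> real"
  assumes [measurable]: "f \<in> borel_measurable borel"
  shows "integrable lborel (\<lambda>y. f (y + w)) \<longleftrightarrow> integrable lborel f"
    and "(LINT y|lborel. f (y + w)) = (LINT y|lborel. f y)"
proof -
  have "integrable (distr lborel borel ((+) w)) f \<longleftrightarrow> integrable lborel (\<lambda>y. f (w + y))"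
    by (rule integrable_distr_eq) simp_all
  then show "integrable lborel (\<lambda>y. f (y + w)) \<longleftrightarrow> integrable lborel f"
    by (simp add: lborel_distr_plus add.commute)
  have "integral\<^sup>L (distr lborel borel ((+) w)) f = (LINT y|lborel. f (w + y))"
    by (rule integral_distr) simp_all
  then show "(LINT y|lborel. f (y + w)) = (LINT y|lborel. f y)"
    by (simp add: lborel_distr_plus add.commute)
qed

text \<open>Translation invariance makes the integral of a difference quotient vanish.\<close>

lemma integral_derivative_zero:
  fixes P :: "'e::euclidean_space \<Rightarrow> real"
  assumes der: "\<And>y. (P has_derivative P' y) (at y)"
    and cont: "continuous_on UNIV (\<lambda>y. P' y v)"
    and Y: "compact Y" "\<And>y. y \<notin> Y \<Longrightarrow> P y = 0"
  shows "(LINT y|lborel. P' y v) = 0"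
proof -
  have contP: "continuous_on UNIV P"
    using has_derivative_continuous[OF der] by (intro continuous_at_imp_continuous_on) blast
  then have mP [measurable]: "P \<in> borel_measurable borel" by (rule borel_measurable_continuous_onI)
  have m' [measurable]: "(\<lambda>y. P' y v) \<in> borel_measurable borel" using cont by (rule borel_measurable_continuous_onI)
  have iP: "integrable lborel P"
  proof -
    have "integrable lborel (\<lambda>y. indicator Y y *\<^sub>R P y)"
      using continuous_on_subset[OF contP] by (intro borel_integrable_compact Y(1)) auto
    moreover have "indicator Y y *\<^sub>R P y = P y" for y using Y(2)[of y] by (cases "y \<in> Y") auto
    ultimately show ?thesis by (simp only:)
  qed
  have off: "P' y v = 0" if "y \<notin> Y" for y
  proof -
    have o: "open (- Y)" using compact_imp_closed[OF Y(1)] by auto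
    have "(P has_derivative (\<lambda>v. 0)) (at y)"
      by (rule has_derivative_transform_within_open[OF has_derivative_const o]) (use that Y(2) in auto)
    then show ?thesis using has_derivative_unique[OF der] by metis
  qed
  obtain L where L: "0 \<le> L" "\<And>y. \<bar>P' y v\<bar> \<le> L"
  proof -
    have "bounded ((\<lambda>y. P' y v) ` Y)"
      using continuous_on_subset[OF cont] Y(1) by (intro compact_imp_bounded compact_continuous_image) auto
    then obtain L where L: "\<And>y. y \<in> Y \<Longrightarrow> \<bar>P' y v\<bar> \<le> L" by (auto simp: bounded_iff)
    show ?thesis
    proof (rule that[of "\<bar>L\<bar>"])
      show "\<bar>P' y v\<bar> \<le> \<bar>L\<bar>" for y using L[of y] off[of y] by (cases "y \<in> Y") auto
    qed simp
  qed
  have line: "((\<lambda>t. P (y + t *\<^sub>R v)) has_real_derivative P' (y + t *\<^sub>R v) v) (at t)" for y t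
  proof -
    have "((\<lambda>t. y + t *\<^sub>R v) has_derivative (\<lambda>s. s *\<^sub>R v)) (at t)"
      by (auto intro!: derivative_eq_intros)
    from diff_chain_at[OF this der]
    have "((\<lambda>t. P (y + t *\<^sub>R v)) has_derivative (\<lambda>s. P' (y + t *\<^sub>R v) (s *\<^sub>R v))) (at t)"
      by (simp add: o_def)
    moreover have "P' (y + t *\<^sub>R v) (s *\<^sub>R v) = P' (y + t *\<^sub>R v) v * s" for s
      using linear_scale[OF has_derivative_linear[OF der]] by simp
    ultimately show ?thesis by (simp add: has_field_derivative_def)
  qed
  let ?s = "\<lambda>n. inverse (real (Suc n))"
  let ?Q = "\<lambda>n y. (P (y + ?s n *\<^sub>R v) - P y) / ?s n"
  \<comment> \<open>The step sizes lie in {0..1}, so this compact set contains the supports of all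
    difference quotients and carries the dominating function.\<close>
  define Z where "Z = (\<lambda>(y, t). y - t *\<^sub>R v) ` (Y \<times> {0..1::real})"
  have Z: "compact Z"
    unfolding Z_def case_prod_unfold
    by (intro compact_continuous_image compact_Times Y(1) compact_Icc continuous_intros)
  \<comment> \<open>By the mean value theorem a difference quotient is a directional derivative at
    an intermediate point, so it obeys the same bound.\<close>
  have Qb: "\<bar>?Q n y\<bar> \<le> L" for n y
  proof -
    have "0 < ?s n" by simp
    then obtain z where "P (y + ?s n *\<^sub>R v) - P (y + 0 *\<^sub>R v) = (?s n - 0) * P' (y + z *\<^sub>R v) v"
      using MVT2[of 0 "?s n" "\<lambda>t. P (y + t *\<^sub>R v)" "\<lambda>t. P' (y + t *\<^sub>R v) v"] line by blast
    then have "?Q n y = P' (y + z *\<^sub>R v) v" by simp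
    then show ?thesis using L(2) by simp
  qed
  have Q0: "?Q n y = 0" if "y \<notin> Z" for n y
  proof -
    have "y \<notin> Y" using that by (force simp: Z_def)
    moreover have "y + ?s n *\<^sub>R v \<notin> Y"
    proof
      assume "y + ?s n *\<^sub>R v \<in> Y"
      moreover have "?s n \<in> {0..1}" by (simp add: field_simps)
      ultimately have "(y + ?s n *\<^sub>R v) - ?s n *\<^sub>R v \<in> Z"
        unfolding Z_def by (intro image_eqI[of _ _ "(y + ?s n *\<^sub>R v, ?s n)"]) auto
      then show False using that by simp
    qed
    ultimately show ?thesis using Y(2) by simp
  qed
  have "(\<lambda>n. LINT y|lborel. ?Q n y) \<longlonglongrightarrow> (LINT y|lborel. P' y v)"
  proof (rule integral_dominated_convergence[where w = "\<lambda>y. indicator Z y *\<^sub>R L"])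
    show "integrable lborel (\<lambda>y. indicator Z y *\<^sub>R L)"
      by (intro borel_integrable_compact Z continuous_intros)
    show "AE y in lborel. (\<lambda>n. ?Q n y) \<longlonglongrightarrow> P' y v"
    proof (rule AE_I2)
      fix y
      have "((\<lambda>t. (P (y + (0 + t) *\<^sub>R v) - P (y + 0 *\<^sub>R v)) / t) \<longlongrightarrow> P' y v) (at 0)"
        using line[of y 0] by (simp add: DERIV_def)
      then have *: "((\<lambda>t. (P (y + t *\<^sub>R v) - P y) / t) \<longlongrightarrow> P' y v) (at 0)" by simp
      have "filterlim ?s (at 0) sequentially"
        unfolding filterlim_at using LIMSEQ_inverse_real_of_nat by (auto intro: always_eventually)
      from filterlim_compose[OF * this] show "(\<lambda>n. ?Q n y) \<longlonglongrightarrow> P' y v" .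
    qed
    show "AE y in lborel. norm (?Q n y) \<le> indicator Z y *\<^sub>R L" for n
    proof (rule AE_I2)
      fix y show "norm (?Q n y) \<le> indicator Z y *\<^sub>R L"
        using Qb[where n = n and y = y] Q0[where n = n and y = y] by (cases "y \<in> Z") (simp_all only: indicator_simps real_norm_def scaleR_one, simp_all)
    qed
  qed simp_all
  moreover have "(LINT y|lborel. ?Q n y) = 0" for n
  proof -
    have i: "integrable lborel (\<lambda>y. P (y + ?s n *\<^sub>R v))"
      using iP by (subst integral_translate(1)) auto
    have "(LINT y|lborel. ?Q n y) = ((LINT y|lborel. P (y + ?s n *\<^sub>R v)) - (LINT y|lborel. P y)) / ?s n"
      by (simp only: integral_divide_zero Bochner_Integration.integral_diff[OF i iP])
    then show ?thesis by (simp only: integral_translate(2)[OF mP] diff_self div_0)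
  qed
  ultimately show ?thesis by (simp add: LIMSEQ_const_iff)
qed

lemma bump_inE:
  assumes "bump_in U (\<psi> :: 'e::euclidean_space \<Rightarrow> real)"
  obtains Y where "compact Y" "Y \<subseteq> U" "\<And>y. y \<notin> Y \<Longrightarrow> \<psi> y = 0" "\<And>y v. y \<notin> Y \<Longrightarrow> dirderiv v \<psi> y = 0"
    "continuous_on UNIV \<psi>" "\<And>b. b \<in> Basis \<Longrightarrow> continuous_on UNIV (dirderiv b \<psi>)"
    "\<And>y. (\<psi> has_derivative frechet_derivative \<psi> (at y)) (at y)"
proof (rule that[of "closure {y. \<psi> y \<noteq> 0}"])
  let ?Y = "closure {y. \<psi> y \<noteq> 0}"
  have sm: "smooth_on \<psi> UNIV" using assms by (simp add: bump_in_def)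
  show "compact ?Y" "?Y \<subseteq> U" using assms by (auto simp: bump_in_def)
  show z: "\<psi> y = 0" if "y \<notin> ?Y" for y using that closure_subset[of "{y. \<psi> y \<noteq> 0}"] by auto
  show "dirderiv v \<psi> y = 0" if "y \<notin> ?Y" for y v
  proof -
    have "frechet_derivative \<psi> (at y) = frechet_derivative (\<lambda>y. 0) (at y)"
    proof (rule frechet_derivative_cong_open[of "- ?Y"])
      show "\<psi> y = 0" if "y \<in> - ?Y" for y using z that by blast
    qed (use that in \<open>simp_all add: open_Compl\<close>)
    then show ?thesis by (simp add: frechet_derivative_eq[OF has_derivative_const])
  qed
  show "continuous_on UNIV \<psi>" using sm by (rule smooth_on_continuous)
  show "continuous_on UNIV (dirderiv b \<psi>)" if "b \<in> Basis" for b
    using smooth_on_dirderiv[OF sm that] by (rule smooth_on_continuous)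
  show "(\<psi> has_derivative frechet_derivative \<psi> (at y)) (at y)" for y
    using smooth_on_has_derivative[OF sm] by simp
qed

lemma integrable_compact_support:
  fixes \<eta> :: "'e::euclidean_space \<Rightarrow> real"
  assumes "continuous_on UNIV \<eta>" "compact Y" "\<And>y. y \<notin> Y \<Longrightarrow> \<eta> y = 0"
  shows "integrable lborel \<eta>"
proof -
  have "integrable lborel (\<lambda>y. indicator Y y *\<^sub>R \<eta> y)"
    using continuous_on_subset[OF assms(1)] by (intro borel_integrable_compact assms(2)) auto
  moreover have "indicator Y y *\<^sub>R \<eta> y = \<eta> y" for y
    using assms(3)[of y] by (cases "y \<in> Y") auto
  ultimately show ?thesis by (simp only:)
qed

lemma matrix_inv_mult:
  fixes A :: "real ^ 'n::finite ^ 'n"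
  assumes "det A \<noteq> 0"
  shows "matrix_inv A *v (A *v x) = x" "A *v (matrix_inv A *v x) = x"
proof -
  have "\<exists>B. A ** B = mat 1 \<and> B ** A = mat 1"
    using assms invertible_det_nz[of A] by (simp add: invertible_def)
  then have "A ** matrix_inv A = mat 1 \<and> matrix_inv A ** A = mat 1"
    unfolding matrix_inv_def by (rule someI_ex)
  then show "matrix_inv A *v (A *v x) = x" "A *v (matrix_inv A *v x) = x"
    by (simp_all add: matrix_vector_mul_assoc)
qed

text \<open>Cramer's rule writes the components as quotients of determinants, which are visibly
  continuous.\<close>

lemma continuous_on_matrix_inv_mult:
  fixes A :: "'a::topological_space \<Rightarrow> real ^ 'n::finite ^ 'n"
  assumes "continuous_on S A" "continuous_on S v" "\<And>x. x \<in> S \<Longrightarrow> det (A x) \<noteq> 0"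
  shows "continuous_on S (\<lambda>x. matrix_inv (A x) *v v x)"
proof -
  have eq: "matrix_inv (A x) *v v x = (\<chi> k. det (\<chi> i j. if j = k then v x $ i else A x $ i $ j) / det (A x))"
    if "x \<in> S" for x
    by (rule cramer[OF assms(3)[OF that], THEN iffD1, OF matrix_inv_mult(2)[OF assms(3)[OF that]]])
  have "continuous_on S (\<lambda>x. \<chi> k. det (\<chi> i j. if j = k then v x $ i else A x $ i $ j) / det (A x))"
  proof (intro continuous_on_vec_lambda continuous_on_divide continuous_on_det assms(1))
    fix k i j
    show "continuous_on S (\<lambda>x. if j = k then v x $ i else A x $ i $ j)"
      using assms(1,2) by (cases "j = k") (auto intro!: continuous_intros)
  qed (use assms(3) in auto)
  then show ?thesis by (rule continuous_on_eq) (simp only: eq)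
qed

section \<open>Weak gradients\<close>

context closed_manifold
begin

text \<open>Separates the integral identity in \<open>weak_gradient\<close> from measurability and
  integrability. The identity restricts to smaller domains and survives limits, while integrability
  is recorded globally in \<open>L2_field\<close>.\<close>

definition dist_grad :: "'a set \<Rightarrow> ('a \<Rightarrow> real) \<Rightarrow> ('a \<Rightarrow> ('a, 'n) tvec) \<Rightarrow> bool" where
  "dist_grad \<Omega> u X \<longleftrightarrow> (\<forall>c\<in>charts M. \<forall>\<psi> i. bump_in (cmap c ` (cdom c \<inter> \<Omega>)) \<psi> \<longrightarrow>
     (LINT y|lborel. u (cinv c y) * dirderiv (axis i 1) \<psi> y) =
     - (LINT y|lborel. (gmat M c (cinv c y) *v X (cinv c y) c) $ i * \<psi> y))"

definition vext :: "'a set \<Rightarrow> ('a \<Rightarrow> ('a, 'n) tvec) \<Rightarrow> 'a \<Rightarrow> ('a, 'n) tvec" where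
  "vext \<Omega> X x = (if x \<in> \<Omega> then X x else (\<lambda>c. 0))"

lemma vext_UNIV [simp]: "vext UNIV X = X"
  by (simp add: vext_def fun_eq_iff)

lemma zero_ext_UNIV [simp]: "zero_ext UNIV u = u"
  by (simp add: zero_ext_def)

lemma cmap_image_cinv_in: "c \<in> charts M \<Longrightarrow> y \<in> cmap c ` (cdom c \<inter> \<Omega>) \<Longrightarrow> cinv c y \<in> \<Omega>"
  using cinv_cmap by auto

lemma dist_grad_cong:
  assumes "\<And>x. x \<in> \<Omega> \<Longrightarrow> u x = u' x" "\<And>x. x \<in> \<Omega> \<Longrightarrow> X x = X' x"
  shows "dist_grad \<Omega> u X \<longleftrightarrow> dist_grad \<Omega> u' X'"
proof -
  have eq: "u (cinv c y) * dirderiv (axis i 1) \<psi> y = u' (cinv c y) * dirderiv (axis i 1) \<psi> y \<and>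
      (gmat M c (cinv c y) *v X (cinv c y) c) $ i * \<psi> y = (gmat M c (cinv c y) *v X' (cinv c y) c) $ i * \<psi> y"
    if c: "c \<in> charts M" and \<psi>: "bump_in (cmap c ` (cdom c \<inter> \<Omega>)) \<psi>" for c \<psi> i y
  proof -
    obtain Y where Y: "compact Y" "Y \<subseteq> cmap c ` (cdom c \<inter> \<Omega>)" "\<And>y. y \<notin> Y \<Longrightarrow> \<psi> y = 0"
      "\<And>y v. y \<notin> Y \<Longrightarrow> dirderiv v \<psi> y = 0"
      by (rule bump_inE[OF \<psi>]) blast
    show ?thesis
    proof (cases "y \<in> Y")
      case True
      then have "cinv c y \<in> \<Omega>" using Y(2) cmap_image_cinv_in[OF c, of y \<Omega>] by blast
      then show ?thesis using assms by simp
    qed (simp add: Y)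
  qed
  show ?thesis
    unfolding dist_grad_def
  proof (intro ball_cong refl all_cong1 imp_cong)
    fix c \<psi> i assume c: "c \<in> charts M" and \<psi>: "bump_in (cmap c ` (cdom c \<inter> \<Omega>)) \<psi>"
    have "(\<lambda>y. u (cinv c y) * dirderiv (axis i 1) \<psi> y) = (\<lambda>y. u' (cinv c y) * dirderiv (axis i 1) \<psi> y)"
      "(\<lambda>y. (gmat M c (cinv c y) *v X (cinv c y) c) $ i * \<psi> y) = (\<lambda>y. (gmat M c (cinv c y) *v X' (cinv c y) c) $ i * \<psi> y)"
      using eq[OF c \<psi>] by blast+
    then show "((LINT y|lborel. u (cinv c y) * dirderiv (axis i 1) \<psi> y) =
        - (LINT y|lborel. (gmat M c (cinv c y) *v X (cinv c y) c) $ i * \<psi> y)) =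
      ((LINT y|lborel. u' (cinv c y) * dirderiv (axis i 1) \<psi> y) =
        - (LINT y|lborel. (gmat M c (cinv c y) *v X' (cinv c y) c) $ i * \<psi> y))"
      by (simp only:)
  qed
qed

lemma dist_grad_mono: "dist_grad \<Omega> u X \<Longrightarrow> \<Omega>' \<subseteq> \<Omega> \<Longrightarrow> dist_grad \<Omega>' u X"
  unfolding dist_grad_def bump_in_def by (meson Int_mono image_mono order_refl subset_trans)

lemma L2_iff: "u \<in> L2 M \<Omega> \<longleftrightarrow> L2_fun (zero_ext \<Omega> u)"
proof -
  have "(\<lambda>x. indicator \<Omega> x *\<^sub>R u x) = zero_ext \<Omega> u"
    "(\<lambda>x. indicator \<Omega> x *\<^sub>R (u x)\<^sup>2) = (\<lambda>x. (zero_ext \<Omega> u x)\<^sup>2)"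
    by (auto simp: zero_ext_def)
  then show ?thesis
    by (simp add: L2_def L2_fun_def set_borel_measurable_def set_integrable_def del: real_scaleR_def)
qed

lemma tnorm_vext: "indicator \<Omega> x *\<^sub>R (tnorm M x (X x))\<^sup>2 = tinner M x (vext \<Omega> X x) (vext \<Omega> X x)"
  by (simp add: vext_def tnorm_sq)

text \<open>All pointwise and integral conditions pass to extensions by 0, but the distributional
  identity is still tested only inside \<open>\<Omega>\<close>: across the boundary the extended
  function may jump. \<open>H10_extension\<close> removes this restriction for functions of
  \<open>H10\<close>.\<close>

lemma weak_gradient_iff:
  "weak_gradient M \<Omega> u X \<longleftrightarrow> L2_field (vext \<Omega> X) \<and> dist_grad \<Omega> (zero_ext \<Omega> u) (vext \<Omega> X)"
proof -
  have 1: "(\<forall>x\<in>\<Omega>. tangent_vector M x (X x)) \<longleftrightarrow> (\<forall>x. tangent_vector M x (vext \<Omega> X x))"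
    unfolding vext_def by (metis tangent_vector_zero)
  have 2: "set_borel_measurable V (cdom c \<inter> \<Omega>) (\<lambda>x. X x c)
    \<longleftrightarrow> (\<lambda>x. indicator (cdom c) x *\<^sub>R vext \<Omega> X x c) \<in> borel_measurable borel" for c
  proof -
    have "(\<lambda>x. indicator (cdom c \<inter> \<Omega>) x *\<^sub>R X x c) = (\<lambda>x. indicator (cdom c) x *\<^sub>R vext \<Omega> X x c)"
      by (auto simp: vext_def indicator_def)
    then show ?thesis by (simp add: set_borel_measurable_def)
  qed
  have 3: "set_integrable V \<Omega> (\<lambda>x. (tnorm M x (X x))\<^sup>2)
    \<longleftrightarrow> integrable V (\<lambda>x. tinner M x (vext \<Omega> X x) (vext \<Omega> X x))"
    unfolding set_integrable_def tnorm_vext ..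
  have 4: "dist_grad \<Omega> (zero_ext \<Omega> u) (vext \<Omega> X) \<longleftrightarrow> dist_grad \<Omega> u X"
    by (rule dist_grad_cong) (simp_all add: zero_ext_def vext_def)
  show ?thesis
    unfolding 4 unfolding weak_gradient_def L2_field_def 1 2 3 dist_grad_def bump_in_def
    by (simp only: conj_assoc)
qed

subsection \<open>Uniqueness\<close>

lemma cinv_image_borel:
  assumes c: "c \<in> charts M" and N: "N \<in> sets borel"
  shows "cinv c ` (N \<inter> cimg c) \<in> sets borel"
proof -
  have "cinv c ` (N \<inter> cimg c) = cdom c \<inter> cmap c -` (N \<inter> cimg c)"
    by (rule cinv_image_eq[OF c]) simp
  also have "\<dots> = cdom c \<inter> cmap c -` N" by auto
  also have "cdom c \<inter> cmap c -` N \<in> sets (restrict_space borel (cdom c))"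
    using measurable_sets[OF borel_measurable_continuous_on_restrict[OF continuous_cmap[OF c]] N]
    by (simp add: space_restrict_space Int_commute)
  finally show ?thesis
    using open_cdom[OF c] by (auto simp: sets_restrict_space)
qed

text \<open>The volume has a density with respect to Lebesgue measure in the chart, so the image of
  a Lebesgue null set is a null set of the manifold.\<close>

lemma AE_chart:
  assumes c: "c \<in> charts M" and AE: "AE y in lborel. y \<in> cimg c \<longrightarrow> P (cinv c y)"
  shows "AE x in V. x \<in> cdom c \<longrightarrow> P x"
proof -
  obtain N where N: "{y \<in> space lborel. \<not> (y \<in> cimg c \<longrightarrow> P (cinv c y))} \<subseteq> N" "N \<in> null_sets lborel"
    using AE by (auto elim: AE_E simp: null_sets_def)
  let ?N = "cinv c ` (N \<inter> cimg c)"
  have Nb: "?N \<in> sets borel" using N(2) by (intro cinv_image_borel c) auto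
  have sub: "?N \<subseteq> cdom c" using cinv_in[OF c] by blast
  have img: "cmap c ` ?N = N \<inter> cimg c" using cmap_cinv[OF c] by (force simp: image_image)
  have "emeasure V ?N = emeasure (chart_volume c) ?N"
    by (rule riemannian_volume_characterization(2)[OF c Nb sub])
  also have "\<dots> = (\<integral>\<^sup>+y. ennreal (indicator (N \<inter> cimg c) y * vdens c y) \<partial>lborel)"
    using emeasure_chart_volume[OF c Nb] sub img by (simp add: Int_absorb2)
  also have "\<dots> = (\<integral>\<^sup>+(y :: real ^ 'n). 0 \<partial>lborel)"
  proof (rule nn_integral_cong_AE)
    show "AE y in lborel. ennreal (indicator (N \<inter> cimg c) y * vdens c y) = 0"
      using AE_not_in[OF N(2)] by (rule AE_mp) (auto intro!: AE_I2)
  qed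
  finally have "?N \<in> null_sets V" using Nb by (auto simp: null_sets_def)
  from AE_not_in[OF this] show ?thesis
  proof (rule AE_mp, intro AE_I2 impI)
    fix x assume x: "x \<notin> ?N" "x \<in> cdom c"
    show "P x"
    proof (rule ccontr)
      assume "\<not> P x"
      then have "cmap c x \<in> N \<inter> cimg c" using N(1) x cinv_cmap[OF c x(2)] by auto
      then show False using x cinv_cmap[OF c x(2)] by (metis image_eqI)
    qed
  qed
qed

lemma AE_chartsI:
  assumes "\<And>c. c \<in> charts M \<Longrightarrow> AE x in V. x \<in> cdom c \<longrightarrow> P x"
  shows "AE x in V. P x"
proof -
  obtain cs :: "nat \<Rightarrow> ('a, 'n) chart" and m where
    cs: "\<And>i. i < m \<Longrightarrow> cs i \<in> charts M" "(\<Union>i<m. cdom (cs i)) = UNIV"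
    by (rule finite_chart_cover) blast
  have "AE x in V. \<forall>i\<in>{..<m}. x \<in> cdom (cs i) \<longrightarrow> P x"
    by (rule AE_finite_allI) (use cs(1) assms in auto)
  then show ?thesis
  proof (rule AE_mp, intro AE_I2 impI)
    fix x assume *: "\<forall>i\<in>{..<m}. x \<in> cdom (cs i) \<longrightarrow> P x"
    have "x \<in> (\<Union>i<m. cdom (cs i))" using cs(2) by simp
    then show "P x" using * by blast
  qed
qed

lemma bump_pairing:
  assumes c: "c \<in> charts M" and \<psi>: "bump_in (cimg c) \<psi>"
  shows "\<exists>C. pairing c \<psi> C" "\<exists>C. pairing c (dirderiv (axis i 1) \<psi>) C"
proof -
  obtain Y where Y: "compact Y" "Y \<subseteq> cimg c" "\<And>y. y \<notin> Y \<Longrightarrow> \<psi> y = 0"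
    "\<And>y v. y \<notin> Y \<Longrightarrow> dirderiv v \<psi> y = 0" "continuous_on UNIV \<psi>"
    "\<And>b. b \<in> Basis \<Longrightarrow> continuous_on UNIV (dirderiv b \<psi>)"
    by (rule bump_inE[OF \<psi>]) blast
  have p: "\<exists>C. pairing c \<eta> C" if "continuous_on UNIV \<eta>" "\<And>y. y \<notin> Y \<Longrightarrow> \<eta> y = 0" for \<eta>
    using that by (intro pairing_bound[OF c Y(1,2)] integrable_compact_support[OF _ Y(1)]
        borel_measurable_continuous_onI continuous_intros) auto
  show "\<exists>C. pairing c \<psi> C" by (rule p[OF Y(5,3)])
  show "\<exists>C. pairing c (dirderiv (axis i 1) \<psi>) C" by (rule p[OF Y(6) Y(4)]) simp_all
qed

lemma bump_in_cimg: "bump_in (cmap c ` (cdom c \<inter> \<Omega>)) \<psi> \<Longrightarrow> bump_in (cimg c) \<psi>"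
  unfolding bump_in_def by (meson Int_lower1 image_mono subset_trans)

text \<open>In every chart the fundamental lemma identifies the lowered components of the two
  fields. The metric matrix is invertible, and a tangent vector is determined by its components in
  one chart.\<close>

lemma dist_grad_unique:
  assumes \<Omega>: "open \<Omega>" and X: "L2_field X" "dist_grad \<Omega> u X" and X': "L2_field X'" "dist_grad \<Omega> u X'"
  shows "AE x in V. x \<in> \<Omega> \<longrightarrow> X x = X' x"
proof (rule AE_chartsI, rule AE_chart)
  fix c assume c: "c \<in> charts M"
  let ?U = "cmap c ` (cdom c \<inter> \<Omega>)"
  have U: "open ?U" using open_cmap_image[OF c \<Omega>] .
  let ?F = "\<lambda>Z i y. (gmat M c (cinv c y) *v Z (cinv c y) c) $ i"
  have "AE y in lborel. y \<in> ?U \<longrightarrow> ?F X i y - ?F X' i y = 0" for i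
  proof (rule fundamental_lemma[OF U])
    fix a b :: "real ^ 'n" assume ab: "cbox a b \<subseteq> ?U"
    then have sub: "cbox a b \<subseteq> cimg c" by auto
    have sq: "integrable lborel (\<lambda>y. (indicator (cbox a b) y :: real)\<^sup>2)"
      using integrable_real_indicator[of "cbox a b" lborel] emeasure_lborel_cbox_finite[of a b]
      by (simp add: power2_eq_square indicator_inter_arith[symmetric])
    have "\<exists>C. pairing c (indicator (cbox a b)) C"
      by (rule pairing_bound[OF c compact_cbox sub _ sq]) auto
    then obtain C where "pairing c (indicator (cbox a b)) C" ..
    note C = pairing_field(1)[OF this]
    show "integrable lborel (\<lambda>y. indicator (cbox a b) y * (?F X i y - ?F X' i y))"
      using Bochner_Integration.integrable_diff[OF C[OF X(1), of i] C[OF X'(1), of i]]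
      by (simp add: algebra_simps)
  next
    fix \<psi> :: "real ^ 'n \<Rightarrow> real" assume \<psi>: "bump_in ?U \<psi>"
    obtain C where "pairing c \<psi> C" using bump_pairing(1)[OF c bump_in_cimg[OF \<psi>]] ..
    note C = pairing_field(1)[OF this]
    have "(LINT y|lborel. ?F X i y * \<psi> y) = (LINT y|lborel. ?F X' i y * \<psi> y)"
      using X(2)[unfolded dist_grad_def, rule_format, OF c \<psi>, of i]
        X'(2)[unfolded dist_grad_def, rule_format, OF c \<psi>, of i] by simp
    then show "(LINT y|lborel. (?F X i y - ?F X' i y) * \<psi> y) = 0"
      using C[OF X(1)] C[OF X'(1)] by (simp add: left_diff_distrib)
  qed
  then have "AE y in lborel. \<forall>i\<in>UNIV. y \<in> ?U \<longrightarrow> ?F X i y - ?F X' i y = 0"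
    by (intro AE_finite_allI) auto
  then show "AE y in lborel. y \<in> cimg c \<longrightarrow> cinv c y \<in> \<Omega> \<longrightarrow> X (cinv c y) = X' (cinv c y)"
  proof (rule AE_mp, intro AE_I2 impI)
    fix y assume eq: "\<forall>i\<in>UNIV. y \<in> ?U \<longrightarrow> ?F X i y - ?F X' i y = 0" and y: "y \<in> cimg c" "cinv c y \<in> \<Omega>"
    have p: "cinv c y \<in> cdom c" using cinv_in[OF c y(1)] .
    have "y \<in> ?U" using y p cmap_cinv[OF c y(1)] by (metis IntI image_eqI)
    then have "gmat M c (cinv c y) *v X (cinv c y) c = gmat M c (cinv c y) *v X' (cinv c y) c"
      using eq by (simp add: vec_eq_iff)
    then have "X (cinv c y) c = X' (cinv c y) c"
      using matrix_inv_mult(1)[of "gmat M c (cinv c y)"] det_gmat_pos[OF c p] by (metis less_irrefl)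
    then show "X (cinv c y) = X' (cinv c y)"
      using X(1) X'(1) c p by (intro tangent_vector_eqI) (auto simp: L2_field_def)
  qed
qed

section \<open>Linearity and closedness of the distributional gradient\<close>

lemma dist_grad_lin:
  assumes u: "L2_fun u" "L2_field X" "dist_grad \<Omega> u X" and v: "L2_fun v" "L2_field Y" "dist_grad \<Omega> v Y"
  shows "dist_grad \<Omega> (\<lambda>x. a * u x + b * v x) (\<lambda>x c. a *\<^sub>R X x c + b *\<^sub>R Y x c)"
  unfolding dist_grad_def
proof (intro ballI allI impI)
  fix c \<psi> i assume c: "c \<in> charts M" and \<psi>: "bump_in (cmap c ` (cdom c \<inter> \<Omega>)) \<psi>"
  let ?F = "\<lambda>Z y. (gmat M c (cinv c y) *v Z (cinv c y) c) $ i * \<psi> y"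
  let ?G = "\<lambda>w y. w (cinv c y) * dirderiv (axis i 1) \<psi> y"
  obtain C1 where "pairing c (dirderiv (axis i 1) \<psi>) C1" using bump_pairing(2)[OF c bump_in_cimg[OF \<psi>]] ..
  note C1 = pairing_fun(1)[OF this]
  obtain C2 where "pairing c \<psi> C2" using bump_pairing(1)[OF c bump_in_cimg[OF \<psi>]] ..
  note C2 = pairing_field(1)[OF this, where i = i]
  have eq: "(LINT y|lborel. ?G u y) = - (LINT y|lborel. ?F X y)" "(LINT y|lborel. ?G v y) = - (LINT y|lborel. ?F Y y)"
    by (rule u(3)[unfolded dist_grad_def, rule_format, OF c \<psi>]
        v(3)[unfolded dist_grad_def, rule_format, OF c \<psi>])+
  have "(LINT y|lborel. ?G (\<lambda>x. a * u x + b * v x) y) = (LINT y|lborel. a * ?G u y + b * ?G v y)"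
    by (rule Bochner_Integration.integral_cong) (simp_all add: algebra_simps)
  also have "\<dots> = a * (LINT y|lborel. ?G u y) + b * (LINT y|lborel. ?G v y)"
    using C1[OF u(1)] C1[OF v(1)] by simp
  also have "\<dots> = - (a * (LINT y|lborel. ?F X y) + b * (LINT y|lborel. ?F Y y))" by (simp add: eq)
  also have "\<dots> = - (LINT y|lborel. a * ?F X y + b * ?F Y y)"
    using C2[OF u(2)] C2[OF v(2)] by simp
  also have "\<dots> = - (LINT y|lborel. ?F (\<lambda>x c. a *\<^sub>R X x c + b *\<^sub>R Y x c) y)"
    by (intro arg_cong[of _ _ uminus] Bochner_Integration.integral_cong)
      (simp_all add: algebra_simps matrix_vector_mult_scaleR)
  finally show "(LINT y|lborel. ?G (\<lambda>x. a * u x + b * v x) y) = - (LINT y|lborel. ?F (\<lambda>x c. a *\<^sub>R X x c + b *\<^sub>R Y x c) y)" .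
qed

text \<open>By \<open>pairing\<close> both sides of the identity depend continuously on the function
  and on the field in L^2, so it survives simultaneous convergence of the two.\<close>

lemma dist_grad_limit:
  assumes k: "\<And>k::nat. L2_fun (w k)" "\<And>k. L2_field (Z k)" "\<And>k. dist_grad \<Omega> (w k) (Z k)"
    and u: "L2_fun u" "L2_field X"
    and lim: "(\<lambda>k. LINT x|V. (u x - w k x)\<^sup>2) \<longlonglongrightarrow> 0"
      "(\<lambda>k. ip (\<lambda>x c. X x c - Z k x c) (\<lambda>x c. X x c - Z k x c)) \<longlonglongrightarrow> 0"
  shows "dist_grad \<Omega> u X"
  unfolding dist_grad_def
proof (intro ballI allI impI)
  fix c \<psi> i assume c: "c \<in> charts M" and \<psi>: "bump_in (cmap c ` (cdom c \<inter> \<Omega>)) \<psi>"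
  let ?F = "\<lambda>Z y. (gmat M c (cinv c y) *v Z (cinv c y) c) $ i * \<psi> y"
  let ?G = "\<lambda>w y. w (cinv c y) * dirderiv (axis i 1) \<psi> y"
  obtain C1 where "pairing c (dirderiv (axis i 1) \<psi>) C1" using bump_pairing(2)[OF c bump_in_cimg[OF \<psi>]] ..
  note C1 = pairing_fun[OF this]
  obtain C2 where "pairing c \<psi> C2" using bump_pairing(1)[OF c bump_in_cimg[OF \<psi>]] ..
  note C2 = pairing_field[OF this, where i = i]
  have sq0: "f \<longlonglongrightarrow> 0" if "\<And>k. (f k)\<^sup>2 \<le> C * g k" "g \<longlonglongrightarrow> 0" for f g :: "nat \<Rightarrow> real" and C
  proof -
    have "(\<lambda>k. C * g k) \<longlonglongrightarrow> 0" using tendsto_mult_left[OF that(2), of C] by simp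
    then have "(\<lambda>k. (f k)\<^sup>2) \<longlonglongrightarrow> 0"
      by (rule tendsto_sandwich[OF _ _ tendsto_const, rotated -1]) (use that in auto)
    from tendsto_real_sqrt[OF this] show ?thesis by (simp add: tendsto_rabs_zero_iff)
  qed
  have Lw: "L2_fun (\<lambda>x. u x - w k x)" for k using L2_fun_lin[OF u(1) k(1), of 1 "-1"] by simp
  have LZ: "L2_field (\<lambda>x c. X x c - Z k x c)" for k using L2_field_lin[OF u(2) k(2), of 1 "-1"] by simp
  have "(\<lambda>k. LINT y|lborel. ?G (\<lambda>x. u x - w k x) y) \<longlonglongrightarrow> 0"
    by (rule sq0[OF C1(2)[OF Lw] lim(1)])
  moreover have "(LINT y|lborel. ?G (\<lambda>x. u x - w k x) y) = (LINT y|lborel. ?G u y) - (LINT y|lborel. ?G (w k) y)" for k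
    using C1(1)[OF u(1)] C1(1)[OF k(1)] by (simp add: left_diff_distrib)
  ultimately have 1: "(\<lambda>k. (LINT y|lborel. ?G u y) - (LINT y|lborel. ?G (w k) y)) \<longlonglongrightarrow> 0" by simp
  have "(\<lambda>k. LINT y|lborel. ?F (\<lambda>x c. X x c - Z k x c) y) \<longlonglongrightarrow> 0"
    by (rule sq0[OF C2(2)[OF LZ] lim(2)])
  moreover have "(LINT y|lborel. ?F (\<lambda>x c. X x c - Z k x c) y) = (LINT y|lborel. ?F X y) - (LINT y|lborel. ?F (Z k) y)" for k
    using C2(1)[OF u(2)] C2(1)[OF k(2)] by (simp add: left_diff_distrib matrix_vector_mult_diff_distrib)
  ultimately have 2: "(\<lambda>k. (LINT y|lborel. ?F X y) - (LINT y|lborel. ?F (Z k) y)) \<longlonglongrightarrow> 0" by simp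
  have 3: "(LINT y|lborel. ?G (w k) y) = - (LINT y|lborel. ?F (Z k) y)" for k
    by (rule k(3)[unfolded dist_grad_def, rule_format, OF c \<psi>])
  from tendsto_add[OF 1 2] have "(\<lambda>k::nat. (LINT y|lborel. ?G u y) + (LINT y|lborel. ?F X y)) \<longlonglongrightarrow> 0"
    unfolding 3 by simp
  then show "(LINT y|lborel. ?G u y) = - (LINT y|lborel. ?F X y)" by (simp add: LIMSEQ_const_iff)
qed

end

section \<open>Smooth functions as Sobolev functions\<close>

lemma linear_axis_expansion:
  fixes L :: "real ^ 'n::finite \<Rightarrow> real"
  assumes "linear L"
  shows "L w = (\<Sum>i\<in>UNIV. (w $ i) * L (axis i 1))"
proof -
  have "w = (\<Sum>i\<in>UNIV. (w $ i) *\<^sub>R axis i 1)"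
    by (simp add: basis_expansion scalar_mult_eq_scaleR[symmetric])
  then have "L w = L (\<Sum>i\<in>UNIV. (w $ i) *\<^sub>R axis i 1)" by simp
  also have "\<dots> = (\<Sum>i\<in>UNIV. (w $ i) * L (axis i 1))"
    using assms by (simp add: linear_sum linear_scale)
  finally show ?thesis .
qed

context closed_manifold
begin

lemma continuous_chartI:
  assumes "\<And>c. c \<in> charts M \<Longrightarrow> continuous_on (cdom c) F"
  shows "continuous_on UNIV F"
proof -
  have "continuous_on (\<Union>c\<in>charts M. cdom c) F"
    by (rule continuous_on_open_UN) (use assms open_cdom in auto)
  moreover have "(\<Union>c\<in>charts M. cdom c) = UNIV"
  proof -
    have "\<exists>c\<in>charts M. x \<in> cdom c" for x by (rule ex_chart[of x]) blast
    then show ?thesis by blast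
  qed
  ultimately show ?thesis by simp
qed

lemma continuous_via_chart:
  assumes c: "c \<in> charts M" and "continuous_on (cimg c) (\<lambda>y. F (cinv c y))"
  shows "continuous_on (cdom c) F"
proof -
  have "continuous_on (cdom c) (\<lambda>x. F (cinv c (cmap c x)))"
    by (rule continuous_on_compose2[OF assms(2) continuous_cmap[OF c]]) simp
  then show ?thesis by (rule continuous_on_eq) (simp add: cinv_cmap[OF c])
qed

lemma integrable_continuous:
  fixes F :: "'a \<Rightarrow> real"
  assumes "continuous_on UNIV F"
  shows "integrable V F"
proof -
  interpret V: finite_measure V by (rule finite_measure_V)
  have "bounded (range F)"
    using compact_continuous_image[OF assms compact_UNIV] by (rule compact_imp_bounded)
  then obtain b where "\<And>x. norm (F x) \<le> b" by (auto simp: bounded_iff)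
  then show ?thesis
    using borel_measurable_continuous_onI[OF assms] by (intro V.integrable_const_bound[of _ b]) auto
qed

lemma smooth_fun_chart: "smooth_fun M \<phi> \<Longrightarrow> c \<in> charts M \<Longrightarrow> smooth_on (\<lambda>y. \<phi> (cinv c y)) (cimg c)"
  by (simp add: smooth_fun_def)

lemma smooth_fun_continuous: "smooth_fun M \<phi> \<Longrightarrow> continuous_on UNIV \<phi>"
  by (intro continuous_chartI continuous_via_chart smooth_on_continuous smooth_fun_chart)

lemma smooth_fun_const: "smooth_fun M (\<lambda>x. k)"
  by (simp add: smooth_fun_def smooth_on_const)

lemma smooth_fun_mult:
  "smooth_fun M \<phi> \<Longrightarrow> smooth_fun M \<psi> \<Longrightarrow> smooth_fun M (\<lambda>x. \<phi> x * \<psi> x)"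
  unfolding smooth_fun_def by (intro ballI smooth_on_mult open_cimg) blast+

lemma smooth_fun_add:
  "smooth_fun M \<phi> \<Longrightarrow> smooth_fun M \<psi> \<Longrightarrow> smooth_fun M (\<lambda>x. \<phi> x + \<psi> x)"
  unfolding smooth_fun_def by (intro ballI smooth_on_add open_cimg) blast+

lemma smooth_fun_lin:
  "smooth_fun M \<phi> \<Longrightarrow> smooth_fun M \<psi> \<Longrightarrow> smooth_fun M (\<lambda>x. a * \<phi> x + b * \<psi> x)"
  by (intro smooth_fun_add smooth_fun_mult smooth_fun_const)

lemma smooth_fun_sum:
  assumes "\<And>i. i \<in> I \<Longrightarrow> smooth_fun M (\<phi> i)"
  shows "smooth_fun M (\<lambda>x. \<Sum>i\<in>I. \<phi> i x)"
  using assms by (induction I rule: infinite_finite_induct) (auto intro: smooth_fun_const smooth_fun_add)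

lemma smooth_fun_inverse:
  "smooth_fun M \<phi> \<Longrightarrow> (\<And>x. \<phi> x \<noteq> 0) \<Longrightarrow> smooth_fun M (\<lambda>x. inverse (\<phi> x))"
  unfolding smooth_fun_def by (intro ballI smooth_on_inverse open_cimg) blast+

lemma smooth_fun_has_derivative:
  assumes "smooth_fun M \<phi>" "c \<in> charts M" "y \<in> cimg c"
  shows "((\<lambda>y. \<phi> (cinv c y)) has_derivative frechet_derivative (\<lambda>y. \<phi> (cinv c y)) (at y)) (at y)"
  by (rule smooth_on_has_derivative[OF smooth_fun_chart[OF assms(1,2)] assms(3)])

text \<open>The coordinates of the differential, that is, the gradient with its index lowered. It
  does not involve the metric, so calculus rules are proved for it and then carried over by
  \<open>gradient_chart\<close>.\<close>

definition covec :: "('a, 'n) chart \<Rightarrow> ('a \<Rightarrow> real) \<Rightarrow> real ^ 'n \<Rightarrow> real ^ 'n" where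
  "covec c \<phi> y = (\<chi> i. dirderiv (axis i 1) (\<lambda>y. \<phi> (cinv c y)) y)"

lemma covec_inner:
  assumes "smooth_fun M \<phi>" "c \<in> charts M" "y \<in> cimg c"
  shows "frechet_derivative (\<lambda>y. \<phi> (cinv c y)) (at y) w = covec c \<phi> y \<bullet> w"
  using linear_axis_expansion[OF has_derivative_linear[OF smooth_fun_has_derivative[OF assms]], of w]
  by (simp add: covec_def inner_vec_def mult.commute)

lemma covec_derivative:
  assumes "smooth_fun M \<phi>" "c \<in> charts M" "y \<in> cimg c"
  shows "((\<lambda>y. \<phi> (cinv c y)) has_derivative (\<lambda>w. covec c \<phi> y \<bullet> w)) (at y)"
proof -
  have "frechet_derivative (\<lambda>y. \<phi> (cinv c y)) (at y) = (\<lambda>w. covec c \<phi> y \<bullet> w)"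
    using covec_inner[OF assms] by blast
  then show ?thesis using smooth_fun_has_derivative[OF assms] by simp
qed

lemma covec_eqI:
  assumes "smooth_fun M \<phi>" "c \<in> charts M" "y \<in> cimg c"
    and "((\<lambda>y. \<phi> (cinv c y)) has_derivative (\<lambda>w. v \<bullet> w)) (at y)"
  shows "covec c \<phi> y = v"
proof -
  have "(\<lambda>w. covec c \<phi> y \<bullet> w) = (\<lambda>w. v \<bullet> w)"
    using has_derivative_unique[OF covec_derivative[OF assms(1-3)] assms(4)] .
  then show ?thesis by (metis vector_eq_rdot)
qed

lemma covec_change:
  assumes \<phi>: "smooth_fun M \<phi>" and cd: "c \<in> charts M" "d \<in> charts M" "p \<in> cdom c" "p \<in> cdom d"
  shows "covec c \<phi> (cmap c p) \<bullet> w = covec d \<phi> (cmap d p) \<bullet> chart_change c d p w"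
proof -
  let ?S = "cmap c ` (cdom c \<inter> cdom d)"
  have p: "cmap c p \<in> ?S" using cd by auto
  have S: "open ?S" using cd by (intro open_cmap_image open_cdom)
  have "((\<lambda>y. \<phi> (cinv d (cmap d (cinv c y)))) has_derivative
      (\<lambda>w. covec d \<phi> (cmap d p) \<bullet> chart_change c d p w)) (at (cmap c p))"
    using diff_chain_at[OF has_derivative_chart_change[OF cd], of "\<lambda>y. \<phi> (cinv d y)"]
      covec_derivative[OF \<phi> cd(2) cmap_in[OF cd(4)]] cd
    by (simp add: cinv_cmap o_def)
  then have "((\<lambda>y. \<phi> (cinv c y)) has_derivative
      (\<lambda>w. covec d \<phi> (cmap d p) \<bullet> chart_change c d p w)) (at (cmap c p))"
    by (rule has_derivative_transform_within_open[OF _ S p])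
      (use cinv_cmap[OF cd(1)] cinv_cmap[OF cd(2)] in auto)
  from has_derivative_unique[OF covec_derivative[OF \<phi> cd(1) cmap_in[OF cd(3)]] this]
  show ?thesis by metis
qed

lemma gradient_chart:
  assumes "c \<in> charts M" "p \<in> cdom c"
  shows "gradient M \<phi> p c = matrix_inv (gmat M c p) *v covec c \<phi> (cmap c p)"
  using assms by (simp add: gradient_def covec_def)

lemma gmat_gradient:
  assumes "c \<in> charts M" "p \<in> cdom c"
  shows "gmat M c p *v gradient M \<phi> p c = covec c \<phi> (cmap c p)"
  unfolding gradient_chart[OF assms]
  by (rule matrix_inv_mult(2)) (use det_gmat_pos[OF assms] in simp)

text \<open>The differential transforms as a covector. Pairing with an arbitrary vector through the
  invariant metric turns this into the vector law, because the metric is nondegenerate.\<close>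

lemma tangent_gradient:
  assumes \<phi>: "smooth_fun M \<phi>"
  shows "tangent_vector M p (gradient M \<phi> p)"
  unfolding tangent_vector_def
proof (intro conjI allI impI ballI)
  fix c d assume "c \<in> charts M" "d \<in> charts M" "p \<in> cdom c \<inter> cdom d"
  then have cd: "c \<in> charts M" "d \<in> charts M" "p \<in> cdom c" "p \<in> cdom d" by auto
  let ?J = "chart_change c d p"
  have "z \<bullet> (gmat M d p *v ?J (gradient M \<phi> p c)) = z \<bullet> covec d \<phi> (cmap d p)" for z
  proof -
    define w where "w = chart_change d c p z"
    have z: "z = ?J w" using chart_change_inverse[OF cd(2,1,4,3)] by (simp add: w_def)
    have "z \<bullet> (gmat M d p *v ?J (gradient M \<phi> p c)) = w \<bullet> (gmat M c p *v gradient M \<phi> p c)"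
      unfolding z by (rule gmat_change[OF cd, symmetric])
    also have "\<dots> = z \<bullet> covec d \<phi> (cmap d p)"
      using covec_change[OF \<phi> cd, of w] by (simp add: gmat_gradient[OF cd(1,3)] z inner_commute)
    finally show ?thesis .
  qed
  then have "gmat M d p *v ?J (gradient M \<phi> p c) = covec d \<phi> (cmap d p)"
    by (metis vector_eq_ldot)
  then show "gradient M \<phi> p d = ?J (gradient M \<phi> p c)"
    using matrix_inv_mult(1)[of "gmat M d p" "?J (gradient M \<phi> p c)"] det_gmat_pos[OF cd(2,4)]
    by (simp add: gradient_chart[OF cd(2,4)])
qed (auto simp: gradient_def)

lemma continuous_covec:
  assumes "smooth_fun M \<phi>" "c \<in> charts M"
  shows "continuous_on (cimg c) (covec c \<phi>)"
  unfolding covec_def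
  by (intro continuous_on_vec_lambda smooth_on_continuous smooth_on_dirderiv smooth_fun_chart assms) simp

lemma continuous_gradient:
  assumes \<phi>: "smooth_fun M \<phi>" and c: "c \<in> charts M"
  shows "continuous_on (cdom c) (\<lambda>p. gradient M \<phi> p c)"
proof (rule continuous_via_chart[OF c])
  have "continuous_on (cimg c) (\<lambda>y. matrix_inv (gmat M c (cinv c y)) *v covec c \<phi> y)"
    by (rule continuous_on_matrix_inv_mult[OF continuous_gmat[OF c] continuous_covec[OF \<phi> c]])
      (use det_gmat_pos[OF c] cinv_in[OF c] in \<open>metis less_irrefl\<close>)
  then show "continuous_on (cimg c) (\<lambda>y. gradient M \<phi> (cinv c y) c)"
    by (rule continuous_on_eq) (simp only: gradient_chart[OF c cinv_in[OF c]] cmap_cinv[OF c])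
qed

lemma tinner_gradient:
  assumes "smooth_fun M \<phi>" "c \<in> charts M" "p \<in> cdom c"
  shows "tinner M p (gradient M \<phi> p) (gradient M \<phi> p) = gradient M \<phi> p c \<bullet> covec c \<phi> (cmap c p)"
  using tinner_chart[OF assms(2,3) tangent_gradient[OF assms(1)] tangent_gradient[OF assms(1)]]
  by (simp add: gmat_gradient[OF assms(2,3)])

lemma continuous_tinner_gradient:
  assumes \<phi>: "smooth_fun M \<phi>"
  shows "continuous_on UNIV (\<lambda>p. tinner M p (gradient M \<phi> p) (gradient M \<phi> p))"
proof (rule continuous_chartI)
  fix c assume c: "c \<in> charts M"
  have "continuous_on (cdom c) (\<lambda>p. covec c \<phi> (cmap c p))"
    by (rule continuous_on_compose2[OF continuous_covec[OF \<phi> c] continuous_cmap[OF c]]) simp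
  then have "continuous_on (cdom c) (\<lambda>p. gradient M \<phi> p c \<bullet> covec c \<phi> (cmap c p))"
    by (intro continuous_on_inner continuous_gradient \<phi> c)
  then show "continuous_on (cdom c) (\<lambda>p. tinner M p (gradient M \<phi> p) (gradient M \<phi> p))"
    by (rule continuous_on_eq) (simp add: tinner_gradient[OF \<phi> c])
qed

lemma L2_field_gradient:
  assumes \<phi>: "smooth_fun M \<phi>"
  shows "L2_field (gradient M \<phi>)"
  unfolding L2_field_def
proof (intro conjI allI ballI)
  show "tangent_vector M x (gradient M \<phi> x)" for x by (rule tangent_gradient[OF \<phi>])
  show "(\<lambda>x. indicator (cdom c) x *\<^sub>R gradient M \<phi> x c) \<in> borel_measurable borel" if "c \<in> charts M" for c
    by (rule borel_measurable_continuous_on_indicator[OF _ continuous_gradient[OF \<phi> that]])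
      (use open_cdom[OF that] in auto)
  show "integrable V (\<lambda>x. tinner M x (gradient M \<phi> x) (gradient M \<phi> x))"
    by (rule integrable_continuous[OF continuous_tinner_gradient[OF \<phi>]])
qed

lemma L2_fun_continuous:
  assumes "continuous_on UNIV \<phi>" shows "L2_fun \<phi>"
  unfolding L2_fun_def using assms
  by (intro conjI borel_measurable_continuous_onI integrable_continuous continuous_intros)

lemma L2_fun_smooth: "smooth_fun M \<phi> \<Longrightarrow> L2_fun \<phi>"
  by (intro L2_fun_continuous smooth_fun_continuous)

lemma gradient_lin:
  assumes "smooth_fun M \<phi>" "smooth_fun M \<psi>"
  shows "gradient M (\<lambda>x. a * \<phi> x + b * \<psi> x) = (\<lambda>p c. a *\<^sub>R gradient M \<phi> p c + b *\<^sub>R gradient M \<psi> p c)"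
proof (intro ext)
  fix p c
  show "gradient M (\<lambda>x. a * \<phi> x + b * \<psi> x) p c = a *\<^sub>R gradient M \<phi> p c + b *\<^sub>R gradient M \<psi> p c"
  proof (cases "c \<in> charts M \<and> p \<in> cdom c")
    case True
    then have c: "c \<in> charts M" and p: "p \<in> cdom c" by auto
    have "covec c (\<lambda>x. a * \<phi> x + b * \<psi> x) (cmap c p) = a *\<^sub>R covec c \<phi> (cmap c p) + b *\<^sub>R covec c \<psi> (cmap c p)"
    proof (rule covec_eqI[OF smooth_fun_lin[OF assms] c cmap_in[OF p]])
      show "((\<lambda>y. a * \<phi> (cinv c y) + b * \<psi> (cinv c y)) has_derivative
        (\<bullet>) (a *\<^sub>R covec c \<phi> (cmap c p) + b *\<^sub>R covec c \<psi> (cmap c p))) (at (cmap c p))"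
        by (rule derivative_eq_intros covec_derivative assms c cmap_in p refl)+
          (simp add: inner_add_left fun_eq_iff)
    qed
    then show ?thesis
      by (simp add: gradient_chart[OF c p] matrix_vector_right_distrib matrix_vector_mult_scaleR)
  next
    case False
    then show ?thesis by (auto simp: gradient_def)
  qed
qed

lemma gradient_diff:
  assumes "smooth_fun M \<phi>" "smooth_fun M \<psi>"
  shows "gradient M (\<lambda>x. \<phi> x - \<psi> x) = (\<lambda>p c. gradient M \<phi> p c - gradient M \<psi> p c)"
  using gradient_lin[OF assms, of 1 "-1"] by simp

lemma gradient_local:
  assumes "open W" "p \<in> W" "\<And>x. x \<in> W \<Longrightarrow> \<phi> x = 0"
  shows "gradient M \<phi> p = (\<lambda>c. 0)"
proof
  fix c
  show "gradient M \<phi> p c = 0"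
  proof (cases "c \<in> charts M \<and> p \<in> cdom c")
    case True
    then have c: "c \<in> charts M" and p: "p \<in> cdom c" by auto
    have o: "open (cmap c ` (cdom c \<inter> W))" by (rule open_cmap_image[OF c assms(1)])
    have "frechet_derivative (\<lambda>y. \<phi> (cinv c y)) (at (cmap c p)) = frechet_derivative (\<lambda>y. 0) (at (cmap c p))"
      by (rule frechet_derivative_cong_open[OF o])
        (use p assms(2,3) cmap_image_cinv_in[OF c] in auto)
    then have "covec c \<phi> (cmap c p) = 0"
      by (simp add: covec_def vec_eq_iff frechet_derivative_eq[OF has_derivative_const])
    then show ?thesis by (simp add: gradient_chart[OF c p])
  qed (auto simp: gradient_def)
qed

text \<open>Integration by parts: the derivative of the compactly supported product of the function
  with the bump integrates to 0, and the product rule splits it into the two sides.\<close>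

lemma dist_grad_smooth:
  assumes \<phi>: "smooth_fun M \<phi>"
  shows "dist_grad UNIV \<phi> (gradient M \<phi>)"
  unfolding dist_grad_def
proof (intro ballI allI impI)
  fix c \<psi> and i :: 'n assume c: "c \<in> charts M" and "bump_in (cmap c ` (cdom c \<inter> UNIV)) \<psi>"
  then have \<psi>: "bump_in (cimg c) \<psi>" by simp
  obtain Y where Y: "compact Y" "Y \<subseteq> cimg c" "\<And>y. y \<notin> Y \<Longrightarrow> \<psi> y = 0"
    "\<And>y v. y \<notin> Y \<Longrightarrow> dirderiv v \<psi> y = 0" "continuous_on UNIV \<psi>"
    "\<And>b. b \<in> Basis \<Longrightarrow> continuous_on UNIV (dirderiv b \<psi>)"
    "\<And>y. (\<psi> has_derivative frechet_derivative \<psi> (at y)) (at y)"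
    by (rule bump_inE[OF \<psi>]) blast
  let ?e = "axis i (1 :: real)"
  let ?f = "\<lambda>y. \<phi> (cinv c y)"
  define P where "P = (\<lambda>y. ?f y * \<psi> y)"
  \<comment> \<open>The product extends by 0 to all of Euclidean space. Outside the image of the
    chart it vanishes on a neighbourhood, so the value 0 is the correct derivative there.\<close>
  define P' where "P' = (\<lambda>y w. if y \<in> cimg c then ?f y * dirderiv w \<psi> y + (covec c \<phi> y \<bullet> w) * \<psi> y else 0)"
  have oY: "open (- Y)" using compact_imp_closed[OF Y(1)] by (simp add: open_Compl)
  have off: "P' y w = 0" "P y = 0" if "y \<notin> Y" for y w using Y(3,4)[OF that] by (simp_all add: P'_def P_def)
  have der: "(P has_derivative P' y) (at y)" for y
  proof (cases "y \<in> cimg c")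
    case True
    have "((\<lambda>y. ?f y * \<psi> y) has_derivative (\<lambda>w. ?f y * dirderiv w \<psi> y + (covec c \<phi> y \<bullet> w) * \<psi> y)) (at y)"
      by (rule has_derivative_mult[OF covec_derivative[OF \<phi> c True] Y(7)])
    then show ?thesis using True by (simp add: P_def P'_def)
  next
    case False
    then have y: "y \<in> - Y" using Y(2) by auto
    have "(P has_derivative (\<lambda>w. 0)) (at y)"
      by (rule has_derivative_transform_within_open[OF has_derivative_const oY y]) (use off in auto)
    then show ?thesis using False by (simp add: P'_def)
  qed
  have cf: "continuous_on (cimg c) ?f" by (rule smooth_on_continuous[OF smooth_fun_chart[OF \<phi> c]])
  have cont: "continuous_on UNIV (\<lambda>y. P' y ?e)"
  proof -
    have e: "continuous_on (cimg c) (dirderiv ?e \<psi>)" using continuous_on_subset[OF Y(6)[of ?e]] by simp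
    have "continuous_on (cimg c) (\<lambda>y. ?f y * dirderiv ?e \<psi> y + (covec c \<phi> y \<bullet> ?e) * \<psi> y)"
      by (intro continuous_on_add continuous_on_mult continuous_on_inner cf e continuous_covec \<phi> c
          continuous_on_const continuous_on_subset[OF Y(5)]) simp
    then have 1: "continuous_on (cimg c) (\<lambda>y. P' y ?e)"
      by (rule continuous_on_eq) (simp add: P'_def)
    have 2: "continuous_on (- Y) (\<lambda>y. P' y ?e)"
      by (rule continuous_on_eq[OF continuous_on_const[of _ 0]]) (simp add: off)
    have "cimg c \<union> - Y = UNIV" using Y(2) by auto
    then show ?thesis using continuous_on_open_Un[OF open_cimg[OF c] oY 1 2] by simp
  qed
  have zero: "(LINT y|lborel. P' y ?e) = 0"
    by (rule integral_derivative_zero[OF der cont Y(1)]) (use off in simp)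
  have eq: "P' y ?e = ?f y * dirderiv ?e \<psi> y + (gmat M c (cinv c y) *v gradient M \<phi> (cinv c y) c) $ i * \<psi> y" for y
  proof (cases "y \<in> cimg c")
    case True
    have "covec c \<phi> y = gmat M c (cinv c y) *v gradient M \<phi> (cinv c y) c"
      using gmat_gradient[OF c cinv_in[OF c True], of \<phi>] cmap_cinv[OF c True] by simp
    then show ?thesis using True by (simp add: P'_def inner_axis)
  next
    case False
    then have "y \<notin> Y" using Y(2) by auto
    then show ?thesis using off(1)[of y ?e] Y(3,4) by simp
  qed
  obtain C1 where "pairing c (dirderiv ?e \<psi>) C1" using bump_pairing(2)[OF c \<psi>] ..
  note C1 = pairing_fun(1)[OF this L2_fun_smooth[OF \<phi>]]
  obtain C2 where "pairing c \<psi> C2" using bump_pairing(1)[OF c \<psi>] ..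
  note C2 = pairing_field(1)[OF this L2_field_gradient[OF \<phi>], of i]
  show "(LINT y|lborel. ?f y * dirderiv ?e \<psi> y) = - (LINT y|lborel. (gmat M c (cinv c y) *v gradient M \<phi> (cinv c y) c) $ i * \<psi> y)"
    using zero unfolding eq Bochner_Integration.integral_add[OF C1 C2] by simp
qed

section \<open>Extension by zero and weak solutions\<close>

lemma test_fun_vanish:
  assumes "test_fun M \<Omega> \<phi>" "x \<notin> \<Omega>"
  shows "\<phi> x = 0" "gradient M \<phi> x = (\<lambda>c. 0)"
proof -
  have x: "x \<in> - closure {x. \<phi> x \<noteq> 0}" using assms by (auto simp: test_fun_def)
  have z: "\<phi> y = 0" if "y \<in> - closure {x. \<phi> x \<noteq> 0}" for y
    using that closure_subset[of "{x. \<phi> x \<noteq> 0}"] by blast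
  show "\<phi> x = 0" by (rule z[OF x])
  show "gradient M \<phi> x = (\<lambda>c. 0)"
    by (rule gradient_local[OF _ x]) (rule open_Compl closed_closure z, assumption?)+
qed

lemma test_fun_smooth: "test_fun M \<Omega> \<phi> \<Longrightarrow> smooth_fun M \<phi>"
  by (simp add: test_fun_def)

lemma test_fun_ext:
  assumes "test_fun M \<Omega> \<phi>"
  shows "zero_ext \<Omega> \<phi> = \<phi>" "vext \<Omega> (gradient M \<phi>) = gradient M \<phi>"
  using test_fun_vanish[OF assms] by (auto simp: zero_ext_def vext_def)

lemma weak_gradient_test:
  assumes "test_fun M \<Omega> \<phi>"
  shows "weak_gradient M \<Omega> \<phi> (gradient M \<phi>)"
  using L2_field_gradient[OF test_fun_smooth[OF assms]]
    dist_grad_mono[OF dist_grad_smooth[OF test_fun_smooth[OF assms]], of \<Omega>]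
  by (simp add: weak_gradient_iff test_fun_ext[OF assms])

lemma weak_gradient_wgrad:
  assumes "weak_gradient M \<Omega> u X" shows "weak_gradient M \<Omega> u (wgrad M \<Omega> u)"
  using someI[of "weak_gradient M \<Omega> u", OF assms] by (simp add: wgrad_def)

text \<open>\<open>wgrad\<close> is picked by \<open>SOME\<close>. Uniqueness lets any concrete weak
  gradient stand in for it inside integrals.\<close>

lemma wgrad_AE:
  assumes "open \<Omega>" "weak_gradient M \<Omega> u X"
  shows "AE x in V. vext \<Omega> (wgrad M \<Omega> u) x = vext \<Omega> X x"
proof -
  have "AE x in V. x \<in> \<Omega> \<longrightarrow> vext \<Omega> (wgrad M \<Omega> u) x = vext \<Omega> X x"
    using weak_gradient_wgrad[OF assms(2)] assms(2) unfolding weak_gradient_iff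
    by (intro dist_grad_unique[OF assms(1)]) auto
  then show ?thesis by (rule AE_mp) (auto intro!: AE_I2 simp: vext_def)
qed

lemma ip_cong_AE:
  assumes "L2_field X" "L2_field X'" "L2_field Y" "L2_field Y'"
    and "AE x in V. X x = X' x" "AE x in V. Y x = Y' x"
  shows "ip X Y = ip X' Y'"
  unfolding ip_def
proof (rule integral_cong_AE)
  show "(\<lambda>x. tinner M x (X x) (Y x)) \<in> borel_measurable V" "(\<lambda>x. tinner M x (X' x) (Y' x)) \<in> borel_measurable V"
    using L2_field_tinner[OF assms(1,3)] L2_field_tinner[OF assms(2,4)] by auto
  show "AE x in V. tinner M x (X x) (Y x) = tinner M x (X' x) (Y' x)"
    using assms(5,6) by eventually_elim simp
qed

lemma set_integral_tinner:
  "(LINT x:\<Omega>|V. tinner M x (X x) (Y x)) = ip (vext \<Omega> X) (vext \<Omega> Y)"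
  unfolding set_lebesgue_integral_def ip_def
  by (rule Bochner_Integration.integral_cong) (auto simp: vext_def indicator_def)

text \<open>Squaring removes the root, and any weak gradient at hand may replace the chosen one; all
  later estimates of the norm go through this form.\<close>

lemma H1_norm_sq:
  assumes \<Omega>: "open \<Omega>" and w: "weak_gradient M \<Omega> w Y"
  shows "(H1_norm M \<Omega> w)\<^sup>2 = (LINT x|V. (zero_ext \<Omega> w x)\<^sup>2) + ip (vext \<Omega> Y) (vext \<Omega> Y)"
proof -
  have "(LINT x:\<Omega>|V. (w x)\<^sup>2) = (LINT x|V. (zero_ext \<Omega> w x)\<^sup>2)"
    unfolding set_lebesgue_integral_def
    by (rule Bochner_Integration.integral_cong) (auto simp: zero_ext_def indicator_def)
  moreover have "(LINT x:\<Omega>|V. (tnorm M x (wgrad M \<Omega> w x))\<^sup>2) = ip (vext \<Omega> (wgrad M \<Omega> w)) (vext \<Omega> (wgrad M \<Omega> w))"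
    unfolding tnorm_sq by (rule set_integral_tinner)
  moreover have "ip (vext \<Omega> (wgrad M \<Omega> w)) (vext \<Omega> (wgrad M \<Omega> w)) = ip (vext \<Omega> Y) (vext \<Omega> Y)"
    using w weak_gradient_wgrad[OF w] wgrad_AE[OF \<Omega> w]
    by (intro ip_cong_AE) (auto simp: weak_gradient_iff)
  ultimately show ?thesis
    unfolding H1_norm_def by (simp add: ip_nonneg)
qed

lemma weak_gradient_diff:
  assumes "u \<in> L2 M \<Omega>" "v \<in> L2 M \<Omega>" "weak_gradient M \<Omega> u X" "weak_gradient M \<Omega> v Y"
  shows "weak_gradient M \<Omega> (\<lambda>x. u x - v x) (\<lambda>x c. X x c - Y x c)"
proof -
  have z: "zero_ext \<Omega> (\<lambda>x. u x - v x) = (\<lambda>x. 1 * zero_ext \<Omega> u x + (-1) * zero_ext \<Omega> v x)"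
    "vext \<Omega> (\<lambda>x c. X x c - Y x c) = (\<lambda>x c. 1 *\<^sub>R vext \<Omega> X x c + (-1) *\<^sub>R vext \<Omega> Y x c)"
    by (auto simp: zero_ext_def vext_def fun_eq_iff)
  show ?thesis
    using assms unfolding weak_gradient_iff L2_iff z by (blast intro: L2_field_lin dist_grad_lin)
qed

text \<open>Functions of \<open>H10\<close> are limits of test functions, so no jump occurs when they are extended by
  zero: the weak gradient of the extension is the extension of the weak gradient.\<close>

lemma H10_extension:
  assumes \<Omega>: "open \<Omega>" and u: "u \<in> H10 M \<Omega>"
  defines "X \<equiv> vext \<Omega> (wgrad M \<Omega> u)"
  obtains \<phi> where "L2_fun (zero_ext \<Omega> u)" "L2_field X" "dist_grad UNIV (zero_ext \<Omega> u) X"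
    "\<And>k::nat. test_fun M \<Omega> (\<phi> k)"
    "(\<lambda>k. LINT x|V. (zero_ext \<Omega> u x - \<phi> k x)\<^sup>2) \<longlonglongrightarrow> 0"
    "(\<lambda>k. ip (\<lambda>x c. X x c - gradient M (\<phi> k) x c) (\<lambda>x c. X x c - gradient M (\<phi> k) x c)) \<longlonglongrightarrow> 0"
proof -
  obtain \<phi> where \<phi>: "\<And>k::nat. test_fun M \<Omega> (\<phi> k)" "(\<lambda>k. H1_norm M \<Omega> (\<lambda>x. u x - \<phi> k x)) \<longlonglongrightarrow> 0"
    using u by (auto simp: H10_def)
  have L2: "u \<in> L2 M \<Omega>" and w: "weak_gradient M \<Omega> u (wgrad M \<Omega> u)"
    using u weak_gradient_wgrad by (auto simp: H10_def H1_def)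
  have L: "L2_fun (zero_ext \<Omega> u)" "L2_field X"
    using L2 w by (simp_all add: L2_iff weak_gradient_iff X_def)
  have \<phi>2: "\<phi> k \<in> L2 M \<Omega>" for k
    unfolding L2_iff test_fun_ext[OF \<phi>(1)] by (rule L2_fun_smooth[OF test_fun_smooth[OF \<phi>(1)]])
  have ext: "zero_ext \<Omega> (\<lambda>x. u x - \<phi> k x) = (\<lambda>x. zero_ext \<Omega> u x - \<phi> k x)"
    "vext \<Omega> (\<lambda>x c. wgrad M \<Omega> u x c - gradient M (\<phi> k) x c) = (\<lambda>x c. X x c - gradient M (\<phi> k) x c)" for k
    using test_fun_vanish[OF \<phi>(1)[of k]] by (auto simp: zero_ext_def vext_def X_def fun_eq_iff)
  have sq: "(H1_norm M \<Omega> (\<lambda>x. u x - \<phi> k x))\<^sup>2 = (LINT x|V. (zero_ext \<Omega> u x - \<phi> k x)\<^sup>2)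
    + ip (\<lambda>x c. X x c - gradient M (\<phi> k) x c) (\<lambda>x c. X x c - gradient M (\<phi> k) x c)" for k
    using H1_norm_sq[OF \<Omega> weak_gradient_diff[OF L2 \<phi>2 w weak_gradient_test[OF \<phi>(1)], of k]]
    unfolding ext .
  have "(\<lambda>k. (H1_norm M \<Omega> (\<lambda>x. u x - \<phi> k x))\<^sup>2) \<longlonglongrightarrow> 0"
    using tendsto_power[OF \<phi>(2), of 2] by simp
  then have lim: "(\<lambda>k. (LINT x|V. (zero_ext \<Omega> u x - \<phi> k x)\<^sup>2)
    + ip (\<lambda>x c. X x c - gradient M (\<phi> k) x c) (\<lambda>x c. X x c - gradient M (\<phi> k) x c)) \<longlonglongrightarrow> 0"
    by (simp only: sq)
  have 1: "(\<lambda>k. LINT x|V. (zero_ext \<Omega> u x - \<phi> k x)\<^sup>2) \<longlonglongrightarrow> 0"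
    by (rule tendsto_sandwich[OF _ _ tendsto_const lim]) (simp_all add: ip_nonneg)
  have 2: "(\<lambda>k. ip (\<lambda>x c. X x c - gradient M (\<phi> k) x c) (\<lambda>x c. X x c - gradient M (\<phi> k) x c)) \<longlonglongrightarrow> 0"
    by (rule tendsto_sandwich[OF _ _ tendsto_const lim]) (simp_all add: ip_nonneg)
  have "dist_grad UNIV (zero_ext \<Omega> u) X"
    by (rule dist_grad_limit[OF _ _ _ L 1 2])
      (intro L2_fun_smooth L2_field_gradient dist_grad_smooth test_fun_smooth[OF \<phi>(1)])+
  from that[OF L this \<phi>(1) 1 2] show ?thesis .
qed

lemma test_fun_H10:
  assumes \<Omega>: "open \<Omega>" and \<phi>: "test_fun M \<Omega> \<phi>"
  shows "\<phi> \<in> H10 M \<Omega>"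
proof -
  have L2: "\<phi> \<in> L2 M \<Omega>"
    unfolding L2_iff test_fun_ext[OF \<phi>] by (rule L2_fun_smooth[OF test_fun_smooth[OF \<phi>]])
  note w = weak_gradient_test[OF \<phi>]
  have "(H1_norm M \<Omega> (\<lambda>x. \<phi> x - \<phi> x))\<^sup>2 = 0"
    using H1_norm_sq[OF \<Omega> weak_gradient_diff[OF L2 L2 w w]] by (simp add: zero_ext_def vext_def ip_def)
  then have "(\<lambda>k::nat. H1_norm M \<Omega> (\<lambda>x. \<phi> x - \<phi> x)) \<longlonglongrightarrow> 0" by simp
  then show ?thesis
    using L2 w \<phi> unfolding H10_def H1_def by (auto intro!: exI[of _ "\<lambda>k. \<phi>"])
qed

text \<open>The weak gradient chosen for a test function agrees almost everywhere with its classical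
  gradient, so the weak formulation can be read with the latter and with integrals over the whole
  manifold.\<close>

lemma weak_solution_test:
  assumes \<Omega>: "open \<Omega>" and u: "weak_solution M \<Omega> f u" and \<phi>: "test_fun M \<Omega> \<phi>"
  shows "ip (vext \<Omega> (wgrad M \<Omega> u)) (gradient M \<phi>) = (LINT x|V. f x * \<phi> x)"
proof -
  have u1: "u \<in> H10 M \<Omega>" using u by (simp add: weak_solution_def)
  then have w: "weak_gradient M \<Omega> u (wgrad M \<Omega> u)"
    using weak_gradient_wgrad by (auto simp: H10_def H1_def)
  note w' = weak_gradient_test[OF \<phi>]
  have L: "L2_field (vext \<Omega> (wgrad M \<Omega> u))" "L2_field (vext \<Omega> (wgrad M \<Omega> \<phi>))" "L2_field (gradient M \<phi>)"
    using w weak_gradient_wgrad[OF w'] L2_field_gradient[OF test_fun_smooth[OF \<phi>]]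
    by (simp_all add: weak_gradient_iff)
  have "ip (vext \<Omega> (wgrad M \<Omega> u)) (gradient M \<phi>) = ip (vext \<Omega> (wgrad M \<Omega> u)) (vext \<Omega> (wgrad M \<Omega> \<phi>))"
    using wgrad_AE[OF \<Omega> w'] unfolding test_fun_ext(2)[OF \<phi>]
    by (intro ip_cong_AE L) (auto elim: eventually_mono)
  also have "\<dots> = (LINT x:\<Omega>|V. f x * \<phi> x)"
    using u test_fun_H10[OF \<Omega> \<phi>] by (simp add: weak_solution_def set_integral_tinner)
  also have "\<dots> = (LINT x|V. f x * \<phi> x)"
    unfolding set_lebesgue_integral_def using test_fun_vanish(1)[OF \<phi>]
    by (intro Bochner_Integration.integral_cong) (auto simp: indicator_def)
  finally show ?thesis .
qed

end

section \<open>A Poincare inequality\<close>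

lemma indicator_ennreal_measurable:
  fixes q :: "'a::topological_space \<Rightarrow> real"
  assumes "A \<in> sets borel" "continuous_on A q"
  shows "(\<lambda>x. indicator A x * ennreal (q x)) \<in> borel_measurable borel"
proof -
  have "(\<lambda>x. ennreal (indicator A x *\<^sub>R q x)) \<in> borel_measurable borel"
    by (intro measurable_compose[OF borel_measurable_continuous_on_indicator measurable_ennreal] assms)
  moreover have "ennreal (indicator A x *\<^sub>R q x) = indicator A x * ennreal (q x)" for x
    by (auto simp: indicator_def)
  ultimately show ?thesis by (simp only:)
qed

text \<open>The fundamental theorem of calculus along the segment writes the difference as an
  integral over {0..1}. Cauchy-Schwarz is applied twice, to the integral and to the inner product
  with \<open>v\<close>.\<close>

lemma square_difference_le:
  fixes w :: "'e::euclidean_space \<Rightarrow> real"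
  assumes U: "open U" and der: "\<And>x. x \<in> U \<Longrightarrow> (w has_derivative (\<lambda>h. G x \<bullet> h)) (at x)"
    and G: "continuous_on U G" and seg: "\<And>t. 0 \<le> t \<Longrightarrow> t \<le> 1 \<Longrightarrow> y + t *\<^sub>R v \<in> U"
  shows "ennreal ((w (y + v) - w y)\<^sup>2)
    \<le> (\<integral>\<^sup>+t. indicator {0..1} t * ennreal ((v \<bullet> v) * (G (y + t *\<^sub>R v) \<bullet> G (y + t *\<^sub>R v))) \<partial>lborel)"
proof -
  let ?g = "\<lambda>t. G (y + t *\<^sub>R v) \<bullet> v"
  let ?i = "indicator {0..1} :: real \<Rightarrow> real"
  have isc: "isCont (\<lambda>t. G (y + t *\<^sub>R v)) t" if "0 \<le> t" "t \<le> 1" for t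
  proof -
    have "isCont G (y + t *\<^sub>R v)" using G U seg[OF that] by (simp add: continuous_on_eq_continuous_at)
    moreover have "isCont (\<lambda>t. y + t *\<^sub>R v) t" by (intro continuous_intros)
    ultimately show ?thesis by (rule isCont_o2[rotated])
  qed
  have d: "((\<lambda>t. w (y + t *\<^sub>R v)) has_real_derivative ?g t) (at t)" if "0 \<le> t" "t \<le> 1" for t
  proof -
    have "((\<lambda>t. y + t *\<^sub>R v) has_derivative (\<lambda>s. s *\<^sub>R v)) (at t)"
      by (auto intro!: derivative_eq_intros)
    from diff_chain_at[OF this der[OF seg[OF that]]] show ?thesis
      unfolding has_field_derivative_def o_def by (rule has_derivative_eq_rhs) (simp add: fun_eq_iff)
  qed
  have "(LINT t|lborel. ?g t * ?i t) = w (y + 1 *\<^sub>R v) - w (y + 0 *\<^sub>R v)"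
    by (rule integral_FTC_Icc_real) (use d isc in \<open>auto intro!: isCont_inner\<close>)
  moreover have "(?i t * ?g t) * ?i t = ?g t * ?i t" for t by (simp add: indicator_def)
  ultimately have ftc: "w (y + v) - w y = (LINT t|lborel. (?i t * ?g t) * ?i t)"
    by (simp only: scaleR_one scaleR_zero_left add_0_right)
  have cg: "continuous_on {0..1} ?g"
    using isc by (intro continuous_at_imp_continuous_on ballI isCont_inner) auto
  have m: "(\<lambda>t. ?i t * ?g t) \<in> borel_measurable lborel"
    using borel_measurable_continuous_on_indicator[OF _ cg] by simp
  have i1: "integrable lborel (\<lambda>t. (?i t * ?g t)\<^sup>2)"
  proof -
    have "integrable lborel (\<lambda>t. ?i t *\<^sub>R (?g t)\<^sup>2)"
      by (intro borel_integrable_compact continuous_intros cg) auto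
    moreover have "?i t *\<^sub>R (?g t)\<^sup>2 = (?i t * ?g t)\<^sup>2" for t by (auto simp: indicator_def)
    ultimately show ?thesis by (simp only:)
  qed
  have sq: "(?i t)\<^sup>2 = ?i t" for t by (auto simp: indicator_def)
  have i2: "integrable lborel (\<lambda>t. (?i t)\<^sup>2)" unfolding sq by simp
  have "(w (y + v) - w y)\<^sup>2 \<le> (LINT t|lborel. (?i t * ?g t)\<^sup>2) * (LINT t|lborel. (?i t)\<^sup>2)"
    unfolding ftc by (rule Cauchy_Schwarz_integral(2)[OF m _ i1 i2]) simp
  also have "(LINT t|lborel. (?i t)\<^sup>2) = 1" unfolding sq by simp
  finally have "ennreal ((w (y + v) - w y)\<^sup>2) \<le> ennreal (LINT t|lborel. (?i t * ?g t)\<^sup>2)"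
    by (intro ennreal_leI) simp
  also have "\<dots> = (\<integral>\<^sup>+t. ennreal ((?i t * ?g t)\<^sup>2) \<partial>lborel)"
    by (rule nn_integral_eq_integral[symmetric, OF i1]) simp
  also have "\<dots> \<le> (\<integral>\<^sup>+t. indicator {0..1} t * ennreal ((v \<bullet> v) * (G (y + t *\<^sub>R v) \<bullet> G (y + t *\<^sub>R v))) \<partial>lborel)"
  proof (rule nn_integral_mono)
    fix t
    have "(?g t)\<^sup>2 \<le> (v \<bullet> v) * (G (y + t *\<^sub>R v) \<bullet> G (y + t *\<^sub>R v))"
      using Cauchy_Schwarz_ineq[of "G (y + t *\<^sub>R v)" v] by (simp add: mult.commute)
    then show "ennreal ((?i t * ?g t)\<^sup>2) \<le> indicator {0..1} t * ennreal ((v \<bullet> v) * (G (y + t *\<^sub>R v) \<bullet> G (y + t *\<^sub>R v)))"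
      by (auto simp: indicator_def intro!: ennreal_leI)
  qed
  finally show ?thesis .
qed

text \<open>Integrates \<open>square_difference_le\<close> over \<open>E\<close> and exchanges the
  integrals. For each fixed time the translated slice stays in \<open>Y\<close>, so translation
  invariance bounds it by the full integral over \<open>Y\<close>.\<close>

lemma translation_estimate:
  fixes w :: "'e::euclidean_space \<Rightarrow> real"
  assumes U: "open U" and der: "\<And>x. x \<in> U \<Longrightarrow> (w has_derivative (\<lambda>h. G x \<bullet> h)) (at x)"
    and G: "continuous_on U G" and Y: "compact Y" "Y \<subseteq> U" and E: "E \<in> sets borel"
    and seg: "\<And>y t. y \<in> E \<Longrightarrow> 0 \<le> t \<Longrightarrow> t \<le> 1 \<Longrightarrow> y + t *\<^sub>R v \<in> Y"
  shows "(\<integral>\<^sup>+y. indicator E y * ennreal ((w (y + v) - w y)\<^sup>2) \<partial>lborel)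
    \<le> ennreal (v \<bullet> v) * (\<integral>\<^sup>+y. indicator Y y * ennreal (G y \<bullet> G y) \<partial>lborel)"
proof -
  \<comment> \<open>Cutting the integrand off outside \<open>Y\<close> gives a function that is
    Borel on the whole space and may be translated freely.\<close>
  define H where "H = (\<lambda>y. ennreal (indicator Y y *\<^sub>R ((v \<bullet> v) * (G y \<bullet> G y))))"
  have [measurable]: "Y \<in> sets borel" using Y(1) by (rule borel_compact)
  note [measurable] = E
  have "continuous_on Y (\<lambda>y. (v \<bullet> v) * (G y \<bullet> G y))"
    by (intro continuous_intros continuous_on_subset[OF G Y(2)])
  then have [measurable]: "H \<in> borel_measurable borel"
    unfolding H_def by (intro measurable_compose[OF borel_measurable_continuous_on_indicator measurable_ennreal]) simp_all
  have "(\<integral>\<^sup>+y. indicator E y * ennreal ((w (y + v) - w y)\<^sup>2) \<partial>lborel)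
    \<le> (\<integral>\<^sup>+y. (\<integral>\<^sup>+t. indicator E y * (indicator {0..1} t * H (y + t *\<^sub>R v)) \<partial>lborel) \<partial>lborel)"
  proof (rule nn_integral_mono)
    fix y
    show "indicator E y * ennreal ((w (y + v) - w y)\<^sup>2)
      \<le> (\<integral>\<^sup>+t. indicator E y * (indicator {0..1} t * H (y + t *\<^sub>R v)) \<partial>lborel)"
    proof (cases "y \<in> E")
      case True
      have "ennreal ((w (y + v) - w y)\<^sup>2) \<le> (\<integral>\<^sup>+t. indicator {0..1} t * ennreal ((v \<bullet> v) * (G (y + t *\<^sub>R v) \<bullet> G (y + t *\<^sub>R v))) \<partial>lborel)"
        by (rule square_difference_le[OF U der G]) (use seg[OF True] Y(2) in auto)
      also have "\<dots> = (\<integral>\<^sup>+t. indicator {0..1} t * H (y + t *\<^sub>R v) \<partial>lborel)"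
        by (rule nn_integral_cong) (use seg[OF True] in \<open>auto simp: H_def indicator_def\<close>)
      finally show ?thesis using True by simp
    qed simp
  qed
  also have "\<dots> = (\<integral>\<^sup>+t. (\<integral>\<^sup>+y. indicator E y * (indicator {0..1} t * H (y + t *\<^sub>R v)) \<partial>lborel) \<partial>lborel)"
    by (rule lborel_pair.Fubini'[symmetric]) simp
  also have "\<dots> \<le> (\<integral>\<^sup>+t. indicator {0..1::real} t * (\<integral>\<^sup>+y. H y \<partial>lborel) \<partial>lborel)"
  proof (rule nn_integral_mono)
    fix t :: real
    have "(\<integral>\<^sup>+y. indicator E y * (indicator {0..1} t * H (y + t *\<^sub>R v)) \<partial>lborel)
      \<le> (\<integral>\<^sup>+y. indicator {0..1} t * H (y + t *\<^sub>R v) \<partial>lborel)"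
      by (intro nn_integral_mono) (auto simp: indicator_def)
    also have "\<dots> = indicator {0..1} t * (\<integral>\<^sup>+y. H (y + t *\<^sub>R v) \<partial>lborel)"
      by (rule nn_integral_cmult) simp
    finally show "(\<integral>\<^sup>+y. indicator E y * (indicator {0..1} t * H (y + t *\<^sub>R v)) \<partial>lborel)
      \<le> indicator {0..1} t * (\<integral>\<^sup>+y. H y \<partial>lborel)"
      by (simp add: nn_integral_translate)
  qed
  also have "\<dots> = (\<integral>\<^sup>+y. H y \<partial>lborel)" by (simp add: nn_integral_multc)
  also have "\<dots> = (\<integral>\<^sup>+y. ennreal (v \<bullet> v) * (indicator Y y * ennreal (G y \<bullet> G y)) \<partial>lborel)"
    by (rule nn_integral_cong) (auto simp: H_def indicator_def ennreal_mult)
  also have "\<dots> = ennreal (v \<bullet> v) * (\<integral>\<^sup>+y. indicator Y y * ennreal (G y \<bullet> G y) \<partial>lborel)"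
  proof (rule nn_integral_cmult)
    have "(\<lambda>y. indicator Y y * ennreal (G y \<bullet> G y)) \<in> borel_measurable borel"
      by (intro indicator_ennreal_measurable continuous_intros continuous_on_subset[OF G Y(2)]) simp
    then show "(\<lambda>y. indicator Y y * ennreal (G y \<bullet> G y)) \<in> borel_measurable lborel" by simp
  qed
  finally show ?thesis .
qed

section \<open>Comparison of chart quantities with Riemannian ones, and the chaining
  argument\<close>

context closed_manifold
begin

text \<open>On \<open>Y\<close> the density lies between two positive constants, and one constant
  serves both directions. Integrals with values in \<open>ennreal\<close> spare every integrability
  condition.\<close>

lemma chart_nn_bounds:
  assumes c: "c \<in> charts M" and Y: "compact Y" "Y \<subseteq> cimg c"
  obtains C :: real where "0 < C"
    "\<And>F. F \<in> borel_measurable borel \<Longrightarrow> (\<integral>\<^sup>+y. indicator Y y * F (cinv c y) \<partial>lborel)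
      \<le> ennreal C * (\<integral>\<^sup>+x. indicator (cinv c ` Y) x * F x \<partial>V)"
    "\<And>F. F \<in> borel_measurable borel \<Longrightarrow> (\<integral>\<^sup>+x. indicator (cinv c ` Y) x * F x \<partial>V)
      \<le> ennreal C * (\<integral>\<^sup>+y. indicator Y y * F (cinv c y) \<partial>lborel)"
proof -
  obtain a b where ab: "0 < a" "0 < b" "\<And>y. y \<in> Y \<Longrightarrow> a \<le> vdens c y \<and> vdens c y \<le> b"
    by (rule chart_bounds[OF c Y]) blast
  have [measurable]: "Y \<in> sets borel" "cinv c ` Y \<in> sets borel"
    using borel_compact[OF Y(1)] borel_compact[OF compact_cinv_image[OF c Y]] by auto
  have [measurable]: "cinv' c \<in> borel_measurable borel" by (rule cinv'_measurable[OF c])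
  have [measurable]: "(\<lambda>y. indicator Y y * vdens c y) \<in> borel_measurable borel"
    by (rule indicator_vdens_measurable[OF c _ Y(2)]) simp
  have eq: "(\<integral>\<^sup>+x. indicator (cinv c ` Y) x * F x \<partial>V)
      = (\<integral>\<^sup>+y. ennreal (indicator Y y * vdens c y) * F (cinv c y) \<partial>lborel)"
    and mF: "(\<lambda>y. indicator Y y * F (cinv c y)) \<in> borel_measurable borel"
    and mF': "(\<lambda>y. ennreal (indicator Y y * vdens c y) * F (cinv c y)) \<in> borel_measurable borel"
    if [measurable]: "F \<in> borel_measurable borel" for F
  proof -
    have "(\<integral>\<^sup>+x. indicator (cinv c ` Y) x * F x \<partial>V)
      = (\<integral>\<^sup>+x. ennreal (indicator (cdom c) x) * (indicator (cinv c ` Y) x * F x) \<partial>V)"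
      using cinv_in[OF c] Y(2) by (intro nn_integral_cong) (auto simp: indicator_def)
    also have "\<dots> = (\<integral>\<^sup>+y. ennreal (indicator (cimg c) y * vdens c y) * (indicator (cinv c ` Y) (cinv c y) * F (cinv c y)) \<partial>lborel)"
      by (rule nn_integral_chart[OF c]) simp
    also have "\<dots> = (\<integral>\<^sup>+y. ennreal (indicator Y y * vdens c y) * F (cinv c y) \<partial>lborel)"
    proof (rule nn_integral_cong)
      fix y
      have "cinv c y \<in> cinv c ` Y \<longleftrightarrow> y \<in> Y" if "y \<in> cimg c"
      proof
        assume "cinv c y \<in> cinv c ` Y"
        then obtain y' where y': "y' \<in> Y" "cinv c y = cinv c y'" by blast
        have "y' \<in> cimg c" using y'(1) Y(2) by (rule subsetD[rotated])
        from cmap_cinv[OF c this] cmap_cinv[OF c that] show "y \<in> Y" using y' by simp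
      qed (rule imageI)
      then show "ennreal (indicator (cimg c) y * vdens c y) * (indicator (cinv c ` Y) (cinv c y) * F (cinv c y))
        = ennreal (indicator Y y * vdens c y) * F (cinv c y)"
        using Y(2) by (cases "y \<in> cimg c") (auto simp: indicator_def)
    qed
    finally show "(\<integral>\<^sup>+x. indicator (cinv c ` Y) x * F x \<partial>V)
      = (\<integral>\<^sup>+y. ennreal (indicator Y y * vdens c y) * F (cinv c y) \<partial>lborel)" .
    have "(\<lambda>y. indicator Y y * F (cinv' c y)) \<in> borel_measurable borel" by simp
    moreover have "indicator Y y * F (cinv' c y) = indicator Y y * F (cinv c y)" for y
      using Y(2) by (auto simp: cinv'_def indicator_def)
    ultimately show "(\<lambda>y. indicator Y y * F (cinv c y)) \<in> borel_measurable borel" by simp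
    have "(\<lambda>y. ennreal (indicator Y y * vdens c y) * F (cinv' c y)) \<in> borel_measurable borel" by simp
    moreover have "ennreal (indicator Y y * vdens c y) * F (cinv' c y) = ennreal (indicator Y y * vdens c y) * F (cinv c y)" for y
      using Y(2) by (auto simp: cinv'_def indicator_def)
    ultimately show "(\<lambda>y. ennreal (indicator Y y * vdens c y) * F (cinv c y)) \<in> borel_measurable borel" by simp
  qed
  define C where "C = max (1 / a) b"
  show ?thesis
  proof (rule that[of C])
    show "0 < C" using ab by (simp add: C_def less_max_iff_disj)
    fix F :: "'a \<Rightarrow> ennreal" assume F: "F \<in> borel_measurable borel"
    have "(\<integral>\<^sup>+y. indicator Y y * F (cinv c y) \<partial>lborel)
      \<le> (\<integral>\<^sup>+y. ennreal C * (ennreal (indicator Y y * vdens c y) * F (cinv c y)) \<partial>lborel)"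
    proof (rule nn_integral_mono)
      fix y
      show "indicator Y y * F (cinv c y) \<le> ennreal C * (ennreal (indicator Y y * vdens c y) * F (cinv c y))"
      proof (cases "y \<in> Y")
        case True
        have "1 = 1 / a * a" using ab by simp
        also have "\<dots> \<le> C * vdens c y" using ab(3)[OF True] ab(1) by (intro mult_mono) (auto simp: C_def)
        finally have "ennreal 1 \<le> ennreal C * ennreal (vdens c y)"
          using ab(1) ab(3)[OF True] by (subst ennreal_mult[symmetric]) (auto simp: C_def intro!: ennreal_leI simp: le_max_iff_disj)
        then have "1 * F (cinv c y) \<le> (ennreal C * ennreal (vdens c y)) * F (cinv c y)"
          by (intro mult_right_mono) auto
        then show ?thesis using True by (simp add: mult.assoc)
      qed simp
    qed
    also have "\<dots> = ennreal C * (\<integral>\<^sup>+x. indicator (cinv c ` Y) x * F x \<partial>V)"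
      unfolding eq[OF F] by (rule nn_integral_cmult) (use mF'[OF F] in simp)
    finally show "(\<integral>\<^sup>+y. indicator Y y * F (cinv c y) \<partial>lborel)
      \<le> ennreal C * (\<integral>\<^sup>+x. indicator (cinv c ` Y) x * F x \<partial>V)" .
    have "(\<integral>\<^sup>+x. indicator (cinv c ` Y) x * F x \<partial>V) \<le> (\<integral>\<^sup>+y. ennreal C * (indicator Y y * F (cinv c y)) \<partial>lborel)"
      unfolding eq[OF F]
    proof (rule nn_integral_mono)
      fix y
      show "ennreal (indicator Y y * vdens c y) * F (cinv c y) \<le> ennreal C * (indicator Y y * F (cinv c y))"
        using ab(3)[of y] by (cases "y \<in> Y") (auto simp: C_def intro!: mult_right_mono ennreal_leI simp: le_max_iff_disj)
    qed
    also have "\<dots> = ennreal C * (\<integral>\<^sup>+y. indicator Y y * F (cinv c y) \<partial>lborel)"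
      by (rule nn_integral_cmult) (use mF[OF F] in simp)
    finally show "(\<integral>\<^sup>+x. indicator (cinv c ` Y) x * F x \<partial>V)
      \<le> ennreal C * (\<integral>\<^sup>+y. indicator Y y * F (cinv c y) \<partial>lborel)" .
  qed
qed

text \<open>The squared length of the gradient X equals X . w, where w = g X is the differential.
  The first inequality bounds |w| by |X| and |X|^2 by X . w.\<close>

lemma covec_bounds:
  assumes c: "c \<in> charts M" and Y: "compact Y" "Y \<subseteq> cimg c"
  obtains C :: real where "0 < C"
    "\<And>\<phi> y. smooth_fun M \<phi> \<Longrightarrow> y \<in> Y \<Longrightarrow> covec c \<phi> y \<bullet> covec c \<phi> y
      \<le> C * tinner M (cinv c y) (gradient M \<phi> (cinv c y)) (gradient M \<phi> (cinv c y))"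
    "\<And>\<phi> y. smooth_fun M \<phi> \<Longrightarrow> y \<in> Y \<Longrightarrow>
      tinner M (cinv c y) (gradient M \<phi> (cinv c y)) (gradient M \<phi> (cinv c y)) \<le> C * (covec c \<phi> y \<bullet> covec c \<phi> y)"
proof -
  obtain a b where ab: "0 < a" "0 < b"
    "\<And>y v. y \<in> Y \<Longrightarrow> a * (v \<bullet> v) \<le> v \<bullet> (gmat M c (cinv c y) *v v)"
    "\<And>y v. y \<in> Y \<Longrightarrow> norm (gmat M c (cinv c y) *v v) \<le> b * norm v"
    by (rule chart_bounds[OF c Y]) blast
  define C where "C = max (b\<^sup>2 / a) (1 / a)"
  have C: "0 < C" using ab by (simp add: C_def less_max_iff_disj)
  have *: "covec c \<phi> y \<bullet> covec c \<phi> y \<le> C * tinner M (cinv c y) (gradient M \<phi> (cinv c y)) (gradient M \<phi> (cinv c y)) \<and>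
      tinner M (cinv c y) (gradient M \<phi> (cinv c y)) (gradient M \<phi> (cinv c y)) \<le> C * (covec c \<phi> y \<bullet> covec c \<phi> y)"
    if \<phi>: "smooth_fun M \<phi>" and y: "y \<in> Y" for \<phi> y
  proof -
    have y': "y \<in> cimg c" using y Y by auto
    define X where "X = gradient M \<phi> (cinv c y) c"
    define w where "w = covec c \<phi> y"
    have gX: "gmat M c (cinv c y) *v X = w"
      using gmat_gradient[OF c cinv_in[OF c y'], of \<phi>] cmap_cinv[OF c y'] by (simp add: X_def w_def)
    have t: "tinner M (cinv c y) (gradient M \<phi> (cinv c y)) (gradient M \<phi> (cinv c y)) = X \<bullet> w"
      using tinner_gradient[OF \<phi> c cinv_in[OF c y']] cmap_cinv[OF c y'] by (simp add: X_def w_def)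
    have low: "a * (X \<bullet> X) \<le> X \<bullet> w" using ab(3)[OF y, of X] by (simp add: gX)
    have nn: "0 \<le> X \<bullet> w" using low ab(1) by (metis inner_ge_zero less_imp_le mult_nonneg_nonneg order_trans)
    have "norm w \<le> b * norm X" using ab(4)[OF y, of X] by (simp add: gX)
    then have "(norm w)\<^sup>2 \<le> (b * norm X)\<^sup>2" by (intro power_mono) auto
    then have "w \<bullet> w \<le> b\<^sup>2 * (X \<bullet> X)" by (simp add: power_mult_distrib dot_square_norm)
    also have "\<dots> \<le> b\<^sup>2 * (X \<bullet> w / a)"
      using low ab(1) by (intro mult_left_mono) (auto simp: field_simps)
    also have "\<dots> = b\<^sup>2 / a * (X \<bullet> w)" by simp
    also have "\<dots> \<le> C * (X \<bullet> w)" using nn by (intro mult_right_mono) (auto simp: C_def)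
    finally have 1: "w \<bullet> w \<le> C * (X \<bullet> w)" .
    \<comment> \<open>The reverse inequality: Cauchy-Schwarz bounds X . w by |X| |w|, the lower
      bound of the metric absorbs |X|^2 into X . w, and one factor X . w cancels.\<close>
    have "(a * (X \<bullet> w))\<^sup>2 \<le> a\<^sup>2 * ((X \<bullet> X) * (w \<bullet> w))"
      using mult_left_mono[OF Cauchy_Schwarz_ineq[of X w], of "a\<^sup>2"] by (simp add: power_mult_distrib)
    also have "\<dots> = (a * (X \<bullet> X)) * (a * (w \<bullet> w))" by (simp add: power2_eq_square)
    also have "\<dots> \<le> (X \<bullet> w) * (a * (w \<bullet> w))" using low ab(1) by (intro mult_right_mono) auto
    finally have "(X \<bullet> w) * (a * (X \<bullet> w)) \<le> (X \<bullet> w) * (w \<bullet> w)"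
      using ab(1) by (simp add: power2_eq_square)
    then have "a * (X \<bullet> w) \<le> w \<bullet> w"
      using nn by (cases "X \<bullet> w = 0") (auto simp: mult_le_cancel_left)
    then have "X \<bullet> w \<le> 1 / a * (w \<bullet> w)" using ab(1) by (simp add: field_simps)
    also have "\<dots> \<le> C * (w \<bullet> w)" by (intro mult_right_mono) (auto simp: C_def)
    finally show ?thesis using 1 unfolding t w_def[symmetric] by simp
  qed
  show ?thesis by (rule that[OF C]) (use * in blast)+
qed

definition energy :: "('a \<Rightarrow> real) \<Rightarrow> real" where
  "energy \<phi> = ip (gradient M \<phi>) (gradient M \<phi>)"

lemma energy_nonneg: "0 \<le> energy \<phi>"
  by (simp add: energy_def ip_nonneg)

lemma ennreal_energy:
  assumes "smooth_fun M \<phi>"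
  shows "(\<integral>\<^sup>+x. ennreal (tinner M x (gradient M \<phi> x) (gradient M \<phi> x)) \<partial>V) = ennreal (energy \<phi>)"
  unfolding energy_def ip_def
  by (rule nn_integral_eq_integral[OF integrable_continuous[OF continuous_tinner_gradient[OF assms]]])
    (simp add: tinner_nonneg)

lemma tinner_gradient_measurable:
  "smooth_fun M \<phi> \<Longrightarrow> (\<lambda>x. ennreal (tinner M x (gradient M \<phi> x) (gradient M \<phi> x))) \<in> borel_measurable borel"
  using borel_measurable_continuous_onI[OF continuous_tinner_gradient] by simp

lemma smooth_square_measurable:
  "smooth_fun M \<phi> \<Longrightarrow> (\<lambda>x. ennreal ((\<phi> x)\<^sup>2)) \<in> borel_measurable borel"
  using borel_measurable_continuous_onI[OF smooth_fun_continuous] by simp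

text \<open>The constant is chosen before the function, and the right hand side is always the energy
  over the whole manifold. So such estimates can be chained and summed without keeping track of
  where the energy sits.\<close>

definition controlled :: "'a set \<Rightarrow> 'a set \<Rightarrow> bool" where
  "controlled N W \<longleftrightarrow> (\<exists>C. \<forall>\<phi>. smooth_fun M \<phi> \<longrightarrow> (\<forall>x\<in>N. \<phi> x = 0) \<longrightarrow>
    (\<integral>\<^sup>+x. indicator W x * ennreal ((\<phi> x)\<^sup>2) \<partial>V) \<le> ennreal C * ennreal (energy \<phi>))"

text \<open>The mass near \<open>z\<close> controls the mass near \<open>y\<close>: the values at \<open>y + x\<close> and \<open>z + x\<close> differ by an
  integral of the gradient over a segment that stays in the coordinate ball.\<close>

lemma controlled_step:
  assumes c: "c \<in> charts M" and r: "cball y r \<subseteq> cimg c" and z: "z \<in> ball y r"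
    and W: "open W" "cinv c z \<in> W" "controlled N W"
  obtains \<delta> where "0 < \<delta>" "\<delta> \<le> r" "controlled N (cinv c ` ball y \<delta>)"
proof -
  have r0: "0 < r" using z by (metis ball_eq_empty empty_iff not_less)
  have zc: "z \<in> cimg c" using z r ball_subset_cball by blast
  have "z \<in> cmap c ` (cdom c \<inter> W)"
    using W(2) cinv_in[OF c zc] cmap_cinv[OF c zc] by (metis IntI image_eqI)
  then have "open (cmap c ` (cdom c \<inter> W) \<inter> ball y r)" "z \<in> cmap c ` (cdom c \<inter> W) \<inter> ball y r"
    using open_cmap_image[OF c W(1)] z by auto
  then obtain \<delta>0 where \<delta>0: "0 < \<delta>0" "cball z \<delta>0 \<subseteq> cmap c ` (cdom c \<inter> W) \<inter> ball y r"
    using open_contains_cball by meson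
  define \<delta> where "\<delta> = min \<delta>0 r"
  have \<delta>: "0 < \<delta>" "\<delta> \<le> r" using \<delta>0 r0 by (auto simp: \<delta>_def)
  have sub: "cball z \<delta> \<subseteq> cmap c ` (cdom c \<inter> W)" "cball z \<delta> \<subseteq> cball y r"
    using \<delta>0(2) by (auto simp: \<delta>_def subset_iff)
  \<comment> \<open>Translation by this vector takes the ball about \<open>z\<close>, where the mass
    is controlled, to the ball of equal radius about \<open>y\<close>.\<close>
  define v where "v = y - z"
  have sub': "cball y \<delta> \<subseteq> cball y r" using \<delta> by auto
  have seg: "e + t *\<^sub>R v \<in> cball y r" if "e \<in> cball z \<delta>" "0 \<le> t" "t \<le> 1" for e t
  proof -
    have "dist y (e + v) = dist z e" by (simp add: v_def dist_norm algebra_simps)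
    then have "e + v \<in> cball y r" using that(1) \<delta> by auto
    moreover have "e \<in> cball y r" using that(1) sub(2) by auto
    ultimately have "(1 - t) *\<^sub>R e + t *\<^sub>R (e + v) \<in> cball y r"
      using convex_cball[of y r] that by (auto simp: convex_alt)
    then show ?thesis by (simp add: algebra_simps)
  qed
  obtain C1 where C1: "0 < C1" "\<And>F. F \<in> borel_measurable borel \<Longrightarrow> (\<integral>\<^sup>+y. indicator (cball z \<delta>) y * F (cinv c y) \<partial>lborel)
      \<le> ennreal C1 * (\<integral>\<^sup>+x. indicator (cinv c ` cball z \<delta>) x * F x \<partial>V)"
    by (rule chart_nn_bounds[OF c compact_cball order_trans[OF sub(2) r]]) blast
  obtain C2 where C2: "0 < C2" "\<And>F. F \<in> borel_measurable borel \<Longrightarrow> (\<integral>\<^sup>+x. indicator (cinv c ` cball y \<delta>) x * F x \<partial>V)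
      \<le> ennreal C2 * (\<integral>\<^sup>+x. indicator (cball y \<delta>) x * F (cinv c x) \<partial>lborel)"
    by (rule chart_nn_bounds[OF c compact_cball order_trans[OF sub' r]]) blast
  obtain C3 where C3: "0 < C3" "\<And>F. F \<in> borel_measurable borel \<Longrightarrow> (\<integral>\<^sup>+x. indicator (cball y r) x * F (cinv c x) \<partial>lborel)
      \<le> ennreal C3 * (\<integral>\<^sup>+x. indicator (cinv c ` cball y r) x * F x \<partial>V)"
    by (rule chart_nn_bounds[OF c compact_cball r]) blast
  obtain C4 where C4: "0 < C4" "\<And>\<phi> x. smooth_fun M \<phi> \<Longrightarrow> x \<in> cball y r \<Longrightarrow> covec c \<phi> x \<bullet> covec c \<phi> x
      \<le> C4 * tinner M (cinv c x) (gradient M \<phi> (cinv c x)) (gradient M \<phi> (cinv c x))"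
    by (rule covec_bounds[OF c compact_cball r]) blast
  obtain C0 where C0: "\<And>\<phi>. smooth_fun M \<phi> \<Longrightarrow> (\<And>x. x \<in> N \<Longrightarrow> \<phi> x = 0) \<Longrightarrow>
      (\<integral>\<^sup>+x. indicator W x * ennreal ((\<phi> x)\<^sup>2) \<partial>V) \<le> ennreal C0 * ennreal (energy \<phi>)"
    using W(3) unfolding controlled_def by blast
  \<comment> \<open>The first summand is the controlled mass near \<open>z\<close>, the second the
    translation error. \<open>C1\<close> to \<open>C3\<close> compare chart and manifold integrals,
    \<open>C4\<close> compares gradients, and the factors 2 come from splitting a square. The
    absolute value guards against a negative \<open>C0\<close>.\<close>
  define C where "C = C2 * (2 * (C1 * \<bar>C0\<bar>) + 2 * ((v \<bullet> v) * (C4 * C3)))"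
  have "controlled N (cinv c ` ball y \<delta>)"
    unfolding controlled_def
  proof (intro exI[of _ C] allI impI)
    fix \<phi> assume \<phi>: "smooth_fun M \<phi>" "\<forall>x\<in>N. \<phi> x = 0"
    let ?f = "\<lambda>x. \<phi> (cinv c x)"
    let ?E = "ennreal (energy \<phi>)"
    note m = smooth_square_measurable[OF \<phi>(1)]
    have cf: "continuous_on (cimg c) ?f" by (rule smooth_on_continuous[OF smooth_fun_chart[OF \<phi>(1) c]])
    have A: "(\<integral>\<^sup>+x. indicator (cball z \<delta>) x * ennreal ((?f x)\<^sup>2) \<partial>lborel) \<le> ennreal (C1 * \<bar>C0\<bar>) * ?E"
    proof -
      have "(\<integral>\<^sup>+x. indicator (cball z \<delta>) x * ennreal ((?f x)\<^sup>2) \<partial>lborel)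
        \<le> ennreal C1 * (\<integral>\<^sup>+x. indicator (cinv c ` cball z \<delta>) x * ennreal ((\<phi> x)\<^sup>2) \<partial>V)"
        by (rule C1(2)[OF m])
      also have "\<dots> \<le> ennreal C1 * (\<integral>\<^sup>+x. indicator W x * ennreal ((\<phi> x)\<^sup>2) \<partial>V)"
      proof (intro mult_left_mono nn_integral_mono)
        have "cinv c ` cball z \<delta> \<subseteq> W" using sub(1) cmap_image_cinv_in[OF c] by blast
        then show "indicator (cinv c ` cball z \<delta>) x * ennreal ((\<phi> x)\<^sup>2) \<le> indicator W x * ennreal ((\<phi> x)\<^sup>2)" for x
          by (auto simp: indicator_def)
      qed simp
      also have "\<dots> \<le> ennreal C1 * (ennreal C0 * ?E)" using C0 \<phi> by (intro mult_left_mono) auto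
      also have "\<dots> \<le> ennreal C1 * (ennreal \<bar>C0\<bar> * ?E)" by (intro mult_left_mono mult_right_mono ennreal_leI) auto
      finally show ?thesis using C1(1) by (simp add: ennreal_mult mult.assoc)
    qed
    have B: "(\<integral>\<^sup>+x. indicator (cball y r) x * ennreal (covec c \<phi> x \<bullet> covec c \<phi> x) \<partial>lborel) \<le> ennreal (C4 * C3) * ?E"
    proof -
      let ?T = "\<lambda>x. ennreal (tinner M x (gradient M \<phi> x) (gradient M \<phi> x))"
      have mT: "(\<lambda>x. ennreal C4 * ?T x) \<in> borel_measurable borel"
        using tinner_gradient_measurable[OF \<phi>(1)] by simp
      have "(\<integral>\<^sup>+x. indicator (cball y r) x * ennreal (covec c \<phi> x \<bullet> covec c \<phi> x) \<partial>lborel)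
        \<le> (\<integral>\<^sup>+x. indicator (cball y r) x * (ennreal C4 * ?T (cinv c x)) \<partial>lborel)"
        using C4 \<phi>(1) by (intro nn_integral_mono)
          (auto simp: indicator_def ennreal_mult[symmetric] tinner_nonneg intro!: ennreal_leI)
      also have "\<dots> \<le> ennreal C3 * (\<integral>\<^sup>+x. indicator (cinv c ` cball y r) x * (ennreal C4 * ?T x) \<partial>V)"
        by (rule C3(2)[OF mT])
      also have "\<dots> \<le> ennreal C3 * (\<integral>\<^sup>+x. ennreal C4 * ?T x \<partial>V)"
        by (intro mult_left_mono nn_integral_mono) (auto simp: indicator_def)
      also have "(\<integral>\<^sup>+x. ennreal C4 * ?T x \<partial>V) = ennreal C4 * ?E"
        using nn_integral_cmult[of ?T V "ennreal C4"] tinner_gradient_measurable[OF \<phi>(1)] ennreal_energy[OF \<phi>(1)] by simp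
      finally show ?thesis using C3(1) C4(1) by (simp add: ennreal_mult mult_ac)
    qed
    have tr: "(\<integral>\<^sup>+x. indicator (cball z \<delta>) x * ennreal ((?f (x + v) - ?f x)\<^sup>2) \<partial>lborel)
      \<le> ennreal (v \<bullet> v) * (\<integral>\<^sup>+x. indicator (cball y r) x * ennreal (covec c \<phi> x \<bullet> covec c \<phi> x) \<partial>lborel)"
      by (rule translation_estimate[OF open_cimg[OF c] covec_derivative[OF \<phi>(1) c] continuous_covec[OF \<phi>(1) c] compact_cball r])
        (use seg in auto)
    have mE: "(\<lambda>x. indicator (cball y \<delta>) x * ennreal ((?f x)\<^sup>2)) \<in> borel_measurable borel"
      by (intro indicator_ennreal_measurable continuous_intros continuous_on_subset[OF cf order_trans[OF sub' r]]) simp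
    have ms: "(\<lambda>x. indicator (cball z \<delta>) x * ennreal (2 * (?f x)\<^sup>2)) \<in> borel_measurable borel"
      "(\<lambda>x. indicator (cball z \<delta>) x * ennreal (2 * (?f (x + v) - ?f x)\<^sup>2)) \<in> borel_measurable borel"
      "(\<lambda>x. indicator (cball z \<delta>) x * ennreal ((?f x)\<^sup>2)) \<in> borel_measurable borel"
      "(\<lambda>x. indicator (cball z \<delta>) x * ennreal ((?f (x + v) - ?f x)\<^sup>2)) \<in> borel_measurable borel"
    proof -
      have 1: "continuous_on (cball z \<delta>) ?f" using continuous_on_subset[OF cf order_trans[OF sub(2) r]] .
      have "(\<lambda>x. x + v) ` cball z \<delta> \<subseteq> cimg c" using seg[of _ 1] r by force
      then have 2: "continuous_on (cball z \<delta>) (\<lambda>x. ?f (x + v))"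
        by (intro continuous_on_compose2[OF cf, of _ "\<lambda>x. x + v"] continuous_intros)
      show "(\<lambda>x. indicator (cball z \<delta>) x * ennreal (2 * (?f x)\<^sup>2)) \<in> borel_measurable borel"
        "(\<lambda>x. indicator (cball z \<delta>) x * ennreal (2 * (?f (x + v) - ?f x)\<^sup>2)) \<in> borel_measurable borel"
        "(\<lambda>x. indicator (cball z \<delta>) x * ennreal ((?f x)\<^sup>2)) \<in> borel_measurable borel"
        "(\<lambda>x. indicator (cball z \<delta>) x * ennreal ((?f (x + v) - ?f x)\<^sup>2)) \<in> borel_measurable borel"
        by (intro indicator_ennreal_measurable continuous_intros 1 2; simp)+
    qed
    have two: "(\<integral>\<^sup>+x. indicator (cball z \<delta>) x * ennreal (2 * q x) \<partial>lborel) = 2 * (\<integral>\<^sup>+x. indicator (cball z \<delta>) x * ennreal (q x) \<partial>lborel)"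
      if "(\<lambda>x. indicator (cball z \<delta>) x * ennreal (q x)) \<in> borel_measurable borel" "\<And>x. 0 \<le> q x" for q :: "real ^ 'n \<Rightarrow> real"
    proof -
      have "(\<lambda>x. indicator (cball z \<delta>) x * ennreal (q x)) \<in> borel_measurable lborel" using that(1) by simp
      from nn_integral_cmult[OF this, of 2] show ?thesis
        by (simp add: ennreal_mult that(2) mult_ac)
    qed
    have "(\<integral>\<^sup>+x. indicator (cball y \<delta>) x * ennreal ((?f x)\<^sup>2) \<partial>lborel)
      = (\<integral>\<^sup>+x. indicator (cball y \<delta>) (x + v) * ennreal ((?f (x + v))\<^sup>2) \<partial>lborel)"
      by (rule nn_integral_translate[OF mE, symmetric])
    also have "\<dots> \<le> (\<integral>\<^sup>+x. indicator (cball z \<delta>) x * ennreal (2 * (?f x)\<^sup>2)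
        + indicator (cball z \<delta>) x * ennreal (2 * (?f (x + v) - ?f x)\<^sup>2) \<partial>lborel)"
    proof (rule nn_integral_mono)
      fix x
      have "dist y (x + v) = dist z x" by (simp add: v_def dist_norm algebra_simps)
      then have i: "indicator (cball y \<delta>) (x + v) = (indicator (cball z \<delta>) x :: ennreal)" by (simp add: indicator_def)
      have "(?f (x + v))\<^sup>2 \<le> 2 * (?f x)\<^sup>2 + 2 * (?f (x + v) - ?f x)\<^sup>2"
        using zero_le_power2[of "?f (x + v) - 2 * ?f x"] by (simp add: power2_eq_square algebra_simps)
      then have "ennreal ((?f (x + v))\<^sup>2) \<le> ennreal (2 * (?f x)\<^sup>2 + 2 * (?f (x + v) - ?f x)\<^sup>2)"
        by (rule ennreal_leI)
      also have "\<dots> = ennreal (2 * (?f x)\<^sup>2) + ennreal (2 * (?f (x + v) - ?f x)\<^sup>2)"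
        by (rule ennreal_plus) simp_all
      finally show "indicator (cball y \<delta>) (x + v) * ennreal ((?f (x + v))\<^sup>2)
        \<le> indicator (cball z \<delta>) x * ennreal (2 * (?f x)\<^sup>2) + indicator (cball z \<delta>) x * ennreal (2 * (?f (x + v) - ?f x)\<^sup>2)"
        unfolding i distrib_left[symmetric] by (rule mult_left_mono) simp
    qed
    also have "\<dots> = 2 * (\<integral>\<^sup>+x. indicator (cball z \<delta>) x * ennreal ((?f x)\<^sup>2) \<partial>lborel)
      + 2 * (\<integral>\<^sup>+x. indicator (cball z \<delta>) x * ennreal ((?f (x + v) - ?f x)\<^sup>2) \<partial>lborel)"
      using ms by (subst nn_integral_add) (simp_all add: two)
    also have "\<dots> \<le> 2 * (ennreal (C1 * \<bar>C0\<bar>) * ?E) + 2 * (ennreal (v \<bullet> v) * (ennreal (C4 * C3) * ?E))"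
      by (intro add_mono mult_left_mono A order_trans[OF tr] B) auto
    finally have main: "(\<integral>\<^sup>+x. indicator (cball y \<delta>) x * ennreal ((?f x)\<^sup>2) \<partial>lborel)
      \<le> 2 * (ennreal (C1 * \<bar>C0\<bar>) * ?E) + 2 * (ennreal (v \<bullet> v) * (ennreal (C4 * C3) * ?E))" .
    have "(\<integral>\<^sup>+x. indicator (cinv c ` ball y \<delta>) x * ennreal ((\<phi> x)\<^sup>2) \<partial>V)
      \<le> (\<integral>\<^sup>+x. indicator (cinv c ` cball y \<delta>) x * ennreal ((\<phi> x)\<^sup>2) \<partial>V)"
      by (intro nn_integral_mono) (auto simp: indicator_def)
    also have "\<dots> \<le> ennreal C2 * (\<integral>\<^sup>+x. indicator (cball y \<delta>) x * ennreal ((?f x)\<^sup>2) \<partial>lborel)"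
      by (rule C2(2)[OF m])
    also have "\<dots> \<le> ennreal C2 * (2 * (ennreal (C1 * \<bar>C0\<bar>) * ?E) + 2 * (ennreal (v \<bullet> v) * (ennreal (C4 * C3) * ?E)))"
      by (rule mult_left_mono[OF main]) simp
    also have "\<dots> = ennreal C * ?E"
      using C1(1) C2(1) C3(1) C4(1)
      by (simp add: C_def ennreal_mult ennreal_plus distrib_left distrib_right mult_ac)
    finally show "(\<integral>\<^sup>+x. indicator (cinv c ` ball y \<delta>) x * ennreal ((\<phi> x)\<^sup>2) \<partial>V) \<le> ennreal C * ?E" .
  qed
  from that[OF \<delta> this] show ?thesis .
qed

text \<open>The points having a controlled neighbourhood form a set that is open by definition,
  closed by \<open>controlled_step\<close>, and nonempty because it contains \<open>N\<close>.
  Connectedness makes it everything, and compactness leaves finitely many constants to add.\<close>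

lemma Poincare:
  assumes N: "open N" "N \<noteq> {}"
  obtains C where "0 \<le> C"
    "\<And>\<phi>. smooth_fun M \<phi> \<Longrightarrow> (\<And>x. x \<in> N \<Longrightarrow> \<phi> x = 0) \<Longrightarrow> (LINT x|V. (\<phi> x)\<^sup>2) \<le> C * energy \<phi>"
proof -
  define P where "P = {p. \<exists>W. open W \<and> p \<in> W \<and> controlled N W}"
  have "open P"
    unfolding open_subopen[of P] by (auto simp: P_def)
  moreover have "closed P"
  proof -
    \<comment> \<open>A coordinate ball about a limit point contains a controlled point, from which
      control is transported to the centre of the ball.\<close>
    have "p \<in> P" if p: "p \<in> closure P" for p
    proof -
      obtain c where c: "c \<in> charts M" "p \<in> cdom c" by (rule ex_chart)
      obtain r where r: "0 < r" "cball (cmap c p) r \<subseteq> cimg c"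
        by (rule chart_ball[OF c(1) cmap_in[OF c(2)]])
      have sub: "ball (cmap c p) r \<subseteq> cimg c" using r(2) ball_subset_cball by blast
      have "open (cinv c ` ball (cmap c p) r)" "p \<in> cinv c ` ball (cmap c p) r"
        using open_cinv_image[OF c(1) open_ball sub] r(1) cinv_cmap[OF c] by (auto intro!: image_eqI[of p _ "cmap c p"])
      then obtain z where z: "z \<in> ball (cmap c p) r" "cinv c z \<in> P"
        using p unfolding closure_iff_nhds_not_empty by blast
      then obtain W where W: "open W" "cinv c z \<in> W" "controlled N W" by (auto simp: P_def)
      obtain \<delta> where \<delta>: "0 < \<delta>" "\<delta> \<le> r" "controlled N (cinv c ` ball (cmap c p) \<delta>)"
        by (rule controlled_step[OF c(1) r(2) z(1) W])
      have "ball (cmap c p) \<delta> \<subseteq> cimg c" using \<delta>(2) sub by auto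
      then have "open (cinv c ` ball (cmap c p) \<delta>)" by (rule open_cinv_image[OF c(1) open_ball])
      moreover have "p \<in> cinv c ` ball (cmap c p) \<delta>"
        using \<delta>(1) cinv_cmap[OF c] by (auto intro!: image_eqI[of p _ "cmap c p"])
      ultimately show ?thesis using \<delta>(3) by (auto simp: P_def)
    qed
    then have "closure P = P" using closure_subset by blast
    then show ?thesis by (metis closed_closure)
  qed
  moreover have "controlled N N"
    unfolding controlled_def
  proof (intro exI[of _ 0] allI impI)
    fix \<phi> :: "'a \<Rightarrow> real" assume "\<forall>x\<in>N. \<phi> x = 0"
    then have "(\<lambda>x. indicator N x * ennreal ((\<phi> x)\<^sup>2)) = (\<lambda>x. 0)" by (auto simp: indicator_def)
    then show "(\<integral>\<^sup>+x. indicator N x * ennreal ((\<phi> x)\<^sup>2) \<partial>V) \<le> ennreal 0 * ennreal (energy \<phi>)" by simp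
  qed
  then have "P \<noteq> {}" using N by (auto simp: P_def)
  ultimately have "P = UNIV"
    using connectedD[OF connected_UNIV, of P "- P"] by (auto simp: open_Compl)
  then have "\<exists>W. open W \<and> p \<in> W \<and> controlled N W" for p by (auto simp: P_def)
  then obtain W where W: "\<And>p. open (W p)" "\<And>p. p \<in> W p" "\<And>p. controlled N (W p)" by metis
  obtain F where F: "finite F" "UNIV \<subseteq> (\<Union>p\<in>F. W p)"
    by (rule compactE_image[OF compact_UNIV, of UNIV W]) (use W(1,2) in blast)+
  obtain C where C: "\<And>p \<phi>. smooth_fun M \<phi> \<Longrightarrow> (\<And>x. x \<in> N \<Longrightarrow> \<phi> x = 0) \<Longrightarrow>
      (\<integral>\<^sup>+x. indicator (W p) x * ennreal ((\<phi> x)\<^sup>2) \<partial>V) \<le> ennreal (C p) * ennreal (energy \<phi>)"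
    using W(3) unfolding controlled_def by metis
  show ?thesis
  proof (rule that[of "\<Sum>p\<in>F. \<bar>C p\<bar>"])
    show "0 \<le> (\<Sum>p\<in>F. \<bar>C p\<bar>)" by (rule sum_nonneg) simp
    fix \<phi> assume \<phi>: "smooth_fun M \<phi>" "\<And>x. x \<in> N \<Longrightarrow> \<phi> x = 0"
    note m = smooth_square_measurable[OF \<phi>(1)]
    have i: "integrable V (\<lambda>x. (\<phi> x)\<^sup>2)" using L2_fun_smooth[OF \<phi>(1)] by (simp add: L2_fun_def)
    have "ennreal (LINT x|V. (\<phi> x)\<^sup>2) = (\<integral>\<^sup>+x. ennreal ((\<phi> x)\<^sup>2) \<partial>V)"
      by (rule nn_integral_eq_integral[symmetric, OF i]) simp
    also have "\<dots> \<le> (\<integral>\<^sup>+x. (\<Sum>p\<in>F. indicator (W p) x * ennreal ((\<phi> x)\<^sup>2)) \<partial>V)"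
    proof (rule nn_integral_mono)
      fix x
      obtain p where p: "p \<in> F" "x \<in> W p" using F(2) by blast
      then have "ennreal ((\<phi> x)\<^sup>2) = indicator (W p) x * ennreal ((\<phi> x)\<^sup>2)" by simp
      also have "\<dots> \<le> (\<Sum>p\<in>F. indicator (W p) x * ennreal ((\<phi> x)\<^sup>2))"
        using p(1) F(1) by (intro member_le_sum) simp_all
      finally show "ennreal ((\<phi> x)\<^sup>2) \<le> (\<Sum>p\<in>F. indicator (W p) x * ennreal ((\<phi> x)\<^sup>2))" .
    qed
    also have "\<dots> = (\<Sum>p\<in>F. \<integral>\<^sup>+x. indicator (W p) x * ennreal ((\<phi> x)\<^sup>2) \<partial>V)"
      using W(1) m by (intro nn_integral_sum) auto
    also have "\<dots> \<le> (\<Sum>p\<in>F. ennreal \<bar>C p\<bar> * ennreal (energy \<phi>))"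
      by (intro sum_mono order_trans[OF C[OF \<phi>]] mult_right_mono ennreal_leI) auto
    also have "\<dots> = ennreal ((\<Sum>p\<in>F. \<bar>C p\<bar>) * energy \<phi>)"
      by (simp add: sum_distrib_right[symmetric] ennreal_mult sum_nonneg energy_nonneg)
    finally show "(LINT x|V. (\<phi> x)\<^sup>2) \<le> (\<Sum>p\<in>F. \<bar>C p\<bar>) * energy \<phi>"
      by (simp add: energy_nonneg sum_nonneg mult_nonneg_nonneg ennreal_le_iff)
  qed
qed

end

section \<open>Transplantation between the manifold and a chart\<close>

definition grad_vec :: "(real ^ 'n::finite \<Rightarrow> real) \<Rightarrow> real ^ 'n \<Rightarrow> real ^ 'n" where
  "grad_vec w y = (\<chi> i. dirderiv (axis i 1) w y)"

definition sob_eucl :: "(real ^ 'n::finite \<Rightarrow> real) \<Rightarrow> real" where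
  "sob_eucl w = (LINT y|lborel. (w y)\<^sup>2 + grad_vec w y \<bullet> grad_vec w y)"

lemma sob_eucl_nonneg: "0 \<le> sob_eucl w"
  by (simp add: sob_eucl_def)

definition supported :: "('e \<Rightarrow> real) \<Rightarrow> 'e set \<Rightarrow> bool" where
  "supported w Y \<longleftrightarrow> (\<forall>y. y \<notin> Y \<longrightarrow> w y = 0)"

lemma supported_mono: "supported w Y \<Longrightarrow> Y \<subseteq> Z \<Longrightarrow> supported w Z"
  by (auto simp: supported_def)

lemma continuous_grad_vec:
  assumes "smooth_on w UNIV" shows "continuous_on UNIV (grad_vec w)"
  unfolding grad_vec_def
  by (intro continuous_on_vec_lambda smooth_on_continuous smooth_on_dirderiv assms) simp

lemma grad_vec_diff:
  fixes v w :: "real ^ 'n::finite \<Rightarrow> real"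
  assumes "smooth_on v UNIV" "smooth_on w UNIV"
  shows "grad_vec (\<lambda>y. v y - w y) y = grad_vec v y - grad_vec w y"
proof -
  have "((\<lambda>y. v y - w y) has_derivative
      (\<lambda>h. frechet_derivative v (at y) h - frechet_derivative w (at y) h)) (at y)"
    using smooth_on_has_derivative[OF assms(1)] smooth_on_has_derivative[OF assms(2)]
    by (intro has_derivative_diff) auto
  then show ?thesis by (simp add: grad_vec_def vec_eq_iff frechet_derivative_eq)
qed

lemma grad_vec_translate:
  fixes w :: "real ^ 'n::finite \<Rightarrow> real"
  assumes "smooth_on w UNIV"
  shows "grad_vec (\<lambda>y. w (y + v)) y = grad_vec w (y + v)"
proof -
  have "((\<lambda>y. y + v) has_derivative (\<lambda>h. h)) (at y)" by (auto intro!: derivative_eq_intros)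
  from diff_chain_at[OF this smooth_on_has_derivative[OF assms, of "y + v"]]
  have "((\<lambda>y. w (y + v)) has_derivative frechet_derivative w (at (y + v))) (at y)"
    by (simp add: o_def)
  then show ?thesis by (simp add: grad_vec_def frechet_derivative_eq)
qed

lemma grad_vec_supported:
  assumes "supported w Y" "closed Y" "y \<notin> Y"
  shows "grad_vec w y = 0"
proof -
  have "frechet_derivative w (at y) = frechet_derivative (\<lambda>y. 0) (at y)"
    by (rule frechet_derivative_cong_open[of "- Y"])
      (use assms in \<open>auto simp: supported_def open_Compl\<close>)
  then show ?thesis by (simp add: grad_vec_def vec_eq_iff frechet_derivative_eq[OF has_derivative_const])
qed

lemma sob_eucl_integrable:
  fixes w :: "real ^ 'n::finite \<Rightarrow> real"
  assumes "smooth_on w UNIV" "compact Y" "supported w Y"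
  shows "integrable lborel (\<lambda>y. (w y)\<^sup>2 + grad_vec w y \<bullet> grad_vec w y)"
proof (rule integrable_compact_support[OF _ assms(2)])
  show "continuous_on UNIV (\<lambda>y. (w y)\<^sup>2 + grad_vec w y \<bullet> grad_vec w y)"
    by (intro continuous_intros continuous_grad_vec smooth_on_continuous assms)
  show "(w y)\<^sup>2 + grad_vec w y \<bullet> grad_vec w y = 0" if "y \<notin> Y" for y
    using grad_vec_supported[OF assms(3) compact_imp_closed[OF assms(2)] that] assms(3) that
    by (simp add: supported_def)
qed

lemma ennreal_sob_eucl:
  fixes w :: "real ^ 'n::finite \<Rightarrow> real"
  assumes "smooth_on w UNIV" "compact Y" "supported w Y"
  shows "(\<integral>\<^sup>+y. ennreal ((w y)\<^sup>2 + grad_vec w y \<bullet> grad_vec w y) \<partial>lborel) = ennreal (sob_eucl w)"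
  unfolding sob_eucl_def by (rule nn_integral_eq_integral[OF sob_eucl_integrable[OF assms]]) simp

lemma sob_eucl_translate:
  fixes w :: "real ^ 'n::finite \<Rightarrow> real"
  assumes "smooth_on w UNIV"
  shows "sob_eucl (\<lambda>y. w (y + v)) = sob_eucl w"
proof -
  have "continuous_on UNIV (\<lambda>y. (w y)\<^sup>2 + grad_vec w y \<bullet> grad_vec w y)"
    by (intro continuous_intros continuous_grad_vec smooth_on_continuous assms)
  from integral_translate(2)[OF borel_measurable_continuous_onI[OF this], of v]
  show ?thesis by (simp add: sob_eucl_def grad_vec_translate[OF assms])
qed

lemma square_diff_le: "(a - b)\<^sup>2 \<le> 2 * a\<^sup>2 + 2 * (b :: real)\<^sup>2"
  using zero_le_power2[of "a + b"] by (simp add: power2_eq_square algebra_simps)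

lemma inner_diff_le: "(a - b) \<bullet> (a - b) \<le> 2 * (a \<bullet> a) + 2 * (b \<bullet> (b :: 'a::real_inner))"
  using inner_ge_zero[of "a + b"] by (simp add: inner_add inner_diff inner_commute)

lemma sob_eucl_diff:
  fixes v w :: "real ^ 'n::finite \<Rightarrow> real"
  assumes v: "smooth_on v UNIV" "supported v Y" and w: "smooth_on w UNIV" "supported w Y" and Y: "compact Y"
  shows "sob_eucl (\<lambda>y. v y - w y) \<le> 2 * sob_eucl v + 2 * sob_eucl w"
proof -
  let ?q = "\<lambda>w y. (w y)\<^sup>2 + grad_vec w y \<bullet> grad_vec w y"
  have s: "smooth_on (\<lambda>y. v y - w y) UNIV" "supported (\<lambda>y. v y - w y) Y"
    using v w by (auto intro: smooth_on_diff simp: supported_def)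
  have "sob_eucl (\<lambda>y. v y - w y) \<le> (LINT y|lborel. 2 * ?q v y + 2 * ?q w y)"
    unfolding sob_eucl_def
  proof (rule integral_mono)
    show "integrable lborel (?q (\<lambda>y. v y - w y))" by (rule sob_eucl_integrable[OF s(1) Y s(2)])
    show "integrable lborel (\<lambda>y. 2 * ?q v y + 2 * ?q w y)"
      by (intro Bochner_Integration.integrable_add integrable_mult_right
          sob_eucl_integrable[OF v(1) Y v(2)] sob_eucl_integrable[OF w(1) Y w(2)])
    show "?q (\<lambda>y. v y - w y) y \<le> 2 * ?q v y + 2 * ?q w y" for y
      using square_diff_le[of "v y" "w y"] inner_diff_le[of "grad_vec v y" "grad_vec w y"]
      by (simp add: grad_vec_diff[OF v(1) w(1)])
  qed
  also have "\<dots> = (LINT y|lborel. 2 * ?q v y) + (LINT y|lborel. 2 * ?q w y)"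
    by (intro Bochner_Integration.integral_add integrable_mult_right
        sob_eucl_integrable[OF v(1) Y v(2)] sob_eucl_integrable[OF w(1) Y w(2)])
  also have "\<dots> = 2 * sob_eucl v + 2 * sob_eucl w"
    by (simp only: integral_mult_right_zero sob_eucl_def)
  finally show ?thesis .
qed

text \<open>A smooth function with compact support and its gradient are continuous and bounded, so
  dominated convergence applies. The rate depends on \<open>w\<close>.\<close>

lemma sob_eucl_translation_tendsto:
  fixes w :: "real ^ 'n::finite \<Rightarrow> real"
  assumes w: "smooth_on w UNIV" "supported w Y" "compact Y"
    and T: "\<And>k::nat. 0 \<le> T k \<and> T k \<le> 1" "T \<longlonglongrightarrow> 0"
  shows "(\<lambda>k. sob_eucl (\<lambda>y. w (y - T k *\<^sub>R v) - w y)) \<longlonglongrightarrow> 0"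
proof -
  let ?g = "grad_vec w"
  let ?q = "\<lambda>k y. (w (y - T k *\<^sub>R v) - w y)\<^sup>2 + (?g (y - T k *\<^sub>R v) - ?g y) \<bullet> (?g (y - T k *\<^sub>R v) - ?g y)"
  have cw: "continuous_on UNIV w" and cg: "continuous_on UNIV ?g"
    using w(1) by (auto intro: smooth_on_continuous continuous_grad_vec)
  note [measurable] = borel_measurable_continuous_onI[OF cw] borel_measurable_continuous_onI[OF cg]
  have sm: "smooth_on (\<lambda>y. w (y - T k *\<^sub>R v)) UNIV" for k
    using smooth_on_translate[OF w(1), of "- (T k *\<^sub>R v)"] by simp
  have eq: "sob_eucl (\<lambda>y. w (y - T k *\<^sub>R v) - w y) = (LINT y|lborel. ?q k y)" for k
    using grad_vec_translate[OF w(1), of "- (T k *\<^sub>R v)"]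
    by (simp add: sob_eucl_def grad_vec_diff[OF sm w(1)])
  have off: "w y = 0" "?g y = 0" if "y \<notin> Y" for y
    using w that grad_vec_supported[OF w(2) compact_imp_closed[OF w(3)] that] by (auto simp: supported_def)
  obtain B where B: "\<And>y. (w y)\<^sup>2 + ?g y \<bullet> ?g y \<le> B" "0 \<le> B"
  proof -
    have "continuous_on Y (\<lambda>y. (w y)\<^sup>2 + ?g y \<bullet> ?g y)"
      by (intro continuous_intros continuous_on_subset[OF cw] continuous_on_subset[OF cg]) auto
    then have "bounded ((\<lambda>y. (w y)\<^sup>2 + ?g y \<bullet> ?g y) ` Y)"
      by (intro compact_imp_bounded compact_continuous_image w(3))
    then obtain b where b: "\<And>y. y \<in> Y \<Longrightarrow> \<bar>(w y)\<^sup>2 + ?g y \<bullet> ?g y\<bar> \<le> b" by (auto simp: bounded_iff)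
    show ?thesis
    proof (rule that[of "\<bar>b\<bar>"])
      show "(w y)\<^sup>2 + ?g y \<bullet> ?g y \<le> \<bar>b\<bar>" for y
        using b[of y] off[of y] by (cases "y \<in> Y") auto
    qed simp
  qed
  \<comment> \<open>Contains the support of \<open>w\<close> and of all its translates by at most
    one multiple of \<open>v\<close>.\<close>
  define Z where "Z = (\<lambda>(y, t). y + t *\<^sub>R v) ` (Y \<times> {0..1::real})"
  have Z: "compact Z"
    unfolding Z_def case_prod_unfold
    by (intro compact_continuous_image compact_Times w(3) compact_Icc continuous_intros)
  have YZ: "y \<in> Z" if "y - t *\<^sub>R v \<in> Y" "0 \<le> t" "t \<le> 1" for y t
    unfolding Z_def using that by (intro image_eqI[of _ _ "(y - t *\<^sub>R v, t)"]) auto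
  have q0: "?q k y = 0" if "y \<notin> Z" for k y
  proof -
    have "y \<notin> Y" "y - T k *\<^sub>R v \<notin> Y" using YZ[of y 0] YZ[of y "T k"] T(1)[of k] that by auto
    then show ?thesis using off by simp
  qed
  have qB: "?q k y \<le> 4 * B" for k y
    using square_diff_le[of "w (y - T k *\<^sub>R v)" "w y"] inner_diff_le[of "?g (y - T k *\<^sub>R v)" "?g y"]
      B(1)[of y] B(1)[of "y - T k *\<^sub>R v"] by linarith
  have qn: "0 \<le> ?q k y" for k y by simp
  have "(\<lambda>k. LINT y|lborel. ?q k y) \<longlonglongrightarrow> (LINT (y :: real ^ 'n)|lborel. 0)"
  proof (rule integral_dominated_convergence[where w = "\<lambda>y. indicator Z y *\<^sub>R (4 * B)"])
    show "integrable lborel (\<lambda>y. indicator Z y *\<^sub>R (4 * B))"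
      by (intro borel_integrable_compact Z continuous_intros)
    show "AE y in lborel. (\<lambda>k. ?q k y) \<longlonglongrightarrow> 0"
    proof (rule AE_I2)
      fix y
      have t: "(\<lambda>k. y - T k *\<^sub>R v) \<longlonglongrightarrow> y"
        using tendsto_diff[OF tendsto_const tendsto_scaleR[OF T(2) tendsto_const], of y v] by simp
      have "(\<lambda>k. w (y - T k *\<^sub>R v)) \<longlonglongrightarrow> w y" "(\<lambda>k. ?g (y - T k *\<^sub>R v)) \<longlonglongrightarrow> ?g y"
        using cw cg t by (auto intro: isCont_tendsto_compose simp: continuous_on_eq_continuous_at)
      then have "(\<lambda>k. ?q k y) \<longlonglongrightarrow> (w y - w y)\<^sup>2 + (?g y - ?g y) \<bullet> (?g y - ?g y)"
        by (intro tendsto_intros)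
      then show "(\<lambda>k. ?q k y) \<longlonglongrightarrow> 0" by simp
    qed
    show "AE y in lborel. norm (?q k y) \<le> indicator Z y *\<^sub>R (4 * B)" for k
    proof (rule AE_I2)
      fix y
      show "norm (?q k y) \<le> indicator Z y *\<^sub>R (4 * B)"
      proof (cases "y \<in> Z")
        case True
        have "norm (?q k y) = ?q k y" using qn[where k = k and y = y] by (simp only: real_norm_def abs_of_nonneg)
        then show ?thesis using qB[where k = k and y = y] True by simp
      next
        case False
        have "norm (?q k y) = 0" using q0[OF False] by (simp only: norm_zero)
        then show ?thesis using False by simp
      qed
    qed
  qed simp_all
  then show ?thesis by (simp add: eq)
qed

section \<open>The squared Sobolev norm of smooth functions on the manifold and in charts\<close>

context closed_manifold
begin

text \<open>The square of the H^1 norm for smooth functions, with the classical gradient in place of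
  the choice \<open>wgrad\<close>.\<close>

definition sob :: "('a \<Rightarrow> real) \<Rightarrow> real" where
  "sob \<phi> = (LINT x|V. (\<phi> x)\<^sup>2) + energy \<phi>"

lemma sob_nonneg: "0 \<le> sob \<phi>"
  by (simp add: sob_def energy_nonneg)

lemma sob_density_integrable:
  assumes "smooth_fun M \<phi>"
  shows "integrable V (\<lambda>x. (\<phi> x)\<^sup>2)" "integrable V (\<lambda>x. tinner M x (gradient M \<phi> x) (gradient M \<phi> x))"
  using L2_fun_smooth[OF assms] L2_field_gradient[OF assms] by (auto simp: L2_fun_def L2_field_def)

lemma sob_eq:
  assumes "smooth_fun M \<phi>"
  shows "sob \<phi> = (LINT x|V. (\<phi> x)\<^sup>2 + tinner M x (gradient M \<phi> x) (gradient M \<phi> x))"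
  using sob_density_integrable[OF assms] by (simp add: sob_def energy_def ip_def)

lemma ennreal_sob:
  assumes "smooth_fun M \<phi>"
  shows "(\<integral>\<^sup>+x. ennreal ((\<phi> x)\<^sup>2 + tinner M x (gradient M \<phi> x) (gradient M \<phi> x)) \<partial>V) = ennreal (sob \<phi>)"
  unfolding sob_eq[OF assms]
  by (rule nn_integral_eq_integral) (use sob_density_integrable[OF assms] in \<open>auto simp: tinner_nonneg\<close>)

lemma sob_density_measurable:
  assumes "smooth_fun M \<phi>"
  shows "(\<lambda>x. ennreal ((\<phi> x)\<^sup>2 + tinner M x (gradient M \<phi> x) (gradient M \<phi> x))) \<in> borel_measurable borel"
  using borel_measurable_continuous_onI[OF continuous_tinner_gradient[OF assms]]
    borel_measurable_continuous_onI[OF smooth_fun_continuous[OF assms]] by simp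

lemma smooth_fun_diff: "smooth_fun M \<phi> \<Longrightarrow> smooth_fun M \<psi> \<Longrightarrow> smooth_fun M (\<lambda>x. \<phi> x - \<psi> x)"
  using smooth_fun_lin[of \<phi> \<psi> 1 "-1"] by simp

lemma sob_lin:
  assumes "smooth_fun M \<phi>" "smooth_fun M \<psi>"
  shows "sob (\<lambda>x. a * \<phi> x + b * \<psi> x) \<le> 2 * a\<^sup>2 * sob \<phi> + 2 * b\<^sup>2 * sob \<psi>"
proof -
  let ?q = "\<lambda>\<phi> x. (\<phi> x)\<^sup>2 + tinner M x (gradient M \<phi> x) (gradient M \<phi> x)"
  have i: "integrable V (?q \<phi>)" if "smooth_fun M \<phi>" for \<phi>
    using sob_density_integrable[OF that] by simp
  have "sob (\<lambda>x. a * \<phi> x + b * \<psi> x) \<le> (LINT x|V. 2 * a\<^sup>2 * ?q \<phi> x + 2 * b\<^sup>2 * ?q \<psi> x)"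
    unfolding sob_eq[OF smooth_fun_lin[OF assms]]
  proof (rule integral_mono)
    show "integrable V (?q (\<lambda>x. a * \<phi> x + b * \<psi> x))" by (rule i[OF smooth_fun_lin[OF assms]])
    show "integrable V (\<lambda>x. 2 * a\<^sup>2 * ?q \<phi> x + 2 * b\<^sup>2 * ?q \<psi> x)"
      using i[OF assms(1)] i[OF assms(2)] by simp
    fix x
    have "(a * \<phi> x + b * \<psi> x)\<^sup>2 \<le> 2 * a\<^sup>2 * (\<phi> x)\<^sup>2 + 2 * b\<^sup>2 * (\<psi> x)\<^sup>2"
      using square_diff_le[of "a * \<phi> x" "- b * \<psi> x"] by (simp add: power_mult_distrib)
    moreover have "tinner M x (\<lambda>c. a *\<^sub>R gradient M \<phi> x c + b *\<^sub>R gradient M \<psi> x c) (\<lambda>c. a *\<^sub>R gradient M \<phi> x c + b *\<^sub>R gradient M \<psi> x c)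
      \<le> 2 * a\<^sup>2 * tinner M x (gradient M \<phi> x) (gradient M \<phi> x) + 2 * b\<^sup>2 * tinner M x (gradient M \<psi> x) (gradient M \<psi> x)"
      using tinner_nonneg[of x "\<lambda>c. a *\<^sub>R gradient M \<phi> x c + (- b) *\<^sub>R gradient M \<psi> x c"]
      unfolding tinner_lin_square by simp
    ultimately show "?q (\<lambda>x. a * \<phi> x + b * \<psi> x) x \<le> 2 * a\<^sup>2 * ?q \<phi> x + 2 * b\<^sup>2 * ?q \<psi> x"
      unfolding gradient_lin[OF assms] by (simp add: algebra_simps)
  qed
  also have "\<dots> = 2 * a\<^sup>2 * sob \<phi> + 2 * b\<^sup>2 * sob \<psi>"
    using i[OF assms(1)] i[OF assms(2)] unfolding sob_eq[OF assms(1)] sob_eq[OF assms(2)] by simp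
  finally show ?thesis .
qed

lemma sob_add:
  assumes "smooth_fun M \<phi>" "smooth_fun M \<psi>"
  shows "sob (\<lambda>x. \<phi> x + \<psi> x) \<le> 2 * sob \<phi> + 2 * sob \<psi>"
  using sob_lin[OF assms, of 1 1] by simp

text \<open>Each application of \<open>sob_add\<close> costs a factor 2. The exponential constant is
  harmless, since the sum will run over a fixed finite partition of unity.\<close>

lemma sob_sum:
  assumes "finite I" "\<And>i. i \<in> I \<Longrightarrow> smooth_fun M (\<phi> i)"
  shows "sob (\<lambda>x. \<Sum>i\<in>I. \<phi> i x) \<le> 2 ^ card I * (\<Sum>i\<in>I. sob (\<phi> i))"
  using assms
proof (induction I)
  case empty
  have "sob (\<lambda>x. 0) = 0"
    using gradient_local[OF open_UNIV UNIV_I, of "\<lambda>x. 0"] by (simp add: sob_def energy_def ip_def)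
  then show ?case by simp
next
  case (insert j I)
  have "sob (\<lambda>x. \<Sum>i\<in>insert j I. \<phi> i x) = sob (\<lambda>x. \<phi> j x + (\<Sum>i\<in>I. \<phi> i x))"
    using insert by simp
  also have "\<dots> \<le> 2 * sob (\<phi> j) + 2 * sob (\<lambda>x. \<Sum>i\<in>I. \<phi> i x)"
    using insert by (intro sob_add smooth_fun_sum) auto
  also have "\<dots> \<le> 2 ^ card (insert j I) * sob (\<phi> j) + 2 * (2 ^ card I * (\<Sum>i\<in>I. sob (\<phi> i)))"
  proof (intro add_mono mult_right_mono mult_left_mono)
    have "(2::real) ^ 1 \<le> 2 ^ card (insert j I)"
      using insert by (intro power_increasing) auto
    then show "(2::real) \<le> 2 ^ card (insert j I)" by simp
  qed (use insert sob_nonneg in auto)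
  also have "\<dots> = 2 ^ card (insert j I) * (\<Sum>i\<in>insert j I. sob (\<phi> i))"
    using insert by (simp add: algebra_simps)
  finally show ?case .
qed

lemma gradient_mult:
  assumes "smooth_fun M \<rho>" "smooth_fun M \<phi>"
  shows "gradient M (\<lambda>x. \<rho> x * \<phi> x) p = (\<lambda>c. \<rho> p *\<^sub>R gradient M \<phi> p c + \<phi> p *\<^sub>R gradient M \<rho> p c)"
proof
  fix c
  show "gradient M (\<lambda>x. \<rho> x * \<phi> x) p c = \<rho> p *\<^sub>R gradient M \<phi> p c + \<phi> p *\<^sub>R gradient M \<rho> p c"
  proof (cases "c \<in> charts M \<and> p \<in> cdom c")
    case True
    then have c: "c \<in> charts M" and p: "p \<in> cdom c" by auto
    have "covec c (\<lambda>x. \<rho> x * \<phi> x) (cmap c p) = \<rho> p *\<^sub>R covec c \<phi> (cmap c p) + \<phi> p *\<^sub>R covec c \<rho> (cmap c p)"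
    proof (rule covec_eqI[OF smooth_fun_mult[OF assms] c cmap_in[OF p]])
      show "((\<lambda>y. \<rho> (cinv c y) * \<phi> (cinv c y)) has_derivative
        (\<bullet>) (\<rho> p *\<^sub>R covec c \<phi> (cmap c p) + \<phi> p *\<^sub>R covec c \<rho> (cmap c p))) (at (cmap c p))"
        by (rule has_derivative_eq_rhs[OF has_derivative_mult[OF
              covec_derivative[OF assms(1) c cmap_in[OF p]] covec_derivative[OF assms(2) c cmap_in[OF p]]]])
          (simp add: inner_add_left fun_eq_iff cinv_cmap[OF c p])
    qed
    then show ?thesis
      by (simp add: gradient_chart[OF c p] matrix_vector_right_distrib matrix_vector_mult_scaleR)
  next
    case False
    then show ?thesis by (auto simp: gradient_def)
  qed
qed

lemma continuous_bounded:
  fixes F :: "'a \<Rightarrow> real"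
  assumes "continuous_on UNIV F"
  obtains b where "0 < b" "\<And>x. \<bar>F x\<bar> \<le> b"
proof -
  have "bounded (range F)"
    using compact_continuous_image[OF assms compact_UNIV] by (rule compact_imp_bounded)
  then obtain b where b: "\<And>x. \<bar>F x\<bar> \<le> b" by (auto simp: bounded_iff)
  show ?thesis
  proof (rule that[of "\<bar>b\<bar> + 1"])
    show "\<bar>F x\<bar> \<le> \<bar>b\<bar> + 1" for x using b[of x] by linarith
  qed simp
qed

text \<open>By the product rule the constant depends only on the suprema of the squared multiplier
  and of its squared gradient, which are finite by compactness.\<close>

lemma sob_mult:
  assumes \<rho>: "smooth_fun M \<rho>"
  obtains C where "0 < C" "\<And>\<phi>. smooth_fun M \<phi> \<Longrightarrow> sob (\<lambda>x. \<rho> x * \<phi> x) \<le> C * sob \<phi>"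
proof -
  have "continuous_on UNIV (\<lambda>x. (\<rho> x)\<^sup>2)" by (intro continuous_intros smooth_fun_continuous[OF \<rho>])
  then obtain a where a: "0 < a" "\<And>x. \<bar>(\<rho> x)\<^sup>2\<bar> \<le> a"
    by (rule continuous_bounded) blast
  obtain b where b: "0 < b" "\<And>x. \<bar>tinner M x (gradient M \<rho> x) (gradient M \<rho> x)\<bar> \<le> b"
    by (rule continuous_bounded[OF continuous_tinner_gradient[OF \<rho>]]) blast
  define C where "C = 2 * a + 2 * b"
  show ?thesis
  proof (rule that[of C])
    show "0 < C" using a b by (simp add: C_def)
    fix \<phi> assume \<phi>: "smooth_fun M \<phi>"
    let ?q = "\<lambda>\<phi> x. (\<phi> x)\<^sup>2 + tinner M x (gradient M \<phi> x) (gradient M \<phi> x)"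
    have i: "integrable V (?q \<phi>)" if "smooth_fun M \<phi>" for \<phi>
      using sob_density_integrable[OF that] by simp
    have "sob (\<lambda>x. \<rho> x * \<phi> x) \<le> (LINT x|V. C * ?q \<phi> x)"
      unfolding sob_eq[OF smooth_fun_mult[OF \<rho> \<phi>]]
    proof (rule integral_mono)
      show "integrable V (?q (\<lambda>x. \<rho> x * \<phi> x))" by (rule i[OF smooth_fun_mult[OF \<rho> \<phi>]])
      show "integrable V (\<lambda>x. C * ?q \<phi> x)" using i[OF \<phi>] by simp
      fix x
      let ?t = "\<lambda>\<phi>. tinner M x (gradient M \<phi> x) (gradient M \<phi> x)"
      have "tinner M x (gradient M (\<lambda>x. \<rho> x * \<phi> x) x) (gradient M (\<lambda>x. \<rho> x * \<phi> x) x)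
        \<le> 2 * (\<rho> x)\<^sup>2 * ?t \<phi> + 2 * (\<phi> x)\<^sup>2 * ?t \<rho>"
        using tinner_nonneg[of x "\<lambda>c. \<rho> x *\<^sub>R gradient M \<phi> x c + (- \<phi> x) *\<^sub>R gradient M \<rho> x c"]
        unfolding gradient_mult[OF \<rho> \<phi>] tinner_lin_square by simp
      also have "\<dots> \<le> 2 * a * ?t \<phi> + 2 * (\<phi> x)\<^sup>2 * b"
        using a(2)[of x] b(2)[of x] tinner_nonneg by (intro add_mono mult_mono mult_left_mono mult_right_mono) auto
      finally have 1: "?t (\<lambda>x. \<rho> x * \<phi> x) \<le> 2 * a * ?t \<phi> + 2 * b * (\<phi> x)\<^sup>2" by (simp add: mult_ac)
      have 2: "(\<rho> x * \<phi> x)\<^sup>2 \<le> a * (\<phi> x)\<^sup>2"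
        using a(2)[of x] by (auto simp: power_mult_distrib intro: mult_right_mono)
      have "0 \<le> a * (\<phi> x)\<^sup>2" "0 \<le> b * ?t \<phi>" using a(1) b(1) tinner_nonneg[of x "gradient M \<phi> x"] by auto
      then show "?q (\<lambda>x. \<rho> x * \<phi> x) x \<le> C * ?q \<phi> x"
        using 1 2 unfolding C_def by (simp add: algebra_simps)
    qed
    also have "\<dots> = C * sob \<phi>" unfolding sob_eq[OF \<phi>] by simp
    finally show "sob (\<lambda>x. \<rho> x * \<phi> x) \<le> C * sob \<phi>" .
  qed
qed

definition push :: "('a, 'n) chart \<Rightarrow> (real ^ 'n \<Rightarrow> real) \<Rightarrow> 'a \<Rightarrow> real" where
  "push c w x = (if x \<in> cdom c then w (cmap c x) else 0)"

definition pull :: "('a, 'n) chart \<Rightarrow> ('a \<Rightarrow> real) \<Rightarrow> real ^ 'n \<Rightarrow> real" where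
  "pull c \<phi> y = (if y \<in> cimg c then \<phi> (cinv c y) else 0)"

lemma supported_push:
  assumes "c \<in> charts M" "supported w Y" shows "supported (push c w) (cinv c ` Y)"
  using assms cinv_cmap[OF assms(1)] unfolding supported_def push_def by (metis image_eqI)

lemma supported_pull:
  assumes "c \<in> charts M" "Y \<subseteq> cimg c" "supported \<phi> (cinv c ` Y)" shows "supported (pull c \<phi>) Y"
  unfolding supported_def pull_def
proof (intro allI impI)
  fix y assume y: "y \<notin> Y"
  have "cinv c y \<notin> cinv c ` Y" if "y \<in> cimg c"
  proof
    assume "cinv c y \<in> cinv c ` Y"
    then obtain y' where y': "y' \<in> Y" "cinv c y = cinv c y'" by blast
    have "y' \<in> cimg c" using y'(1) assms(2) by blast
    from cmap_cinv[OF assms(1) this] cmap_cinv[OF assms(1) that] show False using y y' by simp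
  qed
  then show "(if y \<in> cimg c then \<phi> (cinv c y) else 0) = 0"
    using assms(3) by (simp add: supported_def)
qed

lemma push_pull:
  assumes "c \<in> charts M" "Y \<subseteq> cimg c" "supported \<phi> (cinv c ` Y)" shows "push c (pull c \<phi>) = \<phi>"
proof
  fix x
  show "push c (pull c \<phi>) x = \<phi> x"
  proof (cases "x \<in> cdom c")
    case False
    then have "x \<notin> cinv c ` Y" using cinv_in[OF assms(1)] assms(2) by blast
    then show ?thesis using False assms(3) by (simp add: push_def supported_def)
  qed (simp add: push_def pull_def cinv_cmap[OF assms(1)])
qed

text \<open>In another chart the function is a composition with the transition map on the overlap,
  and 0 off the image of the compact set. That image is closed because the space is Hausdorff, so
  the two open pieces cover the chart.\<close>

lemma smooth_push:
  assumes c: "c \<in> charts M" and w: "smooth_on w UNIV" and Y: "compact Y" "Y \<subseteq> cimg c" "supported w Y"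
  shows "smooth_fun M (push c w)"
  unfolding smooth_fun_def
proof
  fix d assume d: "d \<in> charts M"
  let ?O1 = "cmap d ` (cdom d \<inter> cdom c)" and ?O2 = "cmap d ` (cdom d \<inter> (- cinv c ` Y))"
  have o1: "open ?O1" using open_cmap_image[OF d open_cdom[OF c]] .
  have o2: "open ?O2"
    using open_cmap_image[OF d, of "- cinv c ` Y"] compact_imp_closed[OF compact_cinv_image[OF c Y(1,2)]]
    by (simp add: open_Compl)
  have s1: "smooth_on (\<lambda>y. push c w (cinv d y)) ?O1"
  proof -
    have "smooth_on (\<lambda>y. w (cmap c (cinv d y))) ?O1"
      by (rule smooth_on_compose[OF o1 open_UNIV _ smooth_chart_change[OF d c] w]) simp
    then show ?thesis
      by (rule smooth_on_cong[OF o1, THEN iffD1, rotated]) (auto simp: push_def cinv_cmap[OF d])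
  qed
  have s2: "smooth_on (\<lambda>y. push c w (cinv d y)) ?O2"
    by (rule smooth_on_cong[OF o2, THEN iffD1, OF _ smooth_on_const[of 0]])
      (use supported_push[OF c Y(3)] in \<open>auto simp: cinv_cmap[OF d] supported_def\<close>)
  have "cinv c ` Y \<subseteq> cdom c" using cinv_in[OF c] Y(2) by blast
  then have "(cdom d \<inter> cdom c) \<union> (cdom d \<inter> (- cinv c ` Y)) = cdom d" by blast
  then have "?O1 \<union> ?O2 = cimg d" by (metis image_Un)
  then show "smooth_on (\<lambda>y. push c w (cinv d y)) (cimg d)"
    using smooth_on_Un[OF o1 o2 s1 s2] by simp
qed

lemma smooth_pull:
  assumes c: "c \<in> charts M" and \<phi>: "smooth_fun M \<phi>" and Y: "compact Y" "Y \<subseteq> cimg c" "supported \<phi> (cinv c ` Y)"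
  shows "smooth_on (pull c \<phi>) UNIV"
proof -
  have o2: "open (- Y)" using compact_imp_closed[OF Y(1)] by (simp add: open_Compl)
  have s1: "smooth_on (pull c \<phi>) (cimg c)"
    by (rule smooth_on_cong[OF open_cimg[OF c], THEN iffD1, OF _ smooth_fun_chart[OF \<phi> c]]) (simp add: pull_def)
  have s2: "smooth_on (pull c \<phi>) (- Y)"
    by (rule smooth_on_cong[OF o2, THEN iffD1, OF _ smooth_on_const[of 0]])
      (use supported_pull[OF c Y(2,3)] in \<open>auto simp: supported_def\<close>)
  have "cimg c \<union> - Y = UNIV" using Y(2) by auto
  then show ?thesis using smooth_on_Un[OF open_cimg[OF c] o2 s1 s2] by simp
qed

lemma covec_grad_vec:
  assumes c: "c \<in> charts M" and y: "y \<in> cimg c" and eq: "\<And>y. y \<in> cimg c \<Longrightarrow> \<phi> (cinv c y) = w y"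
  shows "covec c \<phi> y = grad_vec w y"
  unfolding covec_def grad_vec_def
  using frechet_derivative_cong_open[OF open_cimg[OF c] y, of "\<lambda>y. \<phi> (cinv c y)" w] eq by simp

lemma push_cinv: "c \<in> charts M \<Longrightarrow> y \<in> cimg c \<Longrightarrow> push c w (cinv c y) = w y"
  using cinv_in[of c y] cmap_cinv[of c y] by (simp add: push_def)

lemma sob_push:
  assumes c: "c \<in> charts M" and Y: "compact Y" "Y \<subseteq> cimg c"
  obtains C where "0 < C" "\<And>w. smooth_on w UNIV \<Longrightarrow> supported w Y \<Longrightarrow> sob (push c w) \<le> C * sob_eucl w"
proof -
  obtain C1 where C1: "0 < C1" "\<And>F. F \<in> borel_measurable borel \<Longrightarrow> (\<integral>\<^sup>+x. indicator (cinv c ` Y) x * F x \<partial>V)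
      \<le> ennreal C1 * (\<integral>\<^sup>+y. indicator Y y * F (cinv c y) \<partial>lborel)"
    by (rule chart_nn_bounds[OF c Y]) blast
  obtain C2 where C2: "0 < C2" "\<And>\<phi> y. smooth_fun M \<phi> \<Longrightarrow> y \<in> Y \<Longrightarrow>
      tinner M (cinv c y) (gradient M \<phi> (cinv c y)) (gradient M \<phi> (cinv c y)) \<le> C2 * (covec c \<phi> y \<bullet> covec c \<phi> y)"
    by (rule covec_bounds[OF c Y]) blast
  show ?thesis
  \<comment> \<open>\<open>C1\<close> compares the measures, \<open>C2\<close> the gradient terms,
    and the summand 1 accounts for the function value.\<close>
  proof (rule that[of "C1 * (1 + C2)"])
    show "0 < C1 * (1 + C2)" using C1 C2 by simp
    fix w :: "real ^ 'n \<Rightarrow> real" assume w: "smooth_on w UNIV" "supported w Y"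
    let ?\<phi> = "push c w"
    let ?q = "\<lambda>x. ennreal ((?\<phi> x)\<^sup>2 + tinner M x (gradient M ?\<phi> x) (gradient M ?\<phi> x))"
    let ?p = "\<lambda>y. (w y)\<^sup>2 + grad_vec w y \<bullet> grad_vec w y"
    have \<phi>: "smooth_fun M ?\<phi>" by (rule smooth_push[OF c w(1) Y w(2)])
    have o: "open (- cinv c ` Y)"
      using compact_imp_closed[OF compact_cinv_image[OF c Y]] by (simp add: open_Compl)
    have q: "?q x = indicator (cinv c ` Y) x * ?q x" for x
    proof (cases "x \<in> cinv c ` Y")
      case False
      have z: "?\<phi> z = 0" if "z \<in> - cinv c ` Y" for z
        using that supported_push[OF c w(2)] by (simp add: supported_def)
      have "gradient M ?\<phi> x = (\<lambda>c. 0)" by (rule gradient_local[OF o _ z]) (use False in simp_all)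
      then show ?thesis using z[of x] False by simp
    qed simp
    have "ennreal (sob ?\<phi>) = (\<integral>\<^sup>+x. indicator (cinv c ` Y) x * ?q x \<partial>V)"
      unfolding ennreal_sob[OF \<phi>, symmetric] by (rule nn_integral_cong) (rule q)
    also have "\<dots> \<le> ennreal C1 * (\<integral>\<^sup>+y. indicator Y y * ?q (cinv c y) \<partial>lborel)"
      by (rule C1(2)[OF sob_density_measurable[OF \<phi>]])
    also have "\<dots> \<le> ennreal C1 * (\<integral>\<^sup>+y. ennreal (1 + C2) * ennreal (?p y) \<partial>lborel)"
    proof (intro mult_left_mono nn_integral_mono)
      fix y
      show "indicator Y y * ?q (cinv c y) \<le> ennreal (1 + C2) * ennreal (?p y)"
      proof (cases "y \<in> Y")
        case True
        then have y: "y \<in> cimg c" using Y(2) by auto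
        have cv: "covec c ?\<phi> y = grad_vec w y" by (rule covec_grad_vec[OF c y]) (rule push_cinv[OF c])
        have "0 \<le> C2 * (w y)\<^sup>2" using C2(1) by simp
        moreover have "(1 + C2) * ?p y = ?p y + C2 * (w y)\<^sup>2 + C2 * (grad_vec w y \<bullet> grad_vec w y)"
          by (simp add: algebra_simps)
        ultimately have "(?\<phi> (cinv c y))\<^sup>2 + tinner M (cinv c y) (gradient M ?\<phi> (cinv c y)) (gradient M ?\<phi> (cinv c y)) \<le> (1 + C2) * ?p y"
          using C2(2)[OF \<phi> True] inner_ge_zero[of "grad_vec w y"] unfolding cv push_cinv[OF c y] by linarith
        then have "?q (cinv c y) \<le> ennreal ((1 + C2) * ?p y)" by (rule ennreal_leI)
        also have "\<dots> = ennreal (1 + C2) * ennreal (?p y)" using C2(1) by (intro ennreal_mult) auto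
        finally show ?thesis using True by simp
      qed simp
    qed simp
    also have "(\<integral>\<^sup>+y. ennreal (1 + C2) * ennreal (?p y) \<partial>lborel) = ennreal (1 + C2) * ennreal (sob_eucl w)"
    proof -
      have "continuous_on UNIV ?p" by (intro continuous_intros continuous_grad_vec smooth_on_continuous w)
      from measurable_compose[OF borel_measurable_continuous_onI[OF this] measurable_ennreal]
      have "(\<lambda>y. ennreal (?p y)) \<in> borel_measurable lborel" by (simp only: measurable_lborel2)
      from nn_integral_cmult[OF this] show ?thesis unfolding ennreal_sob_eucl[OF w(1) Y(1) w(2)] .
    qed
    also have "ennreal C1 * (ennreal (1 + C2) * ennreal (sob_eucl w)) = ennreal (C1 * (1 + C2) * sob_eucl w)"
    proof -
      have a: "0 \<le> C1" and b: "0 \<le> 1 + C2" using C1(1) C2(1) by auto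
      show ?thesis
        by (subst ennreal_mult[OF mult_nonneg_nonneg[OF a b] sob_eucl_nonneg], subst ennreal_mult[OF a b])
          (simp only: mult.assoc)
    qed
    finally show "sob ?\<phi> \<le> C1 * (1 + C2) * sob_eucl w"
      using C1(1) C2(1) by (subst (asm) ennreal_le_iff) (auto simp: sob_eucl_nonneg intro!: mult_nonneg_nonneg)
  qed
qed

lemma sob_pull:
  assumes c: "c \<in> charts M" and Y: "compact Y" "Y \<subseteq> cimg c"
  obtains C where "0 < C"
    "\<And>\<phi>. smooth_fun M \<phi> \<Longrightarrow> supported \<phi> (cinv c ` Y) \<Longrightarrow> sob_eucl (pull c \<phi>) \<le> C * sob \<phi>"
proof -
  obtain C1 where C1: "0 < C1" "\<And>F. F \<in> borel_measurable borel \<Longrightarrow> (\<integral>\<^sup>+y. indicator Y y * F (cinv c y) \<partial>lborel)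
      \<le> ennreal C1 * (\<integral>\<^sup>+x. indicator (cinv c ` Y) x * F x \<partial>V)"
    by (rule chart_nn_bounds[OF c Y]) blast
  obtain C2 where C2: "0 < C2" "\<And>\<phi> y. smooth_fun M \<phi> \<Longrightarrow> y \<in> Y \<Longrightarrow> covec c \<phi> y \<bullet> covec c \<phi> y
      \<le> C2 * tinner M (cinv c y) (gradient M \<phi> (cinv c y)) (gradient M \<phi> (cinv c y))"
    by (rule covec_bounds[OF c Y]) blast
  show ?thesis
  proof (rule that[of "C1 * (1 + C2)"])
    show "0 < C1 * (1 + C2)" using C1 C2 by simp
    fix \<phi> assume \<phi>: "smooth_fun M \<phi>" "supported \<phi> (cinv c ` Y)"
    let ?w = "pull c \<phi>"
    let ?q = "\<lambda>x. (\<phi> x)\<^sup>2 + tinner M x (gradient M \<phi> x) (gradient M \<phi> x)"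
    let ?p = "\<lambda>y. (?w y)\<^sup>2 + grad_vec ?w y \<bullet> grad_vec ?w y"
    note w = smooth_pull[OF c \<phi>(1) Y \<phi>(2)] supported_pull[OF c Y(2) \<phi>(2)]
    have m: "(\<lambda>x. ennreal (1 + C2) * ennreal (?q x)) \<in> borel_measurable borel"
      using sob_density_measurable[OF \<phi>(1)] by simp
    have "ennreal (sob_eucl ?w) = (\<integral>\<^sup>+y. ennreal (?p y) \<partial>lborel)"
      by (rule ennreal_sob_eucl[OF w(1) Y(1) w(2), symmetric])
    also have "\<dots> \<le> (\<integral>\<^sup>+y. indicator Y y * (ennreal (1 + C2) * ennreal (?q (cinv c y))) \<partial>lborel)"
    proof (rule nn_integral_mono)
      fix y
      show "ennreal (?p y) \<le> indicator Y y * (ennreal (1 + C2) * ennreal (?q (cinv c y)))"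
      proof (cases "y \<in> Y")
        case True
        then have y: "y \<in> cimg c" using Y(2) by auto
        have cv: "covec c \<phi> y = grad_vec ?w y" by (rule covec_grad_vec[OF c y]) (simp add: pull_def)
        have "?w y = \<phi> (cinv c y)" using y by (simp add: pull_def)
        moreover have "0 \<le> C2 * (\<phi> (cinv c y))\<^sup>2" "0 \<le> tinner M (cinv c y) (gradient M \<phi> (cinv c y)) (gradient M \<phi> (cinv c y))"
          using C2(1) tinner_nonneg by auto
        ultimately have "?p y \<le> (1 + C2) * ?q (cinv c y)"
          using C2(2)[OF \<phi>(1) True] unfolding cv by (simp add: algebra_simps)
        then have "ennreal (?p y) \<le> ennreal ((1 + C2) * ?q (cinv c y))" by (rule ennreal_leI)
        also have "\<dots> = ennreal (1 + C2) * ennreal (?q (cinv c y))"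
          using C2(1) tinner_nonneg by (intro ennreal_mult) auto
        finally show ?thesis using True by simp
      next
        case False
        then show ?thesis
          using grad_vec_supported[OF w(2) compact_imp_closed[OF Y(1)] False] w(2) by (simp add: supported_def)
      qed
    qed
    also have "\<dots> \<le> ennreal C1 * (\<integral>\<^sup>+x. indicator (cinv c ` Y) x * (ennreal (1 + C2) * ennreal (?q x)) \<partial>V)"
      by (rule C1(2)[OF m])
    also have "\<dots> \<le> ennreal C1 * (\<integral>\<^sup>+x. ennreal (1 + C2) * ennreal (?q x) \<partial>V)"
      by (intro mult_left_mono nn_integral_mono) (auto simp: indicator_def)
    also have "(\<integral>\<^sup>+x. ennreal (1 + C2) * ennreal (?q x) \<partial>V) = ennreal (1 + C2) * ennreal (sob \<phi>)"
    proof -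
      have "(\<lambda>x. ennreal (?q x)) \<in> borel_measurable V" using sob_density_measurable[OF \<phi>(1)] by simp
      from nn_integral_cmult[OF this] show ?thesis unfolding ennreal_sob[OF \<phi>(1)] .
    qed
    also have "ennreal C1 * (ennreal (1 + C2) * ennreal (sob \<phi>)) = ennreal (C1 * (1 + C2) * sob \<phi>)"
    proof -
      have a: "0 \<le> C1" and b: "0 \<le> 1 + C2" using C1(1) C2(1) by auto
      show ?thesis
        by (subst ennreal_mult[OF mult_nonneg_nonneg[OF a b] sob_nonneg], subst ennreal_mult[OF a b])
          (simp only: mult.assoc)
    qed
    finally show "sob_eucl ?w \<le> C1 * (1 + C2) * sob \<phi>"
      using C1(1) C2(1) by (subst (asm) ennreal_le_iff) (auto simp: sob_nonneg intro!: mult_nonneg_nonneg)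
  qed
qed

end

section \<open>Shifting test functions into the domain\<close>

context closed_manifold
begin

text \<open>Cuts off with \<open>\<rho>\<close>, translates in the chart and transplants back. The
  value at \<open>y\<close> is taken from \<open>y - t *\<^sub>R e\<close>, so supports move in the
  direction \<open>e\<close>.\<close>

definition shift :: "('a, 'n) chart \<Rightarrow> real ^ 'n \<Rightarrow> ('a \<Rightarrow> real) \<Rightarrow> real \<Rightarrow> ('a \<Rightarrow> real) \<Rightarrow> 'a \<Rightarrow> real" where
  "shift c e \<rho> t \<phi> = push c (\<lambda>y. pull c (\<lambda>x. \<rho> x * \<phi> x) (y - t *\<^sub>R e))"

lemma shift_diff: "shift c e \<rho> t (\<lambda>x. \<phi> x - \<psi> x) = (\<lambda>x. shift c e \<rho> t \<phi> x - shift c e \<rho> t \<psi> x)"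
  by (auto simp: shift_def push_def pull_def fun_eq_iff algebra_simps)

text \<open>Two complementary facts: a bound for all functions with a constant independent of
  \<open>t\<close>, and convergence for each single function as the length tends to 0. The
  convergence is not uniform over bounded families, hence both are kept.\<close>

lemma shift_estimates:
  assumes c: "c \<in> charts M" and r: "0 < r" "cball z (2 * r) \<subseteq> cimg c"
    and \<rho>: "smooth_fun M \<rho>" "supported \<rho> (cinv c ` cball z r)"
    and t0: "0 < t0" "t0 \<le> 1" "t0 * norm e \<le> r"
  shows "\<And>\<phi> t. smooth_fun M \<phi> \<Longrightarrow> 0 \<le> t \<Longrightarrow> t \<le> t0 \<Longrightarrow> smooth_fun M (shift c e \<rho> t \<phi>)"
    and "\<exists>C. 0 < C \<and> (\<forall>\<phi> t. smooth_fun M \<phi> \<longrightarrow> 0 \<le> t \<longrightarrow> t \<le> t0 \<longrightarrow>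
      sob (\<lambda>x. shift c e \<rho> t \<phi> x - \<rho> x * \<phi> x) \<le> C * sob \<phi>)"
    and "\<And>\<phi> T. smooth_fun M \<phi> \<Longrightarrow> (\<And>k::nat. 0 \<le> T k \<and> T k \<le> t0) \<Longrightarrow> T \<longlonglongrightarrow> 0 \<Longrightarrow>
      (\<lambda>k. sob (\<lambda>x. shift c e \<rho> (T k) \<phi> x - \<rho> x * \<phi> x)) \<longlonglongrightarrow> 0"
proof -
  \<comment> \<open>The cut-off function lives over the ball of radius \<open>r\<close>.
    Translations of length at most \<open>r\<close> stay in the ball of double radius, which is
    still inside the chart.\<close>
  let ?Y = "cball z r" and ?Y2 = "cball z (2 * r)"
  define w where "w = (\<lambda>\<phi>. pull c (\<lambda>x. \<rho> x * \<phi> x))"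
  have sub: "?Y \<subseteq> ?Y2" using r by auto
  have Yc: "?Y \<subseteq> cimg c" using sub r(2) by (rule order_trans)
  have supp\<rho>: "supported (\<lambda>x. \<rho> x * \<phi> x) (cinv c ` ?Y)" for \<phi>
    using \<rho>(2) by (auto simp: supported_def)
  have w: "smooth_on (w \<phi>) UNIV" "supported (w \<phi>) ?Y" if "smooth_fun M \<phi>" for \<phi>
    unfolding w_def
    by (rule smooth_pull[OF c smooth_fun_mult[OF \<rho>(1) that] compact_cball Yc supp\<rho>],
        rule supported_pull[OF c Yc supp\<rho>])
  have tw: "smooth_on (\<lambda>y. w \<phi> (y - t *\<^sub>R e)) UNIV" "supported (\<lambda>y. w \<phi> (y - t *\<^sub>R e)) ?Y2"
    "sob_eucl (\<lambda>y. w \<phi> (y - t *\<^sub>R e)) = sob_eucl (w \<phi>)"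
    if \<phi>: "smooth_fun M \<phi>" and t: "0 \<le> t" "t \<le> t0" for \<phi> t
  proof -
    show "smooth_on (\<lambda>y. w \<phi> (y - t *\<^sub>R e)) UNIV"
      using smooth_on_translate[OF w(1)[OF \<phi>], of "- (t *\<^sub>R e)"] by simp
    show "sob_eucl (\<lambda>y. w \<phi> (y - t *\<^sub>R e)) = sob_eucl (w \<phi>)"
      using sob_eucl_translate[OF w(1)[OF \<phi>], of "- (t *\<^sub>R e)"] by simp
    show "supported (\<lambda>y. w \<phi> (y - t *\<^sub>R e)) ?Y2"
      unfolding supported_def
    proof (intro allI impI)
      fix y assume y: "y \<notin> ?Y2"
      have "t * norm e \<le> r" using t t0(3) by (meson mult_right_mono norm_ge_zero order_trans)
      moreover have "dist z y \<le> dist z (y - t *\<^sub>R e) + t * norm e"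
        using dist_triangle[of z y "y - t *\<^sub>R e"] t by (simp add: dist_norm)
      ultimately have "y - t *\<^sub>R e \<notin> ?Y" using y by auto
      then show "w \<phi> (y - t *\<^sub>R e) = 0" using w(2)[OF \<phi>] by (simp add: supported_def)
    qed
  qed
  have diff: "(\<lambda>x. shift c e \<rho> t \<phi> x - \<rho> x * \<phi> x) = push c (\<lambda>y. w \<phi> (y - t *\<^sub>R e) - w \<phi> y)" for \<phi> t
  proof
    fix x
    have "\<rho> x * \<phi> x = push c (w \<phi>) x"
      using fun_cong[OF push_pull[OF c Yc supp\<rho>[of \<phi>]], of x] by (simp add: w_def)
    then show "shift c e \<rho> t \<phi> x - \<rho> x * \<phi> x = push c (\<lambda>y. w \<phi> (y - t *\<^sub>R e) - w \<phi> y) x"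
      by (simp add: shift_def w_def push_def)
  qed
  show "smooth_fun M (shift c e \<rho> t \<phi>)" if "smooth_fun M \<phi>" "0 \<le> t" "t \<le> t0" for \<phi> t
  proof -
    have "shift c e \<rho> t \<phi> = push c (\<lambda>y. w \<phi> (y - t *\<^sub>R e))" by (simp add: shift_def w_def)
    then show ?thesis using smooth_push[OF c tw(1)[OF that] compact_cball r(2) tw(2)[OF that]] by simp
  qed
  obtain C1 where C1: "0 < C1" "\<And>w. smooth_on w UNIV \<Longrightarrow> supported w ?Y2 \<Longrightarrow> sob (push c w) \<le> C1 * sob_eucl w"
    by (rule sob_push[OF c compact_cball r(2)]) blast
  obtain C2 where C2: "0 < C2" "\<And>\<phi>. smooth_fun M \<phi> \<Longrightarrow> supported \<phi> (cinv c ` ?Y) \<Longrightarrow> sob_eucl (pull c \<phi>) \<le> C2 * sob \<phi>"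
    by (rule sob_pull[OF c compact_cball Yc]) blast
  obtain C3 where C3: "0 < C3" "\<And>\<phi>. smooth_fun M \<phi> \<Longrightarrow> sob (\<lambda>x. \<rho> x * \<phi> x) \<le> C3 * sob \<phi>"
    by (rule sob_mult[OF \<rho>(1)]) blast
  have bound: "sob (\<lambda>x. shift c e \<rho> t \<phi> x - \<rho> x * \<phi> x) \<le> C1 * sob_eucl (\<lambda>y. w \<phi> (y - t *\<^sub>R e) - w \<phi> y)"
    if "smooth_fun M \<phi>" "0 \<le> t" "t \<le> t0" for \<phi> t
    unfolding diff
    using tw(1,2)[OF that] w(1)[OF that(1)] supported_mono[OF w(2)[OF that(1)] sub]
    by (intro C1(2) smooth_on_diff) (auto simp: supported_def)
  show "\<exists>C. 0 < C \<and> (\<forall>\<phi> t. smooth_fun M \<phi> \<longrightarrow> 0 \<le> t \<longrightarrow> t \<le> t0 \<longrightarrow>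
      sob (\<lambda>x. shift c e \<rho> t \<phi> x - \<rho> x * \<phi> x) \<le> C * sob \<phi>)"
  proof (intro exI[of _ "C1 * (4 * (C2 * C3))"] conjI allI impI)
    show "0 < C1 * (4 * (C2 * C3))" using C1 C2 C3 by simp
    fix \<phi> t assume \<phi>: "smooth_fun M \<phi>" and t: "0 \<le> t" "t \<le> t0"
    have "sob_eucl (\<lambda>y. w \<phi> (y - t *\<^sub>R e) - w \<phi> y) \<le> 2 * sob_eucl (\<lambda>y. w \<phi> (y - t *\<^sub>R e)) + 2 * sob_eucl (w \<phi>)"
      by (rule sob_eucl_diff[OF tw(1,2)[OF \<phi> t] w(1)[OF \<phi>] supported_mono[OF w(2)[OF \<phi>] sub] compact_cball])
    also have "\<dots> = 4 * sob_eucl (w \<phi>)" using tw(3)[OF \<phi> t] by simp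
    also have "sob_eucl (w \<phi>) \<le> C2 * sob (\<lambda>x. \<rho> x * \<phi> x)"
      unfolding w_def by (rule C2(2)[OF smooth_fun_mult[OF \<rho>(1) \<phi>] supp\<rho>])
    also have "sob (\<lambda>x. \<rho> x * \<phi> x) \<le> C3 * sob \<phi>" by (rule C3(2)[OF \<phi>])
    finally have "sob_eucl (\<lambda>y. w \<phi> (y - t *\<^sub>R e) - w \<phi> y) \<le> 4 * (C2 * (C3 * sob \<phi>))"
      using C2(1) by simp
    then have "C1 * sob_eucl (\<lambda>y. w \<phi> (y - t *\<^sub>R e) - w \<phi> y) \<le> C1 * (4 * (C2 * (C3 * sob \<phi>)))"
      using C1(1) by (intro mult_left_mono) auto
    with bound[OF \<phi> t] show "sob (\<lambda>x. shift c e \<rho> t \<phi> x - \<rho> x * \<phi> x) \<le> C1 * (4 * (C2 * C3)) * sob \<phi>"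
      by (simp add: mult.assoc)
  qed
  fix \<phi> and T :: "nat \<Rightarrow> real"
  assume \<phi>: "smooth_fun M \<phi>" and T: "\<And>k. 0 \<le> T k \<and> T k \<le> t0" "T \<longlonglongrightarrow> 0"
  have T1: "0 \<le> T k \<and> T k \<le> 1" for k using T(1)[of k] t0(2) by auto
  have "(\<lambda>k. sob_eucl (\<lambda>y. w \<phi> (y - T k *\<^sub>R e) - w \<phi> y)) \<longlonglongrightarrow> 0"
    by (rule sob_eucl_translation_tendsto[OF w(1)[OF \<phi>] w(2)[OF \<phi>] compact_cball T1 T(2)])
  then have "(\<lambda>k. C1 * sob_eucl (\<lambda>y. w \<phi> (y - T k *\<^sub>R e) - w \<phi> y)) \<longlonglongrightarrow> 0"
    using tendsto_mult_left by fastforce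
  then show "(\<lambda>k. sob (\<lambda>x. shift c e \<rho> (T k) \<phi> x - \<rho> x * \<phi> x)) \<longlonglongrightarrow> 0"
    by (rule tendsto_sandwich[OF _ _ tendsto_const, rotated -1])
      (use bound[OF \<phi>] T(1) in \<open>auto simp: sob_nonneg intro!: always_eventually\<close>)
qed

text \<open>Near a point of the boundary \<open>e\<close> is the Euclidean gradient of \<open>h\<close>, elsewhere it is \<open>0\<close>.\<close>

definition inward_patch ::
    "('a \<Rightarrow> real) \<Rightarrow> 'a \<Rightarrow> ('a, 'n) chart \<Rightarrow> real \<Rightarrow> real ^ 'n \<Rightarrow> real \<Rightarrow> real \<Rightarrow> bool" where
  "inward_patch h p c r e \<kappa> t0 \<longleftrightarrow> c \<in> charts M \<and> p \<in> cdom c \<and> 0 < r \<and> cball (cmap c p) (2 * r) \<subseteq> cimg c \<and>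
    0 < \<kappa> \<and> 0 < t0 \<and> t0 \<le> 1 \<and> t0 * norm e \<le> r \<and>
    (\<forall>y t. y \<in> cball (cmap c p) r \<longrightarrow> 0 < t \<longrightarrow> t \<le> t0 \<longrightarrow> - (\<kappa> * t) < h (cinv c y) \<longrightarrow> 0 < h (cinv c (y + t *\<^sub>R e)))"

lemma inward_patchD:
  assumes "inward_patch h p c r e \<kappa> t0"
  shows "c \<in> charts M" "p \<in> cdom c" "0 < r" "cball (cmap c p) (2 * r) \<subseteq> cimg c"
    and "0 < \<kappa>" "0 < t0" "t0 \<le> 1" "t0 * norm e \<le> r"
    and "\<And>y t. y \<in> cball (cmap c p) r \<Longrightarrow> 0 < t \<Longrightarrow> t \<le> t0 \<Longrightarrow> - (\<kappa> * t) < h (cinv c y) \<Longrightarrow>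
      0 < h (cinv c (y + t *\<^sub>R e))"
proof -
  note p = assms[unfolded inward_patch_def]
  show "c \<in> charts M" "p \<in> cdom c" "0 < r" "cball (cmap c p) (2 * r) \<subseteq> cimg c"
    "0 < \<kappa>" "0 < t0" "t0 \<le> 1" "t0 * norm e \<le> r"
    by (rule p[THEN conjunct1] p[THEN conjunct2, THEN conjunct1] p[THEN conjunct2, THEN conjunct2, THEN conjunct1]
        p[THEN conjunct2, THEN conjunct2, THEN conjunct2, THEN conjunct1]
        p[THEN conjunct2, THEN conjunct2, THEN conjunct2, THEN conjunct2, THEN conjunct1]
        p[THEN conjunct2, THEN conjunct2, THEN conjunct2, THEN conjunct2, THEN conjunct2, THEN conjunct1]
        p[THEN conjunct2, THEN conjunct2, THEN conjunct2, THEN conjunct2, THEN conjunct2, THEN conjunct2, THEN conjunct1]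
        p[THEN conjunct2, THEN conjunct2, THEN conjunct2, THEN conjunct2, THEN conjunct2, THEN conjunct2, THEN conjunct2, THEN conjunct1])+
  have "\<forall>y t. y \<in> cball (cmap c p) r \<longrightarrow> 0 < t \<longrightarrow> t \<le> t0 \<longrightarrow> - (\<kappa> * t) < h (cinv c y) \<longrightarrow> 0 < h (cinv c (y + t *\<^sub>R e))"
    using p by (elim conjE)
  then show "\<And>y t. y \<in> cball (cmap c p) r \<Longrightarrow> 0 < t \<Longrightarrow> t \<le> t0 \<Longrightarrow> - (\<kappa> * t) < h (cinv c y) \<Longrightarrow>
      0 < h (cinv c (y + t *\<^sub>R e))"
    by blast
qed

section \<open>Directions of increase for the defining function\<close>

lemma C2\<alpha>_fun_chart:
  assumes "C2\<alpha>_fun M \<alpha> h" "c \<in> charts M"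
  shows "Ck_on 2 (\<lambda>y. h (cinv c y)) (cimg c)"
  using assms by (simp add: C2\<alpha>_fun_def C2\<alpha>_on_def)

lemma C2\<alpha>_fun_continuous: "C2\<alpha>_fun M \<alpha> h \<Longrightarrow> continuous_on UNIV h"
  by (rule continuous_chartI, rule continuous_via_chart, assumption)
    (rule Ck_on_continuous[OF C2\<alpha>_fun_chart])

text \<open>At a zero of \<open>h\<close> the derivative along the coordinate gradient is positive,
  and by continuity it stays above a positive constant on a whole patch, so a step of length
  \<open>t\<close> raises \<open>h\<close> by more than that constant times \<open>t\<close>. At any
  other point no motion is required.\<close>

lemma inward_patch_exists:
  assumes h: "C2\<alpha>_fun M \<alpha> h" and nz: "h p = 0 \<Longrightarrow> tnorm M p (gradient M h p) \<noteq> 0"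
  shows "\<exists>c r e \<kappa> t0. inward_patch h p c r e \<kappa> t0"
proof (cases "h p = 0")
  case False
  obtain c where c: "c \<in> charts M" "p \<in> cdom c" by (rule ex_chart)
  have cont: "continuous_on (cimg c) (\<lambda>y. h (cinv c y))" by (rule Ck_on_continuous[OF C2\<alpha>_fun_chart[OF h c(1)]])
  let ?I = "if 0 < h p then {0<..} else {..<h p / 2}"
  have "open (cimg c \<inter> (\<lambda>y. h (cinv c y)) -` ?I)"
    by (rule continuous_open_preimage[OF cont open_cimg[OF c(1)]]) auto
  moreover have "cmap c p \<in> cimg c \<inter> (\<lambda>y. h (cinv c y)) -` ?I"
    using False c(2) cinv_cmap[OF c] by auto
  ultimately obtain s where s: "0 < s" "cball (cmap c p) s \<subseteq> cimg c \<inter> (\<lambda>y. h (cinv c y)) -` ?I"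
    using open_contains_cball by meson
  have half: "y \<in> cball (cmap c p) s" if "y \<in> cball (cmap c p) (s / 2)" for y using that s(1) by auto
  \<comment> \<open>With \<open>e = 0\<close> nothing moves. Where h p > 0, the function is positive
    on the patch. Where h p < 0, it lies below h p / 2, which is at most -t, so the premise of the
    patch condition fails.\<close>
  have "inward_patch h p c (s / 2) 0 1 (min 1 (\<bar>h p\<bar> / 2))"
    unfolding inward_patch_def
  proof (intro conjI allI impI)
    fix y t assume y: "y \<in> cball (cmap c p) (s / 2)" and t: "0 < t" "t \<le> min 1 (\<bar>h p\<bar> / 2)" "- (1 * t) < h (cinv c y)"
    have "h (cinv c y) \<in> ?I" using s(2) half[OF y] by blast
    then show "0 < h (cinv c (y + t *\<^sub>R 0))" using t False by (auto split: if_splits)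
  qed (use c s False in auto)
  then show ?thesis by blast
next
  case True
  \<comment> \<open>The chart is the one that \<open>tinner\<close> selects, so that a vanishing
    coordinate gradient in it directly contradicts the nonzero \<open>tnorm\<close>.\<close>
  define c where "c = (SOME c. c \<in> charts M \<and> p \<in> cdom c)"
  have c: "c \<in> charts M" "p \<in> cdom c" unfolding c_def by (rule some_chart)+
  let ?f = "\<lambda>y. h (cinv c y)" and ?z = "cmap c p"
  define v where "v = (\<chi> i. dirderiv (axis i 1) ?f ?z)"
  have "v \<noteq> 0"
  proof
    assume "v = 0"
    then have "gradient M h p c = 0" using c by (simp add: gradient_def v_def)
    then show False using nz[OF True] by (simp add: tnorm_def tinner_def c_def[symmetric])
  qed
  have C2: "Ck_on (Suc (Suc 0)) ?f (cimg c)" using C2\<alpha>_fun_chart[OF h c(1)] by (simp add: numeral_2_eq_2)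
  have fd: "(?f has_derivative frechet_derivative ?f (at y)) (at y)" if "y \<in> cimg c" for y
    using C2 that unfolding Ck_on.simps frechet_derivative_works by blast
  define D where "D = (\<lambda>y. \<Sum>i\<in>UNIV. v $ i * dirderiv (axis i 1) ?f y)"
  have D: "frechet_derivative ?f (at y) v = D y" if "y \<in> cimg c" for y
    unfolding D_def by (rule linear_axis_expansion[OF has_derivative_linear[OF fd[OF that]]])
  have cD: "continuous_on (cimg c) D"
  proof -
    have "Ck_on (Suc 0) (dirderiv (axis i 1) ?f) (cimg c)" for i using C2 by simp
    then have "continuous_on (cimg c) (dirderiv (axis i 1) ?f)" for i by (rule Ck_on_continuous)
    then show ?thesis unfolding D_def by (intro continuous_intros)
  qed
  have Dz: "D ?z = v \<bullet> v" by (simp add: D_def v_def inner_vec_def)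
  \<comment> \<open>The derivative of \<open>h\<close> along \<open>v\<close> equals v . v at the
    point itself; half of this value persists on a small ball.\<close>
  define \<kappa> where "\<kappa> = (v \<bullet> v) / 2"
  have \<kappa>: "0 < \<kappa>" "\<kappa> < D ?z" using \<open>v \<noteq> 0\<close> by (simp_all add: \<kappa>_def Dz)
  have "open (cimg c \<inter> D -` {\<kappa><..})"
    by (rule continuous_open_preimage[OF cD open_cimg[OF c(1)]]) auto
  moreover have "?z \<in> cimg c \<inter> D -` {\<kappa><..}" using c(2) \<kappa> by auto
  ultimately obtain s where s: "0 < s" "cball ?z s \<subseteq> cimg c \<inter> D -` {\<kappa><..}"
    using open_contains_cball by meson
  define r where "r = s / 2"
  have r: "0 < r" "cball ?z (2 * r) \<subseteq> cimg c" "\<And>y. y \<in> cball ?z (2 * r) \<Longrightarrow> \<kappa> < D y"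
    using s by (auto simp: r_def)
  define t0 where "t0 = min 1 (r / norm v)"
  have t0: "0 < t0" "t0 \<le> 1" "t0 * norm v \<le> r"
    using r(1) \<open>v \<noteq> 0\<close> by (auto simp: t0_def min_def field_simps)
  have "inward_patch h p c r v \<kappa> t0"
    unfolding inward_patch_def
  proof (intro conjI allI impI c r(1,2) \<kappa>(1) t0)
    fix y t assume y: "y \<in> cball ?z r" and t: "0 < t" "t \<le> t0" "- (\<kappa> * t) < ?f y"
    have in2: "y + a *\<^sub>R v \<in> cball ?z (2 * r)" if "0 \<le> a" "a \<le> t" for a
    proof -
      have "a * norm v \<le> r" using that t t0(3) by (meson mult_right_mono norm_ge_zero order_trans)
      moreover have "dist ?z (y + a *\<^sub>R v) \<le> dist ?z y + a * norm v"
        using dist_triangle[of ?z "y + a *\<^sub>R v" y] that by (simp add: dist_norm)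
      ultimately show ?thesis using y by auto
    qed
    have "((\<lambda>a. ?f (y + a *\<^sub>R v)) has_real_derivative D (y + a *\<^sub>R v)) (at a)" if "0 \<le> a" "a \<le> t" for a
    proof -
      have m: "y + a *\<^sub>R v \<in> cimg c" using in2[OF that] r(2) by blast
      have "((\<lambda>a. y + a *\<^sub>R v) has_derivative (\<lambda>s. s *\<^sub>R v)) (at a)"
        by (auto intro!: derivative_eq_intros)
      from diff_chain_at[OF this fd[OF m]]
      show ?thesis
        unfolding has_field_derivative_def o_def
        by (rule has_derivative_eq_rhs)
          (simp add: fun_eq_iff linear_scale[OF has_derivative_linear[OF fd[OF m]]] D[OF m])
    qed
    then obtain a where a: "0 < a" "a < t" "?f (y + t *\<^sub>R v) - ?f (y + 0 *\<^sub>R v) = (t - 0) * D (y + a *\<^sub>R v)"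
      using MVT2[of 0 t "\<lambda>a. ?f (y + a *\<^sub>R v)" "\<lambda>a. D (y + a *\<^sub>R v)"] t(1) by blast
    have "\<kappa> < D (y + a *\<^sub>R v)" by (rule r(3)[OF in2]) (use a in auto)
    then have "t * \<kappa> < t * D (y + a *\<^sub>R v)" using t(1) by simp
    then show "0 < ?f (y + t *\<^sub>R v)" using a(3) t(3) by (simp add: mult.commute)
  qed
  then show ?thesis by blast
qed

section \<open>A partition of unity and the combined inward shift\<close>

lemma smooth_chart_bump:
  assumes c: "c \<in> charts M" and r: "0 < r" "cball z r \<subseteq> cimg c"
  obtains b where "smooth_fun M b" "\<And>x. 0 \<le> b x" "\<And>x. x \<in> cinv c ` ball z r \<Longrightarrow> 0 < b x"
    "supported b (cinv c ` cball z r)"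
proof -
  obtain \<beta> :: "real ^ 'n \<Rightarrow> real" where \<beta>: "smooth_on \<beta> UNIV" "\<And>y. 0 \<le> \<beta> y" "\<And>y. 0 < \<beta> y \<longleftrightarrow> y \<in> ball z r"
    by (rule smooth_ball_bump[OF r(1), of z]) blast
  have supp: "supported \<beta> (cball z r)"
    unfolding supported_def
  proof (intro allI impI)
    fix y assume "y \<notin> cball z r"
    then have "\<not> 0 < \<beta> y" unfolding \<beta>(3) by auto
    then show "\<beta> y = 0" using \<beta>(2)[of y] by simp
  qed
  show ?thesis
  proof (rule that[of "push c \<beta>"])
    show "smooth_fun M (push c \<beta>)" by (rule smooth_push[OF c \<beta>(1) compact_cball r(2) supp])
    show "0 \<le> push c \<beta> x" for x using \<beta>(2) by (simp add: push_def)
    show "0 < push c \<beta> x" if x: "x \<in> cinv c ` ball z r" for x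
    proof -
      obtain y where y: "y \<in> ball z r" "x = cinv c y" using x by blast
      have "y \<in> cimg c" using y(1) r(2) ball_subset_cball by blast
      then show ?thesis using push_cinv[OF c, of y \<beta>] y \<beta>(3) by simp
    qed
    show "supported (push c \<beta>) (cinv c ` cball z r)" by (rule supported_push[OF c supp])
  qed
qed

text \<open>A partition of unity subordinate to finitely many inward patches splits a function into
  pieces, each shifted in its own direction. Each piece lands in the superlevel set at level 0,
  hence so does the sum, and the estimates add up. \<open>S t\<close> is compatible with
  differences, which later allows an approximant to be split off.\<close>

lemma inward_shift:
  assumes h: "C2\<alpha>_fun M \<alpha> h" and nz: "\<And>p. h p = 0 \<Longrightarrow> tnorm M p (gradient M h p) \<noteq> 0"
  obtains S :: "real \<Rightarrow> ('a \<Rightarrow> real) \<Rightarrow> 'a \<Rightarrow> real" and \<kappa> t0 C where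
    "0 < \<kappa>" "0 < t0" "0 \<le> C"
    "\<And>\<phi> t. smooth_fun M \<phi> \<Longrightarrow> 0 < t \<Longrightarrow> t \<le> t0 \<Longrightarrow> smooth_fun M (S t \<phi>)"
    "\<And>\<phi> \<psi> t. S t (\<lambda>x. \<phi> x - \<psi> x) = (\<lambda>x. S t \<phi> x - S t \<psi> x)"
    "\<And>\<phi> t. smooth_fun M \<phi> \<Longrightarrow> 0 < t \<Longrightarrow> t \<le> t0 \<Longrightarrow> sob (\<lambda>x. S t \<phi> x - \<phi> x) \<le> C * sob \<phi>"
    "\<And>\<phi> T. smooth_fun M \<phi> \<Longrightarrow> (\<And>k::nat. 0 < T k \<and> T k \<le> t0) \<Longrightarrow> T \<longlonglongrightarrow> 0 \<Longrightarrow>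
      (\<lambda>k. sob (\<lambda>x. S (T k) \<phi> x - \<phi> x)) \<longlonglongrightarrow> 0"
    "\<And>\<phi> t \<epsilon>. test_fun M {x. - \<epsilon> < h x} \<phi> \<Longrightarrow> 0 < t \<Longrightarrow> t \<le> t0 \<Longrightarrow> \<epsilon> \<le> \<kappa> * t \<Longrightarrow>
      test_fun M {x. 0 < h x} (S t \<phi>)"
proof -
  have "\<forall>p. \<exists>c r e \<kappa> t0. inward_patch h p c r e \<kappa> t0" using inward_patch_exists[OF h nz] by blast
  then obtain c r e \<kappa> t0 where patch: "\<And>p. inward_patch h p (c p) (r p) (e p) (\<kappa> p) (t0 p)" by metis
  note c = inward_patchD(1,2)[OF patch] and r = inward_patchD(3,4)[OF patch] and \<kappa> = inward_patchD(5)[OF patch]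
    and t0 = inward_patchD(6-8)[OF patch] and inward = inward_patchD(9)[OF patch]
  let ?z = "\<lambda>p. cmap (c p) p"
  have r': "cball (?z p) (r p) \<subseteq> cimg (c p)" for p
  proof -
    have "cball (?z p) (r p) \<subseteq> cball (?z p) (2 * r p)" using r(1)[of p] by auto
    then show ?thesis using r(2) by (rule order_trans)
  qed
  have "\<exists>b. smooth_fun M b \<and> (\<forall>x. 0 \<le> b x) \<and> (\<forall>x\<in>cinv (c p) ` ball (?z p) (r p). 0 < b x) \<and>
      supported b (cinv (c p) ` cball (?z p) (r p))" for p
    by (rule smooth_chart_bump[OF c(1) r(1) r', of p]) blast
  from choice[OF allI, OF this] obtain b where b': "\<forall>p. smooth_fun M (b p) \<and> (\<forall>x. 0 \<le> b p x) \<and>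
      (\<forall>x\<in>cinv (c p) ` ball (?z p) (r p). 0 < b p x) \<and> supported (b p) (cinv (c p) ` cball (?z p) (r p))" ..
  have b: "smooth_fun M (b p)" "0 \<le> b p x" "x \<in> cinv (c p) ` ball (?z p) (r p) \<Longrightarrow> 0 < b p x"
    "supported (b p) (cinv (c p) ` cball (?z p) (r p))" for p x
    using b' by blast+
  have o: "open (cinv (c p) ` ball (?z p) (r p))" for p
    by (rule open_cinv_image[OF c(1) open_ball order_trans[OF ball_subset_cball r']])
  have "p \<in> cinv (c p) ` ball (?z p) (r p)" for p
    using r(1)[of p] cinv_cmap[OF c, of p] by (intro image_eqI[of _ _ "?z p"]) simp_all
  then have "UNIV \<subseteq> (\<Union>p\<in>UNIV. cinv (c p) ` ball (?z p) (r p))" by blast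
  then obtain I where I: "finite I" "UNIV \<subseteq> (\<Union>p\<in>I. cinv (c p) ` ball (?z p) (r p))"
    by (rule compactE_image[OF compact_UNIV o]) blast
  have In: "I \<noteq> {}" using I(2) by auto
  define s where "s = (\<lambda>x. \<Sum>p\<in>I. b p x)"
  have s: "smooth_fun M s" unfolding s_def by (rule smooth_fun_sum) (rule b)
  have spos: "0 < s x" for x
  proof -
    obtain p where p: "p \<in> I" "x \<in> cinv (c p) ` ball (?z p) (r p)" using I(2) by blast
    then show ?thesis unfolding s_def using I(1) b(2,3) by (intro sum_pos2[of I p]) auto
  qed
  \<comment> \<open>Dividing the bumps by their positive sum makes them add up to 1, so that without
    shifting the pieces reassemble the original function.\<close>
  define \<rho> where "\<rho> = (\<lambda>p x. b p x * inverse (s x))"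
  have \<rho>: "smooth_fun M (\<rho> p)" "supported (\<rho> p) (cinv (c p) ` cball (?z p) (r p))" for p
  proof -
    have "s x \<noteq> 0" for x using spos[of x] by simp
    then show "smooth_fun M (\<rho> p)" unfolding \<rho>_def by (intro smooth_fun_mult b smooth_fun_inverse s)
    show "supported (\<rho> p) (cinv (c p) ` cball (?z p) (r p))"
      using b(4)[of p] by (simp add: supported_def \<rho>_def)
  qed
  have sum1: "(\<Sum>p\<in>I. \<rho> p x) = 1" for x
  proof -
    have "(\<Sum>p\<in>I. \<rho> p x) = s x * inverse (s x)" by (simp add: \<rho>_def s_def sum_distrib_right)
    then show ?thesis using spos[of x] by simp
  qed
  \<comment> \<open>Finitely many patches admit one rate of increase and one maximal length valid
    for all of them.\<close>
  define K where "K = Min (\<kappa> ` I)"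
  define T0 where "T0 = Min (t0 ` I)"
  have K: "0 < K" "\<And>p. p \<in> I \<Longrightarrow> K \<le> \<kappa> p" and T0: "0 < T0" "\<And>p. p \<in> I \<Longrightarrow> T0 \<le> t0 p"
    using I(1) In \<kappa> t0(1) by (auto simp: K_def T0_def)
  define S where "S = (\<lambda>t \<phi> x. \<Sum>p\<in>I. shift (c p) (e p) (\<rho> p) t \<phi> x)"
  note est = shift_estimates[OF c(1) r \<rho> t0]
  obtain B where B: "\<And>p. 0 < B p" "\<And>p \<phi> t. smooth_fun M \<phi> \<Longrightarrow> 0 \<le> t \<Longrightarrow> t \<le> t0 p \<Longrightarrow>
      sob (\<lambda>x. shift (c p) (e p) (\<rho> p) t \<phi> x - \<rho> p x * \<phi> x) \<le> B p * sob \<phi>"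
    using est(2) by metis
  have diff: "(\<lambda>x. S t \<phi> x - \<phi> x) = (\<lambda>x. \<Sum>p\<in>I. shift (c p) (e p) (\<rho> p) t \<phi> x - \<rho> p x * \<phi> x)" for t \<phi>
    by (simp add: S_def sum_subtractf sum_distrib_right[symmetric] sum1)
  have dsm: "smooth_fun M (\<lambda>x. shift (c p) (e p) (\<rho> p) t \<phi> x - \<rho> p x * \<phi> x)"
    if "smooth_fun M \<phi>" "0 < t" "t \<le> T0" "p \<in> I" for p t \<phi>
    using that T0(2)[OF that(4)] by (intro smooth_fun_diff smooth_fun_mult \<rho> est(1)) auto
  have ssum: "sob (\<lambda>x. S t \<phi> x - \<phi> x) \<le> 2 ^ card I * (\<Sum>p\<in>I. sob (\<lambda>x. shift (c p) (e p) (\<rho> p) t \<phi> x - \<rho> p x * \<phi> x))"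
    if "smooth_fun M \<phi>" "0 < t" "t \<le> T0" for t \<phi>
    unfolding diff by (rule sob_sum[OF I(1) dsm[OF that]])
  show ?thesis
  proof (rule that[of K T0 "2 ^ card I * (\<Sum>p\<in>I. B p)" S])
    show "0 < K" "0 < T0" by fact+
    show "0 \<le> 2 ^ card I * (\<Sum>p\<in>I. B p)" using B(1) by (intro mult_nonneg_nonneg sum_nonneg) (auto intro: less_imp_le)
    show sm: "smooth_fun M (S t \<phi>)" if "smooth_fun M \<phi>" "0 < t" "t \<le> T0" for \<phi> t
      unfolding S_def using that T0(2) by (intro smooth_fun_sum est(1)) force+
    show "S t (\<lambda>x. \<phi> x - \<psi> x) = (\<lambda>x. S t \<phi> x - S t \<psi> x)" for \<phi> \<psi> t
      by (simp add: S_def shift_diff sum_subtractf)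
    show "sob (\<lambda>x. S t \<phi> x - \<phi> x) \<le> 2 ^ card I * (\<Sum>p\<in>I. B p) * sob \<phi>"
      if "smooth_fun M \<phi>" "0 < t" "t \<le> T0" for \<phi> t
    proof -
      have "(\<Sum>p\<in>I. sob (\<lambda>x. shift (c p) (e p) (\<rho> p) t \<phi> x - \<rho> p x * \<phi> x)) \<le> (\<Sum>p\<in>I. B p * sob \<phi>)"
        using that T0(2) by (intro sum_mono B(2)) force+
      then have "2 ^ card I * (\<Sum>p\<in>I. sob (\<lambda>x. shift (c p) (e p) (\<rho> p) t \<phi> x - \<rho> p x * \<phi> x))
        \<le> 2 ^ card I * (\<Sum>p\<in>I. B p * sob \<phi>)" by (intro mult_left_mono) auto
      also have "\<dots> = 2 ^ card I * (\<Sum>p\<in>I. B p) * sob \<phi>" by (simp only: sum_distrib_right mult.assoc)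
      finally show ?thesis by (rule order_trans[OF ssum[OF that]])
    qed
    show "(\<lambda>k. sob (\<lambda>x. S (T k) \<phi> x - \<phi> x)) \<longlonglongrightarrow> 0"
      if \<phi>: "smooth_fun M \<phi>" and T: "\<And>k::nat. 0 < T k \<and> T k \<le> T0" "T \<longlonglongrightarrow> 0" for \<phi> T
    proof -
      have "(\<lambda>k. sob (\<lambda>x. shift (c p) (e p) (\<rho> p) (T k) \<phi> x - \<rho> p x * \<phi> x)) \<longlonglongrightarrow> 0" if p: "p \<in> I" for p
      proof (rule est(3)[OF \<phi> _ T(2)])
        show "0 \<le> T k \<and> T k \<le> t0 p" for k using T(1)[of k] T0(2)[OF p] by linarith
      qed
      then have "(\<lambda>k. 2 ^ card I * (\<Sum>p\<in>I. sob (\<lambda>x. shift (c p) (e p) (\<rho> p) (T k) \<phi> x - \<rho> p x * \<phi> x)))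
        \<longlonglongrightarrow> 2 ^ card I * (\<Sum>p\<in>I. 0)"
        by (intro tendsto_mult tendsto_const tendsto_sum)
      then have lim: "(\<lambda>k. 2 ^ card I * (\<Sum>p\<in>I. sob (\<lambda>x. shift (c p) (e p) (\<rho> p) (T k) \<phi> x - \<rho> p x * \<phi> x))) \<longlonglongrightarrow> 0"
        by simp
      show ?thesis
        by (rule tendsto_sandwich[OF _ _ tendsto_const lim])
          (use ssum[OF \<phi>] T(1) sob_nonneg in \<open>auto intro!: always_eventually\<close>)
    qed
    show "test_fun M {x. 0 < h x} (S t \<phi>)"
      if \<phi>: "test_fun M {x. - \<epsilon> < h x} \<phi>" and t: "0 < t" "t \<le> T0" and \<epsilon>: "\<epsilon> \<le> K * t" for \<phi> t \<epsilon>
    proof -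
      let ?F = "closure {x. \<phi> x \<noteq> 0}"
      \<comment> \<open>In coordinates this is the part of the closed support of the function that
        lies in the patch ball; its translate \<open>R p\<close> is compact and contains the support
        of the shifted piece.\<close>
      define Q where "Q = (\<lambda>p. cball (?z p) (r p) \<inter> (cimg (c p) \<inter> cinv (c p) -` ?F))"
      define R where "R = (\<lambda>p. cinv (c p) ` ((\<lambda>y. y + t *\<^sub>R e p) ` Q p))"
      have Fh: "?F \<subseteq> {x. - \<epsilon> < h x}" using \<phi> by (simp add: test_fun_def)
      have Qc: "compact (Q p)" for p
      proof -
        have "Q p = cball (?z p) (r p) \<inter> cinv (c p) -` ?F" using r'[of p] by (auto simp: Q_def)
        moreover have "closed (cball (?z p) (r p) \<inter> cinv (c p) -` ?F)"
          by (rule continuous_closed_preimage[OF continuous_on_subset[OF continuous_cinv[OF c(1)] r'] closed_cball closed_closure])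
        ultimately show ?thesis by (metis Int_lower1 bounded_cball bounded_subset compact_eq_bounded_closed)
      qed
      have shifted: "y + t *\<^sub>R e p \<in> cimg (c p)" "0 < h (cinv (c p) (y + t *\<^sub>R e p))" if p: "p \<in> I" and y: "y \<in> Q p" for p y
      proof -
        have tp: "t \<le> t0 p" using t(2) T0(2)[OF p] by linarith
        have "t * norm (e p) \<le> r p" using t(1) tp t0(3)[of p] by (meson mult_right_mono norm_ge_zero order_trans)
        moreover have "dist (?z p) (y + t *\<^sub>R e p) \<le> dist (?z p) y + t * norm (e p)"
          using dist_triangle[of "?z p" "y + t *\<^sub>R e p" y] t(1) by (simp add: dist_norm)
        ultimately have "y + t *\<^sub>R e p \<in> cball (?z p) (2 * r p)" using y by (auto simp: Q_def)
        then show "y + t *\<^sub>R e p \<in> cimg (c p)" using r(2) by blast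
        have "cinv (c p) y \<in> ?F" using y by (simp add: Q_def)
        then have "- \<epsilon> < h (cinv (c p) y)" using Fh by blast
        moreover have "\<epsilon> \<le> \<kappa> p * t" using \<epsilon> mult_right_mono[OF K(2)[OF p], of t] t(1) by linarith
        ultimately have "- (\<kappa> p * t) < h (cinv (c p) y)" by linarith
        then show "0 < h (cinv (c p) (y + t *\<^sub>R e p))"
          using y t(1) tp by (intro inward) (auto simp: Q_def)
      qed
      have Rc: "compact (R p)" if "p \<in> I" for p
        unfolding R_def using shifted(1)[OF that]
        by (intro compact_cinv_image[OF c(1)] compact_continuous_image continuous_intros Qc) auto
      have Rh: "R p \<subseteq> {x. 0 < h x}" if "p \<in> I" for p
        using shifted(2)[OF that] by (auto simp: R_def)
      have zero: "shift (c p) (e p) (\<rho> p) t \<phi> x = 0" if p: "p \<in> I" and x: "x \<notin> R p" for p x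
      proof (cases "x \<in> cdom (c p)")
        case True
        define y where "y = cmap (c p) x - t *\<^sub>R e p"
        have xy: "x = cinv (c p) (y + t *\<^sub>R e p)" using cinv_cmap[OF c(1) True] by (simp add: y_def)
        have "y \<notin> Q p" using x xy by (auto simp: R_def)
        then have "pull (c p) (\<lambda>x. \<rho> p x * \<phi> x) y = 0"
        proof (cases "y \<in> cball (?z p) (r p)")
          case False
          have "supported (pull (c p) (\<lambda>x. \<rho> p x * \<phi> x)) (cball (?z p) (r p))"
            by (rule supported_pull[OF c(1) r']) (use \<rho>(2)[of p] in \<open>auto simp: supported_def\<close>)
          then show ?thesis using False by (simp add: supported_def)
        next
          case True
          assume "y \<notin> Q p"
          then have "cinv (c p) y \<notin> ?F" using True r'[of p] by (auto simp: Q_def)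
          then have "\<phi> (cinv (c p) y) = 0" using closure_subset[of "{x. \<phi> x \<noteq> 0}"] by blast
          then show ?thesis by (simp add: pull_def)
        qed
        then show ?thesis using True by (simp add: shift_def push_def y_def)
      qed (simp add: shift_def push_def)
      have cl: "closed (\<Union>p\<in>I. R p)" using Rc I(1) by (intro closed_UN compact_imp_closed) auto
      have "{x. S t \<phi> x \<noteq> 0} \<subseteq> (\<Union>p\<in>I. R p)"
      proof
        fix x assume "x \<in> {x. S t \<phi> x \<noteq> 0}"
        then obtain p where "p \<in> I" "shift (c p) (e p) (\<rho> p) t \<phi> x \<noteq> 0"
          unfolding S_def by (metis (mono_tags, lifting) mem_Collect_eq sum.neutral)
        then show "x \<in> (\<Union>p\<in>I. R p)" using zero by blast
      qed
      then have "closure {x. S t \<phi> x \<noteq> 0} \<subseteq> (\<Union>p\<in>I. R p)" using cl by (rule closure_minimal)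
      then have sub: "closure {x. S t \<phi> x \<noteq> 0} \<subseteq> {x. 0 < h x}" using Rh by blast
      have "compact (closure {x. S t \<phi> x \<noteq> 0})"
        using compact_Int_closed[OF compact_UNIV closed_closure] by simp
      with sub sm[OF test_fun_smooth[OF \<phi>] t] show ?thesis by (simp add: test_fun_def)
    qed
  qed
qed

end

section \<open>Uniform convergence from convergence in the Hoelder norm\<close>

text \<open>A Lebesgue number of a cover by balls of local Hoelder continuity separates two cases:
  close pairs lie in a common ball and use its constant, distant pairs are bounded by the supremum
  of the function.\<close>

lemma locally_Holder_on_compact:
  fixes G :: "'e::metric_space \<Rightarrow> real"
  assumes G: "locally_Holder_on \<alpha> G U" "continuous_on S G" and S: "compact S" "S \<subseteq> U" and \<alpha>: "0 \<le> \<alpha>"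
  shows "\<exists>L. \<forall>x\<in>S. \<forall>y\<in>S. \<bar>G x - G y\<bar> / dist x y powr \<alpha> \<le> L"
proof -
  have "\<forall>x\<in>S. \<exists>q. 0 < fst q \<and> (\<forall>y\<in>ball x (fst q) \<inter> U. \<forall>z\<in>ball x (fst q) \<inter> U. dist (G y) (G z) \<le> snd q * dist y z powr \<alpha>)"
    using G(1) S(2) unfolding locally_Holder_on_def fst_conv split_paired_Ex snd_conv by blast
  from bchoice[OF this] obtain q where q: "\<And>x. x \<in> S \<Longrightarrow> 0 < fst (q x)"
    "\<And>x y z. x \<in> S \<Longrightarrow> y \<in> ball x (fst (q x)) \<Longrightarrow> z \<in> ball x (fst (q x)) \<Longrightarrow> y \<in> U \<Longrightarrow> z \<in> U \<Longrightarrow>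
      dist (G y) (G z) \<le> snd (q x) * dist y z powr \<alpha>"
    by (metis IntI)
  obtain I where I: "I \<subseteq> S" "finite I" "S \<subseteq> (\<Union>x\<in>I. ball x (fst (q x)))"
    by (rule compactE_image[OF S(1), of S "\<lambda>x. ball x (fst (q x))"]) (use q(1) in \<open>auto intro!: bexI\<close>)
  obtain e where e: "0 < e" "\<And>x. x \<in> S \<Longrightarrow> \<exists>A\<in>(\<lambda>x. ball x (fst (q x))) ` I. ball x e \<subseteq> A"
    by (rule Heine_Borel_lemma[OF S(1) I(3)]) auto
  have "bounded (G ` S)" by (intro compact_imp_bounded compact_continuous_image G S)
  then obtain b where b: "\<And>x. x \<in> S \<Longrightarrow> \<bar>G x\<bar> \<le> b" unfolding bounded_iff by auto
  have L0: "0 \<le> (\<Sum>i\<in>I. \<bar>snd (q i)\<bar>)" by (simp add: sum_nonneg)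
  have "\<bar>G x - G y\<bar> / dist x y powr \<alpha> \<le> (\<Sum>i\<in>I. \<bar>snd (q i)\<bar>) + 2 * \<bar>b\<bar> / e powr \<alpha>"
    if x: "x \<in> S" and y: "y \<in> S" for x y
  proof (cases "dist x y < e \<and> x \<noteq> y")
    case True
    then obtain i where i: "i \<in> I" "ball x e \<subseteq> ball i (fst (q i))" using e(2)[OF x] by blast
    have "x \<in> ball i (fst (q i))" "y \<in> ball i (fst (q i))" 
      by (rule subsetD[OF i(2)], use True e(1) in simp)+
    then have "\<bar>G x - G y\<bar> \<le> snd (q i) * dist x y powr \<alpha>"
      using q(2)[of i x y] i(1) I(1) x y S(2) by (auto simp: dist_real_def)
    then have "\<bar>G x - G y\<bar> / dist x y powr \<alpha> \<le> snd (q i)" using True by (simp add: field_simps)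
    also have "\<dots> \<le> \<bar>snd (q i)\<bar>" by simp
    also have "\<dots> \<le> (\<Sum>i\<in>I. \<bar>snd (q i)\<bar>)" using i(1) I(2) by (intro member_le_sum) auto
    finally show ?thesis using e(1) by (simp add: add_increasing2)
  next
    \<comment> \<open>This case includes equal points, where the quotient is 0 / 0 = 0.\<close>
    case False
    have "\<bar>G x - G y\<bar> \<le> 2 * \<bar>b\<bar>" using b[OF x] b[OF y] by linarith
    moreover have "e powr \<alpha> \<le> dist x y powr \<alpha>" if "x \<noteq> y"
      using False that e(1) \<alpha> by (intro powr_mono2) auto
    ultimately have "\<bar>G x - G y\<bar> / dist x y powr \<alpha> \<le> 2 * \<bar>b\<bar> / e powr \<alpha>"
      using e(1) by (cases "x = y") (auto intro!: frac_le)
    then show ?thesis using L0 by linarith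
  qed
  then show ?thesis by blast
qed

lemma Ck_on_dirderiv: "Ck_on (Suc k) F U \<Longrightarrow> b \<in> Basis \<Longrightarrow> Ck_on k (dirderiv b F) U"
  by simp

lemma dirderiv_diff:
  assumes f: "Ck_on (Suc k) f U" and g: "Ck_on (Suc k) g U" and x: "x \<in> U"
  shows "dirderiv b (\<lambda>y. f y - g y) x = dirderiv b f x - dirderiv b g x"
proof -
  have "(f has_derivative frechet_derivative f (at x)) (at x)" "(g has_derivative frechet_derivative g (at x)) (at x)"
    using f g x by (simp_all flip: frechet_derivative_works)
  from frechet_derivative_eq[OF has_derivative_diff[OF this]] show ?thesis by simp
qed

lemma dirderiv_diff_2:
  assumes U: "open U" and f: "Ck_on (Suc (Suc 0)) f U" and g: "Ck_on (Suc (Suc 0)) g U" and x: "x \<in> U"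
    and b: "b \<in> Basis" "b' \<in> Basis"
  shows "dirderiv b' (dirderiv b (\<lambda>y. f y - g y)) x = dirderiv b' (dirderiv b f) x - dirderiv b' (dirderiv b g) x"
proof -
  have "frechet_derivative (dirderiv b (\<lambda>y. f y - g y)) (at x) = frechet_derivative (\<lambda>y. dirderiv b f y - dirderiv b g y) (at x)"
    by (rule frechet_derivative_cong_open[OF U x dirderiv_diff[OF f g]])
  then show ?thesis
    using dirderiv_diff[OF Ck_on_dirderiv[OF f b(1)] Ck_on_dirderiv[OF g b(1)] x] by simp
qed

lemma cSUP_nonneg:
  fixes q :: "'b \<Rightarrow> real"
  assumes "bdd_above (q ` S)" "x \<in> S" "0 \<le> q x"
  shows "0 \<le> (SUP x\<in>S. q x)"
  using cSUP_upper2[OF assms(1,2,3)] by simp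

text \<open>The first supremum dominates the value at the point. The others may be dropped once they
  are known to be nonnegative, but the \<open>SUP\<close> of an unbounded set of reals has no
  controlled value. Hence every family, including the Hoelder quotients, must be shown
  bounded.\<close>

lemma C2\<alpha>_norm_on_ge:
  fixes f g :: "'e::euclidean_space \<Rightarrow> real"
  assumes f: "C2\<alpha>_on \<alpha> f U" and g: "C2\<alpha>_on \<alpha> g U" and U: "open U" and S: "compact S" "S \<subseteq> U"
    and \<alpha>: "0 \<le> \<alpha>" and x: "x \<in> S"
  shows "\<bar>f x - g x\<bar> \<le> C2\<alpha>_norm_on \<alpha> (\<lambda>y. f y - g y) S"
proof -
  let ?F = "\<lambda>y. f y - g y"
  have f2: "Ck_on (Suc (Suc 0)) f U" and g2: "Ck_on (Suc (Suc 0)) g U"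
    using f g by (simp_all add: C2\<alpha>_on_def numeral_2_eq_2)
  have bdd: "bdd_above ((\<lambda>x. \<bar>q x\<bar>) ` S)" if "continuous_on S q" for q :: "'e \<Rightarrow> real"
    by (intro bounded_imp_bdd_above compact_imp_bounded compact_continuous_image continuous_intros that S)
  have c1: "continuous_on U (dirderiv b f)" "continuous_on U (dirderiv b g)" if "b \<in> Basis" for b
    by (rule Ck_on_continuous[OF Ck_on_dirderiv[OF f2 that]], rule Ck_on_continuous[OF Ck_on_dirderiv[OF g2 that]])
  have c2: "continuous_on U (dirderiv b' (dirderiv b f))" "continuous_on U (dirderiv b' (dirderiv b g))"
    if "b \<in> Basis" "b' \<in> Basis" for b b'
    using f2 g2 that by simp_all
  have d1: "dirderiv b ?F y = dirderiv b f y - dirderiv b g y" if "y \<in> S" for b y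
    using dirderiv_diff[OF f2 g2] that S(2) by blast
  have d2: "dirderiv b' (dirderiv b ?F) y = dirderiv b' (dirderiv b f) y - dirderiv b' (dirderiv b g) y"
    if "b \<in> Basis" "b' \<in> Basis" "y \<in> S" for b b' y
    using dirderiv_diff_2[OF U f2 g2] that S(2) by blast
  have "\<bar>?F x\<bar> \<le> (SUP x\<in>S. \<bar>?F x\<bar>)"
    by (rule cSUP_upper[OF x bdd])
      (intro continuous_intros continuous_on_subset[OF Ck_on_continuous[OF f2] S(2)] continuous_on_subset[OF Ck_on_continuous[OF g2] S(2)])
  moreover have "0 \<le> (\<Sum>b\<in>Basis. SUP x\<in>S. \<bar>dirderiv b ?F x\<bar>)"
  proof (rule sum_nonneg)
    fix b :: 'e assume b: "b \<in> Basis"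
    have "continuous_on S (\<lambda>y. dirderiv b f y - dirderiv b g y)"
      by (intro continuous_intros continuous_on_subset[OF _ S(2)] c1 b)
    then have "continuous_on S (dirderiv b ?F)" by (rule continuous_on_eq) (simp add: d1)
    from cSUP_nonneg[OF bdd[OF this] x] show "0 \<le> (SUP x\<in>S. \<bar>dirderiv b ?F x\<bar>)" by simp
  qed
  moreover have "0 \<le> (\<Sum>b\<in>Basis. \<Sum>b'\<in>Basis. SUP x\<in>S. \<bar>dirderiv b' (dirderiv b ?F) x\<bar>)"
  proof (intro sum_nonneg)
    fix b b' :: 'e assume b: "b \<in> Basis" "b' \<in> Basis"
    have "continuous_on S (\<lambda>y. dirderiv b' (dirderiv b f) y - dirderiv b' (dirderiv b g) y)"
      by (intro continuous_intros continuous_on_subset[OF _ S(2)] c2 b)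
    then have "continuous_on S (dirderiv b' (dirderiv b ?F))" by (rule continuous_on_eq) (simp add: d2[OF b])
    from cSUP_nonneg[OF bdd[OF this] x] show "0 \<le> (SUP x\<in>S. \<bar>dirderiv b' (dirderiv b ?F) x\<bar>)" by simp
  qed
  moreover have "0 \<le> (\<Sum>b\<in>Basis. \<Sum>b'\<in>Basis. SUP (x, y)\<in>S \<times> S.
      \<bar>dirderiv b' (dirderiv b ?F) x - dirderiv b' (dirderiv b ?F) y\<bar> / dist x y powr \<alpha>)"
  proof (intro sum_nonneg)
    fix b b' :: 'e assume b: "b \<in> Basis" "b' \<in> Basis"
    let ?f = "dirderiv b' (dirderiv b f)" and ?g = "dirderiv b' (dirderiv b g)"
    let ?q = "\<lambda>(x, y). \<bar>dirderiv b' (dirderiv b ?F) x - dirderiv b' (dirderiv b ?F) y\<bar> / dist x y powr \<alpha>"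
    have H: "locally_Holder_on \<alpha> ?f U" "locally_Holder_on \<alpha> ?g U" using f g b by (simp_all add: C2\<alpha>_on_def)
    obtain L1 where L1: "\<forall>x\<in>S. \<forall>y\<in>S. \<bar>?f x - ?f y\<bar> / dist x y powr \<alpha> \<le> L1"
      using locally_Holder_on_compact[OF H(1) continuous_on_subset[OF c2(1)[OF b] S(2)] S \<alpha>] by blast
    obtain L2 where L2: "\<forall>x\<in>S. \<forall>y\<in>S. \<bar>?g x - ?g y\<bar> / dist x y powr \<alpha> \<le> L2"
      using locally_Holder_on_compact[OF H(2) continuous_on_subset[OF c2(2)[OF b] S(2)] S \<alpha>] by blast
    have "?q (y, z) \<le> L1 + L2" if "y \<in> S" "z \<in> S" for y z
    proof -
      have "?q (y, z) \<le> (\<bar>?f y - ?f z\<bar> + \<bar>?g y - ?g z\<bar>) / dist y z powr \<alpha>"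
        unfolding prod.case d2[OF b that(1)] d2[OF b that(2)] by (intro divide_right_mono) auto
      also have "\<dots> \<le> L1 + L2" unfolding add_divide_distrib using L1 L2 that by (intro add_mono) auto
      finally show ?thesis .
    qed
    then have "bdd_above (?q ` (S \<times> S))" by (intro bdd_aboveI[of _ "L1 + L2"]) auto
    \<comment> \<open>The diagonal pair contributes 0, which makes the supremum of the bounded
      family nonnegative.\<close>
    from cSUP_nonneg[OF this, of "(x, x)"] x show "0 \<le> (SUP p\<in>S \<times> S. ?q p)" by simp
  qed
  ultimately show ?thesis unfolding C2\<alpha>_norm_on_def by linarith
qed

context closed_manifold
begin

text \<open>The coordinate balls cover the manifold, so the norm controls the difference at every
  point; this converts convergence in the norm into uniform convergence.\<close>

lemma C2\<alpha>_norm_ge: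
  assumes B: "coordinate_ball_cover M B" and \<alpha>: "0 \<le> \<alpha>" and h: "C2\<alpha>_fun M \<alpha> h" "C2\<alpha>_fun M \<alpha> h'"
  shows "\<bar>h x - h' x\<bar> \<le> C2\<alpha>_norm B \<alpha> (\<lambda>x. h x - h' x)"
proof -
  have "x \<in> (\<Union>(c, z, r)\<in>B. cinv c ` ball z r)" using B by (simp add: coordinate_ball_cover_def)
  then obtain c z r y where b: "(c, z, r) \<in> B" and y: "y \<in> ball z r" "x = cinv c y" by auto
  have c: "c \<in> charts M" "cball z r \<subseteq> cimg c" and fin: "finite B"
    using B b unfolding coordinate_ball_cover_def by blast+
  have "\<bar>h x - h' x\<bar> \<le> C2\<alpha>_norm_on \<alpha> (\<lambda>y. h (cinv c y) - h' (cinv c y)) (cball z r)"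
    unfolding y(2)
  proof (rule C2\<alpha>_norm_on_ge[OF _ _ open_cimg[OF c(1)] compact_cball c(2) \<alpha>])
    show "C2\<alpha>_on \<alpha> (\<lambda>y. h (cinv c y)) (cimg c)" "C2\<alpha>_on \<alpha> (\<lambda>y. h' (cinv c y)) (cimg c)"
      using h c(1) by (simp_all add: C2\<alpha>_fun_def)
    show "y \<in> cball z r" using y(1) by simp
  qed
  also have "\<dots> \<le> C2\<alpha>_norm B \<alpha> (\<lambda>x. h x - h' x)"
    unfolding C2\<alpha>_norm_def using fin by (intro Max_ge) (auto intro!: rev_image_eqI[OF b])
  finally show ?thesis .
qed

end

section \<open>The Dirichlet functional\<close>

context closed_manifold
begin

definition dirichlet :: "('a \<Rightarrow> real) \<Rightarrow> ('a \<Rightarrow> real) \<Rightarrow> real" where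
  "dirichlet f \<phi> = 2 * (LINT x|V. f x * \<phi> x) - energy \<phi>"

lemma L2_fun_times_integrable: "L2_fun u \<Longrightarrow> L2_fun v \<Longrightarrow> integrable V (\<lambda>x. u x * v x)"
  by (rule Cauchy_Schwarz_integral(1)) (auto simp: L2_fun_def)

lemma integral_lin_square:
  assumes "L2_fun u" "L2_fun v"
  shows "(LINT x|V. (a * u x + b * v x)\<^sup>2)
    = a\<^sup>2 * (LINT x|V. (u x)\<^sup>2) + 2 * (a * b) * (LINT x|V. u x * v x) + b\<^sup>2 * (LINT x|V. (v x)\<^sup>2)"
proof -
  have "(a * u x + b * v x)\<^sup>2 = a\<^sup>2 * (u x)\<^sup>2 + 2 * (a * b) * (u x * v x) + b\<^sup>2 * (v x)\<^sup>2" for x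
    by (simp add: power2_eq_square algebra_simps)
  then show ?thesis
    using assms L2_fun_times_integrable[OF assms] by (simp add: L2_fun_def)
qed

lemma energy_lin:
  assumes "smooth_fun M \<phi>" "smooth_fun M \<psi>"
  shows "energy (\<lambda>x. a * \<phi> x + b * \<psi> x)
    = a\<^sup>2 * energy \<phi> + 2 * (a * b) * ip (gradient M \<phi>) (gradient M \<psi>) + b\<^sup>2 * energy \<psi>"
  unfolding energy_def gradient_lin[OF assms] by (intro ip_lin_square L2_field_gradient assms)

text \<open>The weighted Young inequality, read off from a nonnegative quadratic form at the pair
  (s, -1). It is used both for the L^2 product and for the energy product.\<close>

lemma quadratic_nonneg_Young:
  fixes x y z s :: real
  assumes "0 < s" "0 \<le> s\<^sup>2 * x + 2 * (s * - 1) * y + (- 1)\<^sup>2 * z"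
  shows "2 * y \<le> s * x + z / s"
proof -
  have "2 * s * y \<le> s * (s * x) + z" using assms(2) by (simp add: power2_eq_square algebra_simps)
  then have "(2 * s * y) / s \<le> (s * (s * x) + z) / s" using assms(1) by (intro divide_right_mono) auto
  then show ?thesis using assms(1) by (simp add: add_divide_distrib)
qed

lemma pairing_Young:
  assumes "L2_fun u" "L2_fun v" "0 < s"
  shows "2 * (LINT x|V. u x * v x) \<le> s * (LINT x|V. (u x)\<^sup>2) + (LINT x|V. (v x)\<^sup>2) / s"
proof (rule quadratic_nonneg_Young[OF assms(3)])
  have "0 \<le> (LINT x|V. (s * u x + (- 1) * v x)\<^sup>2)" by simp
  then show "0 \<le> s\<^sup>2 * (LINT x|V. (u x)\<^sup>2) + 2 * (s * - 1) * (LINT x|V. u x * v x) + (- 1)\<^sup>2 * (LINT x|V. (v x)\<^sup>2)"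
    unfolding integral_lin_square[OF assms(1,2)] .
qed

lemma ip_Young:
  assumes "smooth_fun M \<phi>" "smooth_fun M \<psi>" "0 < s"
  shows "2 * ip (gradient M \<phi>) (gradient M \<psi>) \<le> s * energy \<phi> + energy \<psi> / s"
proof (rule quadratic_nonneg_Young[OF assms(3)])
  show "0 \<le> s\<^sup>2 * energy \<phi> + 2 * (s * - 1) * ip (gradient M \<phi>) (gradient M \<psi>) + (- 1)\<^sup>2 * energy \<psi>"
    using energy_nonneg[of "\<lambda>x. s * \<phi> x + (- 1) * \<psi> x"] unfolding energy_lin[OF assms(1,2)] .
qed

text \<open>The linear part is affine, and the parallelogram identity for the energy supplies the
  excess. Two near-maximisers with a large energy distance would therefore have a midpoint above the
  supremum.\<close>

lemma dirichlet_midpoint: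
  assumes f: "L2_fun f" and \<phi>: "smooth_fun M \<phi>" and \<psi>: "smooth_fun M \<psi>"
  shows "dirichlet f (\<lambda>x. 1 / 2 * \<phi> x + 1 / 2 * \<psi> x)
    = (dirichlet f \<phi> + dirichlet f \<psi>) / 2 + energy (\<lambda>x. \<phi> x - \<psi> x) / 4"
proof -
  have "(LINT x|V. f x * (1 / 2 * \<phi> x + 1 / 2 * \<psi> x)) = (LINT x|V. 1 / 2 * (f x * \<phi> x) + 1 / 2 * (f x * \<psi> x))"
    by (intro Bochner_Integration.integral_cong) (auto simp: algebra_simps)
  also have "\<dots> = 1 / 2 * (LINT x|V. f x * \<phi> x) + 1 / 2 * (LINT x|V. f x * \<psi> x)"
    using L2_fun_times_integrable[OF f L2_fun_smooth[OF \<phi>]] L2_fun_times_integrable[OF f L2_fun_smooth[OF \<psi>]]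
    by simp
  finally have "(LINT x|V. f x * (1 / 2 * \<phi> x + 1 / 2 * \<psi> x)) = \<dots>" .
  moreover have "energy (\<lambda>x. \<phi> x - \<psi> x) = energy \<phi> - 2 * ip (gradient M \<phi>) (gradient M \<psi>) + energy \<psi>"
    using energy_lin[OF \<phi> \<psi>, of 1 "-1"] by simp
  ultimately show ?thesis
    unfolding dirichlet_def energy_lin[OF \<phi> \<psi>] by (simp add: power2_eq_square field_simps)
qed

text \<open>Expanding in the difference of the two functions leaves two cross terms, which Young's
  inequality splits with weight \<open>s\<close>. The cost is then small once \<open>s\<close> is
  small and the difference is small compared with \<open>s\<close>.\<close>

lemma dirichlet_perturb:
  assumes f: "L2_fun f" and \<phi>: "smooth_fun M \<phi>" and \<psi>: "smooth_fun M \<psi>" and s: "0 < s"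
  shows "dirichlet f \<phi> - s * ((LINT x|V. (f x)\<^sup>2) + energy \<phi>) - (1 + 1 / s) * sob (\<lambda>x. \<psi> x - \<phi> x) \<le> dirichlet f \<psi>"
proof -
  let ?g = "\<lambda>x. \<psi> x - \<phi> x"
  have g: "smooth_fun M ?g" using smooth_fun_diff \<phi> \<psi> by blast
  have "(LINT x|V. f x * \<psi> x) = (LINT x|V. f x * \<phi> x + f x * ?g x)"
    by (intro Bochner_Integration.integral_cong) (auto simp: algebra_simps)
  also have "\<dots> = (LINT x|V. f x * \<phi> x) + (LINT x|V. f x * ?g x)"
    by (intro Bochner_Integration.integral_add L2_fun_times_integrable f L2_fun_smooth \<phi> g)
  finally have 1: "(LINT x|V. f x * \<psi> x) = (LINT x|V. f x * \<phi> x) + (LINT x|V. f x * ?g x)" .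
  have 2: "energy \<psi> = energy \<phi> + 2 * ip (gradient M \<phi>) (gradient M ?g) + energy ?g"
    using energy_lin[OF \<phi> g, of 1 1] by simp
  have "L2_fun (\<lambda>x. (-1) * f x + 0 * f x)" by (rule L2_fun_lin[OF f f])
  from pairing_Young[OF this L2_fun_smooth[OF g] s]
  have 3: "- 2 * (LINT x|V. f x * ?g x) \<le> s * (LINT x|V. (f x)\<^sup>2) + (LINT x|V. (?g x)\<^sup>2) / s" by simp
  have "0 \<le> (LINT x|V. (?g x)\<^sup>2)" by simp
  then have "(LINT x|V. (?g x)\<^sup>2) / s + energy ?g / s + energy ?g \<le> (1 + 1 / s) * sob ?g"
    by (simp add: sob_def algebra_simps add_divide_distrib)
  with 1 2 3 ip_Young[OF \<phi> g s] show ?thesis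
    unfolding dirichlet_def distrib_left by linarith
qed

text \<open>Coercivity. The Young weight 2 C + 1 is chosen so that the Poincare inequality turns the
  quadratic term into at most half of the energy; the summand 1 keeps the weight positive when
  \<open>C = 0\<close>.\<close>

lemma energy_le_dirichlet:
  assumes f: "L2_fun f" and \<phi>: "smooth_fun M \<phi>" and C: "0 \<le> C" "(LINT x|V. (\<phi> x)\<^sup>2) \<le> C * energy \<phi>"
  shows "dirichlet f \<phi> + energy \<phi> / 2 \<le> (2 * C + 1) * (LINT x|V. (f x)\<^sup>2)"
proof -
  have "(LINT x|V. (\<phi> x)\<^sup>2) / (2 * C + 1) \<le> C * energy \<phi> / (2 * C + 1)"
    using C by (intro divide_right_mono) auto
  also have "\<dots> = C / (2 * C + 1) * energy \<phi>" by simp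
  also have "\<dots> \<le> 1 / 2 * energy \<phi>"
    using C(1) by (intro mult_right_mono energy_nonneg) (simp add: field_simps)
  finally show ?thesis
    using pairing_Young[OF f L2_fun_smooth[OF \<phi>], of "2 * C + 1"] C(1) unfolding dirichlet_def by linarith
qed

lemma test_fun_lin:
  assumes "test_fun M W \<phi>" "test_fun M W \<psi>"
  shows "test_fun M W (\<lambda>x. a * \<phi> x + b * \<psi> x)"
proof -
  have "{x. a * \<phi> x + b * \<psi> x \<noteq> 0} \<subseteq> {x. \<phi> x \<noteq> 0} \<union> {x. \<psi> x \<noteq> 0}" by auto
  then have "closure {x. a * \<phi> x + b * \<psi> x \<noteq> 0} \<subseteq> closure {x. \<phi> x \<noteq> 0} \<union> closure {x. \<psi> x \<noteq> 0}"
    unfolding closure_Un[symmetric] by (rule closure_mono)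
  moreover have "compact (closure {x. a * \<phi> x + b * \<psi> x \<noteq> 0})"
    using compact_Int_closed[OF compact_UNIV closed_closure] by simp
  ultimately show ?thesis using assms by (auto simp: test_fun_def intro: smooth_fun_lin)
qed

lemma test_fun_mono: "test_fun M W \<phi> \<Longrightarrow> W \<subseteq> W' \<Longrightarrow> test_fun M W' \<phi>"
  by (auto simp: test_fun_def)

text \<open>The Cauchy property comes from the parallelogram identity for the energy.\<close>

lemma near_maximisers:
  assumes f: "L2_fun f" and anti: "\<And>k l. k \<le> l \<Longrightarrow> W l \<subseteq> W k"
    and big: "\<And>k. \<exists>\<phi>. test_fun M (W k) \<phi> \<and> E < dirichlet f \<phi>"
    and bound: "\<And>\<phi>. test_fun M (W 0) \<phi> \<Longrightarrow> dirichlet f \<phi> \<le> b"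
  shows "\<exists>\<phi>. (\<forall>k::nat. test_fun M (W k) (\<phi> k)) \<and> (\<forall>k. E - 1 / (real k + 1) \<le> dirichlet f (\<phi> k)) \<and>
    (\<forall>\<eta>>0. \<exists>k0. \<forall>k\<ge>k0. energy (\<lambda>x. \<phi> k x - \<phi> k0 x) \<le> \<eta>)"
proof -
  let ?J = "dirichlet f"
  define T where "T = (\<lambda>k. {\<phi>. test_fun M (W k) \<phi>})"
  have bdd: "bdd_above (?J ` T k)" for k
    using bound test_fun_mono[OF _ anti[OF le0]] by (intro bdd_aboveI[of _ b]) (auto simp: T_def)
  \<comment> \<open>These suprema decrease with \<open>k\<close> and stay above \<open>E\<close>, so
    they converge; closeness to their infimum is what makes near-maximisers of different index
    comparable.\<close>
  define e where "e = (\<lambda>k. Sup (?J ` T k))"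
  have le_e: "?J \<phi> \<le> e k" if "test_fun M (W k) \<phi>" for \<phi> k
    unfolding e_def using that by (intro cSUP_upper bdd) (simp add: T_def)
  have Ee: "E \<le> e k" for k using big[of k] le_e by fastforce
  have ne: "?J ` T k \<noteq> {}" for k using big[of k] by (auto simp: T_def)
  have "\<exists>\<phi>. test_fun M (W k) \<phi> \<and> e k - 1 / (real k + 1) < ?J \<phi>" for k
    using less_cSupD[OF ne, of "e k - 1 / (real k + 1)" k] unfolding e_def[symmetric] by (auto simp: T_def e_def)
  then obtain \<phi> where \<phi>: "\<And>k. test_fun M (W k) (\<phi> k)" "\<And>k. e k - 1 / (real k + 1) < ?J (\<phi> k)" by metis
  show ?thesis
  proof (intro exI[of _ \<phi>] conjI allI impI)
    show "test_fun M (W k) (\<phi> k)" for k by (rule \<phi>)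
    show "E - 1 / (real k + 1) \<le> ?J (\<phi> k)" for k using \<phi>(2)[of k] Ee[of k] by linarith
    show "\<exists>k0. \<forall>k\<ge>k0. energy (\<lambda>x. \<phi> k x - \<phi> k0 x) \<le> \<eta>" if \<eta>: "0 < \<eta>" for \<eta>
    proof -
      define m where "m = Inf (range e)"
      have bd: "bdd_below (range e)" using Ee by (intro bdd_belowI[of _ E]) auto
      have m: "m \<le> e k" for k unfolding m_def using bd by (intro cInf_lower) auto
      obtain k1 where k1: "e k1 < m + \<eta> / 4"
        using cInf_lessD[of "range e" "m + \<eta> / 4"] \<eta> unfolding m_def by auto
      obtain k2 :: nat where k2: "8 / \<eta> < real k2" using reals_Archimedean2 by blast
      let ?k = "max k1 k2"
      have e_anti: "e l \<le> e k" if "k \<le> l" for k l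
        unfolding e_def using test_fun_mono[OF _ anti[OF that]]
        by (intro cSup_subset_mono ne bdd image_mono) (auto simp: T_def)
      have "8 < real k2 * \<eta>" using k2 \<eta> by (simp add: pos_divide_less_eq)
      also have "\<dots> \<le> (real ?k + 1) * \<eta>" using \<eta> by (intro mult_right_mono) auto
      finally have "4 / (real ?k + 1) \<le> \<eta> / 2" by (simp add: field_simps)
      \<comment> \<open>Both functions are competitors on the larger set \<open>W ?k\<close>, hence
        so is their midpoint. The energy of the difference is then at most 2 (e ?k - m) + 4 / (?k +
        1), and each of the two terms is at most \<eta> / 2.\<close>
      have "energy (\<lambda>x. \<phi> k x - \<phi> ?k x) \<le> \<eta>" if k: "?k \<le> k" for k
      proof -
        have t: "test_fun M (W ?k) (\<phi> k)" by (rule test_fun_mono[OF \<phi>(1) anti[OF k]])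
        have "(?J (\<phi> k) + ?J (\<phi> ?k)) / 2 + energy (\<lambda>x. \<phi> k x - \<phi> ?k x) / 4 \<le> e ?k"
          using le_e[OF test_fun_lin[OF t \<phi>(1), of "1 / 2" "1 / 2"]]
          unfolding dirichlet_midpoint[OF f test_fun_smooth[OF t] test_fun_smooth[OF \<phi>(1)]] .
        moreover have "1 / (real k + 1) \<le> 1 / (real ?k + 1)" using k by (intro divide_left_mono) auto
        moreover have "e ?k < m + \<eta> / 4" using e_anti[of k1 ?k] k1 by simp
        ultimately show ?thesis
          using \<phi>(2)[of k] \<phi>(2)[of ?k] m[of k] \<open>4 / (real ?k + 1) \<le> \<eta> / 2\<close> by argo
      qed
      then show ?thesis by blast
    qed
  qed
qed

end

section \<open>Stability of the supremum under enlargement of the superlevel set\<close>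

context closed_manifold
begin

text \<open>Moving a near-maximiser on a slightly larger superlevel set inward turns it into a competitor on
  \<open>{h > 0}\<close> at a small cost; the cost is uniform because the near-maximisers are Cauchy.\<close>

lemma dirichlet_superlevel:
  assumes h: "C2\<alpha>_fun M \<alpha> h" and nz: "\<And>p. h p = 0 \<Longrightarrow> tnorm M p (gradient M h p) \<noteq> 0"
    and neg: "h x0 < 0" and f: "L2_fun f"
    and E: "\<And>\<phi>. test_fun M {x. 0 < h x} \<phi> \<Longrightarrow> dirichlet f \<phi> \<le> E" and \<delta>: "0 < \<delta>"
  shows "\<exists>\<epsilon>>0. \<forall>\<phi>. test_fun M {x. - \<epsilon> < h x} \<phi> \<longrightarrow> dirichlet f \<phi> \<le> E + \<delta>"
proof (rule ccontr)
  assume "\<not> ?thesis"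
  then have big: "\<exists>\<phi>. test_fun M {x. - \<epsilon> < h x} \<phi> \<and> E + \<delta> < dirichlet f \<phi>" if "0 < \<epsilon>" for \<epsilon>
    using that by (meson not_le)
  \<comment> \<open>With this level all sets \<open>W k\<close> avoid a fixed nonempty open set, so
    one Poincare constant holds for every competitor.\<close>
  define \<epsilon> where "\<epsilon> = - h x0 / 2"
  have \<epsilon>: "0 < \<epsilon>" "h x0 < - \<epsilon>" using neg by (auto simp: \<epsilon>_def)
  define W where "W = (\<lambda>k::nat. {x. - (\<epsilon> / (real k + 1)) < h x})"
  have anti: "W l \<subseteq> W k" if "k \<le> l" for k l
  proof -
    have "\<epsilon> / (real l + 1) \<le> \<epsilon> / (real k + 1)" using that \<epsilon>(1) by (intro divide_left_mono) auto
    then show ?thesis by (auto simp: W_def)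
  qed
  have "open {x. h x < - \<epsilon>}"
    by (rule open_Collect_less[OF C2\<alpha>_fun_continuous[OF h] continuous_on_const])
  moreover have "{x. h x < - \<epsilon>} \<noteq> {}" using \<epsilon>(2) by auto
  ultimately obtain C where C: "0 \<le> C" "\<And>\<phi>. smooth_fun M \<phi> \<Longrightarrow> (\<And>x. x \<in> {x. h x < - \<epsilon>} \<Longrightarrow> \<phi> x = 0) \<Longrightarrow>
      (LINT x|V. (\<phi> x)\<^sup>2) \<le> C * energy \<phi>"
    by (rule Poincare) blast
  have P: "(LINT x|V. (\<phi> x)\<^sup>2) \<le> C * energy \<phi>" if "test_fun M (W 0) \<phi>" for \<phi>
    using that by (intro C(2) test_fun_smooth[OF that] test_fun_vanish(1)[OF that]) (auto simp: W_def)
  define F where "F = (LINT x|V. (f x)\<^sup>2)"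
  have F: "0 \<le> F" by (simp add: F_def)
  have coercive: "dirichlet f \<phi> + energy \<phi> / 2 \<le> (2 * C + 1) * F" if "test_fun M (W 0) \<phi>" for \<phi>
    unfolding F_def by (rule energy_le_dirichlet[OF f test_fun_smooth[OF that] C(1) P[OF that]])
  have bound: "dirichlet f \<phi> \<le> (2 * C + 1) * F" if "test_fun M (W 0) \<phi>" for \<phi>
    using coercive[OF that] energy_nonneg[of \<phi>] by linarith
  have bigW: "\<exists>\<phi>. test_fun M (W k) \<phi> \<and> E + \<delta> < dirichlet f \<phi>" for k
    unfolding W_def by (rule big) (use \<epsilon>(1) in simp)
  obtain \<phi> where \<phi>: "\<And>k::nat. test_fun M (W k) (\<phi> k)"
    and max: "\<And>k. E + \<delta> - 1 / (real k + 1) \<le> dirichlet f (\<phi> k)"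
    and Cauchy: "\<And>\<eta>. 0 < \<eta> \<Longrightarrow> \<exists>k0. \<forall>k\<ge>k0. energy (\<lambda>x. \<phi> k x - \<phi> k0 x) \<le> \<eta>"
    using near_maximisers[where W = W, OF f anti bigW bound] by blast
  have \<phi>0: "test_fun M (W 0) (\<phi> k)" for k by (rule test_fun_mono[OF \<phi> anti[OF le0]])
  note sm = test_fun_smooth[OF \<phi>]
  \<comment> \<open>By coercivity a lower bound for the functional is an upper bound for the energy;
    1 / (k + 1) is at most 1.\<close>
  define G where "G = 2 * ((2 * C + 1) * F - (E + \<delta> - 1))"
  have G: "energy (\<phi> k) \<le> G" for k
  proof -
    have "1 / (real k + 1) \<le> 1" by simp
    then show ?thesis using coercive[OF \<phi>0, of k] max[of k] unfolding G_def by argo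
  qed
  have G0: "0 \<le> G" using G[of 0] energy_nonneg[of "\<phi> 0"] by linarith
  obtain S :: "real \<Rightarrow> ('a \<Rightarrow> real) \<Rightarrow> 'a \<Rightarrow> real" and \<kappa> t0 B where \<kappa>: "0 < \<kappa>" "0 < t0" "0 \<le> B"
    and S: "\<And>\<phi> t. smooth_fun M \<phi> \<Longrightarrow> 0 < t \<Longrightarrow> t \<le> t0 \<Longrightarrow> smooth_fun M (S t \<phi>)"
    and S_diff: "\<And>\<phi> \<psi> t. S t (\<lambda>x. \<phi> x - \<psi> x) = (\<lambda>x. S t \<phi> x - S t \<psi> x)"
    and S_bound: "\<And>\<phi> t. smooth_fun M \<phi> \<Longrightarrow> 0 < t \<Longrightarrow> t \<le> t0 \<Longrightarrow> sob (\<lambda>x. S t \<phi> x - \<phi> x) \<le> B * sob \<phi>"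
    and S_tendsto: "\<And>\<phi> T. smooth_fun M \<phi> \<Longrightarrow> (\<And>k::nat. 0 < T k \<and> T k \<le> t0) \<Longrightarrow> T \<longlonglongrightarrow> 0 \<Longrightarrow>
      (\<lambda>k. sob (\<lambda>x. S (T k) \<phi> x - \<phi> x)) \<longlonglongrightarrow> 0"
    and S_test: "\<And>\<phi> t \<epsilon>. test_fun M {x. - \<epsilon> < h x} \<phi> \<Longrightarrow> 0 < t \<Longrightarrow> t \<le> t0 \<Longrightarrow> \<epsilon> \<le> \<kappa> * t \<Longrightarrow>
      test_fun M {x. 0 < h x} (S t \<phi>)"
    by (rule inward_shift[OF h nz]) blast+
  \<comment> \<open>The available gap \<delta> is divided as follows: \<open>s\<close> makes the
    Young cost at most \<delta> / 8, \<open>\<sigma>\<close> is the Sobolev error whose weighted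
    cost is exactly \<delta> / 8, and \<open>\<eta>\<close> is the energy distance for which the
    remainder contributes at most \<sigma> / 4.\<close>
  define s where "s = \<delta> / (8 * (F + G + 1))"
  have s: "0 < s" "s * (F + G) \<le> \<delta> / 8"
  proof -
    show "0 < s" using \<delta> F G0 by (simp add: s_def)
    have "s * (F + G) \<le> s * (F + G + 1)" using \<open>0 < s\<close> by simp
    also have "\<dots> = \<delta> / 8" using F G0 by (simp add: s_def field_simps)
    finally show "s * (F + G) \<le> \<delta> / 8" .
  qed
  define \<sigma> where "\<sigma> = \<delta> / 8 / (1 + 1 / s)"
  have \<sigma>: "0 < \<sigma>" "(1 + 1 / s) * \<sigma> = \<delta> / 8"
  proof -
    have "0 < 1 + 1 / s" using s(1) by (simp add: add_pos_pos)
    then have p: "0 < 1 + 1 / s" "1 + 1 / s \<noteq> 0" by auto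
    show "0 < \<sigma>" unfolding \<sigma>_def by (intro divide_pos_pos p) (use \<delta> in simp_all)
    show "(1 + 1 / s) * \<sigma> = \<delta> / 8"
      unfolding \<sigma>_def using p(2) by (metis nonzero_mult_div_cancel_left times_divide_eq_right)
  qed
  define \<eta> where "\<eta> = \<sigma> / (4 * ((B + 1) * (C + 1)))"
  have \<eta>: "0 < \<eta>" "4 * ((B + 1) * ((C + 1) * \<eta>)) = \<sigma>"
  proof -
    have p: "0 < 4 * ((B + 1) * (C + 1))" using C(1) \<kappa>(3) by simp
    show "0 < \<eta>" unfolding \<eta>_def by (intro divide_pos_pos p \<sigma>(1))
    have "4 * ((B + 1) * (C + 1)) * \<eta> = \<sigma>" unfolding \<eta>_def using p by (metis less_irrefl nonzero_mult_div_cancel_left times_divide_eq_right)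
    then show "4 * ((B + 1) * ((C + 1) * \<eta>)) = \<sigma>" by (simp only: mult.assoc)
  qed
  \<comment> \<open>The order of choices matters: first the index \<open>k0\<close> of a fixed
    approximant, then a shift length \<open>t\<close> small for this approximant, and only then an
    index \<open>k\<close> whose level is small compared with \<open>t\<close>.\<close>
  obtain k0 where k0: "\<And>k. k0 \<le> k \<Longrightarrow> energy (\<lambda>x. \<phi> k x - \<phi> k0 x) \<le> \<eta>" using Cauchy[OF \<eta>(1)] by blast
  define T where "T = (\<lambda>m::nat. t0 / (real m + 1))"
  have T: "0 < T m \<and> T m \<le> t0" for m using \<kappa>(2) by (simp add: T_def field_simps)
  have inv0: "(\<lambda>m. c / (real m + 1)) \<longlonglongrightarrow> 0" for c
    using tendsto_mult_left[OF LIMSEQ_inverse_real_of_nat, of c] by (simp add: divide_inverse add.commute)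
  have "(\<lambda>m. sob (\<lambda>x. S (T m) (\<phi> k0) x - \<phi> k0 x)) \<longlonglongrightarrow> 0"
    by (rule S_tendsto[OF sm T]) (unfold T_def, rule inv0)
  then have "\<forall>\<^sub>F m in sequentially. sob (\<lambda>x. S (T m) (\<phi> k0) x - \<phi> k0 x) < \<sigma> / 4"
    by (rule order_tendstoD) (use \<sigma>(1) in simp)
  then obtain m where m: "sob (\<lambda>x. S (T m) (\<phi> k0) x - \<phi> k0 x) < \<sigma> / 4"
    by (auto simp: eventually_sequentially)
  define t where "t = T m"
  have t: "0 < t" "t \<le> t0" using T by (simp_all add: t_def)
  \<comment> \<open>The three conditions ensure closeness to the approximant, that the shift
    overcomes the level of \<open>W k\<close>, and that the near-maximiser misses at most \<delta> /
    2.\<close>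
  have "\<forall>\<^sub>F k in sequentially. k0 \<le> k \<and> \<epsilon> / (real k + 1) < \<kappa> * t \<and> 1 / (real k + 1) < \<delta> / 2"
    by (intro eventually_conj eventually_ge_at_top order_tendstoD(2)[OF inv0]) (use \<kappa>(1) t(1) \<delta> in simp_all)
  then obtain k where k: "k0 \<le> k" "\<epsilon> / (real k + 1) < \<kappa> * t" "1 / (real k + 1) < \<delta> / 2"
    using eventually_happens'[OF sequentially_bot] by blast
  let ?g = "\<lambda>x. \<phi> k x - \<phi> k0 x"
  have g: "smooth_fun M ?g" by (rule smooth_fun_diff[OF sm sm])
  have tg: "test_fun M (W 0) (\<lambda>x. 1 * \<phi> k x + (-1) * \<phi> k0 x)" by (rule test_fun_lin[OF \<phi>0 \<phi>0])
  have "sob ?g \<le> (C + 1) * energy ?g" using P[OF tg] by (simp add: sob_def algebra_simps)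
  also have "\<dots> \<le> (C + 1) * \<eta>" using k0[OF k(1)] C(1) by (intro mult_left_mono) auto
  finally have sg: "sob ?g \<le> (C + 1) * \<eta>" .
  have "sob (\<lambda>x. S t ?g x - ?g x) \<le> B * sob ?g" by (rule S_bound[OF g t])
  also have "\<dots> \<le> (B + 1) * ((C + 1) * \<eta>)" using sg \<kappa>(3) sob_nonneg[of ?g] by (intro mult_mono) auto
  finally have 1: "sob (\<lambda>x. S t ?g x - ?g x) \<le> \<sigma> / 4" using \<eta>(2) by simp
  \<comment> \<open>The remainder is controlled by the bound uniform in \<open>t\<close>, the fixed
    approximant by convergence of the shifts; each contributes at most \<sigma> / 4 before
    doubling.\<close>
  have eq: "(\<lambda>x. S t (\<phi> k) x - \<phi> k x) = (\<lambda>x. (S t ?g x - ?g x) + (S t (\<phi> k0) x - \<phi> k0 x))"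
    by (simp add: S_diff)
  have "sob (\<lambda>x. S t (\<phi> k) x - \<phi> k x) \<le> 2 * sob (\<lambda>x. S t ?g x - ?g x) + 2 * sob (\<lambda>x. S t (\<phi> k0) x - \<phi> k0 x)"
    unfolding eq by (intro sob_add smooth_fun_diff[OF S[OF g t] g] smooth_fun_diff[OF S[OF sm t] sm])
  also have "\<dots> \<le> \<sigma>" using 1 m unfolding t_def by linarith
  finally have "(1 + 1 / s) * sob (\<lambda>x. S t (\<phi> k) x - \<phi> k x) \<le> (1 + 1 / s) * \<sigma>"
    using s(1) by (intro mult_left_mono) auto
  moreover have "s * (F + energy (\<phi> k)) \<le> s * (F + G)" using G[of k] s(1) by simp
  moreover have "dirichlet f (\<phi> k) - s * (F + energy (\<phi> k)) - (1 + 1 / s) * sob (\<lambda>x. S t (\<phi> k) x - \<phi> k x)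
      \<le> dirichlet f (S t (\<phi> k))"
    unfolding F_def by (rule dirichlet_perturb[OF f sm S[OF sm t] s(1)])
  moreover have "dirichlet f (S t (\<phi> k)) \<le> E"
    by (rule E[OF S_test[OF \<phi>[unfolded W_def] t less_imp_le[OF k(2)]]])
  \<comment> \<open>The shifted function would exceed E + \<delta> - \<delta> / 2 - \<delta> / 8 -
    \<delta> / 8, which is above \<open>E\<close>.\<close>
  ultimately show False using max[of k] k(3) s(2) \<sigma>(2) \<delta> by argo
qed

section \<open>Weak solutions and their approximation\<close>

text \<open>Testing the equation with the function itself completes the square: the defect of the
  functional is exactly the squared gradient distance. Since solutions are limits of test functions,
  the defect can be made arbitrarily small.\<close>

lemma weak_solution_extension:
  assumes W: "open W" and u: "weak_solution M W f u"
  defines "X \<equiv> vext W (wgrad M W u)"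
  shows "L2_fun (zero_ext W u)" "L2_field X" "dist_grad UNIV (zero_ext W u) X"
    and "\<And>\<phi>. test_fun M W \<phi> \<Longrightarrow>
      ip (\<lambda>x c. X x c - gradient M \<phi> x c) (\<lambda>x c. X x c - gradient M \<phi> x c) = ip X X - dirichlet f \<phi>"
    and "\<And>\<eta>. 0 < \<eta> \<Longrightarrow> \<exists>\<phi>. test_fun M W \<phi> \<and> (LINT x|V. (zero_ext W u x - \<phi> x)\<^sup>2) < \<eta> \<and> ip X X - dirichlet f \<phi> < \<eta>"
proof -
  have u1: "u \<in> H10 M W" using u by (simp add: weak_solution_def)
  obtain \<phi> where H: "L2_fun (zero_ext W u)" "L2_field X" "dist_grad UNIV (zero_ext W u) X"
    "\<And>k::nat. test_fun M W (\<phi> k)"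
    "(\<lambda>k. LINT x|V. (zero_ext W u x - \<phi> k x)\<^sup>2) \<longlonglongrightarrow> 0"
    "(\<lambda>k. ip (\<lambda>x c. X x c - gradient M (\<phi> k) x c) (\<lambda>x c. X x c - gradient M (\<phi> k) x c)) \<longlonglongrightarrow> 0"
    unfolding X_def by (rule H10_extension[OF W u1]) blast
  show "L2_fun (zero_ext W u)" "L2_field X" "dist_grad UNIV (zero_ext W u) X" by fact+
  show eq: "ip (\<lambda>x c. X x c - gradient M \<phi> x c) (\<lambda>x c. X x c - gradient M \<phi> x c) = ip X X - dirichlet f \<phi>"
    if \<phi>: "test_fun M W \<phi>" for \<phi>
  proof -
    have "ip X (gradient M \<phi>) = (LINT x|V. f x * \<phi> x)" unfolding X_def by (rule weak_solution_test[OF W u \<phi>])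
    then show ?thesis
      using ip_lin_square[OF H(2) L2_field_gradient[OF test_fun_smooth[OF \<phi>]], of 1 "-1"]
      by (simp add: dirichlet_def energy_def)
  qed
  show "\<exists>\<phi>. test_fun M W \<phi> \<and> (LINT x|V. (zero_ext W u x - \<phi> x)\<^sup>2) < \<eta> \<and> ip X X - dirichlet f \<phi> < \<eta>"
    if \<eta>: "0 < \<eta>" for \<eta>
  proof -
    have "\<forall>\<^sub>F k in sequentially. (LINT x|V. (zero_ext W u x - \<phi> k x)\<^sup>2) < \<eta> \<and> ip X X - dirichlet f (\<phi> k) < \<eta>"
      using order_tendstoD(2)[OF H(5) \<eta>] order_tendstoD(2)[OF H(6) \<eta>] unfolding eq[OF H(4)]
      by (rule eventually_conj)
    then show ?thesis using H(4) by (auto simp: eventually_sequentially)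
  qed
qed

lemma ip_diff_le:
  assumes "L2_field X" "L2_field Y" "L2_field Z"
  shows "ip (\<lambda>x c. X x c - Y x c) (\<lambda>x c. X x c - Y x c)
    \<le> 2 * ip (\<lambda>x c. X x c - Z x c) (\<lambda>x c. X x c - Z x c) + 2 * ip (\<lambda>x c. Y x c - Z x c) (\<lambda>x c. Y x c - Z x c)"
proof -
  have d: "L2_field (\<lambda>x c. X x c - Z x c)" "L2_field (\<lambda>x c. Y x c - Z x c)"
    using L2_field_lin[OF assms(1,3), of 1 "-1"] L2_field_lin[OF assms(2,3), of 1 "-1"] by simp_all
  have eq: "(\<lambda>x c. X x c - Y x c) = (\<lambda>x c. 1 *\<^sub>R (X x c - Z x c) + (-1) *\<^sub>R (Y x c - Z x c))" by simp
  have "0 \<le> ip (\<lambda>x c. 1 *\<^sub>R (X x c - Z x c) + 1 *\<^sub>R (Y x c - Z x c)) (\<lambda>x c. 1 *\<^sub>R (X x c - Z x c) + 1 *\<^sub>R (Y x c - Z x c))"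
    by (rule ip_nonneg)
  then show ?thesis unfolding eq ip_lin_square[OF d] by simp
qed

lemma integral_diff_le:
  assumes "L2_fun u" "L2_fun v" "L2_fun w"
  shows "(LINT x|V. (u x - v x)\<^sup>2) \<le> 2 * (LINT x|V. (u x - w x)\<^sup>2) + 2 * (LINT x|V. (v x - w x)\<^sup>2)"
proof -
  have d: "L2_fun (\<lambda>x. u x - w x)" "L2_fun (\<lambda>x. v x - w x)"
    using L2_fun_lin[OF assms(1,3), of 1 "-1"] L2_fun_lin[OF assms(2,3), of 1 "-1"] by simp_all
  have eq: "(\<lambda>x. (u x - v x)\<^sup>2) = (\<lambda>x. (1 * (u x - w x) + (-1) * (v x - w x))\<^sup>2)" by simp
  have "0 \<le> (LINT x|V. (1 * (u x - w x) + 1 * (v x - w x))\<^sup>2)" by simp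
  then show ?thesis unfolding eq integral_lin_square[OF d] by simp
qed

text \<open>The Poincare inequality is available for test functions only. The solution is therefore
  replaced by a test function close to it, at an error that is then sent to 0.\<close>

lemma weak_solution_close:
  assumes W: "open W" and u: "weak_solution M W f u" and C: "0 \<le> C"
    and P: "\<And>\<phi>. test_fun M W \<phi> \<Longrightarrow> (LINT x|V. (\<phi> x)\<^sup>2) \<le> C * energy \<phi>" and \<phi>: "test_fun M W \<phi>"
  defines "X \<equiv> vext W (wgrad M W u)"
  shows "(LINT x|V. (zero_ext W u x - \<phi> x)\<^sup>2) \<le> 4 * C * (ip X X - dirichlet f \<phi>)"
proof (rule field_le_epsilon)
  note H = weak_solution_extension[OF W u, folded X_def]
  let ?D = "ip X X - dirichlet f \<phi>"
  fix e :: real assume e: "0 < e"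
  \<comment> \<open>The approximation error enters once as 2 \<eta> and once, through the Poincare
    inequality, as 4 C \<eta>; together they make up \<open>e\<close>.\<close>
  define \<eta> where "\<eta> = e / (2 + 4 * C)"
  have \<eta>: "0 < \<eta>" "(2 + 4 * C) * \<eta> = e" using e C by (simp_all add: \<eta>_def)
  obtain \<psi> where \<psi>: "test_fun M W \<psi>" "(LINT x|V. (zero_ext W u x - \<psi> x)\<^sup>2) < \<eta>" "ip X X - dirichlet f \<psi> < \<eta>"
    using H(5)[OF \<eta>(1)] by blast
  note sm = test_fun_smooth[OF \<phi>] test_fun_smooth[OF \<psi>(1)]
  have "energy (\<lambda>x. \<phi> x - \<psi> x) \<le> 2 * ip (\<lambda>x c. gradient M \<phi> x c - X x c) (\<lambda>x c. gradient M \<phi> x c - X x c)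
      + 2 * ip (\<lambda>x c. gradient M \<psi> x c - X x c) (\<lambda>x c. gradient M \<psi> x c - X x c)"
    unfolding energy_def gradient_diff[OF sm] by (rule ip_diff_le[OF L2_field_gradient[OF sm(1)] L2_field_gradient[OF sm(2)] H(2)])
  moreover have "ip (\<lambda>x c. gradient M \<zeta> x c - X x c) (\<lambda>x c. gradient M \<zeta> x c - X x c) = ip X X - dirichlet f \<zeta>"
    if "test_fun M W \<zeta>" for \<zeta>
    using ip_lin_square[OF H(2) L2_field_gradient[OF test_fun_smooth[OF that]], of 1 "-1"]
      ip_lin_square[OF H(2) L2_field_gradient[OF test_fun_smooth[OF that]], of "-1" 1] H(4)[OF that] by simp
  ultimately have "energy (\<lambda>x. \<phi> x - \<psi> x) \<le> 2 * ?D + 2 * \<eta>" using \<phi> \<psi>(1,3) by fastforce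
  then have "C * energy (\<lambda>x. \<phi> x - \<psi> x) \<le> C * (2 * ?D + 2 * \<eta>)" using C by (intro mult_left_mono)
  moreover have "(LINT x|V. (\<phi> x - \<psi> x)\<^sup>2) \<le> C * energy (\<lambda>x. \<phi> x - \<psi> x)"
    using P[OF test_fun_lin[OF \<phi> \<psi>(1), of 1 "-1"]] by simp
  moreover have "(LINT x|V. (zero_ext W u x - \<phi> x)\<^sup>2) \<le> 2 * (LINT x|V. (zero_ext W u x - \<psi> x)\<^sup>2) + 2 * (LINT x|V. (\<phi> x - \<psi> x)\<^sup>2)"
    by (rule integral_diff_le[OF H(1) L2_fun_smooth[OF sm(1)] L2_fun_smooth[OF sm(2)]])
  ultimately show "(LINT x|V. (zero_ext W u x - \<phi> x)\<^sup>2) \<le> 4 * C * ?D + e"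
    using \<psi>(2) \<eta>(2) by (simp add: algebra_simps)
qed

lemma zero_ext_H1:
  assumes "open W" "weak_solution M W f u"
  shows "zero_ext W u \<in> H1 M UNIV" "weak_gradient M UNIV (zero_ext W u) (vext W (wgrad M W u))"
  using weak_solution_extension(1-3)[OF assms] by (auto simp: H1_def L2_iff weak_gradient_iff)

lemma integral_wgrad_zero_ext:
  assumes "open W" "weak_solution M W f u"
  shows "(LINT x|V. (tnorm M x (wgrad M UNIV (zero_ext W u) x))\<^sup>2)
    = ip (vext W (wgrad M W u)) (vext W (wgrad M W u))"
proof -
  note w = zero_ext_H1(2)[OF assms]
  have "(LINT x|V. (tnorm M x (wgrad M UNIV (zero_ext W u) x))\<^sup>2)
    = ip (wgrad M UNIV (zero_ext W u)) (wgrad M UNIV (zero_ext W u))"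
    by (simp add: tnorm_sq ip_def)
  also have "\<dots> = ip (vext W (wgrad M W u)) (vext W (wgrad M W u))"
    using w weak_gradient_wgrad[OF w] wgrad_AE[OF open_UNIV w]
    by (intro ip_cong_AE) (auto simp: weak_gradient_iff)
  finally show ?thesis .
qed

end

section \<open>Stability of weak solutions\<close>

context closed_manifold
begin

text \<open>If \<open>h\<close> were nonnegative, a zero \<open>p\<close> could be reached by an
  inward step from the point one step behind it, and \<open>h\<close> would be positive at
  \<open>p\<close>. Such a negative value opens the region where test functions vanish, as the
  Poincare inequality demands.\<close>

lemma negative_level:
  assumes h: "C2\<alpha>_fun M \<alpha> h" and nz: "\<And>p. h p = 0 \<Longrightarrow> tnorm M p (gradient M h p) \<noteq> 0"
    and ne: "{x. 0 < h x} \<noteq> UNIV"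
  shows "\<exists>x. h x < 0"
proof (rule ccontr)
  assume nonneg: "\<not> ?thesis"
  then obtain p where p: "h p = 0" using ne by (metis UNIV_eq_I linorder_neqE_linordered_idom mem_Collect_eq)
  obtain c r e \<kappa> t0 where P: "inward_patch h p c r e \<kappa> t0"
    using inward_patch_exists[OF h nz[OF p]] by blast
  let ?y = "cmap c p - t0 *\<^sub>R e"
  have y: "?y \<in> cball (cmap c p) r" using inward_patchD(6,8)[OF P] by (simp add: dist_norm)
  have "- (\<kappa> * t0) < h (cinv c ?y)"
    using nonneg mult_pos_pos[OF inward_patchD(5,6)[OF P]] by (meson le_less_trans neg_less_0_iff_less not_le order.strict_trans2)
  then have "0 < h (cinv c (?y + t0 *\<^sub>R e))"
    using inward_patchD(9)[OF P y inward_patchD(6)[OF P] order_refl] by blast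
  then show False using p cinv_cmap[OF inward_patchD(1,2)[OF P]] by simp
qed

text \<open>On the compact support \<open>h\<close> has a positive minimum, which serves as the
  tolerance for perturbations of \<open>h\<close>.\<close>

lemma test_fun_superlevel:
  fixes h :: "'a \<Rightarrow> real"
  assumes h: "continuous_on UNIV h" and \<phi>: "test_fun M {x. 0 < h x} \<phi>"
  shows "\<exists>m>0. \<forall>h'. (\<forall>x. \<bar>h' x - h x\<bar> < m) \<longrightarrow> test_fun M {x. 0 < h' x} \<phi>"
proof -
  let ?F = "closure {x. \<phi> x \<noteq> 0}"
  have F: "compact ?F" "?F \<subseteq> {x. 0 < h x}" using \<phi> by (auto simp: test_fun_def)
  have "\<exists>m>0. \<forall>x\<in>?F. m \<le> h x"
  proof (cases "?F = {}")
    case True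
    then show ?thesis by (intro exI[of _ "1 :: real"]) simp
  next
    case False
    from continuous_attains_inf[OF F(1) False continuous_on_subset[OF h]] F(2) show ?thesis by blast
  qed
  then obtain m where m: "0 < m" "\<And>x. x \<in> ?F \<Longrightarrow> m \<le> h x" by blast
  have "test_fun M {x. 0 < h' x} \<phi>" if "\<And>x. \<bar>h' x - h x\<bar> < m" for h'
  proof -
    have "0 < h' x" if "x \<in> ?F" for x using m(2)[OF that] \<open>\<And>x. \<bar>h' x - h x\<bar> < m\<close>[of x] by linarith
    then show ?thesis using \<phi> by (auto simp: test_fun_def)
  qed
  with m(1) show ?thesis by blast
qed

text \<open>Both solutions are compared with the same test function. Each gradient distance is at
  most \<open>D\<close> and each L^2 distance at most 4 C D; the splitting into two distances
  doubles them, giving 4 D and 16 C D.\<close>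

lemma H1_norm_diff_le:
  assumes W: "open W" "open W'" and u: "weak_solution M W f u" and u': "weak_solution M W' f u'" and C: "0 \<le> C"
    and P: "\<And>\<psi>. test_fun M W \<psi> \<Longrightarrow> (LINT x|V. (\<psi> x)\<^sup>2) \<le> C * energy \<psi>"
      "\<And>\<psi>. test_fun M W' \<psi> \<Longrightarrow> (LINT x|V. (\<psi> x)\<^sup>2) \<le> C * energy \<psi>"
    and \<phi>: "test_fun M W \<phi>" "test_fun M W' \<phi>"
    and D: "ip (vext W (wgrad M W u)) (vext W (wgrad M W u)) \<le> dirichlet f \<phi> + D"
      "ip (vext W' (wgrad M W' u')) (vext W' (wgrad M W' u')) \<le> dirichlet f \<phi> + D"
  shows "(H1_norm M UNIV (\<lambda>x. zero_ext W' u' x - zero_ext W u x))\<^sup>2 \<le> (16 * C + 4) * D"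
proof -
  let ?X = "vext W (wgrad M W u)" and ?X' = "vext W' (wgrad M W' u')"
  let ?u = "zero_ext W u" and ?u' = "zero_ext W' u'"
  note H = weak_solution_extension[OF W(1) u] and H' = weak_solution_extension[OF W(2) u']
  note G = L2_field_gradient[OF test_fun_smooth[OF \<phi>(1)]] and L = L2_fun_smooth[OF test_fun_smooth[OF \<phi>(1)]]
  have L2: "?u \<in> L2 M UNIV" "?u' \<in> L2 M UNIV" using H(1) H'(1) by (simp_all add: L2_iff)
  note w = weak_gradient_diff[OF L2(2,1) zero_ext_H1(2)[OF W(2) u'] zero_ext_H1(2)[OF W(1) u]]
  have "(H1_norm M UNIV (\<lambda>x. ?u' x - ?u x))\<^sup>2
    = (LINT x|V. (?u' x - ?u x)\<^sup>2) + ip (\<lambda>x c. ?X' x c - ?X x c) (\<lambda>x c. ?X' x c - ?X x c)"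
    using H1_norm_sq[OF open_UNIV w] by simp
  moreover have "ip (\<lambda>x c. ?X' x c - ?X x c) (\<lambda>x c. ?X' x c - ?X x c) \<le> 4 * D"
    using ip_diff_le[OF H'(2) H(2) G] H(4)[OF \<phi>(1)] H'(4)[OF \<phi>(2)] D by linarith
  moreover have "(LINT x|V. (?u' x - ?u x)\<^sup>2) \<le> 16 * C * D"
  proof -
    have 1: "4 * C * (ip ?X ?X - dirichlet f \<phi>) \<le> 4 * C * D" "4 * C * (ip ?X' ?X' - dirichlet f \<phi>) \<le> 4 * C * D"
      using C D by (auto intro!: mult_left_mono)
    then show ?thesis
      using integral_diff_le[OF H'(1) H(1) L] weak_solution_close[OF W(1) u C P(1) \<phi>(1)]
        weak_solution_close[OF W(2) u' C P(2) \<phi>(2)] by simp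
  qed
  ultimately show ?thesis by (simp add: algebra_simps)
qed

text \<open>A near-maximiser for the limit domain serves all late domains. The energies on these
  cannot be much larger, because their test functions are competitors on a slightly enlarged
  superlevel set of \<open>h\<close>.\<close>

lemma weak_solutions_converge:
  fixes h :: "'a \<Rightarrow> real" and h' :: "nat \<Rightarrow> 'a \<Rightarrow> real"
  assumes h: "C2\<alpha>_fun M \<alpha> h" and nz: "\<And>p. h p = 0 \<Longrightarrow> tnorm M p (gradient M h p) \<noteq> 0"
    and ne: "{x. 0 < h x} \<noteq> UNIV" and f: "L2_fun f"
    and h': "\<And>j. open {x. 0 < h' j x}"
    and unif: "\<And>e. 0 < e \<Longrightarrow> \<forall>\<^sub>F j in sequentially. \<forall>x. \<bar>h' j x - h x\<bar> < e"
    and u: "weak_solution M {x. 0 < h x} f u" and u': "\<And>j. weak_solution M {x. 0 < h' j x} f (u' j)"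
  defines "X \<equiv> vext {x. 0 < h x} (wgrad M {x. 0 < h x} u)"
    and "X' \<equiv> \<lambda>j. vext {x. 0 < h' j x} (wgrad M {x. 0 < h' j x} (u' j))"
  shows "(\<lambda>j. H1_norm M UNIV (\<lambda>x. zero_ext {x. 0 < h' j x} (u' j) x - zero_ext {x. 0 < h x} u x)) \<longlonglongrightarrow> 0"
    and "(\<lambda>j. ip (X' j) (X' j)) \<longlonglongrightarrow> ip X X"
proof -
  let ?W = "{x. 0 < h x}" and ?W' = "\<lambda>j. {x. 0 < h' j x}"
  let ?n = "\<lambda>j. H1_norm M UNIV (\<lambda>x. zero_ext (?W' j) (u' j) x - zero_ext ?W u x)"
  have hc: "continuous_on UNIV h" by (rule C2\<alpha>_fun_continuous[OF h])
  have W: "open ?W" by (rule open_Collect_less[OF continuous_on_const hc])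
  note H = weak_solution_extension[OF W u, folded X_def]
  obtain x0 where x0: "h x0 < 0" using negative_level[OF h nz ne] by blast
  define \<epsilon>0 where "\<epsilon>0 = - h x0 / 2"
  have \<epsilon>0: "0 < \<epsilon>0" "h x0 < - \<epsilon>0" using x0 by (auto simp: \<epsilon>0_def)
  define N where "N = {x. h x < - \<epsilon>0}"
  have N: "open N" "N \<noteq> {}"
    unfolding N_def using open_Collect_less[OF hc continuous_on_const] \<epsilon>0(2) by auto
  obtain C where C: "0 \<le> C" "\<And>\<phi>. smooth_fun M \<phi> \<Longrightarrow> (\<And>x. x \<in> N \<Longrightarrow> \<phi> x = 0) \<Longrightarrow> (LINT x|V. (\<phi> x)\<^sup>2) \<le> C * energy \<phi>"
    by (rule Poincare[OF N]) blast
  have P: "(LINT x|V. (\<psi> x)\<^sup>2) \<le> C * energy \<psi>" if "test_fun M U \<psi>" "U \<subseteq> {x. - \<epsilon>0 < h x}" for U \<psi>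
    using that by (intro C(2) test_fun_smooth[OF that(1)] test_fun_vanish(1)[OF that(1)]) (auto simp: N_def)
  have le: "dirichlet f \<phi> \<le> ip X X" if "test_fun M ?W \<phi>" for \<phi>
    using H(4)[OF that] ip_nonneg[of "\<lambda>x c. X x c - gradient M \<phi> x c"] by linarith
  have key: "\<forall>\<^sub>F j in sequentially. (?n j)\<^sup>2 \<le> (16 * C + 4) * D \<and> \<bar>ip (X' j) (X' j) - ip X X\<bar> \<le> D" if D: "0 < D" for D
  proof -
    \<comment> \<open>The tolerance \<open>D\<close> is split: \<open>D / 2\<close> for the defect
      on the limit domain, and twice \<open>D / 4\<close> for the approximation on the late domain
      and for the enlargement of the superlevel set.\<close>
    obtain \<phi> where \<phi>: "test_fun M ?W \<phi>" "ip X X - dirichlet f \<phi> < D / 2" using H(5)[of "D / 2"] D by auto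
    obtain m where m: "0 < m" "\<And>g. (\<And>x. \<bar>g x - h x\<bar> < m) \<Longrightarrow> test_fun M {x. 0 < g x} \<phi>"
      using test_fun_superlevel[OF hc \<phi>(1)] by blast
    obtain \<epsilon> where \<epsilon>: "0 < \<epsilon>" "\<And>\<phi>. test_fun M {x. - \<epsilon> < h x} \<phi> \<Longrightarrow> dirichlet f \<phi> \<le> ip X X + D / 4"
      using dirichlet_superlevel[OF h nz x0 f le, of "D / 4"] D by auto
    have "\<forall>\<^sub>F j in sequentially. \<forall>x. \<bar>h' j x - h x\<bar> < min m (min \<epsilon> \<epsilon>0)"
      using m(1) \<epsilon>(1) \<epsilon>0(1) by (intro unif) simp
    then show ?thesis
    proof eventually_elim
      case (elim j)
      have close: "\<bar>h' j x - h x\<bar> < m" "\<bar>h' j x - h x\<bar> < \<epsilon>" "\<bar>h' j x - h x\<bar> < \<epsilon>0" for x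
        using elim by auto
      \<comment> \<open>Uniform closeness puts the late domain both into the superlevel set of the
        energy estimate and into the set on which the common Poincare constant holds.\<close>
      have sub: "- \<epsilon> < h x \<and> - \<epsilon>0 < h x" if "0 < h' j x" for x
        using close(2,3)[of x] that by (auto simp: abs_less_iff)
      note H' = weak_solution_extension[OF h' u'[of j]]
      have \<phi>': "test_fun M (?W' j) \<phi>" by (rule m(2)[OF close(1)])
      have lower: "dirichlet f \<phi> \<le> ip (X' j) (X' j)"
        using H'(4)[OF \<phi>'] ip_nonneg[of "\<lambda>x c. X' j x c - gradient M \<phi> x c"] by (simp add: X'_def)
      have upper: "ip (X' j) (X' j) \<le> ip X X + D / 2"
      proof -
        obtain \<psi> where \<psi>: "test_fun M (?W' j) \<psi>" "ip (X' j) (X' j) - dirichlet f \<psi> < D / 4"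
          using H'(5)[of "D / 4"] D by (auto simp: X'_def)
        have "test_fun M {x. - \<epsilon> < h x} \<psi>" by (rule test_fun_mono[OF \<psi>(1)]) (use sub in auto)
        from \<epsilon>(2)[OF this] \<psi>(2) show ?thesis by linarith
      qed
      have "(?n j)\<^sup>2 \<le> (16 * C + 4) * D"
      proof (rule H1_norm_diff_le[OF W h' u u' C(1) _ _ \<phi>(1) \<phi>'])
        show "(LINT x|V. (\<psi> x)\<^sup>2) \<le> C * energy \<psi>" if "test_fun M ?W \<psi>" for \<psi>
          by (rule P[OF that]) (use \<epsilon>0 in auto)
        show "(LINT x|V. (\<psi> x)\<^sup>2) \<le> C * energy \<psi>" if "test_fun M (?W' j) \<psi>" for \<psi>
          by (rule P[OF that]) (use sub in auto)
        show "ip (vext ?W (wgrad M ?W u)) (vext ?W (wgrad M ?W u)) \<le> dirichlet f \<phi> + D"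
          using \<phi>(2) D unfolding X_def by linarith
        show "ip (vext (?W' j) (wgrad M (?W' j) (u' j))) (vext (?W' j) (wgrad M (?W' j) (u' j))) \<le> dirichlet f \<phi> + D"
          using \<phi>(2) upper unfolding X'_def by linarith
      qed
      moreover have "\<bar>ip (X' j) (X' j) - ip X X\<bar> \<le> D" using lower upper \<phi>(2) D by (simp add: abs_le_iff)
      ultimately show ?case ..
    qed
  qed
  show "(\<lambda>j. ip (X' j) (X' j)) \<longlonglongrightarrow> ip X X"
  proof (rule tendstoI)
    fix e :: real assume e: "0 < e"
    then have "\<forall>\<^sub>F j in sequentially. \<bar>ip (X' j) (X' j) - ip X X\<bar> \<le> e / 2" using key[of "e / 2"] by (auto elim: eventually_mono)
    then show "\<forall>\<^sub>F j in sequentially. dist (ip (X' j) (X' j)) (ip X X) < e"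
      by (rule eventually_mono) (use e in \<open>simp add: dist_real_def\<close>)
  qed
  show "?n \<longlonglongrightarrow> 0"
  proof (rule tendstoI)
    fix e :: real assume e: "0 < e"
    define D where "D = e\<^sup>2 / (2 * (16 * C + 4))"
    have D: "0 < D" "(16 * C + 4) * D < e\<^sup>2"
    proof -
      have p: "0 < 16 * C + 4" using C(1) by simp
      show "0 < D" unfolding D_def using p e by (intro divide_pos_pos) auto
      have "(16 * C + 4) * D = e\<^sup>2 / 2" using p unfolding D_def by (simp add: divide_simps)
      moreover have "0 < e\<^sup>2" using e by simp
      ultimately show "(16 * C + 4) * D < e\<^sup>2" by linarith
    qed
    from key[OF D(1)] show "\<forall>\<^sub>F j in sequentially. dist (?n j) 0 < e"
    proof eventually_elim
      case (elim j)
      then have "(?n j)\<^sup>2 < e\<^sup>2" using D(2) by linarith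
      then have "\<bar>?n j\<bar> < e" using e by (simp add: power2_less_imp_less abs_le_square_iff abs_less_iff power2_less_imp_less[of "\<bar>?n j\<bar>" e])
      then show ?case by (simp add: dist_real_def)
    qed
  qed
qed

end

theorem theorem2p5:
  fixes M :: "('a::t2_space, 'n::finite) riem"
    and B :: "(('a, 'n) chart \<times> (real ^ 'n) \<times> real) set"
    and \<alpha> A c\<^sub>0 \<rho>\<^sub>0 \<rho>\<^sub>1 :: real
    and K C \<Omega> :: "'a set" and \<Omega>\<^sub>j :: "nat \<Rightarrow> 'a set"
    and h f u :: "'a \<Rightarrow> real" and h\<^sub>j u\<^sub>j :: "nat \<Rightarrow> 'a \<Rightarrow> real"
  assumes "closed_riemannian_manifold M" and "2 \<le> CARD('n)"
    and "0 < \<alpha>" and "\<alpha> < 1"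
    and "coordinate_ball_cover M B"
    and "K \<noteq> {}" and "compact K"
    and "reference_domain M \<alpha> K C"
    and "0 < A" and "0 < c\<^sub>0" and "0 < \<rho>\<^sub>0" and "0 < \<rho>\<^sub>1"
    and "\<And>j. \<Omega>\<^sub>j j \<in> admissible M B \<alpha> A c\<^sub>0 \<rho>\<^sub>0 \<rho>\<^sub>1 C"
    and "\<Omega> \<in> admissible M B \<alpha> A c\<^sub>0 \<rho>\<^sub>0 \<rho>\<^sub>1 C"
    and "\<And>j. defining_function M B \<alpha> A c\<^sub>0 \<rho>\<^sub>0 (\<Omega>\<^sub>j j) (h\<^sub>j j)"
    and "defining_function M B \<alpha> A c\<^sub>0 \<rho>\<^sub>0 \<Omega> h"
    and "(\<lambda>j. C2\<alpha>_norm B \<alpha> (\<lambda>x. h\<^sub>j j x - h x)) \<longlonglongrightarrow> 0"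
    and "f \<in> L2 M UNIV" and "ess_supp M f \<subseteq> K"
    and "\<And>j. weak_solution M (\<Omega>\<^sub>j j) f (u\<^sub>j j)"
    and "weak_solution M \<Omega> f u"
  shows "(\<forall>j. zero_ext (\<Omega>\<^sub>j j) (u\<^sub>j j) \<in> H1 M UNIV) \<and> zero_ext \<Omega> u \<in> H1 M UNIV \<and>
         (\<lambda>j. H1_norm M UNIV (\<lambda>x. zero_ext (\<Omega>\<^sub>j j) (u\<^sub>j j) x - zero_ext \<Omega> u x)) \<longlonglongrightarrow> 0 \<and>
         (\<lambda>j. LINT x|riemannian_volume M. (tnorm M x (wgrad M UNIV (zero_ext (\<Omega>\<^sub>j j) (u\<^sub>j j)) x))\<^sup>2)
           \<longlonglongrightarrow> (LINT x|riemannian_volume M. (tnorm M x (wgrad M UNIV (zero_ext \<Omega> u) x))\<^sup>2)"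
proof -
  interpret closed_manifold M by (rule closed_manifold.intro[OF assms(1)])
  note adm = assms(13,14)[unfolded admissible_def mem_Collect_eq]
  note def = assms(15,16)[unfolded defining_function_def]
  have h: "C2\<alpha>_fun M \<alpha> h" "\<Omega> = {x. 0 < h x}"
    "\<And>x. \<bar>h x\<bar> \<le> \<rho>\<^sub>0 \<Longrightarrow> c\<^sub>0 \<le> tnorm M x (gradient M h x)"
    using def(2) by auto
  have hj: "C2\<alpha>_fun M \<alpha> (h\<^sub>j j)" "\<Omega>\<^sub>j j = {x. 0 < h\<^sub>j j x}" for j
    using def(1)[of j] by auto
  have op: "open \<Omega>" "open (\<Omega>\<^sub>j j)" for j using adm(2) adm(1)[of j] by auto
  \<comment> \<open>At a zero of \<open>h\<close> the nondegeneracy bound of the defining function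
    applies, since 0 lies within \<plusminus> \<open>\<rho>\<^sub>0\<close>.\<close>
  have nz: "tnorm M p (gradient M h p) \<noteq> 0" if "h p = 0" for p
    using h(3)[of p] that \<open>0 < c\<^sub>0\<close> \<open>0 < \<rho>\<^sub>0\<close> by auto
  have ne: "{x. 0 < h x} \<noteq> UNIV" using adm(2) h(2) by auto
  have f: "L2_fun f" using \<open>f \<in> L2 M UNIV\<close> by (simp add: L2_iff)
  have unif: "\<forall>\<^sub>F j in sequentially. \<forall>x. \<bar>h\<^sub>j j x - h x\<bar> < e" if "0 < e" for e
    using order_tendstoD(2)[OF assms(17) that]
  proof eventually_elim
    case (elim j)
    show ?case using C2\<alpha>_norm_ge[OF assms(5) less_imp_le[OF assms(3)] hj(1)[of j] h(1)] elim
      by (meson order.strict_trans1)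
  qed
  note u = \<open>weak_solution M \<Omega> f u\<close> assms(20)
  note side = nz ne f op(2)[unfolded hj(2)] unif u(1)[unfolded h(2)] u(2)[unfolded hj(2)]
  have "(\<lambda>j. H1_norm M UNIV (\<lambda>x. zero_ext (\<Omega>\<^sub>j j) (u\<^sub>j j) x - zero_ext \<Omega> u x)) \<longlonglongrightarrow> 0"
    unfolding h(2) hj(2) by (rule weak_solutions_converge(1)[OF h(1)]; fact side)
  moreover have "(\<lambda>j. LINT x|V. (tnorm M x (wgrad M UNIV (zero_ext (\<Omega>\<^sub>j j) (u\<^sub>j j)) x))\<^sup>2)
      \<longlonglongrightarrow> (LINT x|V. (tnorm M x (wgrad M UNIV (zero_ext \<Omega> u) x))\<^sup>2)"
    unfolding integral_wgrad_zero_ext[OF op(1) u(1)] integral_wgrad_zero_ext[OF op(2) u(2)]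
    unfolding h(2) hj(2)
    by (rule weak_solutions_converge(2)[OF h(1)]; fact side)
  ultimately show ?thesis
    using zero_ext_H1(1)[OF op(1) u(1)] zero_ext_H1(1)[OF op(2) u(2)] by blast
qed

end
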